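(* Let $(\theta_n)_{n\in\mathbb N_0}$ be an adapted $D$-valued process satisfying $\theta_n=\Pi\bigl(\theta_{n-1}+\gamma_n(f(\theta_{n-1})+R_n+D_n)\bigr)$ for all $n\in\mathbb N$, with the data $D,f,\Pi,(R_n),(D_n),(\gamma_n),\theta_0$ as described in the context. Let $L>0$ and let $\theta^*\in D$ be an $L$-contracting zero of $f$ with associated matrix $H\in\mathbb R^{d\times d}$. Let $(b_n)_{n\in\mathbb N}$ be a sequence of strictly positive reals, $\bar b_n=\sum_{k=1}^n b_k$ and $\bar\theta_n=\frac1{\bar b_n}\sum_{k=1}^n b_k\theta_k$. Let $\lambda\in(0,1]$, let $\mu\in\mathbb R^d$, $\Gamma\in\mathbb R^{d\times d}$, and let $(\delta_n^{\mathrm{bias}})_{n\in\mathbb N}$, $(\delta_n^{\mathrm{diff}})_{n\in\mathbb N}$ and $(\delta_n)_{n\in\mathbb N}$ be sequences of strictly positive reals. Set $$\varepsilon_n^{\mathrm{bias}}=\frac1{\bar b_n}\sum_{k=1}^n b_k\delta_k^{\mathrm{bias}},\qquad \varepsilon_n^{\mathrm{diff}}=\frac1{\bar b_n}\sqrt{\sum_{k=1}^n (b_k\delta_k^{\mathrm{diff}})^2}.$$ Assume that: (A) $(\gamma_n)$ is decreasing with limit zero, and $$\lim_{n\to\infty}n\gamma_n=\infty,\quad \limsup_{n\to\infty}\frac{\gamma_{n-1}}{\gamma_n}<\infty,\quad \limsup_{n\to\infty}\frac1{\gamma_n}\Bigl(1-\frac{\delta_n}{\delta_{n-1}}\Bigr)\le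 L,\quad \lim_{n\to\infty}\frac1{\gamma_n}\Bigl(\frac{b_{n+1}\gamma_n}{b_n\gamma_{n+1}}-1\Bigr)=0.$$ (B) As $\theta\to\theta^*$, $|f(\theta)-H(\theta-\theta^* )|=\mathcal O(|\theta-\theta^*|^{1+\lambda})$. (C) $\sum_{k=1}^\infty b_k\delta_k^{\mathrm{bias}}=\infty$ and $\sum_{k=1}^\infty(b_k\delta_k^{\mathrm{diff}})^2=\infty$, and for every $\mathbb N$-valued sequence $(L(n))_{n\in\mathbb N}$ with $L(n)\le n$ and $n-L(n)=o(n)$, $$\lim_{n\to\infty}\frac{\sum_{k=L(n)+1}^n b_k\delta_k^{\mathrm{bias}}}{\sum_{k=1}^n b_k\delta_k^{\mathrm{bias}}}=0\quad\text{and}\quad \lim_{n\to\infty}\frac{\sum_{k=L(n)+1}^n (b_k\delta_k^{\mathrm{diff}})^2}{\sum_{k=1}^n (b_k\delta_k^{\mathrm{diff}})^2}=0.$$ (D) On $\{\theta_n\to\theta^*\}$, up to nullsets, $(\delta_n^{\mathrm{bias}})^{-1}R_n\to\mu$, and for some $\varepsilon'>0$ $$\limsup_{n\to\infty}\delta_n^{-1}\,\mathbb E\bigl[1_{\{\theta_{n-1}\in B(\theta^*,\varepsilon')\}}|R_n|^2\bigr]^{1/2}<\infty.$$ (E) On $\{\theta_n\to\theta^*\}$, up to nullsets, $(\delta_n^{\mathrm{diff}})^{-2}\,\mathrm{cov}(D_n|\mathcal F_{n-1})\to\Gamma$; on $\{\theta_n\to\theta^*\}$, for every $\varepsilon>0$,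 $$\lim_{n\to\infty}(\varepsilon_n^{\mathrm{diff}})^{-2}\sum_{l=1}^n\frac{b_l^2}{\bar b_n^2}\,\mathbb E\bigl[1_{\{|D_l|>\varepsilon\bar b_n\varepsilon_n^{\mathrm{diff}}/b_l\}}|D_l|^2\big|\mathcal F_{l-1}\bigr]=0\quad\text{in probability};$$ and for some $\varepsilon'>0$ $$\limsup_{n\to\infty}\Bigl(\frac{\delta_n}{\sqrt{\gamma_n}}\Bigr)^{-1}\mathbb E\bigl[1_{B(\theta^*,\varepsilon')}(\theta_{n-1})|D_n|^2\bigr]^{1/2}<\infty.$$ (F) The term $\frac1{\bar b_n}\sum_{l=1}^n b_l\delta_l^{1+\lambda}$ is of order $o(\varepsilon_n^{\mathrm{bias}})$ or of order $o(\varepsilon_n^{\mathrm{diff}})$. Then there exists a sequence of $\mathbb R^d$-valued random variables $(\vartheta_n)_{n\in\mathbb N}$ such that on $\{\theta_n\to\theta^*\}$ $$(\varepsilon_n^{\mathrm{bias}})^{-1}(\vartheta_n-\theta^* )\to -H^{-1}\mu\ \text{ in probability}\qquad\text{and}\qquad (\varepsilon_n^{\mathrm{diff}})^{-1}(\bar\theta_n-\vartheta_n)\Rightarrow\mathcal N\bigl(0,H^{-1}\Gamma(H^{-1})^\dagger\bigr).$$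
   Context: $(\Omega,\mathcal F,(\mathcal F_n)_{n\in\mathbb N_0},\mathbb P)$ is a filtered probability space; adaptedness and martingale notions refer to it. $D\subset\mathbb R^d$ is closed, $f:D\to\mathbb R^d$ is measurable, and $\theta_0\in D$ is a fixed deterministic starting value. $\Pi:\mathbb R^d\to D$ is a measurable function (the projection) whose restriction to $D$ is the identity and which maps $D^c$ into $\partial D$. $(R_n)_{n\in\mathbb N}$ is an adapted $\mathbb R^d$-valued process, $(D_n)_{n\in\mathbb N}$ is a sequence of $\mathbb R^d$-valued martingale differences, and $(\gamma_n)_{n\in\mathbb N}$ is a sequence of strictly positive reals. For $L\ge0$, a zero $\theta^*$ of $f$ in the interior of $D$ is called an $L$-contracting zero (with matrix $H$) if there is $H\in\mathbb R^{d\times d}$ with $\sup\{\mathrm{Re}(\lambda):\lambda\text{ eigenvalue of }H\}<-L$ and $f(\theta)=H(\theta-\theta^* )+o(|\theta-\theta^*|)$ as $\theta\to\theta^*$. Notation: $B(\theta^*,\varepsilon)$ is the ball of radius $\varepsilon$ around $\theta^*$; $A^\dagger$ is the transpose of $A$. For sequences, $a_n=\mathcal O(b_n)$ means that $b_n$ is eventually strictly positive and $\limsup|a_n|/b_n<\infty$; $a_n=o(b_n)$ means additionally $\lim|a_n|/b_n=0$. For an event $A$: "$X_n\to X$ in probability on $A$" means $\mathbb P(A\cap\{|X_n-X|>\eta\})\to0$ for all $\eta>0$; "$X_n\Rightarrow\nu$ on $A$" means $\mathbb E[1_A g(X_n)]\to\mathbb P(A)\int g\,d\nu$ for all bounded continuous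 $g$ (i.e. convergence in law under $\mathbb P(\cdot|A)$ if $\mathbb P(A)>0$). *)

theory Defs
  imports "HOL-Probability.Probability" "HOL-Library.Landau_Symbols"
begin

text \<open>
  Sequences indexed by the positive integers are functions on \<open>nat\<close> whose value at \<open>0\<close> is
  never constrained and never enters a sum; limits at infinity do not see it.
\<close>

text \<open>Eigenvalues of a real matrix are the complex ones, so the matrix acts on \<open>complex ^ 'd\<close>.\<close>

definition complex_eigenvalue :: "real ^ 'd ^ 'd \<Rightarrow> complex \<Rightarrow> bool" where
  "complex_eigenvalue H z \<longleftrightarrow>
     (\<exists>v :: complex ^ 'd. v \<noteq> 0 \<and> map_matrix complex_of_real H *v v = z *s v)"

definition contracting_zero ::
  "real \<Rightarrow> (real ^ 'd) set \<Rightarrow> (real ^ 'd \<Rightarrow> real ^ 'd) \<Rightarrow> real ^ 'd \<Rightarrow> real ^ 'd ^ 'd \<Rightarrow> bool" where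
  "contracting_zero L D f \<theta>s H \<longleftrightarrow>
     \<theta>s \<in> interior D \<and> f \<theta>s = 0 \<and>
     (SUP z \<in> {z. complex_eigenvalue H z}. Re z) < - L \<and>
     (\<lambda>\<theta>. norm (f \<theta> - H *v (\<theta> - \<theta>s))) \<in> o[at \<theta>s within D](\<lambda>\<theta>. norm (\<theta> - \<theta>s))"

definition weighted_avg :: "(nat \<Rightarrow> real) \<Rightarrow> (nat \<Rightarrow> 'b::real_vector) \<Rightarrow> nat \<Rightarrow> 'b" where
  "weighted_avg b x n = (1 / (\<Sum>k=1..n. b k)) *\<^sub>R (\<Sum>k=1..n. b k *\<^sub>R x k)"

definition eps_bias :: "(nat \<Rightarrow> real) \<Rightarrow> (nat \<Rightarrow> real) \<Rightarrow> nat \<Rightarrow> real" where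
  "eps_bias b \<delta> n = 1 / (\<Sum>k=1..n. b k) * (\<Sum>k=1..n. b k * \<delta> k)"

definition eps_diff :: "(nat \<Rightarrow> real) \<Rightarrow> (nat \<Rightarrow> real) \<Rightarrow> nat \<Rightarrow> real" where
  "eps_diff b \<delta> n = 1 / (\<Sum>k=1..n. b k) * sqrt (\<Sum>k=1..n. (b k * \<delta> k)\<^sup>2)"

definition martingale_differences ::
  "'a measure \<Rightarrow> (nat \<Rightarrow> 'a measure) \<Rightarrow> (nat \<Rightarrow> 'a \<Rightarrow> real ^ 'd) \<Rightarrow> bool" where
  "martingale_differences M F X \<longleftrightarrow>
     (\<forall>n\<ge>1. X n \<in> borel_measurable (F n) \<and> integrable M (X n) \<and>
        (\<forall>i. AE \<omega> in M. real_cond_exp M (F (n - 1)) (\<lambda>\<omega>'. X n \<omega>' $ i) \<omega> = 0))"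

text \<open>
  No square integrability of \<open>X\<close> is presupposed: \<^const>\<open>real_cond_exp\<close> is the difference of the
  conditional expectations of the positive and the negative part, hence it is the usual (generalised)
  conditional expectation wherever both are finite.
\<close>

definition cond_cov :: "'a measure \<Rightarrow> 'a measure \<Rightarrow> ('a \<Rightarrow> real ^ 'd) \<Rightarrow> 'a \<Rightarrow> real ^ 'd ^ 'd" where
  "cond_cov M G X \<omega> =
     (\<chi> i j. real_cond_exp M G
        (\<lambda>\<omega>'. (X \<omega>' $ i - real_cond_exp M G (\<lambda>x. X x $ i) \<omega>') *
              (X \<omega>' $ j - real_cond_exp M G (\<lambda>x. X x $ j) \<omega>')) \<omega>)"

text \<open>
  Second moments are kept in \<^typ>\<open>ennreal\<close>, since the Bochner integral of a non-integrable function
  is \<open>0\<close> and would turn a boundedness assumption into a void one.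
\<close>

definition ennreal_sqrt :: "ennreal \<Rightarrow> ennreal" where
  "ennreal_sqrt x = (if x = \<infinity> then \<infinity> else ennreal (sqrt (enn2real x)))"

definition converges_in_prob_on ::
  "'a measure \<Rightarrow> 'a set \<Rightarrow> (nat \<Rightarrow> 'a \<Rightarrow> 'b::metric_space) \<Rightarrow> 'b \<Rightarrow> bool" where
  "converges_in_prob_on M A X c \<longleftrightarrow>
     (\<forall>\<eta>>0. (\<lambda>n. measure M (A \<inter> {\<omega> \<in> space M. dist (X n \<omega>) c > \<eta>})) \<longlonglongrightarrow> 0)"

definition vanishes_in_prob_on ::
  "'a measure \<Rightarrow> 'a set \<Rightarrow> (nat \<Rightarrow> 'a \<Rightarrow> ennreal) \<Rightarrow> bool" where
  "vanishes_in_prob_on M A X \<longleftrightarrow>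
     (\<forall>\<eta>>0::real. (\<lambda>n. measure M (A \<inter> {\<omega> \<in> space M. X n \<omega> > ennreal \<eta>})) \<longlonglongrightarrow> 0)"

definition converges_in_law_on ::
  "'a measure \<Rightarrow> 'a set \<Rightarrow> (nat \<Rightarrow> 'a \<Rightarrow> 'b::metric_space) \<Rightarrow> 'b measure \<Rightarrow> bool" where
  "converges_in_law_on M A X \<nu> \<longleftrightarrow>
     (\<forall>g :: 'b \<Rightarrow> real. continuous_on UNIV g \<longrightarrow> bounded (range g) \<longrightarrow>
        (\<lambda>n. \<integral>\<omega>. indicator A \<omega> * g (X n \<omega>) \<partial>M) \<longlonglongrightarrow> measure M A * (\<integral>x. g x \<partial>\<nu>))"

definition std_normal_vec :: "(real ^ 'd) measure" where
  "std_normal_vec =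
     distr (\<Pi>\<^sub>M i\<in>(UNIV :: 'd set). density lborel std_normal_density) borel (\<lambda>z. \<chi> i. z i)"

text \<open>
  The law of \<open>m + A Z\<close>, with \<open>Z\<close> standard normal and \<open>A A\<^sup>T = \<Sigma>\<close>. It does not depend on the choice
  of \<open>A\<close>, which exists exactly if \<open>\<Sigma>\<close> is symmetric and positive semidefinite; \<open>\<Sigma>\<close> may be singular.
\<close>

definition mv_normal :: "real ^ 'd \<Rightarrow> real ^ 'd ^ 'd \<Rightarrow> (real ^ 'd) measure" where
  "mv_normal m \<Sigma> =
     distr std_normal_vec borel (\<lambda>z. m + (SOME A :: real ^ 'd ^ 'd. A ** transpose A = \<Sigma>) *v z)"

lemma prob_space_std_normal_vec: "prob_space (std_normal_vec :: (real ^ 'd) measure)"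
proof -
  have "prob_space (\<Pi>\<^sub>M i\<in>(UNIV :: 'd set). density lborel (\<lambda>x. ennreal (std_normal_density x)))"
    by (intro prob_space_PiM prob_space_normal_density) simp
  moreover have "(\<lambda>z. \<chi> i. z i) \<in> borel_measurable
      (\<Pi>\<^sub>M i\<in>(UNIV :: 'd set). density lborel (\<lambda>x. ennreal (std_normal_density x)))"
    by (subst borel_measurable_euclidean_space) (auto simp: Basis_vec_def inner_axis)
  ultimately show ?thesis
    unfolding std_normal_vec_def by (rule prob_space.prob_space_distr)
qed

lemma prob_space_mv_normal: "prob_space (mv_normal m \<Sigma> :: (real ^ 'd) measure)"
  unfolding mv_normal_def
  by (rule prob_space.prob_space_distr[OF prob_space_std_normal_vec])
     (simp add: std_normal_vec_def borel_measurable_continuous_onI continuous_on_add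
        matrix_vector_mult_linear_continuous_on linear_continuous_on)

end

theory Submission
  imports Defs "HOL-Computational_Algebra.Fundamental_Theorem_Algebra"
begin

text \<open>
  Near \<open>\<theta>s\<close> the recursion is linear up to an error of order \<open>1 + lam\<close>. Solving the linear recursion and
  exchanging sums writes the weighted sum of \<open>\<theta> l - \<theta>s\<close> as \<open>\<Sum>k. b k * B k n * (R k + D k)\<close> plus a remainder. In a
  Euclidean norm adapted to \<open>H\<close> the maps \<open>1 + \<gamma> k * H\<close> are contractions, and \<open>B k n\<close> is close to \<open>- inverse H\<close>
  except for \<open>k\<close> in a window of length \<open>o(n)\<close> below \<open>n\<close>, which carries a negligible part of the weight by (C).
  The \<open>R\<close>-part then converges by averaging. The \<open>D\<close>-part is treated by a martingale central limit theorem on the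
  event of convergence: the exponential martingale, stopped predictably, is tested against events from
  some \<open>F N\<close> that approximate the event of convergence. The remainder is controlled by a bound of order \<open>\<delta>\<^sup>2\<close> for the
  second moment of \<open>\<theta> n - \<theta>s\<close>, localized to paths staying near \<open>\<theta>s\<close>, which follows from the
  contraction and the moment assumptions; the localization is removed by exhausting the event of convergence.
\<close>

section \<open>Norms adapted to a contracting matrix\<close>

text \<open>The adapted norm has to come from an inner product: in the second moment recursion the
  cross term between the state and the martingale noise vanishes only because the squared norm
  expands bilinearly. The standard norm does not serve, since \<open>1 + \<gamma> k * H\<close> need
  not contract it when \<open>H\<close> is not normal. A square sum over finitely many rescaled
  iterates meets both demands.

  The obstacle in the limit theorem is that the event of convergence need not belong to any
  \<open>F N\<close>: conditioning on it would destroy the martingale property, yet the conditional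
  variances converge only there. Hence characteristic functions restricted to the event are compared
  with probabilities of approximating events, by error bounds at fixed \<open>n\<close>.

  The rates fit because \<open>\<delta>\<close> eventually loses at most a factor
  \<open>1 - \<gamma> n * L3\<close> per step, with \<open>L3\<close> just above \<open>L\<close>,
  while the state contracts at a strictly larger rate. Since \<open>1 + lam \<le> 2\<close>, the
  linearization error is then controlled by second moments alone.\<close>

definition poly_action :: "complex ^ 'd ^ 'd \<Rightarrow> complex poly \<Rightarrow> complex ^ 'd \<Rightarrow> complex ^ 'd" where
  "poly_action A p v = fold_coeffs (\<lambda>a w. a *s v + A *v w) p 0"

lemma poly_action_0 [simp]: "poly_action A 0 v = 0"
  by (simp add: poly_action_def)

lemma poly_action_pCons [simp]: "poly_action A (pCons a p) v = a *s v + A *v poly_action A p v"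
  by (cases "p = 0 \<and> a = 0") (auto simp: poly_action_def)

lemma poly_action_add: "poly_action A (p + q) v = poly_action A p v + poly_action A q v"
  by (induction p q rule: poly_induct2)
     (simp_all add: matrix_vector_right_distrib vector_sadd_rdistrib)

lemma poly_action_smult: "poly_action A (smult c p) v = c *s poly_action A p v"
  by (induction p) (simp_all add: matrix_vector_mult_scaleR vector_smult_assoc vector_add_ldistrib vec.scale)

lemma poly_action_linear:
  "poly_action A ([:- a, 1:] * q) v = A *v poly_action A q v - a *s poly_action A q v"
proof -
  have "[:- a, 1:] * q = smult (- a) q + pCons 0 q" by simp
  then show ?thesis by (simp only: poly_action_add poly_action_smult) (simp add: vec_eq_iff)
qed

lemma poly_action_commute: "poly_action A q (A *v v - a *s v) = A *v poly_action A q v - a *s poly_action A q v"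
proof (induction q)
  case (pCons c q)
  show ?case unfolding poly_action_pCons pCons.IH
    by (simp add: matrix_vector_right_distrib matrix_vector_mult_diff_distrib vec.scale
        vector_smult_assoc vector_ssub_ldistrib vector_add_ldistrib mult.commute[of c])
qed simp

lemma poly_action_monom: "poly_action A (monom c n) v = c *s (((*v) A ^^ n) v)"
  by (induction n) (simp_all add: monom_0 monom_Suc vec.scale)

lemma poly_action_sum: "poly_action A (\<Sum>i\<in>I. p i) v = (\<Sum>i\<in>I. poly_action A (p i) v)"
  by (induction I rule: infinite_finite_induct) (simp_all add: poly_action_add)

text \<open>A Krylov argument: more iterates of \<open>v\<close> than the dimension are linearly
  dependent, and the coefficients of a dependence form the polynomial.
  \<open>poly_action A p v\<close> is \<open>p(A) v\<close>, evaluated by Horner's scheme.\<close>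

lemma annihilating_poly_exists:
  obtains p where "p \<noteq> 0" "poly_action (A :: complex ^ 'd ^ 'd) p v = 0"
proof -
  define x where "x i = ((*v) A ^^ i) v" for i
  \<comment> \<open>This is the real dimension, because \<open>dependent\<close> refers to real
    coefficients. The degree bound doubles, which is harmless.\<close>
  define N where "N = DIM(complex ^ 'd)"
  show ?thesis
  \<comment> \<open>Dependence is a property of the set of iterates, so a repeated iterate has to be
    treated separately. It yields a difference of two monomials.\<close>
  proof (cases "inj_on x {..N}")
    case False
    then obtain i j where ij: "i \<noteq> j" "x i = x j" by (auto simp: inj_on_def)
    have "monom (1::complex) i - monom 1 j \<noteq> 0"
      using ij(1) by (simp add: monom_eq_iff')
    moreover have "poly_action A (monom 1 i - monom 1 j) v = 0"
    proof -
      have "monom (1::complex) i - monom 1 j = monom 1 i + monom (-1) j"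
        by (simp add: minus_monom[symmetric])
      then show ?thesis using ij(2)
        by (simp only: poly_action_add poly_action_monom x_def) (simp add: vec_eq_iff)
    qed
    ultimately show ?thesis by (rule that)
  next
    case True
    then have c: "card (x ` {..N}) = Suc N" by (simp add: card_image)
    have "dependent (x ` {..N})"
      by (rule dependent_biggerset) (simp only: c, simp add: N_def)
    then obtain u w where u: "w \<in> x ` {..N}" "u w \<noteq> 0" "(\<Sum>w\<in>x ` {..N}. u w *\<^sub>R w) = 0"
      by (subst (asm) dependent_finite) auto
    obtain i where i: "i \<le> N" "w = x i" using u(1) by auto
    define p where "p = (\<Sum>i\<le>N. monom (complex_of_real (u (x i))) i)"
    have "coeff p i = u (x i)"
      using i by (simp add: p_def coeff_sum)
    then have "p \<noteq> 0" using u(2) i by auto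
    moreover have "poly_action A p v = 0"
    proof -
      have sc: "complex_of_real a *s w = a *\<^sub>R w" for a and w :: "complex ^ 'd"
        unfolding vec_eq_iff vector_smult_component vector_scaleR_component
        by (simp only: scaleR_conv_of_real simp_thms)
      have "poly_action A p v = (\<Sum>i\<le>N. u (x i) *\<^sub>R x i)"
        unfolding p_def poly_action_sum poly_action_monom x_def[symmetric]
        by (intro sum.cong refl) (simp add: sc)
      also have "\<dots> = 0" using u(3) by (subst (asm) sum.reindex[OF True]) auto
      finally show ?thesis .
    qed
    ultimately show ?thesis by (rule that)
  qed
qed

text \<open>A substitute for the Jordan form. Split a linear factor with root \<open>a\<close> off
  \<open>p\<close>, leaving \<open>q\<close>. Either \<open>q\<close> already annihilates
  \<open>v\<close>, or \<open>q(A) v\<close> is an eigenvector for \<open>a\<close>, so that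
  \<open>norm a \<le> r\<close>. In the latter case \<open>u = A v - a v\<close> is annihilated by
  \<open>q\<close>, and the orbit of \<open>v\<close> solves a first-order recursion with multiplier
  \<open>a\<close> driven by the orbit of \<open>u\<close>, which decays by induction. The room
  between \<open>r\<close> and \<open>\<rho>\<close> absorbs the polynomial factors of a Jordan
  block.\<close>

lemma orbit_decay_of_annihilated:
  fixes A :: "complex ^ 'd ^ 'd"
  assumes ev: "\<And>z w. w \<noteq> 0 \<Longrightarrow> A *v w = z *s w \<Longrightarrow> norm z \<le> r"
    and r: "r < \<rho>" "0 \<le> r"
    and p: "p \<noteq> 0" "poly_action A p v = 0"
  shows "\<exists>C. \<forall>n. norm (((*v) A ^^ n) v) \<le> C * \<rho> ^ n"
  using p
proof (induction "degree p" arbitrary: p v rule: less_induct)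
  case less
  show ?case
  proof (cases "degree p = 0")
    case True
    then obtain c where "p = [:c:]" by (auto elim: degree_eq_zeroE)
    with less.prems have "v = 0" by auto
    moreover have "((*v) A ^^ n) 0 = 0" for n by (induction n) auto
    ultimately show ?thesis by (auto intro!: exI[of _ 0])
  next
    case False
    then obtain a where "poly p a = 0"
      using fundamental_theorem_of_algebra[of p] by (auto simp: constant_degree)
    then obtain q where pq: "p = [:- a, 1:] * q" by (auto simp: poly_eq_0_iff_dvd)
    have q: "q \<noteq> 0" "degree q < degree p"
    proof -
      have q0: "q \<noteq> 0" using less.prems(1) pq by auto
      have "degree p = degree [:- a, 1:] + degree q" unfolding pq
        by (rule degree_mult_eq) (use q0 in auto)
      then show "degree q < degree p" by simp
      show "q \<noteq> 0" by fact
    qed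
    define w where "w = poly_action A q v"
    have Aw: "A *v w = a *s w"
      using less.prems(2) unfolding pq poly_action_linear w_def by simp
    show ?thesis
    proof (cases "w = 0")
      case True
      then show ?thesis using less.hyps[OF q(2,1)] by (simp add: w_def)
    next
      case False
      with ev Aw have a: "norm a \<le> r" by blast
      define u where "u = A *v v - a *s v"
      have "poly_action A q u = 0"
        unfolding u_def poly_action_commute using Aw by (simp add: w_def)
      from less.hyps[OF q(2,1) this] obtain C where C: "\<And>n. norm (((*v) A ^^ n) u) \<le> C * \<rho> ^ n"
        by auto
      \<comment> \<open>The first entry covers \<open>n = 0\<close>; the second makes
        \<open>r * C' + C \<le> \<rho> * C'\<close>, which is what the induction step needs.\<close>
      define C' where "C' = max (norm v) (C / (\<rho> - r))"
      have step: "((*v) A ^^ Suc n) v = a *s ((*v) A ^^ n) v + ((*v) A ^^ n) u" for n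
      proof (induction n)
        case 0 then show ?case by (simp add: u_def)
      next
        case (Suc n)
        show ?case by (subst funpow.simps(2), subst o_apply, subst Suc) (simp add: matrix_vector_right_distrib vec.scale)
      qed
      have nsm: "norm (c *s (y :: complex ^ 'd)) = norm c * norm y" for c y
        by (simp add: norm_vec_def norm_mult L2_set_right_distrib)
      have "norm (((*v) A ^^ n) v) \<le> C' * \<rho> ^ n" for n
      proof (induction n)
        case 0 show ?case by (simp add: C'_def)
      next
        case (Suc n)
        have "norm (((*v) A ^^ Suc n) v) \<le> norm a * norm (((*v) A ^^ n) v) + norm (((*v) A ^^ n) u)"
          unfolding step by (metis nsm norm_triangle_ineq)
        also have "\<dots> \<le> r * (C' * \<rho> ^ n) + C * \<rho> ^ n"
          by (intro add_mono mult_mono a Suc.IH C) (use r in auto)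
        also have "\<dots> = (r * C' + C) * \<rho> ^ n" by (simp add: algebra_simps)
        also have "\<dots> \<le> (\<rho> * C') * \<rho> ^ n"
        proof (rule mult_right_mono)
          have "C / (\<rho> - r) \<le> C'" by (simp add: C'_def)
          then show "r * C' + C \<le> \<rho> * C'" using r by (simp add: field_simps)
        qed (use r in auto)
        finally show ?case by (simp add: algebra_simps)
      qed
      then show ?thesis by blast
    qed
  qed
qed

lemma linear_matrix_power: "linear (((*v) (A :: real ^ 'd ^ 'd)) ^^ n)"
proof (induction n)
  case (Suc n)
  then show ?case unfolding funpow.simps by (rule linear_compose[OF _ matrix_vector_mul_linear])
qed (simp add: linear_id[unfolded id_def])

text \<open>The constant obtained for a single orbit depends on its starting vector. Expanding
  \<open>x\<close> in the standard basis makes it uniform, the sum over the basis being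
  finite.\<close>

lemma matrix_power_decay:
  fixes A :: "real ^ 'd ^ 'd"
  assumes ev: "\<And>z (w :: complex ^ 'd). w \<noteq> 0 \<Longrightarrow> map_matrix complex_of_real A *v w = z *s w \<Longrightarrow> norm z \<le> r"
    and r: "r < \<rho>" "0 \<le> r"
  shows "\<exists>C. \<forall>n x. norm (((*v) A ^^ n) x) \<le> C * \<rho> ^ n * norm x"
proof -
  define cv where "cv x = (\<chi> i. complex_of_real (x $ i))" for x :: "real ^ 'd"
  have cvA: "map_matrix complex_of_real A *v cv x = cv (A *v x)" for x
    by (simp add: vec_eq_iff matrix_vector_mult_def cv_def map_matrix_def)
  have cvn: "((*v) (map_matrix complex_of_real A) ^^ n) (cv x) = cv (((*v) A ^^ n) x)" for n x
    by (induction n) (simp_all add: cvA)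
  have ncv: "norm (cv x) = norm x" for x by (simp add: cv_def norm_vec_def)
  have ex: "\<exists>C. \<forall>n. norm (((*v) A ^^ n) x) \<le> C * \<rho> ^ n" for x
  proof -
    obtain p where "p \<noteq> 0" "poly_action (map_matrix complex_of_real A) p (cv x) = 0"
      by (rule annihilating_poly_exists)
    from orbit_decay_of_annihilated[OF ev r this] show ?thesis by (simp add: cvn ncv)
  qed
  then obtain C where C: "\<And>x n. norm (((*v) A ^^ n) x) \<le> C x * \<rho> ^ n" by metis
  have linp: "linear ((*v) A ^^ n)" for n by (rule linear_matrix_power)
  have "norm (((*v) A ^^ n) x) \<le> (\<Sum>i\<in>UNIV. C (axis i 1)) * \<rho> ^ n * norm x" for n x
  proof -
    have "((*v) A ^^ n) x = (\<Sum>i\<in>UNIV. x $ i *s ((*v) A ^^ n) (axis i 1))"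
    proof -
      have "((*v) A ^^ n) (\<Sum>i\<in>UNIV. x $ i *s axis i 1) = (\<Sum>i\<in>UNIV. x $ i *s ((*v) A ^^ n) (axis i 1))"
      proof -
        have "((*v) A ^^ n) (\<Sum>i\<in>UNIV. x $ i *\<^sub>R axis i 1) = (\<Sum>i\<in>UNIV. x $ i *\<^sub>R ((*v) A ^^ n) (axis i 1))"
          by (simp add: linear_sum[OF linp] linear_cmul[OF linp])
        then show ?thesis by (simp only: scalar_mult_eq_scaleR)
      qed
      then show ?thesis by (simp only: basis_expansion)
    qed
    also have "norm \<dots> \<le> (\<Sum>i\<in>UNIV. norm x * (C (axis i 1) * \<rho> ^ n))"
      by (intro sum_norm_le) (auto simp: scalar_mult_eq_scaleR intro!: mult_mono C component_le_norm_cart)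
    also have "\<dots> = (\<Sum>i\<in>UNIV. C (axis i 1)) * \<rho> ^ n * norm x"
      by (simp add: sum_distrib_right sum_distrib_left algebra_simps)
    finally show ?thesis .
  qed
  then show ?thesis by blast
qed

text \<open>Serves twice: it bounds the quadratic term in the modulus of \<open>1 + h z\<close>, and
  it shows that the supremum of the real parts of the eigenvalues is taken over a set bounded
  above.\<close>

lemma eigenvalue_norm_bound:
  fixes A :: "complex ^ 'd ^ 'd"
  obtains K where "\<And>z w. w \<noteq> 0 \<Longrightarrow> A *v w = z *s w \<Longrightarrow> norm z \<le> K"
proof -
  have "bounded_linear ((*v) A)" by (rule matrix_vector_mul_bounded_linear)
  then obtain K where K: "\<And>w. norm (A *v w) \<le> norm w * K"
    using bounded_linear.bounded by blast
  have "norm z \<le> K" if "w \<noteq> 0" "A *v w = z *s w" for z w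
  proof -
    have "norm (z *s w) = norm z * norm w"
      by (simp add: norm_vec_def norm_mult L2_set_right_distrib)
    with K[of w] that show ?thesis by (simp add: mult.commute)
  qed
  then show ?thesis by (rule that)
qed

text \<open>A Lyapunov norm, truncated to finitely many iterates. Squares are summed, rather than
  taking a maximum or a plain sum, so that the norm is Euclidean, with inner product
  \<open>orbit_inner\<close>.\<close>

definition orbit_norm :: "real ^ 'd ^ 'd \<Rightarrow> real \<Rightarrow> nat \<Rightarrow> real ^ 'd \<Rightarrow> real" where
  "orbit_norm A \<rho> N x = L2_set (\<lambda>n. norm (((*v) A ^^ n) x) / \<rho> ^ n) {..<N}"

definition orbit_inner :: "real ^ 'd ^ 'd \<Rightarrow> real \<Rightarrow> nat \<Rightarrow> real ^ 'd \<Rightarrow> real ^ 'd \<Rightarrow> real" where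
  "orbit_inner A \<rho> N x y = (\<Sum>n<N. (((*v) A ^^ n) x \<bullet> ((*v) A ^^ n) y) / (\<rho> ^ n)\<^sup>2)"

lemma bilinear_orbit_inner: "bilinear (orbit_inner A \<rho> N)"
  unfolding bilinear_def
proof (intro conjI allI)
  note lin = linear_add[OF linear_matrix_power] linear_cmul[OF linear_matrix_power]
  show "linear (\<lambda>y. orbit_inner A \<rho> N x y)" for x
    by (rule linearI) (simp_all add: orbit_inner_def lin inner_right_distrib add_divide_distrib sum.distrib sum_distrib_left)
  show "linear (\<lambda>x. orbit_inner A \<rho> N x y)" for y
    by (rule linearI) (simp_all add: orbit_inner_def lin inner_left_distrib add_divide_distrib sum.distrib sum_distrib_left)
qed

lemma orbit_inner_commute: "orbit_inner A \<rho> N x y = orbit_inner A \<rho> N y x"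
  by (simp add: orbit_inner_def inner_commute)

lemma orbit_inner_self: "orbit_inner A \<rho> N x x = (orbit_norm A \<rho> N x)\<^sup>2"
  by (simp add: orbit_inner_def orbit_norm_def L2_set_def sum_nonneg power_divide dot_square_norm)

lemma orbit_norm_nonneg: "0 \<le> orbit_norm A \<rho> N x"
  by (simp add: orbit_norm_def)

lemma orbit_norm_triangle:
  assumes "\<rho> > 0"
  shows "orbit_norm A \<rho> N (x + y) \<le> orbit_norm A \<rho> N x + orbit_norm A \<rho> N y"
proof -
  have "orbit_norm A \<rho> N (x + y)
      \<le> L2_set (\<lambda>n. norm (((*v) A ^^ n) x) / \<rho> ^ n + norm (((*v) A ^^ n) y) / \<rho> ^ n) {..<N}"
    unfolding orbit_norm_def using assms
    by (intro L2_set_mono) (auto simp: linear_add[OF linear_matrix_power] norm_triangle_ineq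
        intro!: divide_right_mono simp flip: add_divide_distrib)
  also have "\<dots> \<le> orbit_norm A \<rho> N x + orbit_norm A \<rho> N y"
    unfolding orbit_norm_def by (rule L2_set_triangle_ineq)
  finally show ?thesis .
qed

lemma orbit_norm_scaleR: "orbit_norm A \<rho> N (c *\<^sub>R x) = \<bar>c\<bar> * orbit_norm A \<rho> N x"
  by (simp add: orbit_norm_def linear_cmul[OF linear_matrix_power] L2_set_right_distrib)

lemma norm_le_orbit_norm: "N > 0 \<Longrightarrow> norm x \<le> orbit_norm A \<rho> N x"
  unfolding orbit_norm_def
  using member_le_L2_set[of "{..<N}" 0 "\<lambda>n. norm (((*v) A ^^ n) x) / \<rho> ^ n"] by simp

lemma orbit_norm_le_norm:
  assumes "\<rho> > 0"
  obtains C where "C > 0" "\<And>x. orbit_norm A \<rho> N x \<le> C * norm x"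
proof -
  have "\<exists>C. \<forall>x. norm (((*v) A ^^ n) x) \<le> C * norm x" for n
    using linear_bounded[OF linear_matrix_power] .
  then obtain C where C: "\<And>n x. norm (((*v) A ^^ n) x) \<le> C n * norm x" by metis
  define K where "K = (\<Sum>n<N. \<bar>C n\<bar> / \<rho> ^ n) + 1"
  have "orbit_norm A \<rho> N x \<le> K * norm x" for x
  proof -
    have "orbit_norm A \<rho> N x \<le> (\<Sum>n<N. norm (((*v) A ^^ n) x) / \<rho> ^ n)"
      unfolding orbit_norm_def using assms by (intro L2_set_le_sum) auto
    also have "\<dots> \<le> (\<Sum>n<N. \<bar>C n\<bar> / \<rho> ^ n * norm x)"
    proof (rule sum_mono)
      fix n
      have "norm (((*v) A ^^ n) x) \<le> \<bar>C n\<bar> * norm x"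
        by (rule order_trans[OF C]) (auto intro: mult_right_mono)
      then show "norm (((*v) A ^^ n) x) / \<rho> ^ n \<le> \<bar>C n\<bar> / \<rho> ^ n * norm x"
        using assms by (simp add: field_simps)
    qed
    also have "\<dots> \<le> K * norm x" by (simp only: K_def sum_distrib_right[symmetric] distrib_right mult_1) simp
    finally show ?thesis .
  qed
  moreover have "K > 0" unfolding K_def using assms by (intro add_nonneg_pos sum_nonneg) auto
  ultimately show ?thesis by (rule that[rotated])
qed

text \<open>Passing from \<open>x\<close> to \<open>A *v x\<close> shifts the orbit: up to the factor \<open>\<rho>\<close>, the term
  \<open>n = 0\<close> is traded for the smaller term \<open>n = N\<close>.\<close>

lemma orbit_norm_contraction:
  assumes \<rho>: "\<rho> > 0" and N: "\<And>x. norm (((*v) A ^^ N) x) \<le> \<rho> ^ N * norm x"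
  shows "orbit_norm A \<rho> N (A *v x) \<le> \<rho> * orbit_norm A \<rho> N x"
proof (rule power2_le_imp_le)
  define a where "a n = norm (((*v) A ^^ n) x) / \<rho> ^ n" for n
  have "(orbit_norm A \<rho> N (A *v x))\<^sup>2 = (\<Sum>n<N. (norm (((*v) A ^^ n) (A *v x)) / \<rho> ^ n)\<^sup>2)"
    by (simp add: orbit_norm_def L2_set_def sum_nonneg)
  also have "\<dots> = (\<Sum>n<N. \<rho>\<^sup>2 * (a (Suc n))\<^sup>2)"
    using \<rho> by (intro sum.cong refl) (simp add: a_def funpow_swap1 field_simps)
  also have "\<dots> = \<rho>\<^sup>2 * ((\<Sum>n<N. (a n)\<^sup>2) + (a N)\<^sup>2 - (a 0)\<^sup>2)"
    using sum.lessThan_Suc[of "\<lambda>n. (a n)\<^sup>2" N] sum.lessThan_Suc_shift[of "\<lambda>n. (a n)\<^sup>2" N]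
    by (simp add: sum_distrib_left[symmetric])
  also have "\<dots> \<le> \<rho>\<^sup>2 * (\<Sum>n<N. (a n)\<^sup>2)"
  proof (rule mult_left_mono)
    have "a N \<le> a 0" using N[of x] \<rho> by (simp add: a_def field_simps)
    then have "(a N)\<^sup>2 \<le> (a 0)\<^sup>2" using \<rho> by (intro power_mono) (auto simp: a_def)
    then show "(\<Sum>n<N. (a n)\<^sup>2) + (a N)\<^sup>2 - (a 0)\<^sup>2 \<le> (\<Sum>n<N. (a n)\<^sup>2)" by simp
  qed simp
  also have "(\<Sum>n<N. (a n)\<^sup>2) = (orbit_norm A \<rho> N x)\<^sup>2"
    by (simp add: orbit_norm_def L2_set_def sum_nonneg a_def)
  finally show "(orbit_norm A \<rho> N (A *v x))\<^sup>2 \<le> (\<rho> * orbit_norm A \<rho> N x)\<^sup>2"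
    by (simp add: power_mult_distrib)
qed (use \<rho> in \<open>auto simp: orbit_norm_nonneg\<close>)

lemma small_step_modulus:
  fixes h K L L' :: real
  assumes L: "0 < L'" "L' < L" and h: "h > 0" "h * K\<^sup>2 < L - L'" "h * L < 1" and z: "Re z \<le> - L" "norm z \<le> K"
  shows "norm (1 + complex_of_real h * z) \<le> sqrt (1 - 2 * h * L + h\<^sup>2 * K\<^sup>2)"
proof -
  have "(norm (1 + complex_of_real h * z))\<^sup>2 = 1 + 2 * h * Re z + h\<^sup>2 * (norm z)\<^sup>2"
    unfolding cmod_power2 by (simp add: algebra_simps power2_eq_square)
  also have "\<dots> \<le> 1 - 2 * h * L + h\<^sup>2 * K\<^sup>2"
  proof -
    have "h * Re z \<le> h * (- L)" using h z by (intro mult_left_mono) auto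
    moreover have "h\<^sup>2 * (norm z)\<^sup>2 \<le> h\<^sup>2 * K\<^sup>2" using z by (intro mult_left_mono power_mono) auto
    ultimately show ?thesis by simp
  qed
  finally show ?thesis using real_le_rsqrt by auto
qed

text \<open>The left half plane condition becomes a spectral radius condition: for one small step
  \<open>h\<close>, all eigenvalues of \<open>A = 1 + h H\<close> have modulus below
  \<open>\<rho> = 1 - h L'\<close>, so \<open>A\<close> contracts its orbit norm by
  \<open>\<rho>\<close>. The same norm then works for every shorter step, because
  \<open>1 + g H\<close> is a convex combination of the identity and \<open>A\<close>.\<close>

lemma contracting_matrix_norm:
  fixes H :: "real ^ 'd ^ 'd"
  assumes ev: "\<And>z (w :: complex ^ 'd). w \<noteq> 0 \<Longrightarrow> map_matrix complex_of_real H *v w = z *s w \<Longrightarrow> Re z \<le> - L"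
    and L: "0 < L'" "L' < L"
  obtains A \<rho> N h where "\<rho> > 0" "N > 0" "h > 0"
    "\<And>g x. 0 \<le> g \<Longrightarrow> g \<le> h \<Longrightarrow> orbit_norm A \<rho> N (x + g *\<^sub>R (H *v x)) \<le> (1 - g * L') * orbit_norm A \<rho> N x"
proof -
  let ?H = "map_matrix complex_of_real H"
  obtain K where K: "\<And>z w. w \<noteq> 0 \<Longrightarrow> ?H *v w = z *s w \<Longrightarrow> norm z \<le> K"
    using eigenvalue_norm_bound[of ?H] by blast
  \<comment> \<open>The first entry keeps the quadratic term \<open>h K^2\<close> below the gap
    \<open>L - L'\<close>; the second keeps \<open>h L\<close> below \<open>1\<close>, hence
    \<open>\<rho>\<close> positive.\<close>
  define h where "h = min ((L - L') / (2 * (K\<^sup>2 + 1))) (1 / (2 * L))"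
  have h: "h > 0" using L by (simp add: h_def add_nonneg_pos)
  have h1: "h * K\<^sup>2 < L - L'"
  proof -
    have "h * K\<^sup>2 \<le> (L - L') / (2 * (K\<^sup>2 + 1)) * K\<^sup>2" by (intro mult_right_mono) (auto simp: h_def)
    also have "\<dots> = (L - L') * (K\<^sup>2 / (2 * (K\<^sup>2 + 1)))" by simp
    also have "\<dots> < (L - L') * 1"
    proof (rule mult_strict_left_mono)
      have "0 < 2 * (K\<^sup>2 + 1)" "K\<^sup>2 < 2 * (K\<^sup>2 + 1)" by (auto simp: add_nonneg_pos intro: le_less_trans[of _ "2 * K\<^sup>2"])
      then show "K\<^sup>2 / (2 * (K\<^sup>2 + 1)) < 1" by (simp only: divide_less_eq_1_pos)
    qed (use L in simp)
    also have "\<dots> = L - L'" by simp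
    finally show ?thesis .
  qed
  have h2: "h * L < 1"
  proof -
    have "h * L \<le> 1 / (2 * L) * L" using L by (intro mult_right_mono) (auto simp: h_def)
    then show ?thesis using L by simp
  qed
  have h3: "h * L' < 1" using h h2 L by (smt (verit) mult_strict_left_mono)
  define A where "A = mat 1 + h *\<^sub>R H"
  have Ax: "A *v x = x + h *\<^sub>R (H *v x)" for x
    by (simp add: A_def matrix_vector_mult_add_rdistrib scaleR_matrix_vector_assoc)
  define r where "r = sqrt (1 - 2 * h * L + h\<^sup>2 * K\<^sup>2)"
  define \<rho> where "\<rho> = 1 - h * L'"
  have \<rho>: "\<rho> > 0" using h3 by (simp add: \<rho>_def)
  have "1 - 2 * h * L + h\<^sup>2 * K\<^sup>2 < \<rho>\<^sup>2"
  proof -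
    have "h * (h * K\<^sup>2) < h * (L - L')" using h h1 by simp
    then have "h\<^sup>2 * K\<^sup>2 < 2 * (h * (L - L'))" using h L by (simp add: power2_eq_square)
    moreover have "\<rho>\<^sup>2 = 1 - 2 * h * L' + (h * L')\<^sup>2" by (simp add: \<rho>_def power2_eq_square algebra_simps)
    moreover have "(h * L')\<^sup>2 \<ge> 0" by simp
    moreover have "2 * (h * (L - L')) = 2 * h * L - 2 * h * L'" by (simp add: algebra_simps)
    ultimately show ?thesis by linarith
  qed
  then have "r < sqrt (\<rho>\<^sup>2)" unfolding r_def by (rule real_sqrt_less_mono)
  then have r\<rho>: "r < \<rho>" using \<rho> by simp
  \<comment> \<open>The radicand is not known to be nonnegative here, and \<open>sqrt\<close> of a
    negative number is negative; the maximum supplies the nonnegative rate that the decay lemma asks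
    for.\<close>
  define r' where "r' = max r 0"
  have "norm z \<le> r'" if w: "w \<noteq> 0" "map_matrix complex_of_real A *v w = z *s w" for z and w :: "complex ^ 'd"
  proof -
    have Aw: "map_matrix complex_of_real A *v w = w + complex_of_real h *s (?H *v w)"
    proof -
      have "(\<Sum>j\<in>UNIV. (if i = j then w $ j else 0)) = w $ i" for i by simp
      then show ?thesis
        by (simp add: A_def vec_eq_iff matrix_vector_mult_def map_matrix_def mat_def
          sum.distrib algebra_simps sum_distrib_left if_distrib[of complex_of_real]) (simp add: if_distrib[of "\<lambda>x. _ * x"] cong: if_cong)
    qed
    define y where "y = (z - 1) / complex_of_real h"
    have "?H *v w = y *s w"
    proof -
      have "complex_of_real h *s (?H *v w) = (z - 1) *s w"
        using Aw w(2) by (simp add: vector_sub_rdistrib algebra_simps)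
      then have "inverse (complex_of_real h) *s (complex_of_real h *s (?H *v w)) = inverse (complex_of_real h) *s ((z - 1) *s w)"
        by simp
      then show ?thesis using h by (simp only: vector_smult_assoc) (simp add: y_def divide_inverse mult.commute)
    qed
    then have "norm (1 + complex_of_real h * y) \<le> r"
      unfolding r_def using L h h1 h2 w(1) ev[of w y] K[of w y] by (intro small_step_modulus) auto
    then show ?thesis using h by (simp add: y_def r'_def)
  qed
  moreover obtain \<rho>' where \<rho>': "r' < \<rho>'" "\<rho>' < \<rho>"
    using dense[of r' \<rho>] r\<rho> \<rho> by (auto simp: r'_def)
  ultimately obtain C where C: "\<And>n x. norm (((*v) A ^^ n) x) \<le> C * \<rho>' ^ n * norm x"
    using matrix_power_decay[of A r' \<rho>'] by (auto simp: r'_def)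
  have "(\<lambda>n. C * (\<rho>' / \<rho>) ^ n) \<longlonglongrightarrow> C * 0"
    using \<rho>' \<rho> by (intro tendsto_mult tendsto_const LIMSEQ_power_zero) (auto simp: r'_def)
  then have "\<forall>\<^sub>F n in sequentially. C * (\<rho>' / \<rho>) ^ n < 1"
    by (intro order_tendstoD) auto
  then have "\<forall>\<^sub>F n in sequentially. C * (\<rho>' / \<rho>) ^ n < 1 \<and> n > 0"
    using eventually_gt_at_top by (rule eventually_conj)
  \<comment> \<open>\<open>N\<close> iterates suffice for the constant \<open>C\<close> to be beaten
    by the gap between the decay rate \<open>\<rho>'\<close> and the target rate
    \<open>\<rho>\<close>.\<close>
  then obtain N where N: "C * (\<rho>' / \<rho>) ^ N < 1" "N > 0"
    by (auto simp: eventually_sequentially)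
  have "norm (((*v) A ^^ N) x) \<le> \<rho> ^ N * norm x" for x
  proof -
    have "C * \<rho>' ^ N \<le> \<rho> ^ N" using N \<rho> by (simp add: field_simps)
    then show ?thesis using C[of N x] by (meson mult_right_mono norm_ge_zero order_trans)
  qed
  note contr = orbit_norm_contraction[OF \<rho> this]
  have "orbit_norm A \<rho> N (x + g *\<^sub>R (H *v x)) \<le> (1 - g * L') * orbit_norm A \<rho> N x"
    if g: "0 \<le> g" "g \<le> h" for g x
  proof -
    define s where "s = g / h"
    have s: "0 \<le> s" "s \<le> 1" using g h by (auto simp: s_def)
    have "x + g *\<^sub>R (H *v x) = (1 - s) *\<^sub>R x + s *\<^sub>R (A *v x)"
      using h by (simp add: Ax s_def algebra_simps)
    then have "orbit_norm A \<rho> N (x + g *\<^sub>R (H *v x)) \<le> (1 - s) * orbit_norm A \<rho> N x + s * orbit_norm A \<rho> N (A *v x)"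
      using orbit_norm_triangle[OF \<rho>, of A N "(1 - s) *\<^sub>R x" "s *\<^sub>R (A *v x)"] s
      by (simp add: orbit_norm_scaleR)
    also have "\<dots> \<le> (1 - s) * orbit_norm A \<rho> N x + s * (\<rho> * orbit_norm A \<rho> N x)"
      using s contr by (intro add_left_mono mult_left_mono) auto
    also have "\<dots> = (1 - g * L') * orbit_norm A \<rho> N x"
      using h by (simp add: s_def \<rho>_def field_simps)
    finally show ?thesis .
  qed
  from that[OF \<rho> N(2) h this] show ?thesis .
qed

section \<open>Square roots of positive semidefinite matrices\<close>

lemma gram_decomposition:
  fixes S :: "'d::finite \<Rightarrow> 'd \<Rightarrow> real"
  assumes sym: "\<And>i j. S i j = S j i"
    and psd: "\<And>u. 0 \<le> (\<Sum>i\<in>UNIV. \<Sum>j\<in>UNIV. u i * u j * S i j)"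
  shows "\<exists>a :: 'd \<Rightarrow> 'd \<Rightarrow> real. (\<forall>i k. k \<notin> J \<longrightarrow> a i k = 0) \<and> (\<forall>i\<in>J. \<forall>j\<in>J. (\<Sum>k\<in>UNIV. a i k * a j k) = S i j)"
proof -
  have "finite J" by simp
  then show ?thesis using assms
  proof (induction J arbitrary: S)
    case empty
    then show ?case by auto
  next
    case (insert p J)
    note sym = insert.prems(1) and psd = insert.prems(2)
    \<comment> \<open>The quadratic form at the vector with entry \<open>x\<close> at
      \<open>i\<close> and \<open>1\<close> at \<open>j\<close>.\<close>
    have two: "0 \<le> x\<^sup>2 * S i i + 2 * x * S i j + S j j" if "i \<noteq> j" for x i j
    proof -
      define u where "u k = (if k = i then x else if k = j then 1 else 0)" for k
      have us: "(\<Sum>k\<in>UNIV. u k * f k) = x * f i + f j" for f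
      proof -
        have "(\<Sum>k\<in>UNIV. u k * f k) = (\<Sum>k\<in>UNIV. (if k = i then x * f k else 0) + (if k = j then f k else 0))"
          using that by (intro sum.cong) (auto simp: u_def)
        then show ?thesis by (simp add: sum.distrib)
      qed
      have "(\<Sum>k\<in>UNIV. \<Sum>l\<in>UNIV. u k * u l * S k l) = (\<Sum>k\<in>UNIV. u k * (\<Sum>l\<in>UNIV. u l * S k l))"
        by (simp add: sum_distrib_left mult.assoc)
      also have "\<dots> = x\<^sup>2 * S i i + x * S i j + x * S j i + S j j"
        unfolding us by (simp add: power2_eq_square algebra_simps)
      finally show ?thesis using psd[of u] sym[of i j] by (simp add: algebra_simps)
    qed
    have diag: "0 \<le> S i i" for i
    proof -
      have e: "(\<Sum>k\<in>UNIV. (if k = i then 1 else 0) * f k) = f i" for f :: "'d \<Rightarrow> real"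
        by (simp add: if_distrib[of "\<lambda>x. x * _"] cong: if_cong)
      have "(\<Sum>k\<in>UNIV. \<Sum>l\<in>UNIV. (if k = i then 1 else 0) * (if l = i then 1 else 0) * S k l)
          = (\<Sum>k\<in>UNIV. (if k = i then 1 else 0) * (\<Sum>l\<in>UNIV. (if l = i then 1 else 0) * S k l))"
        by (simp only: sum_distrib_left mult.assoc)
      also have "\<dots> = S i i" by (simp only: e)
      finally have "(\<Sum>k\<in>UNIV. \<Sum>l\<in>UNIV. (if k = i then 1 else 0) * (if l = i then 1 else 0) * S k l) = S i i" .
      then show ?thesis using psd[of "\<lambda>k. if k = i then 1 else 0"] by (simp only: )
    qed
    define s where "s = S p p"
    define T where "T i j = S i j - S i p * S p j / s" for i j
    have Tsym: "T i j = T j i" for i j using sym by (simp add: T_def mult.commute)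
    have Tpsd: "0 \<le> (\<Sum>i\<in>UNIV. \<Sum>j\<in>UNIV. u i * u j * T i j)" for u
    proof -
      define m where "m = (\<Sum>i\<in>UNIV. u i * S i p)"
      have m': "(\<Sum>i\<in>UNIV. u i * S p i) = m" using sym by (simp add: m_def)
      \<comment> \<open>Completing the square: \<open>w\<close> moves \<open>u\<close> along
        direction \<open>p\<close> so that the form of \<open>S\<close> at \<open>w\<close> equals
        the form of \<open>T\<close> at \<open>u\<close>. For \<open>s = 0\<close> the shift is zero
        and so is the correction in \<open>T\<close>.\<close>
      define w where "w k = u k - (if k = p then m / s else 0)" for k
      have "(\<Sum>i\<in>UNIV. \<Sum>j\<in>UNIV. w i * w j * S i j)
          = (\<Sum>i\<in>UNIV. \<Sum>j\<in>UNIV. u i * u j * S i j) - 2 * m * (m / s) + (m / s)\<^sup>2 * s"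
      proof -
        define c where "c = m / s"
        define t where "t i = (\<Sum>j\<in>UNIV. u j * S i j)" for i
        have wsum: "(\<Sum>k\<in>UNIV. w k * f k) = (\<Sum>k\<in>UNIV. u k * f k) - c * f p" for f
        proof -
          have "(\<Sum>k\<in>UNIV. w k * f k) = (\<Sum>k\<in>UNIV. u k * f k - (if k = p then c * f p else 0))"
            by (intro sum.cong) (auto simp: w_def c_def left_diff_distrib)
          then show ?thesis by (simp add: sum_subtractf)
        qed
        have "(\<Sum>i\<in>UNIV. \<Sum>j\<in>UNIV. w i * w j * S i j) = (\<Sum>i\<in>UNIV. w i * (\<Sum>j\<in>UNIV. w j * S i j))"
          by (simp add: sum_distrib_left mult.assoc)
        also have "\<dots> = (\<Sum>i\<in>UNIV. w i * (t i - c * S i p))"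
          by (simp only: wsum t_def)
        also have "\<dots> = (\<Sum>i\<in>UNIV. u i * (t i - c * S i p)) - c * (t p - c * s)"
          by (simp only: wsum s_def)
        also have "(\<Sum>i\<in>UNIV. u i * (t i - c * S i p)) = (\<Sum>i\<in>UNIV. u i * t i) - c * m"
          by (simp add: right_diff_distrib sum_subtractf m_def sum_distrib_left mult.left_commute)
        also have "t p = m" using sym by (simp add: t_def m_def)
        also have "(\<Sum>i\<in>UNIV. u i * t i) = (\<Sum>i\<in>UNIV. \<Sum>j\<in>UNIV. u i * u j * S i j)"
          by (simp add: t_def sum_distrib_left mult.assoc)
        finally show ?thesis by (simp add: c_def[symmetric] power2_eq_square algebra_simps)
      qed
      also have "\<dots> = (\<Sum>i\<in>UNIV. \<Sum>j\<in>UNIV. u i * u j * S i j) - m\<^sup>2 / s"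
        by (cases "s = 0") (simp_all add: power2_eq_square field_simps)
      also have "m\<^sup>2 / s = (\<Sum>i\<in>UNIV. \<Sum>j\<in>UNIV. u i * u j * (S i p * S p j / s))"
      proof -
        have "m\<^sup>2 = (\<Sum>i\<in>UNIV. u i * S i p) * (\<Sum>j\<in>UNIV. u j * S p j)" by (simp add: m' m_def power2_eq_square)
        also have "\<dots> = (\<Sum>i\<in>UNIV. \<Sum>j\<in>UNIV. u i * u j * (S i p * S p j))"
          by (simp add: sum_product algebra_simps)
        finally show ?thesis by (simp add: sum_divide_distrib)
      qed
      finally show ?thesis using psd[of w] by (simp add: T_def algebra_simps sum_subtractf)
    qed
    obtain a where a: "\<And>i k. k \<notin> J \<Longrightarrow> a i k = 0" "\<And>i j. i \<in> J \<Longrightarrow> j \<in> J \<Longrightarrow> (\<Sum>k\<in>UNIV. a i k * a j k) = T i j"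
      using insert.IH[OF Tsym Tpsd] by blast
    \<comment> \<open>Row \<open>p\<close> keeps only its pivot entry; the factor of
      \<open>T\<close> is unconstrained in that row, since \<open>p\<close> lies outside
      \<open>J\<close>.\<close>
    define b where "b i k = (if k = p then S i p / sqrt s else if i = p then 0 else a i k)" for i k
    have b0: "b i k = 0" if "k \<notin> insert p J" for i k using that a(1) by (auto simp: b_def)
    have split: "(\<Sum>k\<in>UNIV. b i k * b j k) = S i p * S j p / s + (\<Sum>k\<in>-{p}. b i k * b j k)" for i j
    proof -
      have "(\<Sum>k\<in>UNIV. b i k * b j k) = b i p * b j p + (\<Sum>k\<in>UNIV - {p}. b i k * b j k)"
        by (rule sum.remove) auto
      then show ?thesis using diag[of p] by (simp add: b_def s_def Compl_eq_Diff_UNIV)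
    qed
    \<comment> \<open>If an entry of the pivot column were nonzero, the form would be affine in the
      pivot direction; the chosen \<open>x\<close> makes its value \<open>-1\<close>.\<close>
    have zero: "S i p = 0" if "s = 0" for i
    proof (rule ccontr)
      assume n: "S i p \<noteq> 0"
      then have "p \<noteq> i" using that s_def by auto
      from two[OF this, of "- (S i i + 1) / (2 * S i p)"] n that sym[of p i] show False
        by (simp add: s_def[symmetric] field_simps)
    qed
    have pp: "S i p * S p p / s = S i p" for i using zero by (cases "s = 0") (auto simp: s_def)
    have "(\<Sum>k\<in>UNIV. b i k * b j k) = S i j" if ij: "i \<in> insert p J" "j \<in> insert p J" for i j
    proof (cases "i = p \<or> j = p")
      case True
      then have "(\<Sum>k\<in>-{p}. b i k * b j k) = 0" by (intro sum.neutral) (auto simp: b_def)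
      then show ?thesis unfolding split using True pp[of i] pp[of j] sym by (auto simp: mult.commute)
    next
      case False
      then have "i \<in> J" "j \<in> J" using ij by auto
      have "(\<Sum>k\<in>-{p}. b i k * b j k) = (\<Sum>k\<in>UNIV. a i k * a j k)"
        using False a(1)[of p] insert.hyps by (intro sum.mono_neutral_cong_left) (auto simp: b_def)
      then show ?thesis unfolding split a(2)[OF \<open>i \<in> J\<close> \<open>j \<in> J\<close>] T_def using sym[of j p] by simp
    qed
    with b0 show ?case by (intro exI[of _ b]) blast
  qed
qed

text \<open>This is what makes the choice of a root in \<open>mv_normal\<close> meaningful.\<close>

lemma psd_matrix_square_root:
  fixes \<Sigma> :: "real ^ 'd ^ 'd"
  assumes "transpose \<Sigma> = \<Sigma>" "\<And>u. 0 \<le> u \<bullet> (\<Sigma> *v u)"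
  shows "\<exists>A :: real ^ 'd ^ 'd. A ** transpose A = \<Sigma>"
proof -
  have "\<Sigma> $ i $ j = \<Sigma> $ j $ i" for i j
    using arg_cong[OF assms(1), of "\<lambda>A. A $ j $ i"] by (simp add: transpose_def)
  moreover have "0 \<le> (\<Sum>i\<in>UNIV. \<Sum>j\<in>UNIV. u i * u j * \<Sigma> $ i $ j)" for u
    using assms(2)[of "\<chi> i. u i"]
    by (simp add: inner_vec_def matrix_vector_mult_def sum_distrib_left algebra_simps)
  ultimately obtain a :: "'d \<Rightarrow> 'd \<Rightarrow> real" where "\<forall>i\<in>UNIV. \<forall>j\<in>UNIV. (\<Sum>k\<in>UNIV. a i k * a j k) = \<Sigma> $ i $ j"
    using gram_decomposition[of "\<lambda>i j. \<Sigma> $ i $ j" UNIV] by blast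
  then have "(\<chi> i k. a i k) ** transpose (\<chi> i k. a i k) = \<Sigma>"
    by (simp add: vec_eq_iff matrix_matrix_mult_def transpose_def)
  then show ?thesis by blast
qed

section \<open>Averaging matrices and weighted sums\<close>

text \<open>For \<open>k \<le> n\<close>, \<open>averaging_matrix b \<gamma> H k n\<close> is
  \<open>B k n = (\<gamma> k / b k) * (\<Sum>l=k..n. b l * (\<Prod>j=k+1..l. 1 + \<gamma> j * H))\<close>, computed by recursion on \<open>n - k\<close>: it
  is the total weight with which noise entering at time \<open>k\<close> contributes to the weighted sum up to time \<open>n\<close>.\<close>

primrec averaging_aux :: "(nat \<Rightarrow> real) \<Rightarrow> (nat \<Rightarrow> real) \<Rightarrow> real ^ 'd ^ 'd \<Rightarrow> nat \<Rightarrow> nat \<Rightarrow> real ^ 'd ^ 'd" where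
  "averaging_aux b \<gamma> H n 0 = \<gamma> n *\<^sub>R mat 1"
| "averaging_aux b \<gamma> H n (Suc j) = \<gamma> (n - Suc j) *\<^sub>R mat 1 +
     (\<gamma> (n - Suc j) / b (n - Suc j) * (b (n - j) / \<gamma> (n - j))) *\<^sub>R
       (averaging_aux b \<gamma> H n j ** (mat 1 + \<gamma> (n - j) *\<^sub>R H))"

definition averaging_matrix :: "(nat \<Rightarrow> real) \<Rightarrow> (nat \<Rightarrow> real) \<Rightarrow> real ^ 'd ^ 'd \<Rightarrow> nat \<Rightarrow> nat \<Rightarrow> real ^ 'd ^ 'd" where
  "averaging_matrix b \<gamma> H k n = averaging_aux b \<gamma> H n (n - k)"

lemma averaging_matrix_self: "averaging_matrix b \<gamma> H n n = \<gamma> n *\<^sub>R mat 1"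
  by (simp add: averaging_matrix_def)

lemma averaging_matrix_rec:
  assumes "k < n"
  shows "averaging_matrix b \<gamma> H k n = \<gamma> k *\<^sub>R mat 1 +
    (\<gamma> k / b k * (b (Suc k) / \<gamma> (Suc k))) *\<^sub>R (averaging_matrix b \<gamma> H (Suc k) n ** (mat 1 + \<gamma> (Suc k) *\<^sub>R H))"
proof -
  have "n - k = Suc (n - Suc k)" "n - Suc (n - Suc k) = k" "n - (n - Suc k) = Suc k"
    using assms by auto
  then show ?thesis by (simp add: averaging_matrix_def)
qed

text \<open>The starting index is moved downwards. One step splits \<open>x (Suc m)\<close> into the
  image of \<open>x m\<close> and the new noise, and the recursion for the averaging matrices
  collects both. The initial value has weight \<open>b m / \<gamma> m\<close> because, unlike the
  noise, it enters without a factor \<open>\<gamma> m\<close>.\<close>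

lemma weighted_sum_of_linear_recursion:
  fixes x r :: "nat \<Rightarrow> real ^ 'd"
  assumes b: "\<And>k. k \<ge> m \<Longrightarrow> b k > 0" and \<gamma>: "\<And>k. k \<ge> m \<Longrightarrow> \<gamma> k > 0"
    and x: "\<And>k. m < k \<Longrightarrow> k \<le> n \<Longrightarrow> x k = x (k - 1) + \<gamma> k *\<^sub>R (H *v x (k - 1) + r k)"
    and "m \<le> n"
  shows "(\<Sum>l=m..n. b l *\<^sub>R x l) = (b m / \<gamma> m) *\<^sub>R (averaging_matrix b \<gamma> H m n *v x m)
    + (\<Sum>k=Suc m..n. b k *\<^sub>R (averaging_matrix b \<gamma> H k n *v r k))"
  using \<open>m \<le> n\<close> b \<gamma> x
proof (induction m rule: inc_induct)
  case base
  have "\<gamma> n > 0" using base by auto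
  then show ?case by (simp add: averaging_matrix_self scaleR_matrix_vector_assoc[symmetric])
next
  case (step m)
  note b = step.prems(1) and \<gamma> = step.prems(2) and x = step.prems(3)
  let ?B = "averaging_matrix b \<gamma> H"
  have xm: "x (Suc m) = x m + \<gamma> (Suc m) *\<^sub>R (H *v x m + r (Suc m))"
    using x[of "Suc m"] step.hyps by simp
  have "(\<Sum>l=Suc m..n. b l *\<^sub>R x l) = (b (Suc m) / \<gamma> (Suc m)) *\<^sub>R (?B (Suc m) n *v x (Suc m))
    + (\<Sum>k=Suc (Suc m)..n. b k *\<^sub>R (?B k n *v r k))"
    by (rule step.IH) (use b \<gamma> x in auto)
  also have "?B (Suc m) n *v x (Suc m) = ?B (Suc m) n *v ((mat 1 + \<gamma> (Suc m) *\<^sub>R H) *v x m)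
      + \<gamma> (Suc m) *\<^sub>R (?B (Suc m) n *v r (Suc m))"
    by (simp add: xm matrix_vector_right_distrib matrix_vector_mult_add_rdistrib
        matrix_vector_mult_scaleR scaleR_matrix_vector_assoc[symmetric] algebra_simps)
  finally have "(\<Sum>l=Suc m..n. b l *\<^sub>R x l)
      = (b (Suc m) / \<gamma> (Suc m)) *\<^sub>R (?B (Suc m) n *v ((mat 1 + \<gamma> (Suc m) *\<^sub>R H) *v x m))
      + (b (Suc m) *\<^sub>R (?B (Suc m) n *v r (Suc m)) + (\<Sum>k=Suc (Suc m)..n. b k *\<^sub>R (?B k n *v r k)))"
    using \<gamma>[of "Suc m"] by (simp add: scaleR_add_right)
  also have "b (Suc m) *\<^sub>R (?B (Suc m) n *v r (Suc m)) + (\<Sum>k=Suc (Suc m)..n. b k *\<^sub>R (?B k n *v r k))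
      = (\<Sum>k=Suc m..n. b k *\<^sub>R (?B k n *v r k))"
    using step.hyps by (simp add: sum.atLeast_Suc_atMost[of "Suc m" n])
  finally have *: "(\<Sum>l=Suc m..n. b l *\<^sub>R x l)
      = (b (Suc m) / \<gamma> (Suc m)) *\<^sub>R (?B (Suc m) n *v ((mat 1 + \<gamma> (Suc m) *\<^sub>R H) *v x m))
      + (\<Sum>k=Suc m..n. b k *\<^sub>R (?B k n *v r k))" .
  have "(b m / \<gamma> m) *\<^sub>R (?B m n *v x m) = b m *\<^sub>R x m
      + (b (Suc m) / \<gamma> (Suc m)) *\<^sub>R (?B (Suc m) n *v ((mat 1 + \<gamma> (Suc m) *\<^sub>R H) *v x m))"
    using b[of m] \<gamma>[of m]
    by (simp add: averaging_matrix_rec[OF step.hyps(2)] matrix_vector_mult_add_rdistrib[of "\<gamma> m *\<^sub>R mat 1"]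
        scaleR_matrix_vector_assoc[symmetric] matrix_vector_mul_assoc scaleR_add_right)
  then show ?case
    using step.hyps * by (simp add: sum.atLeast_Suc_atMost[of m n])
qed

text \<open>The majorant is the supremum over the tail. Monotonicity is needed in a backward
  induction, where the error bound at \<open>Suc k\<close> must be dominated by the one at
  \<open>k\<close>.\<close>

lemma decreasing_majorant:
  fixes a :: "nat \<Rightarrow> real"
  assumes "a \<longlonglongrightarrow> 0"
  obtains \<eta> where "\<eta> \<longlonglongrightarrow> 0" "\<And>k. a k \<le> \<eta> k" "\<And>k. \<eta> (Suc k) \<le> \<eta> k" "\<And>k. 0 \<le> \<eta> k"
proof -
  have bdd: "bdd_above ((\<lambda>k. \<bar>a k\<bar>) ` S)" for S
  proof -
    have "Bseq a" using assms by (intro convergent_imp_Bseq) (auto simp: convergent_def)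
    then obtain K where "\<And>n. norm (a n) \<le> K" by (auto simp: Bseq_def)
    then show ?thesis by (intro bdd_aboveI2[of _ _ K]) auto
  qed
  define \<eta> where "\<eta> k = (SUP r\<in>{k..}. \<bar>a r\<bar>)" for k
  have le: "\<bar>a r\<bar> \<le> \<eta> k" if "k \<le> r" for k r
    unfolding \<eta>_def using that by (intro cSUP_upper bdd) auto
  have "\<eta> \<longlonglongrightarrow> 0"
  proof (rule LIMSEQ_I)
    fix e :: real assume e: "e > 0"
    then obtain k where k: "\<And>r. r \<ge> k \<Longrightarrow> \<bar>a r\<bar> < e / 2"
      using LIMSEQ_D[OF assms, of "e / 2"] by auto
    have "norm (\<eta> r - 0) < e" if "r \<ge> k" for r
    proof -
      have "\<eta> r \<le> e / 2" unfolding \<eta>_def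
      proof (rule cSUP_least)
        fix j assume "j \<in> {r..}"
        then show "\<bar>a j\<bar> \<le> e / 2" using k[of j] that by auto
      qed auto
      moreover have "0 \<le> \<eta> r" using le[of r r] by auto
      ultimately show ?thesis using e by auto
    qed
    then show "\<exists>k. \<forall>r\<ge>k. norm (\<eta> r - 0) < e" by blast
  qed
  moreover have "a k \<le> \<eta> k" for k using le[of k k] by auto
  moreover have "\<eta> (Suc k) \<le> \<eta> k" for k unfolding \<eta>_def by (intro cSUP_subset_mono bdd) auto
  moreover have "0 \<le> \<eta> k" for k using le[of k k] by auto
  ultimately show ?thesis by (rule that)
qed

text \<open>The deviation \<open>G k n = B k n + Hi\<close> satisfies a backward recursion in
  \<open>k\<close>: because \<open>Hi\<close> inverts \<open>H\<close>, the constant part cancels up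
  to the increment \<open>\<gamma> k - \<gamma> (Suc k)\<close> and a term of size
  \<open>\<gamma> k * \<alpha>' k\<close>. The factor \<open>1 + \<gamma> H\<close> multiplies from
  the right, so the contraction is applied to the argument, which is why \<open>main\<close>
  measures the argument by \<open>N\<close> and the result by the standard norm.\<close>

lemma averaging_matrix_limit:
  fixes H Hi :: "real ^ 'd ^ 'd" and N :: "real ^ 'd \<Rightarrow> real"
  assumes N: "\<And>x. norm x \<le> N x" "\<And>x. N x \<le> K0 * norm x"
    and contr: "h > 0" "L > 0" "\<And>g x. 0 \<le> g \<Longrightarrow> g \<le> h \<Longrightarrow> N (x + g *\<^sub>R (H *v x)) \<le> (1 - g * L) * N x"
    and Hi: "Hi ** H = mat 1"
    and b: "\<And>n. n \<ge> 1 \<Longrightarrow> b n > 0" and \<gamma>: "\<And>n. n \<ge> 1 \<Longrightarrow> \<gamma> n > 0"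
    and decr: "\<And>n. n \<ge> 1 \<Longrightarrow> \<gamma> (Suc n) \<le> \<gamma> n" "\<gamma> \<longlonglongrightarrow> 0"
    and ratio: "\<forall>\<^sub>F n in sequentially. \<gamma> n \<le> K * \<gamma> (Suc n)"
    and \<alpha>: "(\<lambda>n. 1 / \<gamma> n * (b (Suc n) * \<gamma> n / (b n * \<gamma> (Suc n)) - 1)) \<longlonglongrightarrow> 0"
  obtains k0 c C \<zeta> where "k0 \<ge> 1" "c > 0" "C \<ge> 0" "\<zeta> \<longlonglongrightarrow> 0" "\<And>k. 0 \<le> \<zeta> k"
    "\<And>k n x. k0 \<le> k \<Longrightarrow> k \<le> n \<Longrightarrow>
       norm ((averaging_matrix b \<gamma> H k n + Hi) *v x) \<le> (C * exp (- c * (real (n - k) * \<gamma> n)) + \<zeta> k) * norm x"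
proof -
  define \<alpha>' where "\<alpha>' n = 1 / \<gamma> n * (b (Suc n) * \<gamma> n / (b n * \<gamma> (Suc n)) - 1)" for n
  let ?B = "averaging_matrix b \<gamma> H"
  define G where "G k n = ?B k n + Hi" for k n
  \<comment> \<open>Half of the contraction rate is given up: a factor \<open>1 + c \<gamma>\<close>
    from the ratio of the weights times \<open>1 - 2 c \<gamma>\<close> is still at most
    \<open>1 - c \<gamma>\<close>.\<close>
  define c where "c = L / 2"
  have "bounded_linear ((*v) Hi)" by (rule matrix_vector_mul_bounded_linear)
  then obtain Ki where Ki: "Ki > 0" "\<And>x. norm (Hi *v x) \<le> norm x * Ki"
    using bounded_linear.pos_bounded by blast
  have "\<forall>\<^sub>F n in sequentially. \<gamma> n \<le> K * \<gamma> (Suc n) \<and> \<gamma> n < min h (min (1 / (2 * L)) 1) \<and> K * \<bar>\<alpha>' n\<bar> < L / 2 \<and> n \<ge> 1"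
  proof (intro eventually_conj ratio eventually_ge_at_top)
    show "\<forall>\<^sub>F n in sequentially. \<gamma> n < min h (min (1 / (2 * L)) 1)"
      using decr(2) contr(1,2) by (intro order_tendstoD) auto
    have "(\<lambda>n. K * \<bar>\<alpha>' n\<bar>) \<longlonglongrightarrow> K * \<bar>0\<bar>"
      unfolding \<alpha>'_def by (intro tendsto_intros \<alpha>)
    then show "\<forall>\<^sub>F n in sequentially. K * \<bar>\<alpha>' n\<bar> < L / 2"
      using contr(2) by (intro order_tendstoD) auto
  qed
  then obtain k0 where k0: "\<And>n. n \<ge> k0 \<Longrightarrow> \<gamma> n \<le> K * \<gamma> (Suc n)" "\<And>n. n \<ge> k0 \<Longrightarrow> \<gamma> n \<le> h"
    "\<And>n. n \<ge> k0 \<Longrightarrow> \<gamma> n * L \<le> 1 / 2" "\<And>n. n \<ge> k0 \<Longrightarrow> \<gamma> n \<le> 1" "\<And>n. n \<ge> k0 \<Longrightarrow> K * \<bar>\<alpha>' n\<bar> \<le> L / 2" "k0 \<ge> 1"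
  proof -
    assume *: "\<forall>\<^sub>F n in sequentially. \<gamma> n \<le> K * \<gamma> (Suc n) \<and> \<gamma> n < min h (min (1 / (2 * L)) 1) \<and> K * \<bar>\<alpha>' n\<bar> < L / 2 \<and> n \<ge> 1"
    then obtain k0 where k0: "\<And>n. n \<ge> k0 \<Longrightarrow> \<gamma> n \<le> K * \<gamma> (Suc n) \<and> \<gamma> n < min h (min (1 / (2 * L)) 1) \<and> K * \<bar>\<alpha>' n\<bar> < L / 2 \<and> n \<ge> 1"
      unfolding eventually_sequentially by blast
    show ?thesis
    proof (rule that[of k0])
      fix n assume "n \<ge> k0"
      from k0[OF this] show "\<gamma> n * L \<le> 1 / 2" using contr(2) by (simp add: field_simps)
    qed (use k0 in \<open>auto intro: less_imp_le\<close>)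
  qed
  obtain \<eta> where \<eta>: "\<eta> \<longlonglongrightarrow> 0" "\<And>k. K * \<bar>\<alpha>' k\<bar> * (Ki + 1) \<le> \<eta> k" "\<And>k. \<eta> (Suc k) \<le> \<eta> k" "\<And>k. 0 \<le> \<eta> k"
  proof -
    have "(\<lambda>k. K * \<bar>\<alpha>' k\<bar> * (Ki + 1)) \<longlonglongrightarrow> K * \<bar>0\<bar> * (Ki + 1)"
      unfolding \<alpha>'_def by (intro tendsto_intros \<alpha>)
    then show ?thesis using that by (auto intro: decreasing_majorant)
  qed
  define C where "C = Ki + 1"
  have Nn: "0 \<le> N x" for x using N(1)[of x] norm_ge_zero[of x] by linarith
  \<comment> \<open>The three terms reproduce themselves under the recursion: the exponential
    carries the initial error at \<open>k = n\<close>, \<open>\<gamma> k\<close> sums the increments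
    of \<open>\<gamma>\<close>, and \<open>\<eta> k / c\<close> is the fixed point of the map
    \<open>t\<close> to \<open>(1 - c \<gamma>) t + \<gamma> \<eta>\<close>.\<close>
  have main: "norm (G k n *v x) \<le> (C * exp (- c * (\<Sum>j=Suc k..n. \<gamma> j)) + \<gamma> k + \<eta> k / c) * N x"
    if "k0 \<le> k" "k \<le> n" for k n x
    using that(2,1)
  proof (induction k arbitrary: x rule: inc_induct)
    case base
    have "norm (G n n *v x) \<le> \<gamma> n * norm x + Ki * norm x"
    proof -
      have "G n n *v x = \<gamma> n *\<^sub>R x + Hi *v x"
        by (simp add: G_def averaging_matrix_self matrix_vector_mult_add_rdistrib scaleR_matrix_vector_assoc[symmetric])
      also have "norm \<dots> \<le> norm (\<gamma> n *\<^sub>R x) + norm (Hi *v x)" by (rule norm_triangle_ineq)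
      also have "\<dots> \<le> \<gamma> n * norm x + Ki * norm x" using Ki(2)[of x] \<gamma>[of n] base k0(6) by (simp add: mult.commute)
      finally show ?thesis .
    qed
    also have "\<dots> \<le> (C + \<gamma> n + \<eta> n / c) * N x"
    proof -
      have "(\<gamma> n + Ki) * norm x \<le> (C + \<gamma> n + \<eta> n / c) * N x"
        using N(1)[of x] \<eta>(4)[of n] contr(2) Ki(1) \<gamma>[of n] base k0(6)
        by (intro mult_mono) (auto simp: C_def c_def)
      then show ?thesis by (simp add: algebra_simps)
    qed
    finally show ?case by simp
  next
    case (step k)
    let ?g = "\<gamma> (Suc k)" and ?a = "\<gamma> k * \<alpha>' k"
    have k1: "k \<ge> 1" using k0(6) step.prems by auto
    note pos = b[OF k1] \<gamma>[OF k1] b[of "Suc k"] \<gamma>[of "Suc k"]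
    have fac: "\<gamma> k / b k * (b (Suc k) / ?g) = 1 + ?a"
      using pos by (simp add: \<alpha>'_def field_simps)
    have HiH: "Hi *v (x + ?g *\<^sub>R (H *v x)) = Hi *v x + ?g *\<^sub>R x"
      by (simp add: matrix_vector_right_distrib matrix_vector_mult_scaleR matrix_vector_mul_assoc Hi)
    define y where "y = x + ?g *\<^sub>R (H *v x)"
    have y': "(mat 1 + ?g *\<^sub>R H) *v x = y"
      by (simp add: y_def matrix_vector_mult_add_rdistrib scaleR_matrix_vector_assoc[symmetric])
    have "G k n *v x = \<gamma> k *\<^sub>R x + (1 + ?a) *\<^sub>R (?B (Suc k) n *v y) + Hi *v x"
      unfolding G_def averaging_matrix_rec[OF step.hyps(2)] fac y'[symmetric]
      by (simp only: matrix_vector_mult_add_rdistrib[of _ Hi] matrix_vector_mult_add_rdistrib[of "\<gamma> k *\<^sub>R mat 1"]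
          matrix_vector_mul_assoc scaleR_matrix_vector_assoc[symmetric] matrix_vector_mul_lid)
    also have "?B (Suc k) n *v y = G (Suc k) n *v y - (Hi *v x + ?g *\<^sub>R x)"
      using HiH by (simp add: G_def matrix_vector_mult_add_rdistrib y_def)
    \<comment> \<open>The factor in front of \<open>G (Suc k) n\<close> comes from the ratio of the
      weights, the last summand from its deviation from \<open>1\<close> acting on the limit
      \<open>- Hi\<close>.\<close>
    finally have eq: "G k n *v x = (1 + ?a) *\<^sub>R (G (Suc k) n *v y) + (\<gamma> k - ?g) *\<^sub>R x - ?a *\<^sub>R (Hi *v x + ?g *\<^sub>R x)"
      by (simp add: algebra_simps)
    have g: "?g \<le> h" "?g * L \<le> 1 / 2" "?g \<le> 1" using k0(2,3,4)[of "Suc k"] step.prems by auto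
    have y: "N y \<le> (1 - ?g * L) * N x" unfolding y_def using contr(3)[of ?g x] g pos by auto
    define E where "E = C * exp (- c * (\<Sum>j=Suc (Suc k)..n. \<gamma> j)) + ?g + \<eta> (Suc k) / c"
    have E0: "0 \<le> E" unfolding E_def using Ki(1) \<eta>(4) pos contr(2)
      by (intro add_nonneg_nonneg) (auto simp: C_def c_def)
    have aa: "\<bar>?a\<bar> \<le> K * \<bar>\<alpha>' k\<bar> * ?g"
    proof -
      have "\<bar>?a\<bar> = \<gamma> k * \<bar>\<alpha>' k\<bar>" using pos by (simp add: abs_mult)
      also have "\<dots> \<le> K * ?g * \<bar>\<alpha>' k\<bar>" using k0(1)[OF step.prems] by (intro mult_right_mono) auto
      finally show ?thesis by (simp add: algebra_simps)
    qed
    also have "\<dots> \<le> c * ?g" unfolding c_def using k0(5)[OF step.prems] pos by (intro mult_right_mono) auto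
    finally have ac: "\<bar>?a\<bar> \<le> c * ?g" .
    have "norm (G k n *v x) \<le> norm ((1 + ?a) *\<^sub>R (G (Suc k) n *v y)) + norm ((\<gamma> k - ?g) *\<^sub>R x) + norm (?a *\<^sub>R (Hi *v x + ?g *\<^sub>R x))"
      unfolding eq by (intro norm_triangle_le_diff add_mono norm_triangle_ineq order_refl)
    also have "\<dots> \<le> (1 - c * ?g) * E * N x + (\<gamma> k - ?g) * N x + ?g * \<eta> k * N x"
    proof (intro add_mono)
      have "norm ((1 + ?a) *\<^sub>R (G (Suc k) n *v y)) \<le> (1 + c * ?g) * norm (G (Suc k) n *v y)"
        using ac by (auto intro!: mult_right_mono)
      also have "\<dots> \<le> (1 + c * ?g) * (E * N y)"
        unfolding E_def using step.IH[of y] step.prems pos contr(2) by (intro mult_left_mono) (auto simp: c_def)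
      also have "\<dots> \<le> (1 + c * ?g) * (E * ((1 - ?g * L) * N x))"
        using y E0 pos contr(2) by (intro mult_left_mono) (auto simp: c_def)
      also have "\<dots> = ((1 + c * ?g) * (1 - ?g * L)) * (E * N x)" by (simp add: algebra_simps)
      also have "\<dots> \<le> (1 - c * ?g) * (E * N x)"
        using E0 Nn[of x] pos contr(2) by (intro mult_right_mono) (auto simp: c_def algebra_simps)
      finally show "norm ((1 + ?a) *\<^sub>R (G (Suc k) n *v y)) \<le> (1 - c * ?g) * E * N x" by (simp add: algebra_simps)
      show "norm ((\<gamma> k - ?g) *\<^sub>R x) \<le> (\<gamma> k - ?g) * N x"
        using decr(1)[OF k1] N(1)[of x] by (simp add: mult_left_mono)
      have "norm (Hi *v x + ?g *\<^sub>R x) \<le> norm (Hi *v x) + norm (?g *\<^sub>R x)" by (rule norm_triangle_ineq)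
      also have "\<dots> \<le> norm x * Ki + 1 * norm x" using Ki(2)[of x] g pos by (auto intro!: add_mono mult_left_le_one_le)
      also have "\<dots> = (Ki + 1) * norm x" by (simp add: algebra_simps)
      also have "\<dots> \<le> (Ki + 1) * N x" using N(1)[of x] Ki(1) by (intro mult_left_mono) auto
      finally have "norm (?a *\<^sub>R (Hi *v x + ?g *\<^sub>R x)) \<le> (K * \<bar>\<alpha>' k\<bar> * ?g) * ((Ki + 1) * N x)"
        using aa by (simp only: norm_scaleR) (intro mult_mono, auto)
      also have "\<dots> = ?g * (K * \<bar>\<alpha>' k\<bar> * (Ki + 1)) * N x" by (simp add: algebra_simps)
      also have "\<dots> \<le> ?g * \<eta> k * N x" using pos Nn[of x] \<eta>(2)[of k] by (intro mult_right_mono mult_left_mono) auto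
      finally show "norm (?a *\<^sub>R (Hi *v x + ?g *\<^sub>R x)) \<le> ?g * \<eta> k * N x" .
    qed
    also have "\<dots> = ((1 - c * ?g) * E + (\<gamma> k - ?g) + ?g * \<eta> k) * N x" by (simp add: algebra_simps)
    also have "\<dots> \<le> (C * exp (- c * (\<Sum>j=Suc k..n. \<gamma> j)) + \<gamma> k + \<eta> k / c) * N x"
    proof (intro mult_right_mono Nn)
      define s where "s = C * exp (- c * (\<Sum>j=Suc (Suc k)..n. \<gamma> j))"
      have s0: "0 \<le> s" using Ki(1) by (simp add: s_def C_def)
      have c1: "0 \<le> 1 - c * ?g" using g by (simp add: c_def mult.commute)
      have c0: "c > 0" using contr(2) by (simp add: c_def)
      have "(1 - c * ?g) * s \<le> exp (- c * ?g) * s"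
        using exp_ge_add_one_self[of "- c * ?g"] s0 by (intro mult_right_mono) auto
      also have "\<dots> = C * exp (- c * (\<Sum>j=Suc k..n. \<gamma> j))"
        using step.hyps by (simp add: s_def sum.atLeast_Suc_atMost[of "Suc k" n] algebra_simps exp_add[symmetric])
      finally have 1: "(1 - c * ?g) * s \<le> C * exp (- c * (\<Sum>j=Suc k..n. \<gamma> j))" .
      have 2: "(1 - c * ?g) * ?g \<le> ?g" using pos c0 by (simp add: algebra_simps)
      have "(1 - c * ?g) * (\<eta> (Suc k) / c) \<le> (1 - c * ?g) * (\<eta> k / c)"
        using c1 c0 \<eta>(3)[of k] by (intro mult_left_mono divide_right_mono) auto
      also have "\<dots> = \<eta> k / c - ?g * \<eta> k" using c0 by (simp add: field_simps)
      finally have 3: "(1 - c * ?g) * (\<eta> (Suc k) / c) \<le> \<eta> k / c - ?g * \<eta> k" .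
      have "(1 - c * ?g) * E = (1 - c * ?g) * s + (1 - c * ?g) * ?g + (1 - c * ?g) * (\<eta> (Suc k) / c)"
        by (simp add: E_def s_def algebra_simps)
      then show "(1 - c * ?g) * E + (\<gamma> k - ?g) + ?g * \<eta> k \<le> C * exp (- c * (\<Sum>j=Suc k..n. \<gamma> j)) + \<gamma> k + \<eta> k / c"
        using 1 2 3 by linarith
    qed
    finally show ?case .
  qed
  have decr': "\<gamma> n \<le> \<gamma> j" if "1 \<le> j" "j \<le> n" for j n
    using that(2,1) by (induction n rule: dec_induct) (auto intro: order_trans[OF decr(1)])
  define \<zeta> where "\<zeta> k = (\<bar>\<gamma> k\<bar> + \<eta> k / c) * \<bar>K0\<bar>" for k
  show ?thesis
  proof (rule that[of k0 c "C * \<bar>K0\<bar>" \<zeta>])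
    have "\<zeta> \<longlonglongrightarrow> (\<bar>0\<bar> + 0 / c) * \<bar>K0\<bar>"
      unfolding \<zeta>_def using contr(2) by (intro tendsto_intros decr \<eta>(1)) (auto simp: c_def)
    then show "\<zeta> \<longlonglongrightarrow> 0" by simp
    show "0 \<le> \<zeta> k" for k using \<eta>(4)[of k] contr(2) by (simp add: \<zeta>_def c_def)
    show "k0 \<ge> 1" by (rule k0)
    show "c > 0" "C * \<bar>K0\<bar> \<ge> 0" using contr(2) Ki(1) by (auto simp: c_def C_def)
  next
    fix k n :: nat and x assume kn: "k0 \<le> k" "k \<le> n"
    \<comment> \<open>Since \<open>\<gamma>\<close> decreases, the accumulated step size is at least
      \<open>n - k\<close> times the last step; this form needs only the number of remaining
      indices.\<close>
    have "real (n - k) * \<gamma> n \<le> (\<Sum>j=Suc k..n. \<gamma> j)"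
    proof -
      have "(\<Sum>j=Suc k..n. \<gamma> n) \<le> (\<Sum>j=Suc k..n. \<gamma> j)" by (intro sum_mono decr') auto
      then show ?thesis by simp
    qed
    then have "exp (- c * (\<Sum>j=Suc k..n. \<gamma> j)) \<le> exp (- c * (real (n - k) * \<gamma> n))"
      using contr(2) by (simp add: c_def)
    then have "C * exp (- c * (\<Sum>j=Suc k..n. \<gamma> j)) + \<gamma> k + \<eta> k / c \<le> C * exp (- c * (real (n - k) * \<gamma> n)) + \<bar>\<gamma> k\<bar> + \<eta> k / c"
      using Ki(1) by (intro add_mono mult_left_mono) (auto simp: C_def)
    moreover have "N x \<le> \<bar>K0\<bar> * norm x" using N(2)[of x] by (smt (verit) mult_right_mono norm_ge_zero)
    moreover have "0 \<le> C * exp (- c * (real (n - k) * \<gamma> n)) + \<bar>\<gamma> k\<bar> + \<eta> k / c"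
      using Ki(1) \<eta>(4)[of k] contr(2) by (auto simp: C_def c_def)
    ultimately have "norm (G k n *v x) \<le> (C * exp (- c * (real (n - k) * \<gamma> n)) + \<bar>\<gamma> k\<bar> + \<eta> k / c) * (\<bar>K0\<bar> * norm x)"
      using Nn[of x] by (intro order_trans[OF main[OF kn]] mult_mono) auto
    then show "norm ((?B k n + Hi) *v x) \<le> (C * \<bar>K0\<bar> * exp (- c * (real (n - k) * \<gamma> n)) + \<zeta> k) * norm x"
      by (simp add: G_def \<zeta>_def algebra_simps)
  qed
qed

text \<open>With \<open>s n = sqrt (n * \<gamma> n)\<close>, which tends to infinity, a window of
  length about \<open>n / s n\<close> is short compared with \<open>n\<close>, while its length
  times \<open>\<gamma> n\<close> is about \<open>s n\<close> and hence still tends to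
  infinity.\<close>

lemma window_exists:
  fixes \<gamma> :: "nat \<Rightarrow> real"
  assumes "filterlim (\<lambda>n. real n * \<gamma> n) at_top sequentially" "\<gamma> \<longlonglongrightarrow> 0" "\<And>n. n \<ge> 1 \<Longrightarrow> \<gamma> n > 0"
  obtains l :: "nat \<Rightarrow> nat" where "\<And>n. n \<ge> 1 \<Longrightarrow> 1 \<le> l n \<and> l n \<le> n"
    "(\<lambda>n. real n - real (l n)) \<in> o(\<lambda>n. real n)"
    "filterlim (\<lambda>n. real (n - l n) * \<gamma> n) at_top sequentially"
proof -
  define s where "s n = sqrt (real n * \<gamma> n)" for n
  have s: "filterlim s at_top sequentially"
    unfolding s_def by (rule filterlim_compose[OF sqrt_at_top assms(1)])
  \<comment> \<open>The maximum keeps \<open>l n\<close> in the admissible range; from the point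
    where \<open>s n \<ge> 2\<close> it has no effect.\<close>
  define l where "l n = max 1 (n - nat \<lfloor>real n / s n\<rfloor>)" for n
  have ev: "\<forall>\<^sub>F n in sequentially. s n \<ge> 2 \<and> n \<ge> 2"
    using s by (intro eventually_conj eventually_ge_at_top) (auto simp: filterlim_at_top)
  have nl: "\<forall>\<^sub>F n in sequentially. n - l n = nat \<lfloor>real n / s n\<rfloor>"
  proof (rule eventually_mono[OF ev], elim conjE)
    fix n assume n: "2 \<le> s n" "2 \<le> n"
    have "real n / s n \<le> real n / 2" using n by (intro divide_left_mono) auto
    also have "\<dots> \<le> real n - 1" using n by simp
    finally have "nat \<lfloor>real n / s n\<rfloor> \<le> n - 1" using n by linarith
    then show "n - l n = nat \<lfloor>real n / s n\<rfloor>" using n by (simp add: l_def)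
  qed
  show ?thesis
  proof (rule that[of l])
    show "1 \<le> l n \<and> l n \<le> n" if "n \<ge> 1" for n using that by (auto simp: l_def)
    show "(\<lambda>n. real n - real (l n)) \<in> o(\<lambda>n. real n)"
    proof (rule smalloI_tendsto)
      show "\<forall>\<^sub>F n in sequentially. real n \<noteq> 0" using eventually_gt_at_top[of 0] by eventually_elim auto
      show "(\<lambda>n. (real n - real (l n)) / real n) \<longlonglongrightarrow> 0"
      proof (rule tendsto_sandwich[OF _ _ tendsto_const])
        show "(\<lambda>n. 1 / s n) \<longlonglongrightarrow> 0"
          using s by (intro tendsto_divide_0[OF tendsto_const] filterlim_at_top_imp_at_infinity)
        show "\<forall>\<^sub>F n in sequentially. 0 \<le> (real n - real (l n)) / real n"
          using eventually_ge_at_top[of 1] by eventually_elim (auto simp: l_def)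
        show "\<forall>\<^sub>F n in sequentially. (real n - real (l n)) / real n \<le> 1 / s n"
          using ev nl
        proof eventually_elim
          case (elim n)
          have "l n \<le> n" using elim by (auto simp: l_def)
          then have "real n - real (l n) = real (nat \<lfloor>real n / s n\<rfloor>)" using elim by (simp flip: of_nat_diff)
          also have "\<dots> \<le> real n / s n" using elim by (simp add: of_nat_nat)
          finally show ?case using elim by (simp add: field_simps)
        qed
      qed
    qed
    show "filterlim (\<lambda>n. real (n - l n) * \<gamma> n) at_top sequentially"
    proof (rule filterlim_at_top_mono)
      have "filterlim (\<lambda>n. - \<gamma> n + s n) at_top sequentially"
        by (rule filterlim_tendsto_add_at_top[OF _ s]) (use tendsto_minus[OF assms(2)] in auto)
      then show "filterlim (\<lambda>n. s n - \<gamma> n) at_top sequentially" by (simp add: algebra_simps)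
      show "\<forall>\<^sub>F n in sequentially. s n - \<gamma> n \<le> real (n - l n) * \<gamma> n"
        using ev nl
      proof eventually_elim
        case (elim n)
        have g: "\<gamma> n > 0" using elim assms(3) by auto
        have "real n / s n * \<gamma> n = (s n)\<^sup>2 / s n" using g elim by (simp add: s_def)
        then have "real n / s n * \<gamma> n = s n" using elim by (simp add: power2_eq_square)
        moreover have "(real n / s n - 1) * \<gamma> n \<le> real (nat \<lfloor>real n / s n\<rfloor>) * \<gamma> n"
          using g by (intro mult_right_mono) linarith+
        ultimately show ?case using elim by (simp add: algebra_simps)
      qed
    qed
  qed
qed

text \<open>Toeplitz's lemma: a finite initial part is swamped by the diverging total weight, and
  the rest is uniformly small.\<close>

lemma weighted_average_tendsto_0:
  fixes w \<zeta> :: "nat \<Rightarrow> real"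
  assumes w: "\<And>k. k \<ge> 1 \<Longrightarrow> 0 \<le> w k" and W: "filterlim (\<lambda>n. \<Sum>k=1..n. w k) at_top sequentially"
    and \<zeta>: "\<zeta> \<longlonglongrightarrow> 0"
  shows "(\<lambda>n. (\<Sum>k=1..n. w k * \<zeta> k) / (\<Sum>k=1..n. w k)) \<longlonglongrightarrow> 0"
proof (rule LIMSEQ_I)
  fix e :: real assume e: "e > 0"
  obtain m where m: "\<And>k. k \<ge> m \<Longrightarrow> \<bar>\<zeta> k\<bar> < e / 2" using LIMSEQ_D[OF \<zeta>, of "e / 2"] e by auto
  define c where "c = (\<Sum>k=1..m. w k * \<bar>\<zeta> k\<bar>)"
  have "\<forall>\<^sub>F n in sequentially. (\<Sum>k=1..n. w k) > max 1 (2 * c / e) \<and> n \<ge> m"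
    using W by (intro eventually_conj eventually_ge_at_top) (simp only: filterlim_at_top_dense)
  then obtain n0 where n0: "\<And>n. n \<ge> n0 \<Longrightarrow> (\<Sum>k=1..n. w k) > max 1 (2 * c / e)" "\<And>n. n \<ge> n0 \<Longrightarrow> n \<ge> m"
    by (auto simp: eventually_sequentially)
  have "norm ((\<Sum>k=1..n. w k * \<zeta> k) / (\<Sum>k=1..n. w k) - 0) < e" if n: "n \<ge> n0" for n
  proof -
    let ?W = "\<Sum>k=1..n. w k"
    have W: "?W > 1" "2 * c / e < ?W" using n0(1)[OF n] by auto
    have "\<bar>\<Sum>k=1..n. w k * \<zeta> k\<bar> \<le> (\<Sum>k=1..n. w k * \<bar>\<zeta> k\<bar>)"
      by (rule order_trans[OF sum_abs]) (auto intro!: sum_mono simp: abs_mult w)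
    also have "\<dots> \<le> (\<Sum>k=1..n. (if k \<le> m then w k * \<bar>\<zeta> k\<bar> else 0) + w k * (e / 2))"
    proof (rule sum_mono)
      fix k assume k: "k \<in> {1..n}"
      show "w k * \<bar>\<zeta> k\<bar> \<le> (if k \<le> m then w k * \<bar>\<zeta> k\<bar> else 0) + w k * (e / 2)"
      proof (cases "k \<le> m")
        case False
        then have "w k * \<bar>\<zeta> k\<bar> \<le> w k * (e / 2)" using w[of k] m[of k] k by (intro mult_left_mono) auto
        then show ?thesis using False by simp
      qed (use w[of k] k e in auto)
    qed
    also have "\<dots> = (\<Sum>k=1..n. if k \<le> m then w k * \<bar>\<zeta> k\<bar> else 0) + ?W * (e / 2)"
      by (simp add: sum.distrib sum_distrib_right)
    also have "(\<Sum>k=1..n. if k \<le> m then w k * \<bar>\<zeta> k\<bar> else 0) = c"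
      unfolding c_def using n0(2)[OF n] by (intro sum.mono_neutral_cong_right) auto
    also have "c + ?W * (e / 2) < ?W * e"
      using W e by (simp add: field_simps)
    finally show ?thesis using W by (simp add: field_simps)
  qed
  then show "\<exists>n0. \<forall>n\<ge>n0. norm ((\<Sum>k=1..n. w k * \<zeta> k) / (\<Sum>k=1..n. w k) - 0) < e" by blast
qed

lemma weighted_average_tendsto:
  fixes w \<zeta> :: "nat \<Rightarrow> real"
  assumes w: "\<And>k. k \<ge> 1 \<Longrightarrow> 0 \<le> w k" and W: "filterlim (\<lambda>n. \<Sum>k=1..n. w k) at_top sequentially"
    and \<zeta>: "\<zeta> \<longlonglongrightarrow> z"
  shows "(\<lambda>n. (\<Sum>k=1..n. w k * \<zeta> k) / (\<Sum>k=1..n. w k)) \<longlonglongrightarrow> z"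
proof -
  have "(\<lambda>n. (\<Sum>k=1..n. w k * (\<zeta> k - z)) / (\<Sum>k=1..n. w k)) \<longlonglongrightarrow> 0"
    by (rule weighted_average_tendsto_0[OF w W]) (use \<zeta> in \<open>auto simp: LIM_zero\<close>)
  then have "(\<lambda>n. (\<Sum>k=1..n. w k * (\<zeta> k - z)) / (\<Sum>k=1..n. w k) + z) \<longlonglongrightarrow> 0 + z"
    by (intro tendsto_intros)
  moreover have "\<forall>\<^sub>F n in sequentially. (\<Sum>k=1..n. w k) > 0" using W by (simp only: filterlim_at_top_dense)
  then have "\<forall>\<^sub>F n in sequentially. (\<Sum>k=1..n. w k * (\<zeta> k - z)) / (\<Sum>k=1..n. w k) + z = (\<Sum>k=1..n. w k * \<zeta> k) / (\<Sum>k=1..n. w k)"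
    by eventually_elim (simp add: algebra_simps sum_subtractf sum_distrib_left[symmetric] diff_divide_distrib)
  ultimately show ?thesis by (simp add: tendsto_cong)
qed

text \<open>Below the window the exponential is uniformly small; inside it is bounded by
  \<open>1\<close>, but there the share of the weight vanishes; the part \<open>\<zeta>\<close>
  averages out. The exponential depends on \<open>n - k\<close>, so averaging alone would not
  dispose of indices close to \<open>n\<close>.\<close>

lemma windowed_sum_negligible:
  fixes w \<gamma> \<zeta> :: "nat \<Rightarrow> real" and g :: "nat \<Rightarrow> nat \<Rightarrow> real"
  assumes w: "\<And>k. k \<ge> 1 \<Longrightarrow> 0 \<le> w k" and W: "filterlim (\<lambda>n. \<Sum>k=1..n. w k) at_top sequentially"
    and tail: "\<And>l :: nat \<Rightarrow> nat. (\<And>n. n \<ge> 1 \<Longrightarrow> 1 \<le> l n \<and> l n \<le> n) \<Longrightarrow> (\<lambda>n. real n - real (l n)) \<in> o(\<lambda>n. real n) \<Longrightarrow>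
      (\<lambda>n. (\<Sum>k=l n + 1..n. w k) / (\<Sum>k=1..n. w k)) \<longlonglongrightarrow> 0"
    and \<gamma>: "filterlim (\<lambda>n. real n * \<gamma> n) at_top sequentially" "\<gamma> \<longlonglongrightarrow> 0" "\<And>n. n \<ge> 1 \<Longrightarrow> \<gamma> n > 0"
    and \<zeta>: "\<zeta> \<longlonglongrightarrow> 0" "\<And>k. 0 \<le> \<zeta> k" and c: "c > 0" "C \<ge> 0" and k0: "k0 \<ge> 1"
    and g: "\<And>k n. k0 \<le> k \<Longrightarrow> k \<le> n \<Longrightarrow> 0 \<le> g k n"
      "\<And>k n. k0 \<le> k \<Longrightarrow> k \<le> n \<Longrightarrow> g k n \<le> C * exp (- c * (real (n - k) * \<gamma> n)) + \<zeta> k"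
  shows "(\<lambda>n. (\<Sum>k=k0..n. w k * g k n) / (\<Sum>k=1..n. w k)) \<longlonglongrightarrow> 0"
proof -
  obtain l :: "nat \<Rightarrow> nat" where l: "\<And>n. n \<ge> 1 \<Longrightarrow> 1 \<le> l n \<and> l n \<le> n"
    "(\<lambda>n. real n - real (l n)) \<in> o(\<lambda>n. real n)"
    "filterlim (\<lambda>n. real (n - l n) * \<gamma> n) at_top sequentially"
    using window_exists[OF \<gamma>] by blast
  define W' where "W' n = (\<Sum>k=1..n. w k)" for n
  \<comment> \<open>The three contributions in order: indices below the window, the vanishing part
    \<open>\<zeta>\<close>, and the weight of the window.\<close>
  define u where "u n = C * exp (- c * (real (n - l n) * \<gamma> n)) + (\<Sum>k=1..n. w k * \<zeta> k) / W' n
      + C * ((\<Sum>k=l n + 1..n. w k) / W' n)" for n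
  have W'pos: "\<forall>\<^sub>F n in sequentially. W' n > 0" using W unfolding W'_def by (simp only: filterlim_at_top_dense)
  have "u \<longlonglongrightarrow> C * 0 + 0 + C * 0"
    unfolding u_def W'_def
  proof (intro tendsto_add tendsto_mult tendsto_const weighted_average_tendsto_0[OF w W \<zeta>(1)] tail l(1,2))
    have "filterlim (\<lambda>n. c * (real (n - l n) * \<gamma> n)) at_top sequentially"
      by (rule filterlim_tendsto_pos_mult_at_top[OF tendsto_const c(1) l(3)])
    then have "filterlim (\<lambda>n. - (c * (real (n - l n) * \<gamma> n))) at_bot sequentially"
      by (simp add: filterlim_uminus_at_bot)
    then show "(\<lambda>n. exp (- c * (real (n - l n) * \<gamma> n))) \<longlonglongrightarrow> 0"
      using filterlim_compose[OF exp_at_bot] by simp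
  qed
  then have u0: "u \<longlonglongrightarrow> 0" by simp
  show ?thesis unfolding W'_def[symmetric]
  proof (rule tendsto_sandwich[OF _ _ tendsto_const u0])
    show "\<forall>\<^sub>F n in sequentially. 0 \<le> (\<Sum>k=k0..n. w k * g k n) / W' n"
      using W'pos by eventually_elim (use k0 in \<open>auto intro!: divide_nonneg_pos sum_nonneg mult_nonneg_nonneg w g\<close>)
    show "\<forall>\<^sub>F n in sequentially. (\<Sum>k=k0..n. w k * g k n) / W' n \<le> u n"
      using W'pos eventually_ge_at_top[of 1]
    proof eventually_elim
      case (elim n)
      let ?e = "exp (- c * (real (n - l n) * \<gamma> n))"
      have "(\<Sum>k=k0..n. w k * g k n) \<le> (\<Sum>k=k0..n. w k * (C * ?e) + w k * \<zeta> k + (if l n < k then C * w k else 0))"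
      proof (rule sum_mono)
        fix k assume k: "k \<in> {k0..n}"
        have gn: "\<gamma> n > 0" using \<gamma>(3) elim by auto
        have "g k n \<le> C * ?e + \<zeta> k + (if l n < k then C else 0)"
        proof (cases "l n < k")
          case True
          have "exp (- c * (real (n - k) * \<gamma> n)) \<le> 1" using c gn by auto
          then have "C * exp (- c * (real (n - k) * \<gamma> n)) \<le> C * 1" using c(2) by (intro mult_left_mono) auto
          moreover have "0 \<le> C * ?e" using c by auto
          ultimately show ?thesis using g(2)[of k n] k True by auto
        next
          case False
          have "real (n - l n) * \<gamma> n \<le> real (n - k) * \<gamma> n" using False gn by (intro mult_right_mono) auto
          then have "exp (- c * (real (n - k) * \<gamma> n)) \<le> ?e" using c by auto
          then have "C * exp (- c * (real (n - k) * \<gamma> n)) \<le> C * ?e" using c(2) by (intro mult_left_mono) auto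
          then show ?thesis using g(2)[of k n] k False by auto
        qed
        then have "w k * g k n \<le> w k * (C * ?e + \<zeta> k + (if l n < k then C else 0))"
          using w[of k] k k0 by (intro mult_left_mono) auto
        then show "w k * g k n \<le> w k * (C * ?e) + w k * \<zeta> k + (if l n < k then C * w k else 0)"
          by (auto simp: algebra_simps)
      qed
      also have "\<dots> \<le> (\<Sum>k=1..n. w k * (C * ?e) + w k * \<zeta> k + (if l n < k then C * w k else 0))"
        using k0 c \<zeta>(2) w by (intro sum_mono2) (auto intro!: add_nonneg_nonneg mult_nonneg_nonneg)
      also have "\<dots> = W' n * (C * ?e) + (\<Sum>k=1..n. w k * \<zeta> k) + (\<Sum>k=1..n. if l n < k then C * w k else 0)"
        by (simp add: sum.distrib W'_def sum_distrib_right)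
      also have "(\<Sum>k=1..n. if l n < k then C * w k else 0) = (\<Sum>k=l n+1..n. C * w k)"
        by (intro sum.mono_neutral_cong_right) auto
      finally have "(\<Sum>k=k0..n. w k * g k n) \<le> W' n * u n"
        using elim by (simp add: u_def distrib_left flip: sum_distrib_left)
      then show ?case using elim by (simp add: pos_divide_le_eq mult.commute)
    qed
  qed
qed

text \<open>The ratio of \<open>v\<close> to the square of \<open>\<delta>\<close> stays bounded:
  per step \<open>v\<close> contracts by \<open>1 - 2 \<gamma> L2\<close>, whereas the square of
  \<open>\<delta>\<close> loses at most the factor \<open>1 - 2 \<gamma> L3\<close>. The difference
  of these rates pays for the inhomogeneity.\<close>

lemma quadratic_recursion_bound:
  fixes v \<gamma> \<delta> :: "nat \<Rightarrow> real"
  assumes rec: "\<And>n. n > m \<Longrightarrow> v n \<le> (1 - 2 * \<gamma> n * L2) * v (n - 1) + C * \<gamma> n * (\<delta> n)\<^sup>2"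
    and v: "\<And>n. 0 \<le> v n" and C: "C \<ge> 0"
    and \<gamma>: "\<And>n. n > m \<Longrightarrow> \<gamma> n > 0" "\<And>n. n > m \<Longrightarrow> 2 * \<gamma> n * L2 \<le> 1"
    and \<delta>: "\<And>n. n \<ge> m \<Longrightarrow> \<delta> n > 0" "\<And>n. n > m \<Longrightarrow> 1 / \<gamma> n * (1 - \<delta> n / \<delta> (n - 1)) \<le> L3"
    and L: "0 < L3" "L3 < L2"
  shows "\<exists>K \<ge> 0. \<forall>n\<ge>m. v n \<le> K * (\<delta> n)\<^sup>2"
proof -
  \<comment> \<open>The first entry starts the induction; the second makes the surplus rate
    \<open>2 (L2 - L3)\<close> times \<open>K\<close> exceed \<open>C\<close>.\<close>
  define K where "K = max (v m / (\<delta> m)\<^sup>2) (C / (2 * (L2 - L3)))"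
  have K0: "K \<ge> 0" using v[of m] by (auto simp: K_def le_max_iff_disj)
  have KC: "C \<le> K * (2 * (L2 - L3))"
  proof -
    have "C / (2 * (L2 - L3)) \<le> K" by (simp add: K_def)
    then show ?thesis using L by (simp add: pos_divide_le_eq)
  qed
  have "v n \<le> K * (\<delta> n)\<^sup>2" if "n \<ge> m" for n
    using that
  proof (induction n rule: dec_induct)
    case base
    have "v m / (\<delta> m)\<^sup>2 \<le> K" by (simp add: K_def)
    then show ?case using \<delta>(1)[of m] by (simp add: pos_divide_le_eq)
  next
    case (step n)
    let ?g = "\<gamma> (Suc n)"
    have g: "?g > 0" "2 * ?g * L2 \<le> 1" using \<gamma>[of "Suc n"] step by auto
    have d: "\<delta> n > 0" "\<delta> (Suc n) > 0" using \<delta>(1) step by auto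
    have "1 - \<delta> (Suc n) / \<delta> n \<le> ?g * L3"
      using \<delta>(2)[of "Suc n"] step g by (simp add: field_simps)
    then have dd: "(1 - ?g * L3) * \<delta> n \<le> \<delta> (Suc n)" using d by (simp add: field_simps)
    have gL: "?g * L3 < 1 / 2"
    proof -
      have "?g * L3 < ?g * L2" using g(1) L(2) by simp
      then show ?thesis using g(2) by simp
    qed
    have "((1 - ?g * L3) * \<delta> n)\<^sup>2 \<le> (\<delta> (Suc n))\<^sup>2" using dd d gL by (intro power_mono) auto
    moreover have "(1 - 2 * (?g * L3)) * (\<delta> n)\<^sup>2 \<le> ((1 - ?g * L3) * \<delta> n)\<^sup>2"
    proof -
      have "(1 - ?g * L3)\<^sup>2 = 1 - 2 * (?g * L3) + (?g * L3)\<^sup>2" by (simp add: power2_eq_square algebra_simps)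
      then have "(1 - 2 * (?g * L3)) \<le> (1 - ?g * L3)\<^sup>2" by simp
      then show ?thesis by (simp add: power_mult_distrib mult_right_mono)
    qed
    ultimately have d2: "(1 - 2 * (?g * L3)) * (\<delta> n)\<^sup>2 \<le> (\<delta> (Suc n))\<^sup>2" by linarith
    have "(1 - 2 * ?g * L2) * (\<delta> n)\<^sup>2 \<le> (1 - 2 * ?g * (L2 - L3)) * ((1 - 2 * (?g * L3)) * (\<delta> n)\<^sup>2)"
    proof -
      have "0 \<le> ?g * L3 * (?g * (L2 - L3))" using g L by auto
      then have "1 - 2 * ?g * L2 \<le> (1 - 2 * ?g * (L2 - L3)) * (1 - 2 * (?g * L3))" by (simp add: algebra_simps)
      then show ?thesis by (simp add: mult_right_mono flip: mult.assoc)
    qed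
    also have "\<dots> \<le> (1 - 2 * ?g * (L2 - L3)) * (\<delta> (Suc n))\<^sup>2"
    proof (rule mult_left_mono[OF d2])
      have "0 < ?g * L3" using g L by auto
      then show "0 \<le> 1 - 2 * ?g * (L2 - L3)" using g by (simp add: algebra_simps)
    qed
    finally have *: "(1 - 2 * ?g * L2) * (\<delta> n)\<^sup>2 \<le> (1 - 2 * ?g * (L2 - L3)) * (\<delta> (Suc n))\<^sup>2" .
    have "v (Suc n) \<le> (1 - 2 * ?g * L2) * v n + C * ?g * (\<delta> (Suc n))\<^sup>2" using rec[of "Suc n"] step by auto
    also have "\<dots> \<le> (1 - 2 * ?g * L2) * (K * (\<delta> n)\<^sup>2) + C * ?g * (\<delta> (Suc n))\<^sup>2"
      using g step by (intro add_right_mono mult_left_mono) auto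
    also have "\<dots> \<le> K * ((1 - 2 * ?g * (L2 - L3)) * (\<delta> (Suc n))\<^sup>2) + C * ?g * (\<delta> (Suc n))\<^sup>2"
      using mult_left_mono[OF * K0] by (simp add: algebra_simps)
    also have "\<dots> = K * (\<delta> (Suc n))\<^sup>2 - (K * (2 * (L2 - L3)) - C) * (?g * (\<delta> (Suc n))\<^sup>2)" by (simp add: algebra_simps)
    also have "\<dots> \<le> K * (\<delta> (Suc n))\<^sup>2" using KC g by auto
    finally show ?case .
  qed
  with K0 show ?thesis by blast
qed

section \<open>Exponential martingales\<close>

text \<open>A named version \<open>Y\<close> can be adjusted on null sets, for example to be
  nonnegative everywhere, and then enters pathwise definitions of stopping rules, where almost sure
  identities would be awkward.\<close>

definition cond_exp_version :: "'a measure \<Rightarrow> 'a measure \<Rightarrow> ('a \<Rightarrow> real) \<Rightarrow> ('a \<Rightarrow> real) \<Rightarrow> bool" where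
  "cond_exp_version M G X Y \<longleftrightarrow>
     integrable M X \<and> Y \<in> borel_measurable G \<and> (AE \<omega> in M. real_cond_exp M G X \<omega> = Y \<omega>)"

lemma cond_exp_version_test:
  assumes "prob_space M" "subalgebra M G" "cond_exp_version M G X Y"
    and g: "g \<in> borel_measurable G" "integrable M (\<lambda>\<omega>. g \<omega> * X \<omega>)"
  shows "integrable M (\<lambda>\<omega>. g \<omega> * Y \<omega>)" "(\<integral>\<omega>. g \<omega> * X \<omega> \<partial>M) = (\<integral>\<omega>. g \<omega> * Y \<omega> \<partial>M)"
proof -
  interpret prob_space M by fact
  interpret finite_measure_subalgebra M G by unfold_locales fact
  have X: "integrable M X" and Y: "Y \<in> borel_measurable G"
    and ae: "AE \<omega> in M. real_cond_exp M G X \<omega> = Y \<omega>"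
    using assms(3) by (auto simp: cond_exp_version_def)
  have Xm [measurable]: "X \<in> borel_measurable M" using X by auto
  note [measurable] = measurable_from_subalg[OF assms(2) Y] measurable_from_subalg[OF assms(2) g(1)]
  note * = real_cond_exp_intg[OF g(2,1) Xm]
  have ae': "AE \<omega> in M. g \<omega> * real_cond_exp M G X \<omega> = g \<omega> * Y \<omega>" using ae by eventually_elim simp
  show "integrable M (\<lambda>\<omega>. g \<omega> * Y \<omega>)"
    using ae' *(1) by (subst integrable_cong_AE[of _ M "\<lambda>\<omega>. g \<omega> * real_cond_exp M G X \<omega>"]) (auto elim: eventually_mono)
  show "(\<integral>\<omega>. g \<omega> * X \<omega> \<partial>M) = (\<integral>\<omega>. g \<omega> * Y \<omega> \<partial>M)"
    unfolding *(2)[symmetric] using ae' by (intro integral_cong_AE) auto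
qed

lemma cond_exp_version_integrable:
  assumes "prob_space M" "subalgebra M G" "cond_exp_version M G X Y"
  shows "integrable M X" "integrable M Y" "(\<integral>\<omega>. X \<omega> \<partial>M) = (\<integral>\<omega>. Y \<omega> \<partial>M)" "Y \<in> borel_measurable G"
    "Y \<in> borel_measurable M" "X \<in> borel_measurable M"
proof -
  show X: "integrable M X" using assms by (auto simp: cond_exp_version_def)
  show "integrable M Y" "(\<integral>\<omega>. X \<omega> \<partial>M) = (\<integral>\<omega>. Y \<omega> \<partial>M)"
    using cond_exp_version_test[OF assms, of "\<lambda>_. 1"] X by auto
  show "Y \<in> borel_measurable G" using assms by (auto simp: cond_exp_version_def)
  then show "Y \<in> borel_measurable M" using measurable_from_subalg[OF assms(2)] by blast
  show "X \<in> borel_measurable M" using X by auto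
qed

lemma cond_exp_version_test_complex:
  assumes "prob_space M" "subalgebra M G" "cond_exp_version M G X Y"
    and Z: "Z \<in> borel_measurable G" "\<And>\<omega>. cmod (Z \<omega>) \<le> B"
  shows "integrable M (\<lambda>\<omega>. Z \<omega> * of_real (X \<omega>))" "integrable M (\<lambda>\<omega>. Z \<omega> * of_real (Y \<omega>))"
    "(\<integral>\<omega>. Z \<omega> * of_real (X \<omega>) \<partial>M) = (\<integral>\<omega>. Z \<omega> * of_real (Y \<omega>) \<partial>M)"
proof -
  note i = cond_exp_version_integrable[OF assms(1-3)]
  have Zm [measurable]: "Z \<in> borel_measurable M" using measurable_from_subalg[OF assms(2) Z(1)] .
  note [measurable] = i(5,6)
  have bnd: "integrable M (\<lambda>\<omega>. Z \<omega> * of_real (U \<omega>))" if U: "integrable M U" for U :: "'a \<Rightarrow> real"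
  proof (rule Bochner_Integration.integrable_bound)
    show "integrable M (\<lambda>\<omega>. B * U \<omega>)" using U by simp
    show "(\<lambda>\<omega>. Z \<omega> * of_real (U \<omega>)) \<in> borel_measurable M" using U by measurable
    have "cmod (Z \<omega>) * \<bar>U \<omega>\<bar> \<le> \<bar>B\<bar> * \<bar>U \<omega>\<bar>" for \<omega>
      using Z(2)[of \<omega>] by (intro mult_right_mono) auto
    then show "AE \<omega> in M. norm (Z \<omega> * of_real (U \<omega>)) \<le> norm (B * U \<omega>)"
      by (simp add: norm_mult abs_mult)
  qed
  show iX: "integrable M (\<lambda>\<omega>. Z \<omega> * of_real (X \<omega>))" and iY: "integrable M (\<lambda>\<omega>. Z \<omega> * of_real (Y \<omega>))"
    using bnd i by auto
  have Re: "integrable M (\<lambda>\<omega>. Re (Z \<omega>) * X \<omega>)" and Im: "integrable M (\<lambda>\<omega>. Im (Z \<omega>) * X \<omega>)"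
    using integrable_Re[OF iX] integrable_Im[OF iX] by simp_all
  have ZG: "(\<lambda>\<omega>. Re (Z \<omega>)) \<in> borel_measurable G" "(\<lambda>\<omega>. Im (Z \<omega>)) \<in> borel_measurable G"
    using Z(1) by measurable
  show "(\<integral>\<omega>. Z \<omega> * of_real (X \<omega>) \<partial>M) = (\<integral>\<omega>. Z \<omega> * of_real (Y \<omega>) \<partial>M)"
  proof (rule complex_eqI)
    show "Re (\<integral>\<omega>. Z \<omega> * of_real (X \<omega>) \<partial>M) = Re (\<integral>\<omega>. Z \<omega> * of_real (Y \<omega>) \<partial>M)"
      using cond_exp_version_test(2)[OF assms(1-3) ZG(1) Re] integral_Re[OF iX] integral_Re[OF iY] by simp
    show "Im (\<integral>\<omega>. Z \<omega> * of_real (X \<omega>) \<partial>M) = Im (\<integral>\<omega>. Z \<omega> * of_real (Y \<omega>) \<partial>M)"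
      using cond_exp_version_test(2)[OF assms(1-3) ZG(2) Im] integral_Im[OF iX] integral_Im[OF iY] by simp
  qed
qed

lemma cond_exp_version_mult:
  assumes "prob_space M" "subalgebra M G" "cond_exp_version M G X Y"
    and g: "g \<in> borel_measurable G" "integrable M (\<lambda>\<omega>. g \<omega> * X \<omega>)"
  shows "cond_exp_version M G (\<lambda>\<omega>. g \<omega> * X \<omega>) (\<lambda>\<omega>. g \<omega> * Y \<omega>)"
proof -
  interpret prob_space M by fact
  interpret finite_measure_subalgebra M G by unfold_locales fact
  note i = cond_exp_version_integrable[OF assms(1-3)]
  have "AE \<omega> in M. real_cond_exp M G (\<lambda>\<omega>. g \<omega> * X \<omega>) \<omega> = g \<omega> * real_cond_exp M G X \<omega>"
    using i g by (intro real_cond_exp_mult) auto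
  moreover have "AE \<omega> in M. real_cond_exp M G X \<omega> = Y \<omega>" using assms(3) by (auto simp: cond_exp_version_def)
  ultimately have "AE \<omega> in M. real_cond_exp M G (\<lambda>\<omega>. g \<omega> * X \<omega>) \<omega> = g \<omega> * Y \<omega>"
    by eventually_elim simp
  then show ?thesis using g i by (auto simp: cond_exp_version_def)
qed

lemma cond_exp_version_mult_bounded:
  assumes "prob_space M" "subalgebra M G" "cond_exp_version M G X Y"
    and g: "g \<in> borel_measurable G" "\<And>\<omega>. \<bar>g \<omega>\<bar> \<le> (B :: real)"
  shows "cond_exp_version M G (\<lambda>\<omega>. g \<omega> * X \<omega>) (\<lambda>\<omega>. g \<omega> * Y \<omega>)"
proof (rule cond_exp_version_mult[OF assms(1-4)])
  note i = cond_exp_version_integrable[OF assms(1-3)]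
  note [measurable] = i(6) measurable_from_subalg[OF assms(2) g(1)]
  show "integrable M (\<lambda>\<omega>. g \<omega> * X \<omega>)"
  proof (rule Bochner_Integration.integrable_bound)
    show "integrable M (\<lambda>\<omega>. B * X \<omega>)" using i by simp
    have "\<bar>g \<omega>\<bar> * \<bar>X \<omega>\<bar> \<le> \<bar>B\<bar> * \<bar>X \<omega>\<bar>" for \<omega>
      using g(2)[of \<omega>] by (intro mult_right_mono) auto
    then show "AE \<omega> in M. norm (g \<omega> * X \<omega>) \<le> norm (B * X \<omega>)" by (simp add: abs_mult)
  qed measurable
qed

text \<open>The cubic Taylor bound is used for small \<open>x\<close> and the quadratic one for
  large \<open>x\<close>; after taking conditional expectations the two parts are a multiple of the
  variance and a Lindeberg term.\<close>

lemma iexp_second_order: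
  assumes "0 \<le> \<epsilon>"
  shows "cmod (iexp x - (1 + \<i> * complex_of_real x - complex_of_real (x\<^sup>2 / 2)))
    \<le> \<epsilon> * x\<^sup>2 + (if \<bar>x\<bar> > \<epsilon> then x\<^sup>2 else 0)"
proof -
  have eq: "(\<Sum>k\<le>2. (\<i> * complex_of_real x) ^ k / fact k) = 1 + \<i> * complex_of_real x - complex_of_real (x\<^sup>2 / 2)"
    by (simp add: numeral_2_eq_2 power2_eq_square[unfolded numeral_2_eq_2] algebra_simps)
  show ?thesis
  proof (cases "\<bar>x\<bar> > \<epsilon>")
    case True
    have "cmod (iexp x - (1 + \<i> * complex_of_real x - complex_of_real (x\<^sup>2 / 2))) \<le> x\<^sup>2"
      using iexp_approx2[of x 2] unfolding eq by simp
    then show ?thesis using True assms by (simp add: add_increasing)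
  next
    case False
    have "cmod (iexp x - (1 + \<i> * complex_of_real x - complex_of_real (x\<^sup>2 / 2))) \<le> \<bar>x\<bar> ^ 3 / 6"
      using iexp_approx1[of x 2] unfolding eq by (simp add: fact_numeral eval_nat_numeral)
    also have "\<dots> \<le> \<bar>x\<bar> ^ 3" by simp
    also have "\<bar>x\<bar> ^ 3 = \<bar>x\<bar> * x\<^sup>2" by (simp add: eval_nat_numeral)
    also have "\<dots> \<le> \<epsilon> * x\<^sup>2" using False by (intro mult_right_mono) auto
    finally show ?thesis using False by simp
  qed
qed

lemma exp_minus_second_order:
  assumes "0 \<le> v" "v \<le> (1::real)"
  shows "\<bar>1 - v / 2 - exp (- v / 2)\<bar> \<le> v\<^sup>2"
proof -
  obtain t where t: "\<bar>t\<bar> \<le> \<bar>- v / 2\<bar>" "exp (- v / 2) = (\<Sum>m<2. (- v / 2) ^ m / fact m) + exp t / fact 2 * (- v / 2) ^ 2"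
    using Maclaurin_exp_le by blast
  have "exp t \<le> exp 1" using t(1) assms by simp
  also have "\<dots> \<le> 3" by (rule exp_le)
  finally have "exp t / 8 * v\<^sup>2 \<le> 1 * v\<^sup>2" by (intro mult_right_mono) auto
  moreover have "1 - v / 2 - exp (- v / 2) = - (exp t / 8 * v\<^sup>2)"
    unfolding t(2) by (simp add: eval_nat_numeral field_simps)
  ultimately show ?thesis by simp
qed

text \<open>Both \<open>iexp \<xi>\<close> and \<open>exp (- v / 2)\<close> have the conditional
  second-order expansion \<open>1 - v / 2\<close>, so their difference integrates to the Taylor
  remainders alone. The cap \<open>\<kappa>\<close> on \<open>v\<close> turns the remainder of order
  \<open>v^2\<close> into a small multiple of \<open>v\<close>.\<close>

lemma exponential_martingale_step:
  fixes Z :: "'a \<Rightarrow> complex"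
  assumes M: "prob_space M" and G: "subalgebra M G"
    and Z: "Z \<in> borel_measurable G" "\<And>\<omega>. cmod (Z \<omega>) \<le> B"
    and mean: "cond_exp_version M G \<xi> (\<lambda>_. 0)"
    and var: "cond_exp_version M G (\<lambda>\<omega>. (\<xi> \<omega>)\<^sup>2) v"
    and lind: "cond_exp_version M G (\<lambda>\<omega>. (\<xi> \<omega>)\<^sup>2 * indicator {\<omega>. \<bar>\<xi> \<omega>\<bar> > \<epsilon>} \<omega>) l"
    and v: "\<And>\<omega>. 0 \<le> v \<omega>" "\<And>\<omega>. v \<omega> \<le> \<kappa>" and \<kappa>: "\<kappa> \<le> 1" and \<epsilon>: "0 \<le> \<epsilon>"
  shows "cmod (\<integral>\<omega>. Z \<omega> * (iexp (\<xi> \<omega>) - of_real (exp (- v \<omega> / 2))) \<partial>M)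
    \<le> B * (\<epsilon> * (\<integral>\<omega>. v \<omega> \<partial>M) + (\<integral>\<omega>. l \<omega> \<partial>M) + \<kappa> * (\<integral>\<omega>. v \<omega> \<partial>M))"
proof -
  interpret prob_space M by fact
  have B0: "0 \<le> B" using Z(2) norm_ge_zero order_trans by blast
  note i1 = cond_exp_version_integrable[OF M G mean]
  note i2 = cond_exp_version_integrable[OF M G var]
  note i3 = cond_exp_version_integrable[OF M G lind]
  note t1 = cond_exp_version_test_complex[OF M G mean Z]
  note t2 = cond_exp_version_test_complex[OF M G var Z]
  note [measurable] = i1(6) i2(5) i3(6) measurable_from_subalg[OF G Z(1)]
  let ?r1 = "\<lambda>\<omega>. iexp (\<xi> \<omega>) - (1 + \<i> * complex_of_real (\<xi> \<omega>) - complex_of_real ((\<xi> \<omega>)\<^sup>2 / 2))"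
  let ?r2 = "\<lambda>\<omega>. complex_of_real (1 - v \<omega> / 2 - exp (- v \<omega> / 2))"
  let ?b1 = "\<lambda>\<omega>. \<epsilon> * (\<xi> \<omega>)\<^sup>2 + (\<xi> \<omega>)\<^sup>2 * indicator {\<omega>. \<bar>\<xi> \<omega>\<bar> > \<epsilon>} \<omega>"
  have b1: "cmod (Z \<omega> * ?r1 \<omega>) \<le> B * ?b1 \<omega>" for \<omega>
    unfolding norm_mult using iexp_second_order[OF \<epsilon>, of "\<xi> \<omega>"]
    by (intro mult_mono Z(2) B0) (auto split: if_splits)
  have b2: "cmod (Z \<omega> * ?r2 \<omega>) \<le> B * (\<kappa> * v \<omega>)" for \<omega>
    unfolding norm_mult
  proof (intro mult_mono Z(2) B0)
    have "cmod (?r2 \<omega>) \<le> (v \<omega>)\<^sup>2"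
      using exp_minus_second_order[of "v \<omega>"] v[of \<omega>] \<kappa> by (simp only: norm_of_real)
    also have "\<dots> \<le> \<kappa> * v \<omega>" using v[of \<omega>] by (simp add: power2_eq_square mult_right_mono)
    finally show "cmod (?r2 \<omega>) \<le> \<kappa> * v \<omega>" .
  qed auto
  have ib1: "integrable M (\<lambda>\<omega>. B * ?b1 \<omega>)" using i2(1) i3(1) by simp
  have ir1: "integrable M (\<lambda>\<omega>. Z \<omega> * ?r1 \<omega>)"
  proof (rule Bochner_Integration.integrable_bound[OF ib1])
    show "AE \<omega> in M. norm (Z \<omega> * ?r1 \<omega>) \<le> norm (B * ?b1 \<omega>)"
      unfolding real_norm_def by (intro AE_I2) (rule order_trans[OF b1 abs_ge_self])
  qed measurable
  have ib2: "integrable M (\<lambda>\<omega>. B * (\<kappa> * v \<omega>))" using i2 by simp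
  have ir2: "integrable M (\<lambda>\<omega>. Z \<omega> * ?r2 \<omega>)"
  proof (rule Bochner_Integration.integrable_bound[OF ib2])
    show "AE \<omega> in M. norm (Z \<omega> * ?r2 \<omega>) \<le> norm (B * (\<kappa> * v \<omega>))"
      unfolding real_norm_def by (intro AE_I2) (rule order_trans[OF b2 abs_ge_self])
  qed measurable
  have lin: "(\<integral>\<omega>. a \<omega> + b \<omega> + \<i> * c \<omega> - (1/2) * (d \<omega> - e \<omega>) \<partial>M)
      = (\<integral>\<omega>. a \<omega> \<partial>M) + (\<integral>\<omega>. b \<omega> \<partial>M) + \<i> * (\<integral>\<omega>. c \<omega> \<partial>M) - (1/2) * ((\<integral>\<omega>. d \<omega> \<partial>M) - (\<integral>\<omega>. e \<omega> \<partial>M))"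
    if "integrable M a" "integrable M b" "integrable M c" "integrable M d" "integrable M e" for a b c d e :: "'a \<Rightarrow> complex"
    using that by simp
  \<comment> \<open>The last two groups integrate to zero: \<open>\<xi>\<close> has conditional mean
    zero, and its square has conditional expectation \<open>v\<close>.\<close>
  have "Z \<omega> * (iexp (\<xi> \<omega>) - of_real (exp (- v \<omega> / 2)))
      = Z \<omega> * ?r1 \<omega> + Z \<omega> * ?r2 \<omega> + \<i> * (Z \<omega> * of_real (\<xi> \<omega>)) - (1/2) * (Z \<omega> * of_real ((\<xi> \<omega>)\<^sup>2) - Z \<omega> * of_real (v \<omega>))" for \<omega>
    by (simp add: algebra_simps)
  then have "(\<integral>\<omega>. Z \<omega> * (iexp (\<xi> \<omega>) - of_real (exp (- v \<omega> / 2))) \<partial>M)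
      = (\<integral>\<omega>. Z \<omega> * ?r1 \<omega> + Z \<omega> * ?r2 \<omega> + \<i> * (Z \<omega> * of_real (\<xi> \<omega>)) - (1/2) * (Z \<omega> * of_real ((\<xi> \<omega>)\<^sup>2) - Z \<omega> * of_real (v \<omega>)) \<partial>M)"
    by (simp only:)
  also have "\<dots> = (\<integral>\<omega>. Z \<omega> * ?r1 \<omega> \<partial>M) + (\<integral>\<omega>. Z \<omega> * ?r2 \<omega> \<partial>M) + \<i> * (\<integral>\<omega>. Z \<omega> * of_real (\<xi> \<omega>) \<partial>M)
      - (1/2) * ((\<integral>\<omega>. Z \<omega> * of_real ((\<xi> \<omega>)\<^sup>2) \<partial>M) - (\<integral>\<omega>. Z \<omega> * of_real (v \<omega>) \<partial>M))"
    by (rule lin[OF ir1 ir2 t1(1) t2(1,2)])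
  also have "\<dots> = (\<integral>\<omega>. Z \<omega> * ?r1 \<omega> \<partial>M) + (\<integral>\<omega>. Z \<omega> * ?r2 \<omega> \<partial>M)"
    using t1(3) t2(3) by simp
  finally have eq: "(\<integral>\<omega>. Z \<omega> * (iexp (\<xi> \<omega>) - of_real (exp (- v \<omega> / 2))) \<partial>M)
      = (\<integral>\<omega>. Z \<omega> * ?r1 \<omega> \<partial>M) + (\<integral>\<omega>. Z \<omega> * ?r2 \<omega> \<partial>M)" .
  have le: "cmod ((\<integral>\<omega>. Z \<omega> * ?r1 \<omega> \<partial>M) + (\<integral>\<omega>. Z \<omega> * ?r2 \<omega> \<partial>M)) \<le> (\<integral>\<omega>. B * ?b1 \<omega> \<partial>M) + (\<integral>\<omega>. B * (\<kappa> * v \<omega>) \<partial>M)"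
  proof (intro norm_triangle_le add_mono)
    show "cmod (\<integral>\<omega>. Z \<omega> * ?r1 \<omega> \<partial>M) \<le> (\<integral>\<omega>. B * ?b1 \<omega> \<partial>M)"
      by (rule order_trans[OF integral_norm_bound integral_mono[OF integrable_norm[OF ir1] ib1 b1]])
    show "cmod (\<integral>\<omega>. Z \<omega> * ?r2 \<omega> \<partial>M) \<le> (\<integral>\<omega>. B * (\<kappa> * v \<omega>) \<partial>M)"
      by (rule order_trans[OF integral_norm_bound integral_mono[OF integrable_norm[OF ir2] ib2 b2]])
  qed
  have "(\<integral>\<omega>. B * ?b1 \<omega> \<partial>M) + (\<integral>\<omega>. B * (\<kappa> * v \<omega>) \<partial>M)
      = B * (\<epsilon> * (\<integral>\<omega>. v \<omega> \<partial>M) + (\<integral>\<omega>. l \<omega> \<partial>M) + \<kappa> * (\<integral>\<omega>. v \<omega> \<partial>M))"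
    using i2(1,3) i3(1,3) by (simp add: distrib_left)
  then show ?thesis unfolding eq using le by (simp only:)
qed

text \<open>Telescoping over time: at time \<open>N\<close> the expectation of the exponential
  process on \<open>B\<close> is the probability of \<open>B\<close>, and each later step changes it
  only by the remainder of one increment. That \<open>B\<close> belongs to \<open>F N\<close> keeps
  the process adapted. The bound on the summed variances makes the accumulated error independent of
  the number of steps.\<close>

lemma exponential_martingale_bound:
  fixes N n :: nat and F :: "nat \<Rightarrow> 'a measure" and \<xi> v l :: "nat \<Rightarrow> 'a \<Rightarrow> real"
  assumes M: "prob_space M" and F: "\<And>n. subalgebra M (F n)" "\<And>m n. m \<le> n \<Longrightarrow> sets (F m) \<subseteq> sets (F n)"
    and B: "B \<in> sets (F N)" and Nn: "N \<le> n"
    and \<xi>: "\<And>k. N < k \<Longrightarrow> k \<le> n \<Longrightarrow> \<xi> k \<in> borel_measurable (F k)"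
      "\<And>k. N < k \<Longrightarrow> k \<le> n \<Longrightarrow> cond_exp_version M (F (k - 1)) (\<xi> k) (\<lambda>_. 0)"
    and var: "\<And>k. N < k \<Longrightarrow> k \<le> n \<Longrightarrow> cond_exp_version M (F (k - 1)) (\<lambda>\<omega>. (\<xi> k \<omega>)\<^sup>2) (v k)"
    and lind: "\<And>k. N < k \<Longrightarrow> k \<le> n \<Longrightarrow>
      cond_exp_version M (F (k - 1)) (\<lambda>\<omega>. (\<xi> k \<omega>)\<^sup>2 * indicator {\<omega>. \<bar>\<xi> k \<omega>\<bar> > \<epsilon>} \<omega>) (l k)"
    and v: "\<And>k \<omega>. 0 \<le> v k \<omega>" "\<And>k \<omega>. N < k \<Longrightarrow> k \<le> n \<Longrightarrow> v k \<omega> \<le> \<kappa>" and \<kappa>: "0 \<le> \<kappa>" "\<kappa> \<le> 1" and \<epsilon>: "0 \<le> \<epsilon>"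
    and l: "\<And>k \<omega>. 0 \<le> l k \<omega>"
    and C: "\<And>\<omega>. (\<Sum>k\<in>{N<..n}. v k \<omega>) \<le> C" and \<eta>: "\<And>\<omega>. (\<Sum>k\<in>{N<..n}. l k \<omega>) \<le> \<eta>"
  shows "cmod ((\<integral>\<omega>. indicator B \<omega> * (iexp (\<Sum>k\<in>{N<..n}. \<xi> k \<omega>) * of_real (exp ((\<Sum>k\<in>{N<..n}. v k \<omega>) / 2))) \<partial>M) - measure M B)
    \<le> exp (C / 2) * (\<epsilon> * C + \<eta> + \<kappa> * C)"
proof -
  interpret prob_space M by fact
  define S where "S m \<omega> = (\<Sum>k\<in>{N<..m}. \<xi> k \<omega>)" for m \<omega>
  define V where "V m \<omega> = (\<Sum>k\<in>{N<..m}. v k \<omega>)" for m \<omega>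
  define Z where "Z m \<omega> = indicator B \<omega> * (iexp (S m \<omega>) * of_real (exp (V m \<omega> / 2)))" for m \<omega>
  have meas: "X \<in> borel_measurable (F m)" if "k \<le> m" "X \<in> borel_measurable (F k)" for X :: "'a \<Rightarrow> real" and k m
    using that F measurable_mono[of borel borel "F k" "F m"] by (auto simp: subalgebra_def)
  have vm: "v k \<in> borel_measurable (F (k - 1))" if "N < k" "k \<le> n" for k
    using var[OF that] by (auto simp: cond_exp_version_def)
  have Sm: "S m \<in> borel_measurable (F m)" if "m \<le> n" for m
    unfolding S_def using that by (intro borel_measurable_sum meas[OF _ \<xi>(1)]) auto
  have Vm: "V m \<in> borel_measurable (F (m - 1))" if "m \<le> n" for m
    unfolding V_def using that by (intro borel_measurable_sum meas[OF _ vm]) auto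
  have Bm: "B \<in> sets (F m)" if "N \<le> m" for m using F(2)[OF that] B by auto
  have VC: "V m \<omega> \<le> C" if "m \<le> n" for m \<omega>
  proof -
    have "V m \<omega> \<le> V n \<omega>" unfolding V_def using that v by (intro sum_mono2) auto
    then show ?thesis using C[of \<omega>] by (simp add: V_def)
  qed
  have int: "integrable M (v k)" "integrable M (l k)" if "N < k" "k \<le> n" for k
    using cond_exp_version_integrable(2)[OF M F(1) var[OF that]] cond_exp_version_integrable(2)[OF M F(1) lind[OF that]] by auto
  have Zi: "integrable M (Z m)" if "N \<le> m" "m \<le> n" for m
  proof (rule Bochner_Integration.integrable_bound[where f = "\<lambda>_. exp (C / 2)"])
    have [measurable]: "S m \<in> borel_measurable M" "V m \<in> borel_measurable M" "B \<in> sets M"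
      using measurable_from_subalg[OF F(1) Sm[OF that(2)]] measurable_from_subalg[OF F(1) Vm[OF that(2)]] Bm[OF that(1)] F(1)
      by (auto simp: subalgebra_def)
    show "Z m \<in> borel_measurable M" unfolding Z_def by measurable
    show "AE \<omega> in M. norm (Z m \<omega>) \<le> norm (exp (C / 2))"
      using VC[OF that(2)] by (auto simp: Z_def norm_mult indicator_def)
  qed simp
  have "cmod ((\<integral>\<omega>. Z m \<omega> \<partial>M) - measure M B)
      \<le> exp (C / 2) * (\<Sum>k\<in>{N<..m}. \<epsilon> * (\<integral>\<omega>. v k \<omega> \<partial>M) + (\<integral>\<omega>. l k \<omega> \<partial>M) + \<kappa> * (\<integral>\<omega>. v k \<omega> \<partial>M))"
    if "N \<le> m" "m \<le> n" for m
    using that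
  proof (induction m rule: dec_induct)
    case base
    have "(\<integral>\<omega>. Z N \<omega> \<partial>M) = of_real (\<integral>\<omega>. indicator B \<omega> \<partial>M)"
      unfolding integral_complex_of_real[symmetric]
      by (intro Bochner_Integration.integral_cong) (auto simp: Z_def S_def V_def indicator_def)
    moreover have "B \<in> sets M" using B F by (auto simp: subalgebra_def)
    ultimately show ?case by simp
  next
    case (step m)
    have m: "N < Suc m" "Suc m \<le> n" using step by auto
    \<comment> \<open>The variance is already taken at \<open>Suc m\<close>: being predictable, it
      is known at time \<open>m\<close>, so that the whole prefactor of the next increment is
      \<open>F m\<close>-measurable.\<close>
    define W where "W \<omega> = indicator B \<omega> * (iexp (S m \<omega>) * of_real (exp (V (Suc m) \<omega> / 2)))" for \<omega>
    have SS: "S (Suc m) \<omega> = S m \<omega> + \<xi> (Suc m) \<omega>" "V (Suc m) \<omega> = V m \<omega> + v (Suc m) \<omega>" for \<omega>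
    proof -
      have "{N<..Suc m} = insert (Suc m) {N<..m}" using step by auto
      then show "S (Suc m) \<omega> = S m \<omega> + \<xi> (Suc m) \<omega>" "V (Suc m) \<omega> = V m \<omega> + v (Suc m) \<omega>"
        by (auto simp: S_def V_def)
    qed
    have ZW: "Z (Suc m) \<omega> - Z m \<omega> = W \<omega> * (iexp (\<xi> (Suc m) \<omega>) - of_real (exp (- v (Suc m) \<omega> / 2)))" for \<omega>
    proof -
      have "exp (V (Suc m) \<omega> / 2) * exp (- v (Suc m) \<omega> / 2) = exp (V m \<omega> / 2)"
        by (simp add: SS exp_add[symmetric] add_divide_distrib)
      then have "complex_of_real (exp (V (Suc m) \<omega> / 2)) * of_real (exp (- v (Suc m) \<omega> / 2)) = of_real (exp (V m \<omega> / 2))"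
        by (simp only: of_real_mult[symmetric])
      moreover have "iexp (S (Suc m) \<omega>) = iexp (S m \<omega>) * iexp (\<xi> (Suc m) \<omega>)"
        by (simp add: SS exp_add distrib_left)
      ultimately show ?thesis by (simp only: Z_def W_def right_diff_distrib mult.assoc) (simp add: mult_ac)
    qed
    have "cmod (\<integral>\<omega>. W \<omega> * (iexp (\<xi> (Suc m) \<omega>) - of_real (exp (- v (Suc m) \<omega> / 2))) \<partial>M)
      \<le> exp (C / 2) * (\<epsilon> * (\<integral>\<omega>. v (Suc m) \<omega> \<partial>M) + (\<integral>\<omega>. l (Suc m) \<omega> \<partial>M) + \<kappa> * (\<integral>\<omega>. v (Suc m) \<omega> \<partial>M))"
    proof (rule exponential_martingale_step[OF M F(1)[of m]])
      have [measurable]: "S m \<in> borel_measurable (F m)" "V (Suc m) \<in> borel_measurable (F m)" "B \<in> sets (F m)"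
        using Sm[of m] Vm[of "Suc m"] Bm[of m] step by auto
      show "W \<in> borel_measurable (F m)" unfolding W_def by measurable
      show "cmod (W \<omega>) \<le> exp (C / 2)" for \<omega>
        using VC[of "Suc m" \<omega>] step by (auto simp: W_def norm_mult indicator_def)
      show "cond_exp_version M (F m) (\<xi> (Suc m)) (\<lambda>_. 0)" using \<xi>(2)[OF m] by simp
      show "cond_exp_version M (F m) (\<lambda>\<omega>. (\<xi> (Suc m) \<omega>)\<^sup>2) (v (Suc m))" using var[OF m] by simp
      show "cond_exp_version M (F m) (\<lambda>\<omega>. (\<xi> (Suc m) \<omega>)\<^sup>2 * indicator {\<omega>. \<bar>\<xi> (Suc m) \<omega>\<bar> > \<epsilon>} \<omega>) (l (Suc m))"
        using lind[OF m] by simp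
    qed (use v(1) v(2)[OF m] \<kappa> \<epsilon> in auto)
    also have "(\<integral>\<omega>. W \<omega> * (iexp (\<xi> (Suc m) \<omega>) - of_real (exp (- v (Suc m) \<omega> / 2))) \<partial>M) = (\<integral>\<omega>. Z (Suc m) \<omega> \<partial>M) - (\<integral>\<omega>. Z m \<omega> \<partial>M)"
      unfolding ZW[symmetric] using Zi[of m] Zi[of "Suc m"] step by (intro Bochner_Integration.integral_diff) auto
    finally have st: "cmod ((\<integral>\<omega>. Z (Suc m) \<omega> \<partial>M) - (\<integral>\<omega>. Z m \<omega> \<partial>M))
      \<le> exp (C / 2) * (\<epsilon> * (\<integral>\<omega>. v (Suc m) \<omega> \<partial>M) + (\<integral>\<omega>. l (Suc m) \<omega> \<partial>M) + \<kappa> * (\<integral>\<omega>. v (Suc m) \<omega> \<partial>M))" .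
    have ins: "{N<..Suc m} = insert (Suc m) {N<..m}" using step by auto
    have "cmod ((\<integral>\<omega>. Z (Suc m) \<omega> \<partial>M) - measure M B)
        \<le> cmod ((\<integral>\<omega>. Z (Suc m) \<omega> \<partial>M) - (\<integral>\<omega>. Z m \<omega> \<partial>M)) + cmod ((\<integral>\<omega>. Z m \<omega> \<partial>M) - measure M B)"
      using norm_triangle_ineq[of "(\<integral>\<omega>. Z (Suc m) \<omega> \<partial>M) - (\<integral>\<omega>. Z m \<omega> \<partial>M)" "(\<integral>\<omega>. Z m \<omega> \<partial>M) - measure M B"] by simp
    with st step.IH step.prems show ?case unfolding ins by (simp add: distrib_left)
  qed
  from this[OF Nn order_refl] have "cmod ((\<integral>\<omega>. Z n \<omega> \<partial>M) - measure M B)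
      \<le> exp (C / 2) * (\<Sum>k\<in>{N<..n}. \<epsilon> * (\<integral>\<omega>. v k \<omega> \<partial>M) + (\<integral>\<omega>. l k \<omega> \<partial>M) + \<kappa> * (\<integral>\<omega>. v k \<omega> \<partial>M))" .
  also have "(\<Sum>k\<in>{N<..n}. \<epsilon> * (\<integral>\<omega>. v k \<omega> \<partial>M) + (\<integral>\<omega>. l k \<omega> \<partial>M) + \<kappa> * (\<integral>\<omega>. v k \<omega> \<partial>M))
      = \<epsilon> * (\<integral>\<omega>. (\<Sum>k\<in>{N<..n}. v k \<omega>) \<partial>M) + (\<integral>\<omega>. (\<Sum>k\<in>{N<..n}. l k \<omega>) \<partial>M) + \<kappa> * (\<integral>\<omega>. (\<Sum>k\<in>{N<..n}. v k \<omega>) \<partial>M)"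
    using int by (subst (1 2) Bochner_Integration.integral_sum) (auto simp: sum.distrib sum_distrib_left)
  also have "\<dots> \<le> \<epsilon> * C + \<eta> + \<kappa> * C"
  proof (intro add_mono mult_left_mono \<epsilon> \<kappa>)
    have 1: "(\<integral>\<omega>. (\<Sum>k\<in>{N<..n}. v k \<omega>) \<partial>M) \<le> (\<integral>\<omega>. C \<partial>M)"
      using int C by (intro integral_mono) auto
    then show "(\<integral>\<omega>. (\<Sum>k\<in>{N<..n}. v k \<omega>) \<partial>M) \<le> C" by (simp add: prob_space)
    show "(\<integral>\<omega>. (\<Sum>k\<in>{N<..n}. v k \<omega>) \<partial>M) \<le> C" using 1 by (simp add: prob_space)
    have "(\<integral>\<omega>. (\<Sum>k\<in>{N<..n}. l k \<omega>) \<partial>M) \<le> (\<integral>\<omega>. \<eta> \<partial>M)"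
      using int \<eta> by (intro integral_mono) auto
    then show "(\<integral>\<omega>. (\<Sum>k\<in>{N<..n}. l k \<omega>) \<partial>M) \<le> \<eta>" by (simp add: prob_space)
  qed
  finally show ?thesis by (simp add: Z_def S_def V_def mult_left_mono)
qed

section \<open>A martingale central limit theorem on an event\<close>

text \<open>Turns almost sure statements of the form "eventually in \<open>n\<close>" into small
  probabilities at fixed \<open>n\<close>, by dominated convergence of indicators.\<close>

lemma prob_eventually_avoided:
  assumes M: "prob_space M" and E: "\<And>n. E n \<in> sets M"
    and ae: "AE \<omega> in M. \<forall>\<^sub>F n in sequentially. \<omega> \<notin> E n"
  shows "(\<lambda>n. measure M (E n)) \<longlonglongrightarrow> 0"
proof -
  interpret prob_space M by fact
  have "(\<lambda>n. \<integral>\<omega>. indicator (E n) \<omega> \<partial>M) \<longlonglongrightarrow> (\<integral>\<omega>. (0::real) \<partial>M)"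
  proof (rule integral_dominated_convergence[where w = "\<lambda>_. 1"])
    show "AE \<omega> in M. (\<lambda>n. indicator (E n) \<omega> :: real) \<longlonglongrightarrow> 0"
      using ae by eventually_elim (rule tendsto_eventually, auto elim!: eventually_mono simp: indicator_def)
  qed (use E in \<open>auto simp: indicator_def\<close>)
  then show ?thesis using E by simp
qed

text \<open>As \<open>P\<close> can only switch off, the truncated sum equals the full sum up to the
  last index at which \<open>P\<close> holds, and there \<open>C\<close> bounds it.\<close>

lemma truncated_sum_le:
  fixes v :: "nat \<Rightarrow> real"
  assumes "\<And>k. 0 \<le> v k" "0 \<le> C" and P: "\<And>j k. j \<le> k \<Longrightarrow> P k \<Longrightarrow> P j"
    and C: "\<And>k. P k \<Longrightarrow> (\<Sum>j\<in>{N<..k}. v j) \<le> C"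
  shows "(\<Sum>j\<in>{N<..n}. of_bool (P j) * v j) \<le> C"
proof (induction n)
  case 0
  show ?case using assms(2) by simp
next
  case (Suc n)
  show ?case
  proof (cases "P (Suc n)")
    case True
    then have "(\<Sum>j\<in>{N<..Suc n}. of_bool (P j) * v j) = (\<Sum>j\<in>{N<..Suc n}. v j)"
      using P by (intro sum.cong) auto
    then show ?thesis using C[OF True] by simp
  next
    case False
    have "(\<Sum>j\<in>{N<..Suc n}. of_bool (P j) * v j) = (\<Sum>j\<in>{N<..n}. of_bool (P j) * v j)"
      using False by (intro sum.mono_neutral_right) (auto simp: le_Suc_eq)
    then show ?thesis using Suc by simp
  qed
qed

lemma exp_diff_bound:
  assumes "a \<le> c" "b \<le> (c::real)"
  shows "\<bar>exp a - exp b\<bar> \<le> exp c * \<bar>a - b\<bar>"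
proof -
  have *: "exp y - exp x \<le> exp c * (y - x)" if "x \<le> y" "y \<le> c" for x y :: real
  proof -
    have "exp y - exp x = exp y * (1 - exp (x - y))" by (simp add: exp_diff algebra_simps)
    also have "\<dots> \<le> exp y * (y - x)" using exp_ge_add_one_self[of "x - y"] by (intro mult_left_mono) (simp_all add: algebra_simps)
    also have "\<dots> \<le> exp c * (y - x)" using that by (intro mult_right_mono) auto
    finally show ?thesis .
  qed
  show ?thesis
  proof (cases "a \<le> b")
    case True
    then show ?thesis using *[of a b] assms by simp
  next
    case False
    then show ?thesis using *[of b a] assms by simp
  qed
qed

text \<open>Multiplication by \<open>exp (\<sigma>2 / 2)\<close> turns the Gaussian target into the
  constant \<open>1\<close>. Then four passages are made: from the deterministic variance to the
  random one of the stopped process on \<open>A\<close>, from \<open>A\<close> to \<open>B\<close>,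
  from the exponential process on \<open>B\<close> to the probability of \<open>B\<close>, and back
  to the probability of \<open>A\<close>. The symmetric difference is paid for twice, the
  exceptional event \<open>E\<close> by both exponentials.\<close>

lemma truncated_characteristic_bound:
  fixes N n :: nat and F :: "nat \<Rightarrow> 'a measure" and \<xi> v l :: "nat \<Rightarrow> 'a \<Rightarrow> real"
  assumes M: "prob_space M" and F: "\<And>n. subalgebra M (F n)" "\<And>m n. m \<le> n \<Longrightarrow> sets (F m) \<subseteq> sets (F n)"
    and A: "A \<in> sets M" and B: "B \<in> sets (F N)" and Nn: "N \<le> n"
    and \<xi>: "\<And>k. N < k \<Longrightarrow> k \<le> n \<Longrightarrow> \<xi> k \<in> borel_measurable (F k)"
      "\<And>k. N < k \<Longrightarrow> k \<le> n \<Longrightarrow> cond_exp_version M (F (k - 1)) (\<xi> k) (\<lambda>_. 0)"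
    and var: "\<And>k. N < k \<Longrightarrow> k \<le> n \<Longrightarrow> cond_exp_version M (F (k - 1)) (\<lambda>\<omega>. (\<xi> k \<omega>)\<^sup>2) (v k)"
    and lind: "\<And>k. N < k \<Longrightarrow> k \<le> n \<Longrightarrow>
      cond_exp_version M (F (k - 1)) (\<lambda>\<omega>. (\<xi> k \<omega>)\<^sup>2 * indicator {\<omega>. \<bar>\<xi> k \<omega>\<bar> > \<epsilon>} \<omega>) (l k)"
    and v: "\<And>k \<omega>. 0 \<le> v k \<omega>" and l: "\<And>k \<omega>. 0 \<le> l k \<omega>"
    and par: "0 \<le> \<kappa>" "\<kappa> \<le> 1" "0 \<le> \<epsilon>" "0 \<le> \<eta>" "0 \<le> \<sigma>2" "0 \<le> \<tau>" "\<tau> \<le> 1"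
    and E: "E = {\<omega>\<in>A. \<not> (\<bar>(\<Sum>k\<in>{N<..n}. v k \<omega>) - \<sigma>2\<bar> \<le> \<tau> \<and> (\<Sum>k\<in>{N<..n}. l k \<omega>) \<le> \<eta> \<and> (\<forall>k\<in>{N<..n}. v k \<omega> \<le> \<kappa>))}"
  shows "cmod ((\<integral>\<omega>. indicator A \<omega> * iexp (\<Sum>k\<in>{N<..n}. \<xi> k \<omega>) \<partial>M) * exp (\<sigma>2 / 2) - measure M A)
    \<le> exp ((\<sigma>2 + 1) / 2) * (\<epsilon> * (\<sigma>2 + 1) + \<eta> + \<kappa> * (\<sigma>2 + 1) + 2 * measure M (sym_diff A B) + 2 * measure M E + \<tau>)"
proof -
  interpret prob_space M by fact
  \<comment> \<open>The variance budget of the stopped process; because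
    \<open>\<tau> \<le> 1\<close> it is respected automatically on \<open>A\<close> outside
    \<open>E\<close>.\<close>
  define C where "C = \<sigma>2 + 1"
  have C: "0 \<le> C" using par by (simp add: C_def)
  \<comment> \<open>\<open>P k\<close> is predictable and decreasing in \<open>k\<close>; increments are switched off once it fails, which on \<open>A\<close> happens only inside \<open>E\<close>.\<close>
  define P where "P k \<omega> \<longleftrightarrow> (\<Sum>j\<in>{N<..k}. v j \<omega>) \<le> C \<and> (\<Sum>j\<in>{N<..k}. l j \<omega>) \<le> \<eta> \<and> (\<forall>j\<in>{N<..k}. v j \<omega> \<le> \<kappa>)" for k \<omega>
  define I where "I k \<omega> = (of_bool (P k \<omega>) :: real)" for k \<omega>
  have Pmono: "P j \<omega>" if "j \<le> k" "P k \<omega>" for j k \<omega>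
  proof -
    have "(\<Sum>j\<in>{N<..j}. v j \<omega>) \<le> (\<Sum>j\<in>{N<..k}. v j \<omega>)" "(\<Sum>j\<in>{N<..j}. l j \<omega>) \<le> (\<Sum>j\<in>{N<..k}. l j \<omega>)"
      using that v l by (auto intro!: sum_mono2)
    then show ?thesis using that by (auto simp: P_def)
  qed
  have meas: "X \<in> borel_measurable (F m)" if "k \<le> m" "X \<in> borel_measurable (F k)" for X :: "'a \<Rightarrow> real" and k m
    using that F measurable_mono[of borel borel "F k" "F m"] by (auto simp: subalgebra_def)
  have vm: "v k \<in> borel_measurable (F (k - 1))" "l k \<in> borel_measurable (F (k - 1))" if "N < k" "k \<le> n" for k
    using var[OF that] lind[OF that] by (auto simp: cond_exp_version_def)
  have Im: "I k \<in> borel_measurable (F (k - 1))" if "N < k" "k \<le> n" for k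
  proof -
    have *: "v j \<in> borel_measurable (F (k - 1))" "l j \<in> borel_measurable (F (k - 1))" if "j \<in> {N<..k}" for j
      using that \<open>k \<le> n\<close> by (auto intro!: meas[OF _ vm(1)] meas[OF _ vm(2)])
    note [measurable] = borel_measurable_sum[of "{N<..k}" v, OF *(1)] borel_measurable_sum[of "{N<..k}" l, OF *(2)] *
    show ?thesis unfolding I_def P_def by measurable
  qed
  have I01: "\<bar>I k \<omega>\<bar> \<le> 1" "0 \<le> I k \<omega>" "(I k \<omega>)\<^sup>2 = I k \<omega>" for k \<omega> by (auto simp: I_def)
  define \<xi>' v' l' where "\<xi>' k \<omega> = I k \<omega> * \<xi> k \<omega>" and "v' k \<omega> = I k \<omega> * v k \<omega>" and "l' k \<omega> = I k \<omega> * l k \<omega>" for k \<omega>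
  define S V where "S \<omega> = (\<Sum>k\<in>{N<..n}. \<xi> k \<omega>)" and "V \<omega> = (\<Sum>k\<in>{N<..n}. v k \<omega>)" for \<omega>
  define S' V' where "S' \<omega> = (\<Sum>k\<in>{N<..n}. \<xi>' k \<omega>)" and "V' \<omega> = (\<Sum>k\<in>{N<..n}. v' k \<omega>)" for \<omega>
  define Z where "Z \<omega> = iexp (S' \<omega>) * of_real (exp (V' \<omega> / 2))" for \<omega>
  have V'C: "V' \<omega> \<le> C" for \<omega>
    unfolding V'_def v'_def I_def using v C by (intro truncated_sum_le) (auto intro: Pmono, simp add: P_def)
  have core: "cmod ((\<integral>\<omega>. indicator B \<omega> * Z \<omega> \<partial>M) - measure M B) \<le> exp (C / 2) * (\<epsilon> * C + \<eta> + \<kappa> * C)"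
    unfolding Z_def S'_def V'_def
  proof (rule exponential_martingale_bound[where F = F and l = l', OF M F B Nn])
    fix k assume k: "N < k" "k \<le> n"
    show "\<xi>' k \<in> borel_measurable (F k)"
      unfolding \<xi>'_def using meas[of "k - 1" k, OF _ Im[OF k]] \<xi>(1)[OF k] by measurable
    show "cond_exp_version M (F (k - 1)) (\<xi>' k) (\<lambda>_. 0)"
      using cond_exp_version_mult_bounded[OF M F(1) \<xi>(2)[OF k] Im[OF k] I01(1)] by (simp add: \<xi>'_def[abs_def])
    show "cond_exp_version M (F (k - 1)) (\<lambda>\<omega>. (\<xi>' k \<omega>)\<^sup>2) (v' k)"
      using cond_exp_version_mult_bounded[OF M F(1) var[OF k] Im[OF k] I01(1)] by (simp add: \<xi>'_def[abs_def] v'_def[abs_def] power_mult_distrib I01(3))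
    have "I k \<omega> * ((\<xi> k \<omega>)\<^sup>2 * indicator {\<omega>. \<bar>\<xi> k \<omega>\<bar> > \<epsilon>} \<omega>) = (\<xi>' k \<omega>)\<^sup>2 * indicator {\<omega>. \<bar>\<xi>' k \<omega>\<bar> > \<epsilon>} \<omega>" for \<omega>
      using par by (auto simp: \<xi>'_def I_def indicator_def)
    then show "cond_exp_version M (F (k - 1)) (\<lambda>\<omega>. (\<xi>' k \<omega>)\<^sup>2 * indicator {\<omega>. \<bar>\<xi>' k \<omega>\<bar> > \<epsilon>} \<omega>) (l' k)"
      using cond_exp_version_mult_bounded[OF M F(1) lind[OF k] Im[OF k] I01(1)] by (simp add: l'_def[abs_def])
    show "v' k \<omega> \<le> \<kappa>" for \<omega> using k par v by (auto simp: v'_def I_def P_def)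
  next
    show "0 \<le> v' k \<omega>" "0 \<le> l' k \<omega>" for k \<omega> using v l I01 by (auto simp: v'_def l'_def)
    show "(\<Sum>k\<in>{N<..n}. v' k \<omega>) \<le> C" for \<omega> using V'C by (simp add: V'_def)
    show "(\<Sum>k\<in>{N<..n}. l' k \<omega>) \<le> \<eta>" for \<omega>
      unfolding l'_def I_def using l par by (intro truncated_sum_le) (auto intro: Pmono, simp add: P_def)
  qed (use par in auto)
  have [measurable]: "\<xi> k \<in> borel_measurable M" "v k \<in> borel_measurable M" "l k \<in> borel_measurable M" "I k \<in> borel_measurable M"
    if "k \<in> {N<..n}" for k
    using that measurable_from_subalg[OF F(1) \<xi>(1)] measurable_from_subalg[OF F(1) vm(1)] measurable_from_subalg[OF F(1) vm(2)]
      measurable_from_subalg[OF F(1) Im] by auto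
  have BM [measurable]: "B \<in> sets M" using B F(1) by (auto simp: subalgebra_def)
  note A [measurable]
  have Sm [measurable]: "S \<in> borel_measurable M" unfolding S_def by measurable
  have S'm [measurable]: "S' \<in> borel_measurable M" unfolding S'_def \<xi>'_def by measurable
  have V'm [measurable]: "V' \<in> borel_measurable M" unfolding V'_def v'_def by measurable
  have EM [measurable]: "E \<in> sets M"
  proof -
    have "E = A \<inter> {\<omega>\<in>space M. \<not> (\<bar>(\<Sum>k\<in>{N<..n}. v k \<omega>) - \<sigma>2\<bar> \<le> \<tau> \<and> (\<Sum>k\<in>{N<..n}. l k \<omega>) \<le> \<eta> \<and> (\<forall>k\<in>{N<..n}. v k \<omega> \<le> \<kappa>))}"
      unfolding E using sets.sets_into_space[OF A] by auto
    also have "\<dots> \<in> sets M" by measurable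
    finally show ?thesis .
  qed
  have Zn: "cmod (Z \<omega>) \<le> exp (C / 2)" for \<omega> using V'C[of \<omega>] by (simp add: Z_def norm_mult)
  have Zm [measurable]: "Z \<in> borel_measurable M" unfolding Z_def by measurable
  have e1: "1 \<le> exp (C / 2)" using C by simp
  have int: "integrable M (\<lambda>\<omega>. indicator X \<omega> * Y \<omega>)"
    if [measurable]: "X \<in> sets M" "Y \<in> borel_measurable M" and "\<And>\<omega>. cmod (Y \<omega>) \<le> K" for X K and Y :: "'a \<Rightarrow> complex"
  proof (rule integrable_const_bound[of _ K])
    have "0 \<le> K" using norm_ge_zero[of "Y undefined"] that(3)[of undefined] by linarith
    then show "AE \<omega> in M. norm (indicator X \<omega> * Y \<omega>) \<le> K" using that(3) by (auto simp: indicator_def)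
  qed measurable
  have iA: "integrable M (\<lambda>\<omega>. indicator A \<omega> * (iexp (S \<omega>) * of_real (exp (\<sigma>2 / 2))))"
    by (rule int[of A _ "exp (\<sigma>2 / 2)"]) (auto simp: norm_mult)
  have iAZ: "integrable M (\<lambda>\<omega>. indicator A \<omega> * Z \<omega>)" and iBZ: "integrable M (\<lambda>\<omega>. indicator B \<omega> * Z \<omega>)"
    using int[OF A Zm Zn] int[OF BM Zm Zn] by auto
  have t1: "cmod ((\<integral>\<omega>. indicator A \<omega> * (iexp (S \<omega>) * of_real (exp (\<sigma>2 / 2))) \<partial>M) - (\<integral>\<omega>. indicator A \<omega> * Z \<omega> \<partial>M))
      \<le> exp (C / 2) * (2 * measure M E + \<tau>)"
  proof -
    have b: "cmod (indicator A \<omega> * (iexp (S \<omega>) * of_real (exp (\<sigma>2 / 2))) - indicator A \<omega> * Z \<omega>)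
        \<le> exp (C / 2) * (2 * indicator E \<omega> + \<tau>)" for \<omega>
    proof (cases "\<omega> \<in> E")
      case True
      then have "\<omega> \<in> A" using E by auto
      have "cmod (iexp (S \<omega>) * of_real (exp (\<sigma>2 / 2)) - Z \<omega>) \<le> exp (\<sigma>2 / 2) + exp (C / 2)"
        by (rule order_trans[OF norm_triangle_ineq4]) (use Zn in \<open>auto simp: norm_mult intro!: add_mono\<close>)
      also have "\<dots> \<le> exp (C / 2) * (2 + \<tau>)"
      proof -
        have "exp (\<sigma>2 / 2) \<le> exp (C / 2)" by (simp add: C_def)
        moreover have "0 \<le> exp (C / 2) * \<tau>" using par by simp
        moreover have "exp (C / 2) * (2 + \<tau>) = exp (C / 2) + exp (C / 2) + exp (C / 2) * \<tau>" by (simp add: algebra_simps)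
        ultimately show ?thesis using exp_ge_zero[of "C / 2"] by linarith
      qed
      finally show ?thesis using True \<open>\<omega> \<in> A\<close> by simp
    next
      case False
      show ?thesis
      proof (cases "\<omega> \<in> A")
        case True
        with False have g: "\<bar>V \<omega> - \<sigma>2\<bar> \<le> \<tau>" "(\<Sum>k\<in>{N<..n}. l k \<omega>) \<le> \<eta>" "\<forall>k\<in>{N<..n}. v k \<omega> \<le> \<kappa>"
          by (auto simp: E V_def)
        have VC: "V \<omega> \<le> C" using g(1) par by (simp add: C_def abs_le_iff)
        have "P n \<omega>" using g VC by (auto simp: P_def V_def)
        then have "I k \<omega> = 1" if "k \<le> n" for k using Pmono that by (auto simp: I_def)
        then have "S' \<omega> = S \<omega>" "V' \<omega> = V \<omega>"
          by (auto simp: S'_def S_def V'_def V_def \<xi>'_def v'_def intro!: sum.cong)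
        then have "iexp (S \<omega>) * of_real (exp (\<sigma>2 / 2)) - Z \<omega> = iexp (S \<omega>) * of_real (exp (\<sigma>2 / 2) - exp (V \<omega> / 2))"
          by (simp add: Z_def algebra_simps)
        then have "cmod (iexp (S \<omega>) * of_real (exp (\<sigma>2 / 2)) - Z \<omega>) = \<bar>exp (\<sigma>2 / 2) - exp (V \<omega> / 2)\<bar>"
          by (simp only: norm_mult norm_exp_i_times norm_of_real) simp
        also have "\<dots> \<le> exp (C / 2) * \<bar>\<sigma>2 / 2 - V \<omega> / 2\<bar>" using VC par by (intro exp_diff_bound) (auto simp: C_def)
        also have "\<dots> \<le> exp (C / 2) * \<tau>" using g(1) by (intro mult_left_mono) auto
        finally show ?thesis using False True by simp
      qed (use False par in auto)
    qed
    have "cmod (\<integral>\<omega>. indicator A \<omega> * (iexp (S \<omega>) * of_real (exp (\<sigma>2 / 2))) - indicator A \<omega> * Z \<omega> \<partial>M)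
       \<le> (\<integral>\<omega>. exp (C / 2) * (2 * indicator E \<omega> + \<tau>) \<partial>M)"
      by (rule order_trans[OF integral_norm_bound integral_mono[OF integrable_norm[OF Bochner_Integration.integrable_diff[OF iA iAZ]] _ b]])
         (simp add: emeasure_eq_measure)
    also have "(\<integral>\<omega>. exp (C / 2) * (2 * indicator E \<omega> + \<tau>) \<partial>M) = exp (C / 2) * (2 * measure M E + \<tau>)"
      by (simp add: emeasure_eq_measure prob_space)
    finally show ?thesis using Bochner_Integration.integral_diff[OF iA iAZ] by (simp only:)
  qed
  have SD [measurable]: "sym_diff A B \<in> sets M" by measurable
  have t2: "cmod ((\<integral>\<omega>. indicator A \<omega> * Z \<omega> \<partial>M) - (\<integral>\<omega>. indicator B \<omega> * Z \<omega> \<partial>M)) \<le> exp (C / 2) * measure M (sym_diff A B)"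
  proof -
    have b: "cmod (indicator A \<omega> * Z \<omega> - indicator B \<omega> * Z \<omega>) \<le> exp (C / 2) * indicator (sym_diff A B) \<omega>" for \<omega>
      using Zn[of \<omega>] by (auto simp: indicator_def)
    have "cmod (\<integral>\<omega>. indicator A \<omega> * Z \<omega> - indicator B \<omega> * Z \<omega> \<partial>M) \<le> (\<integral>\<omega>. exp (C / 2) * indicator (sym_diff A B) \<omega> \<partial>M)"
      by (rule order_trans[OF integral_norm_bound integral_mono[OF integrable_norm[OF Bochner_Integration.integrable_diff[OF iAZ iBZ]] _ b]])
         (simp add: emeasure_eq_measure)
    then show ?thesis using Bochner_Integration.integral_diff[OF iAZ iBZ] by simp
  qed
  have t3: "cmod (complex_of_real (measure M B) - measure M A) \<le> exp (C / 2) * measure M (sym_diff A B)"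
  proof -
    have "\<bar>measure M B - measure M A\<bar> \<le> measure M (sym_diff A B)"
    proof -
      have "measure M B \<le> measure M (A \<union> sym_diff A B)" "measure M A \<le> measure M (B \<union> sym_diff A B)"
        by (auto intro!: finite_measure_mono)
      moreover have "measure M (A \<union> sym_diff A B) \<le> measure M A + measure M (sym_diff A B)"
        "measure M (B \<union> sym_diff A B) \<le> measure M B + measure M (sym_diff A B)"
        by (auto intro!: measure_Un_le)
      ultimately show ?thesis by linarith
    qed
    also have "\<dots> \<le> exp (C / 2) * measure M (sym_diff A B)" using mult_right_mono[OF e1, of "measure M (sym_diff A B)"] by simp
    finally show ?thesis by (simp only: of_real_diff[symmetric] norm_of_real)
  qed
  have id: "(\<integral>\<omega>. indicator A \<omega> * iexp (\<Sum>k\<in>{N<..n}. \<xi> k \<omega>) \<partial>M) * exp (\<sigma>2 / 2) = (\<integral>\<omega>. indicator A \<omega> * (iexp (S \<omega>) * of_real (exp (\<sigma>2 / 2))) \<partial>M)"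
    unfolding S_def by (simp add: mult.assoc[symmetric])
  \<comment> \<open>The chain of the four passages described above the lemma.\<close>
  have tri: "cmod (a - d) \<le> x + y + z + w"
    if "cmod (a - b) \<le> x" "cmod (b - c) \<le> y" "cmod (c - e) \<le> z" "cmod (e - d) \<le> w" for a b c d e :: complex and x y z w
    using that norm_triangle_ineq[of "a - b" "b - c"] norm_triangle_ineq[of "a - c" "c - e"] norm_triangle_ineq[of "a - e" "e - d"] by simp
  show ?thesis unfolding id using tri[OF t1 t2 core t3] by (simp only: C_def[symmetric]) (simp add: algebra_simps)
qed

text \<open>The approximating event \<open>B\<close> belongs to some \<open>F N\<close>, so the
  exponential martingale can only be started at time \<open>N\<close>. The increments before
  \<open>N\<close> form a fixed sum, which the diverging normalization \<open>s n\<close>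
  removes.\<close>

theorem martingale_clt_on_event:
  fixes Y y :: "nat \<Rightarrow> 'a \<Rightarrow> real" and s :: "nat \<Rightarrow> real" and F :: "nat \<Rightarrow> 'a measure"
  assumes M: "prob_space M" and F: "\<And>n. subalgebra M (F n)" "\<And>m n. m \<le> n \<Longrightarrow> sets (F m) \<subseteq> sets (F n)"
    and A: "A \<in> sets M" "\<And>e. e > 0 \<Longrightarrow> \<exists>N. \<exists>B\<in>sets (F N). measure M (sym_diff A B) < e"
    and s: "\<And>n. n \<ge> 1 \<Longrightarrow> s n > 0" "\<And>m n. 1 \<le> m \<Longrightarrow> m \<le> n \<Longrightarrow> s m \<le> s n" "filterlim s at_top sequentially"
    and Y: "\<And>k. k \<ge> 1 \<Longrightarrow> Y k \<in> borel_measurable (F k)" "\<And>k. k \<ge> 1 \<Longrightarrow> cond_exp_version M (F (k - 1)) (Y k) (\<lambda>_. 0)"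
    and var: "\<And>k. k \<ge> 1 \<Longrightarrow> cond_exp_version M (F (k - 1)) (\<lambda>\<omega>. (Y k \<omega>)\<^sup>2) (y k)" "\<And>k \<omega>. 0 \<le> y k \<omega>"
    and lind: "\<And>\<epsilon> n k. \<epsilon> > 0 \<Longrightarrow> n \<ge> 1 \<Longrightarrow> k \<ge> 1 \<Longrightarrow>
        cond_exp_version M (F (k - 1)) (\<lambda>\<omega>. (Y k \<omega>)\<^sup>2 * indicator {\<omega>. \<bar>Y k \<omega>\<bar> > \<epsilon> * s n} \<omega>) (l \<epsilon> n k)"
      "\<And>\<epsilon> n k \<omega>. 0 \<le> l \<epsilon> n k \<omega>"
      "\<And>\<epsilon> \<eta>. \<epsilon> > 0 \<Longrightarrow> \<eta> > 0 \<Longrightarrow> (\<lambda>n. measure M (A \<inter> {\<omega>\<in>space M. (\<Sum>k=1..n. l \<epsilon> n k \<omega>) / (s n)\<^sup>2 > \<eta>})) \<longlonglongrightarrow> 0"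
    and lim: "AE \<omega> in M. \<omega> \<in> A \<longrightarrow> (\<lambda>n. (\<Sum>k=1..n. y k \<omega>) / (s n)\<^sup>2) \<longlonglongrightarrow> \<sigma>2"
      "AE \<omega> in M. \<omega> \<in> A \<longrightarrow> (\<lambda>n. y n \<omega> / (s n)\<^sup>2) \<longlonglongrightarrow> 0"
    and \<sigma>2: "0 \<le> \<sigma>2"
  shows "(\<lambda>n. \<integral>\<omega>. indicator A \<omega> * iexp ((\<Sum>k=1..n. Y k \<omega>) / s n) \<partial>M) \<longlonglongrightarrow> of_real (measure M A * exp (- \<sigma>2 / 2))"
proof -
  interpret prob_space M by fact
  define \<phi> where "\<phi> n = (\<integral>\<omega>. indicator A \<omega> * iexp ((\<Sum>k=1..n. Y k \<omega>) / s n) \<partial>M)" for n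
  have Ym: "Y k \<in> borel_measurable M" "y k \<in> borel_measurable M" if "k \<ge> 1" for k
    using measurable_from_subalg[OF F(1) Y(1)[OF that]] cond_exp_version_integrable(5)[OF M F(1) var(1)[OF that]] by auto
  have lm: "l \<epsilon> n k \<in> borel_measurable M" if "\<epsilon> > 0" "n \<ge> 1" "k \<ge> 1" for \<epsilon> n k
    using cond_exp_version_integrable(5)[OF M F(1) lind(1)[OF that]] .
  have Am [measurable]: "A \<in> sets M" by fact
  \<comment> \<open>One number \<open>t\<close> serves as every tolerance: Lindeberg level and
    bound, variance cap, deviation of the variance, and approximation of the event. In
    \<open>K\<close>, the summand \<open>9\<close> consists of \<open>8\<close> from the increments
    after \<open>N\<close> and \<open>1\<close> from the dropped ones.\<close>
  have main: "\<exists>n0. \<forall>n\<ge>n0. cmod (\<phi> n * exp (\<sigma>2 / 2) - measure M A) \<le> K * t"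
    if t: "0 < t" "t \<le> 1" and K: "K = exp ((\<sigma>2 + 1) / 2) * (2 * (\<sigma>2 + 1) + 9)" for t K
  proof -
    obtain N B where B: "B \<in> sets (F N)" "measure M (sym_diff A B) < t" using A(2)[OF t(1)] by blast
    define E where "E n = {\<omega>\<in>A. \<not> (\<bar>(\<Sum>k\<in>{N<..n}. y k \<omega> / (s n)\<^sup>2) - \<sigma>2\<bar> \<le> t
        \<and> (\<Sum>k\<in>{N<..n}. l t n k \<omega> / (s n)\<^sup>2) \<le> t \<and> (\<forall>k\<in>{N<..n}. y k \<omega> / (s n)\<^sup>2 \<le> t))}" for n
    \<comment> \<open>The exceptional event is split by the way its probability is controlled: the
      variance conditions fail only finitely often almost surely on \<open>A\<close>, while the
      Lindeberg sum is small merely in probability.\<close>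
    define E1 where "E1 n = {\<omega>\<in>A. \<not> (\<bar>(\<Sum>k\<in>{N<..n}. y k \<omega> / (s n)\<^sup>2) - \<sigma>2\<bar> \<le> t \<and> (\<forall>k\<in>{N<..n}. y k \<omega> / (s n)\<^sup>2 \<le> t))}" for n
    define E2 where "E2 n = A \<inter> {\<omega>\<in>space M. (\<Sum>k=1..n. l t n k \<omega>) / (s n)\<^sup>2 > t}" for n
    have E1m: "E1 n \<in> sets M" for n
    proof -
      note [measurable] = Ym
      have "E1 n = A \<inter> {\<omega>\<in>space M. \<not> (\<bar>(\<Sum>k\<in>{N<..n}. y k \<omega> / (s n)\<^sup>2) - \<sigma>2\<bar> \<le> t \<and> (\<forall>k\<in>{N<..n}. y k \<omega> / (s n)\<^sup>2 \<le> t))}"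
        unfolding E1_def using sets.sets_into_space[OF A(1)] by auto
      also have "\<dots> \<in> sets M" by measurable auto
      finally show ?thesis .
    qed
    have E2m: "E2 n \<in> sets M" if "n \<ge> 1" for n
    proof -
      have [measurable]: "(\<lambda>\<omega>. \<Sum>k=1..n. l t n k \<omega>) \<in> borel_measurable M"
        by (intro borel_measurable_sum lm) (use t that in auto)
      show ?thesis unfolding E2_def by measurable
    qed
    have sq: "filterlim (\<lambda>n. (s n)\<^sup>2) at_top sequentially"
      using filterlim_at_top_mult_at_top[OF s(3) s(3)] by (simp add: power2_eq_square)
    have c0: "(\<lambda>n. c / (s n)\<^sup>2) \<longlonglongrightarrow> 0" for c :: real
      by (intro tendsto_divide_0[OF tendsto_const] filterlim_at_top_imp_at_infinity sq)
    have "(\<lambda>n. measure M (E1 n)) \<longlonglongrightarrow> 0"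
    proof (rule prob_eventually_avoided[OF M E1m])
      show "AE \<omega> in M. \<forall>\<^sub>F n in sequentially. \<omega> \<notin> E1 n"
        using lim
      proof eventually_elim
        case (elim \<omega>)
        show ?case
        proof (cases "\<omega> \<in> A")
          case True
          have "(\<lambda>n. (\<Sum>k=1..n. y k \<omega>) / (s n)\<^sup>2 - (\<Sum>k=1..N. y k \<omega>) / (s n)\<^sup>2) \<longlonglongrightarrow> \<sigma>2 - 0"
            using elim True by (intro tendsto_diff c0) auto
          moreover have "\<forall>\<^sub>F n in sequentially. (\<Sum>k=1..n. y k \<omega>) / (s n)\<^sup>2 - (\<Sum>k=1..N. y k \<omega>) / (s n)\<^sup>2 = (\<Sum>k\<in>{N<..n}. y k \<omega> / (s n)\<^sup>2)"
            using eventually_ge_at_top[of N]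
          proof eventually_elim
            case (elim n)
            have "{1..n} = {1..N} \<union> {N<..n}" using elim by auto
            then have "(\<Sum>k=1..n. y k \<omega>) = (\<Sum>k=1..N. y k \<omega>) + (\<Sum>k\<in>{N<..n}. y k \<omega>)"
              by (simp only:) (subst sum.union_disjoint, auto)
            then show ?case by (simp add: sum_divide_distrib[symmetric] add_divide_distrib)
          qed
          ultimately have l1: "(\<lambda>n. \<Sum>k\<in>{N<..n}. y k \<omega> / (s n)\<^sup>2) \<longlonglongrightarrow> \<sigma>2" by (simp add: tendsto_cong)
          then have ev1: "\<forall>\<^sub>F n in sequentially. \<bar>(\<Sum>k\<in>{N<..n}. y k \<omega> / (s n)\<^sup>2) - \<sigma>2\<bar> < t"
            using tendstoD[OF l1 t(1)] by (simp add: dist_real_def)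
          \<comment> \<open>The maximum of \<open>y k / (s n)^2\<close> over
            \<open>k \<le> n\<close> is small: for \<open>k > n1\<close> compare with the
            normalization at time \<open>k\<close>, which is smaller; the finitely many other
            indices vanish as \<open>s n\<close> grows.\<close>
          obtain n1 where n1: "\<And>n. n \<ge> n1 \<Longrightarrow> y n \<omega> / (s n)\<^sup>2 < t"
            using order_tendstoD(2)[of "\<lambda>n. y n \<omega> / (s n)\<^sup>2" 0 sequentially t] elim True t by (auto simp: eventually_sequentially)
          have "\<forall>\<^sub>F n in sequentially. \<forall>k\<in>{..n1}. y k \<omega> / (s n)\<^sup>2 < t"
            using order_tendstoD(2)[OF c0 t(1)] by (intro eventually_ball_finite) auto
          with ev1 eventually_ge_at_top[of 1] show ?thesis
          proof eventually_elim
            case (elim n)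
            have "y k \<omega> / (s n)\<^sup>2 \<le> t" if k: "k \<in> {N<..n}" for k
            proof (cases "k \<le> n1")
              case False
              have "y k \<omega> / (s n)\<^sup>2 \<le> y k \<omega> / (s k)\<^sup>2"
                using s(1)[of k] s(1)[of n] s(2)[of k n] k var(2) by (intro divide_left_mono power_mono) auto
              also have "\<dots> < t" using n1[of k] False by auto
              finally show ?thesis by simp
            qed (use elim in \<open>auto intro: less_imp_le\<close>)
            then show ?case using elim by (auto simp: E1_def)
          qed
        qed (auto simp: E1_def)
      qed
    qed
    then have e1: "\<forall>\<^sub>F n in sequentially. measure M (E1 n) < t" using t by (intro order_tendstoD) auto
    have e2: "\<forall>\<^sub>F n in sequentially. measure M (E2 n) < t"
      unfolding E2_def using lind(3)[OF t(1) t(1)] t by (intro order_tendstoD) auto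
    \<comment> \<open>The price of dropping the increments up to time \<open>N\<close>; it is
      bounded by \<open>2\<close> and tends to zero pathwise.\<close>
    define r where "r n \<omega> = cmod (iexp ((\<Sum>k=1..N. Y k \<omega>) / s n) - 1)" for n \<omega>
    have rm: "(\<lambda>\<omega>. r n \<omega>) \<in> borel_measurable M" for n
    proof -
      have [measurable]: "(\<lambda>\<omega>. \<Sum>k=1..N. Y k \<omega>) \<in> borel_measurable M" by (intro borel_measurable_sum Ym) auto
      show ?thesis unfolding r_def by measurable
    qed
    have r2: "r n \<omega> \<le> 2" for n \<omega>
      unfolding r_def by (rule order_trans[OF norm_triangle_ineq4]) simp
    have "(\<lambda>n. \<integral>\<omega>. r n \<omega> \<partial>M) \<longlonglongrightarrow> (\<integral>\<omega>. 0 \<partial>M)"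
    proof (rule integral_dominated_convergence[where w = "\<lambda>_. 2"])
      show "AE \<omega> in M. (\<lambda>n. r n \<omega>) \<longlonglongrightarrow> 0"
      proof (rule AE_I2)
        fix \<omega>
        have "(\<lambda>n. (\<Sum>k=1..N. Y k \<omega>) / s n) \<longlonglongrightarrow> 0"
          by (intro tendsto_divide_0[OF tendsto_const] filterlim_at_top_imp_at_infinity s(3))
        then have "(\<lambda>n. r n \<omega>) \<longlonglongrightarrow> cmod (iexp 0 - 1)"
          unfolding r_def by (intro tendsto_intros) auto
        then show "(\<lambda>n. r n \<omega>) \<longlonglongrightarrow> 0" by simp
      qed
      show "AE \<omega> in M. norm (r n \<omega>) \<le> 2" for n using r2 by (auto simp: r_def)
    qed (use rm in auto)
    then have "\<forall>\<^sub>F n in sequentially. (\<integral>\<omega>. r n \<omega> \<partial>M) < t" using t by (intro order_tendstoD) auto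
    with e1 e2 eventually_ge_at_top[of N] eventually_ge_at_top[of 1]
    have "\<forall>\<^sub>F n in sequentially. cmod (\<phi> n * exp (\<sigma>2 / 2) - measure M A) \<le> K * t"
    proof eventually_elim
      case (elim n)
      note sn = s(1)[OF elim(4)]
      have EE: "measure M (E n) \<le> 2 * t"
      proof -
        have "E n \<subseteq> E1 n \<union> E2 n"
        proof
          fix \<omega> assume w: "\<omega> \<in> E n"
          have "(\<Sum>k\<in>{N<..n}. l t n k \<omega> / (s n)\<^sup>2) \<le> (\<Sum>k=1..n. l t n k \<omega> / (s n)\<^sup>2)"
            using lind(2) by (intro sum_mono2) auto
          also have "\<dots> = (\<Sum>k=1..n. l t n k \<omega>) / (s n)\<^sup>2" by (simp add: sum_divide_distrib)
          finally show "\<omega> \<in> E1 n \<union> E2 n" using w sets.sets_into_space[OF A(1)] by (auto simp: E_def E1_def E2_def)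
        qed
        then have "measure M (E n) \<le> measure M (E1 n \<union> E2 n)" using E1m E2m[OF elim(4)] by (intro finite_measure_mono) auto
        also have "\<dots> \<le> measure M (E1 n) + measure M (E2 n)" using E1m E2m[OF elim(4)] by (intro measure_Un_le) auto
        finally show ?thesis using elim by simp
      qed
      define \<psi> where "\<psi> = (\<integral>\<omega>. indicator A \<omega> * iexp (\<Sum>k\<in>{N<..n}. Y k \<omega> / s n) \<partial>M)"
      have "cmod (\<psi> * exp (\<sigma>2 / 2) - measure M A)
        \<le> exp ((\<sigma>2 + 1) / 2) * (t * (\<sigma>2 + 1) + t + t * (\<sigma>2 + 1) + 2 * measure M (sym_diff A B) + 2 * measure M (E n) + t)"
        unfolding \<psi>_def
      proof (rule truncated_characteristic_bound[where F = F and v = "\<lambda>k \<omega>. y k \<omega> / (s n)\<^sup>2" and l = "\<lambda>k \<omega>. l t n k \<omega> / (s n)\<^sup>2" and \<epsilon> = t,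
            OF M F A(1) B(1) elim(3)])
        fix k assume "N < k" "k \<le> n"
        then have k: "k \<ge> 1" by auto
        show "(\<lambda>\<omega>. Y k \<omega> / s n) \<in> borel_measurable (F k)" using Y(1)[OF k] by measurable
        have cb: "cond_exp_version M (F (k - 1)) (\<lambda>\<omega>. X \<omega> / c) (\<lambda>\<omega>. X' \<omega> / c)" if "cond_exp_version M (F (k - 1)) X X'" for X X' c
          using cond_exp_version_mult_bounded[OF M F(1) that, of "\<lambda>_. 1 / c" "\<bar>1 / c\<bar>"] by simp
        show "cond_exp_version M (F (k - 1)) (\<lambda>\<omega>. Y k \<omega> / s n) (\<lambda>_. 0)" using cb[OF Y(2)[OF k]] by simp
        show "cond_exp_version M (F (k - 1)) (\<lambda>\<omega>. (Y k \<omega> / s n)\<^sup>2) (\<lambda>\<omega>. y k \<omega> / (s n)\<^sup>2)"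
          using cb[OF var(1)[OF k]] by (simp add: power_divide)
        have "(Y k \<omega> / s n)\<^sup>2 * indicator {\<omega>. t < \<bar>Y k \<omega> / s n\<bar>} \<omega> = (Y k \<omega>)\<^sup>2 * indicator {\<omega>. \<bar>Y k \<omega>\<bar> > t * s n} \<omega> / (s n)\<^sup>2" for \<omega>
          using sn by (simp add: indicator_def power_divide field_simps)
        then show "cond_exp_version M (F (k - 1)) (\<lambda>\<omega>. (Y k \<omega> / s n)\<^sup>2 * indicator {\<omega>. t < \<bar>Y k \<omega> / s n\<bar>} \<omega>) (\<lambda>\<omega>. l t n k \<omega> / (s n)\<^sup>2)"
          using cb[OF lind(1)[OF t(1) elim(4) k]] by simp
      qed (use var(2) lind(2) t \<sigma>2 in \<open>auto simp: E_def\<close>)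
      also have "\<dots> \<le> exp ((\<sigma>2 + 1) / 2) * (t * (\<sigma>2 + 1) + t + t * (\<sigma>2 + 1) + 2 * t + 2 * (2 * t) + t)"
        using B(2) EE t \<sigma>2 by (intro mult_left_mono add_mono order_refl) auto
      also have "\<dots> = exp ((\<sigma>2 + 1) / 2) * (2 * (\<sigma>2 + 1) + 8) * t" by (simp add: algebra_simps)
      finally have p1: "cmod (\<psi> * exp (\<sigma>2 / 2) - measure M A) \<le> exp ((\<sigma>2 + 1) / 2) * (2 * (\<sigma>2 + 1) + 8) * t" .
      have bint: "integrable M (\<lambda>\<omega>. indicator A \<omega> * iexp (X \<omega>))" if [measurable]: "X \<in> borel_measurable M" for X :: "'a \<Rightarrow> real"
        by (rule integrable_const_bound[of _ 1]) (auto simp: norm_mult indicator_def)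
      have Xm: "(\<lambda>\<omega>. (\<Sum>k=1..n. Y k \<omega>) / s n) \<in> borel_measurable M" "(\<lambda>\<omega>. \<Sum>k\<in>{N<..n}. Y k \<omega> / s n) \<in> borel_measurable M"
        by (intro borel_measurable_divide borel_measurable_sum borel_measurable_const Ym; simp)+
      have "cmod (\<phi> n - \<psi>) \<le> (\<integral>\<omega>. r n \<omega> \<partial>M)"
        unfolding \<phi>_def \<psi>_def Bochner_Integration.integral_diff[OF bint[OF Xm(1)] bint[OF Xm(2)], symmetric]
      proof (rule order_trans[OF integral_norm_bound integral_mono[OF integrable_norm[OF Bochner_Integration.integrable_diff[OF bint[OF Xm(1)] bint[OF Xm(2)]]]]])
        show "integrable M (\<lambda>\<omega>. r n \<omega>)"
          using rm r2 by (intro integrable_const_bound[of _ 2]) (auto simp: r_def)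
        fix \<omega>
        have "{1..n} = {1..N} \<union> {N<..n}" using elim by auto
        then have "(\<Sum>k=1..n. Y k \<omega>) = (\<Sum>k=1..N. Y k \<omega>) + (\<Sum>k\<in>{N<..n}. Y k \<omega>)"
          by (simp only:) (subst sum.union_disjoint, auto)
        then have e: "(\<Sum>k=1..n. Y k \<omega>) / s n = (\<Sum>k=1..N. Y k \<omega>) / s n + (\<Sum>k\<in>{N<..n}. Y k \<omega> / s n)"
          by (simp add: add_divide_distrib sum_divide_distrib)
        have "indicator A \<omega> * iexp ((\<Sum>k=1..n. Y k \<omega>) / s n) - indicator A \<omega> * iexp (\<Sum>k\<in>{N<..n}. Y k \<omega> / s n)
          = indicator A \<omega> * (iexp (\<Sum>k\<in>{N<..n}. Y k \<omega> / s n) * (iexp ((\<Sum>k=1..N. Y k \<omega>) / s n) - 1))"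
          unfolding e by (simp only: of_real_add distrib_left exp_add) (simp add: algebra_simps)
        then show "cmod (indicator A \<omega> * iexp ((\<Sum>k=1..n. Y k \<omega>) / s n) - indicator A \<omega> * iexp (\<Sum>k\<in>{N<..n}. Y k \<omega> / s n)) \<le> r n \<omega>"
          by (simp only: norm_mult norm_exp_i_times r_def) (auto simp: indicator_def)
      qed
      then have p2: "cmod (\<phi> n - \<psi>) \<le> t" using elim by simp
      have "\<phi> n * exp (\<sigma>2 / 2) - measure M A = (\<phi> n - \<psi>) * exp (\<sigma>2 / 2) + (\<psi> * exp (\<sigma>2 / 2) - measure M A)"
        by (simp add: algebra_simps)
      then have "cmod (\<phi> n * exp (\<sigma>2 / 2) - measure M A) \<le> cmod ((\<phi> n - \<psi>) * exp (\<sigma>2 / 2)) + cmod (\<psi> * exp (\<sigma>2 / 2) - measure M A)"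
        by (simp only: norm_triangle_ineq)
      also have "cmod ((\<phi> n - \<psi>) * exp (\<sigma>2 / 2)) = cmod (\<phi> n - \<psi>) * exp (\<sigma>2 / 2)"
        by (simp only: norm_mult norm_of_real) simp
      also have "\<dots> \<le> t * exp ((\<sigma>2 + 1) / 2)" using p2 t by (intro mult_mono) auto
      finally show ?case using p1 unfolding K by (simp add: algebra_simps)
    qed
    then show ?thesis by (simp add: eventually_sequentially)
  qed
  define K where "K = exp ((\<sigma>2 + 1) / 2) * (2 * (\<sigma>2 + 1) + 9)"
  have K: "K > 0" unfolding K_def using \<sigma>2 by (intro mult_pos_pos) auto
  have "(\<lambda>n. \<phi> n * exp (\<sigma>2 / 2)) \<longlonglongrightarrow> measure M A"
  proof (rule LIMSEQ_I)
    fix e :: real assume e: "e > 0"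
    define t where "t = min 1 (e / (2 * K))"
    have t: "0 < t" "t \<le> 1" "K * t < e"
    proof -
      show "0 < t" "t \<le> 1" using e K by (auto simp: t_def)
      have "K * t \<le> K * (e / (2 * K))" using K by (intro mult_left_mono) (auto simp: t_def)
      also have "\<dots> < e" using K e by simp
      finally show "K * t < e" .
    qed
    show "\<exists>n0. \<forall>n\<ge>n0. norm (\<phi> n * exp (\<sigma>2 / 2) - measure M A) < e"
      using main[OF t(1,2) K_def] t(3) by (meson le_less_trans)
  qed
  then have "(\<lambda>n. \<phi> n * exp (\<sigma>2 / 2) * of_real (exp (- \<sigma>2 / 2))) \<longlonglongrightarrow> of_real (measure M A) * of_real (exp (- \<sigma>2 / 2))"
    by (intro tendsto_intros)
  moreover have "complex_of_real (exp (\<sigma>2 / 2)) * of_real (exp (- \<sigma>2 / 2)) = 1"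
    by (simp only: of_real_mult[symmetric] exp_add[symmetric]) simp
  ultimately show ?thesis by (simp add: \<phi>_def mult.assoc)
qed

text \<open>A Lenglart inequality: switch the increments off, predictably, once the summed
  conditional variances exceed \<open>\<kappa>\<close>, and apply Chebyshev's inequality to the
  stopped sum, whose second moment is at most \<open>\<kappa>\<close>. Thus \<open>v\<close> need
  only be controlled on \<open>A\<close>.\<close>

lemma martingale_tail_bound:
  fixes n :: nat and F :: "nat \<Rightarrow> 'a measure" and \<xi> v :: "nat \<Rightarrow> 'a \<Rightarrow> real"
  assumes M: "prob_space M" and F: "\<And>n. subalgebra M (F n)" "\<And>m n. m \<le> n \<Longrightarrow> sets (F m) \<subseteq> sets (F n)"
    and A: "A \<in> sets M"
    and \<xi>: "\<And>k. N < k \<Longrightarrow> k \<le> n \<Longrightarrow> \<xi> k \<in> borel_measurable (F k)"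
      "\<And>k. N < k \<Longrightarrow> k \<le> n \<Longrightarrow> cond_exp_version M (F (k - 1)) (\<xi> k) (\<lambda>_. 0)"
    and var: "\<And>k. N < k \<Longrightarrow> k \<le> n \<Longrightarrow> cond_exp_version M (F (k - 1)) (\<lambda>\<omega>. (\<xi> k \<omega>)\<^sup>2) (v k)"
    and v: "\<And>k \<omega>. 0 \<le> v k \<omega>" and a: "a > 0" and \<kappa>: "0 \<le> \<kappa>"
  shows "measure M (A \<inter> {\<omega>\<in>space M. \<bar>\<Sum>k\<in>{N<..n}. \<xi> k \<omega>\<bar> > a})
    \<le> measure M (A \<inter> {\<omega>\<in>space M. (\<Sum>k\<in>{N<..n}. v k \<omega>) > \<kappa>}) + \<kappa> / a\<^sup>2"
proof -
  interpret prob_space M by fact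
  define P where "P k \<omega> \<longleftrightarrow> (\<Sum>j\<in>{N<..k}. v j \<omega>) \<le> \<kappa>" for k \<omega>
  define I where "I k \<omega> = (of_bool (P k \<omega>) :: real)" for k \<omega>
  have Pmono: "P j \<omega>" if "j \<le> k" "P k \<omega>" for j k \<omega>
  proof -
    have "(\<Sum>j\<in>{N<..j}. v j \<omega>) \<le> (\<Sum>j\<in>{N<..k}. v j \<omega>)" using that v by (auto intro!: sum_mono2)
    then show ?thesis using that by (auto simp: P_def)
  qed
  have meas: "X \<in> borel_measurable (F m)" if "k \<le> m" "X \<in> borel_measurable (F k)" for X :: "'a \<Rightarrow> real" and k m
    using that F measurable_mono[of borel borel "F k" "F m"] by (auto simp: subalgebra_def)
  have vm: "v k \<in> borel_measurable (F (k - 1))" if "N < k" "k \<le> n" for k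
    using var[OF that] by (auto simp: cond_exp_version_def)
  have Im: "I k \<in> borel_measurable (F (k - 1))" if "N < k" "k \<le> n" for k
  proof -
    have *: "v j \<in> borel_measurable (F (k - 1))" if "j \<in> {N<..k}" for j
      using that \<open>k \<le> n\<close> by (auto intro!: meas[OF _ vm])
    note [measurable] = borel_measurable_sum[of "{N<..k}" v, OF *]
    show ?thesis unfolding I_def P_def by measurable
  qed
  have I01: "\<bar>I k \<omega>\<bar> \<le> 1" "0 \<le> I k \<omega>" "(I k \<omega>)\<^sup>2 = I k \<omega>" for k \<omega> by (auto simp: I_def)
  define \<xi>' v' where "\<xi>' k \<omega> = I k \<omega> * \<xi> k \<omega>" and "v' k \<omega> = I k \<omega> * v k \<omega>" for k \<omega>
  have \<xi>'F: "\<xi>' k \<in> borel_measurable (F k)" and \<xi>'0: "cond_exp_version M (F (k - 1)) (\<xi>' k) (\<lambda>_. 0)"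
    and \<xi>'v: "cond_exp_version M (F (k - 1)) (\<lambda>\<omega>. (\<xi>' k \<omega>)\<^sup>2) (v' k)" if k: "N < k" "k \<le> n" for k
  proof -
    show "\<xi>' k \<in> borel_measurable (F k)"
      unfolding \<xi>'_def using meas[of "k - 1" k, OF _ Im[OF k]] \<xi>(1)[OF k] by measurable
    show "cond_exp_version M (F (k - 1)) (\<xi>' k) (\<lambda>_. 0)"
      using cond_exp_version_mult_bounded[OF M F(1) \<xi>(2)[OF k] Im[OF k] I01(1)] by (simp add: \<xi>'_def[abs_def])
    show "cond_exp_version M (F (k - 1)) (\<lambda>\<omega>. (\<xi>' k \<omega>)\<^sup>2) (v' k)"
      using cond_exp_version_mult_bounded[OF M F(1) var[OF k] Im[OF k] I01(1)] by (simp add: \<xi>'_def[abs_def] v'_def[abs_def] power_mult_distrib I01(3))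
  qed
  define S' where "S' m \<omega> = (\<Sum>k\<in>{N<..m}. \<xi>' k \<omega>)" for m \<omega>
  have S'F: "S' m \<in> borel_measurable (F m)" if "m \<le> n" for m
    unfolding S'_def using that by (intro borel_measurable_sum meas[OF _ \<xi>'F]) auto
  have S'M: "S' m \<in> borel_measurable M" if "m \<le> n" for m
    using measurable_from_subalg[OF F(1) S'F[OF that]] .
  have v'int: "integrable M (v' k)" if "N < k" "k \<le> n" for k
    using cond_exp_version_integrable(2)[OF M F(1) \<xi>'v[OF that]] .
  \<comment> \<open>Orthogonality of the stopped increments: each new one has conditional mean zero
    and is tested against the past sum, which is square integrable.\<close>
  have second: "integrable M (\<lambda>\<omega>. (S' m \<omega>)\<^sup>2) \<and> (\<integral>\<omega>. (S' m \<omega>)\<^sup>2 \<partial>M) = (\<Sum>k\<in>{N<..m}. \<integral>\<omega>. v' k \<omega> \<partial>M)"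
    if "m \<le> n" for m
    using that
  proof (induction m)
    case 0
    show ?case by (simp add: S'_def)
  next
    case (Suc m)
    show ?case
    proof (cases "N < Suc m")
      case False
      then have "{N<..Suc m} = {}" by auto
      then show ?thesis by (simp add: S'_def)
    next
      case True
      then have ins: "{N<..Suc m} = insert (Suc m) {N<..m}" by auto
      then have S: "S' (Suc m) \<omega> = \<xi>' (Suc m) \<omega> + S' m \<omega>" for \<omega> by (simp add: S'_def)
      have IH: "integrable M (\<lambda>\<omega>. (S' m \<omega>)\<^sup>2)" "(\<integral>\<omega>. (S' m \<omega>)\<^sup>2 \<partial>M) = (\<Sum>k\<in>{N<..m}. \<integral>\<omega>. v' k \<omega> \<partial>M)"
        using Suc by auto
      note vv = \<xi>'v[OF True Suc.prems] and zz = \<xi>'0[OF True Suc.prems]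
      note i = cond_exp_version_integrable[OF M F(1) vv]
      have cross: "integrable M (\<lambda>\<omega>. S' m \<omega> * \<xi>' (Suc m) \<omega>)"
      proof (rule Bochner_Integration.integrable_bound)
        show "integrable M (\<lambda>\<omega>. (S' m \<omega>)\<^sup>2 + (\<xi>' (Suc m) \<omega>)\<^sup>2)" using IH(1) i(1) by simp
        show "(\<lambda>\<omega>. S' m \<omega> * \<xi>' (Suc m) \<omega>) \<in> borel_measurable M"
          by (intro borel_measurable_times S'M cond_exp_version_integrable(6)[OF M F(1) zz]) (use Suc.prems in simp)
        have "\<bar>x * y\<bar> \<le> x\<^sup>2 + y\<^sup>2" for x y :: real
        proof -
          have "2 * \<bar>x * y\<bar> \<le> x\<^sup>2 + y\<^sup>2"
            using sum_squares_bound[of "\<bar>x\<bar>" "\<bar>y\<bar>"] by (simp add: abs_mult mult.assoc)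
          then show ?thesis using abs_ge_zero[of "x * y"] by linarith
        qed
        then show "AE \<omega> in M. norm (S' m \<omega> * \<xi>' (Suc m) \<omega>) \<le> norm ((S' m \<omega>)\<^sup>2 + (\<xi>' (Suc m) \<omega>)\<^sup>2)" by simp
      qed
      have "(\<integral>\<omega>. S' m \<omega> * \<xi>' (Suc m) \<omega> \<partial>M) = (\<integral>\<omega>. S' m \<omega> * 0 \<partial>M)"
        using cond_exp_version_test(2)[OF M F(1) zz, of "S' m"] S'F[of m] Suc.prems cross by simp
      then have z: "(\<integral>\<omega>. S' m \<omega> * \<xi>' (Suc m) \<omega> \<partial>M) = 0" by simp
      have sq: "(S' (Suc m) \<omega>)\<^sup>2 = (\<xi>' (Suc m) \<omega>)\<^sup>2 + (S' m \<omega>)\<^sup>2 + 2 * (S' m \<omega> * \<xi>' (Suc m) \<omega>)" for \<omega>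
        by (simp add: S power2_eq_square algebra_simps)
      show ?thesis unfolding sq ins using IH i(1,3) cross z by simp
    qed
  qed
  have v'le: "(\<Sum>k\<in>{N<..n}. v' k \<omega>) \<le> \<kappa>" for \<omega>
    unfolding v'_def I_def using v \<kappa> by (intro truncated_sum_le) (auto intro: Pmono, simp add: P_def)
  have ES: "(\<integral>\<omega>. (S' n \<omega>)\<^sup>2 \<partial>M) \<le> \<kappa>"
  proof -
    have "(\<integral>\<omega>. (S' n \<omega>)\<^sup>2 \<partial>M) = (\<integral>\<omega>. (\<Sum>k\<in>{N<..n}. v' k \<omega>) \<partial>M)"
      using second[of n] v'int by (subst Bochner_Integration.integral_sum) auto
    also have "\<dots> \<le> (\<integral>\<omega>. \<kappa> \<partial>M)" using v'int v'le by (intro integral_mono) auto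
    finally show ?thesis by (simp add: prob_space)
  qed
  have [measurable]: "\<xi> k \<in> borel_measurable M" "v k \<in> borel_measurable M" if "k \<in> {N<..n}" for k
    using that measurable_from_subalg[OF F(1) \<xi>(1)] measurable_from_subalg[OF F(1) vm(1)] by auto
  note [measurable] = A S'M[of n]
  have "A \<inter> {\<omega>\<in>space M. \<bar>\<Sum>k\<in>{N<..n}. \<xi> k \<omega>\<bar> > a}
      \<subseteq> (A \<inter> {\<omega>\<in>space M. (\<Sum>k\<in>{N<..n}. v k \<omega>) > \<kappa>}) \<union> {\<omega>\<in>space M. (S' n \<omega>)\<^sup>2 \<ge> a\<^sup>2}"
  proof
    fix \<omega> assume w: "\<omega> \<in> A \<inter> {\<omega>\<in>space M. \<bar>\<Sum>k\<in>{N<..n}. \<xi> k \<omega>\<bar> > a}"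
    show "\<omega> \<in> (A \<inter> {\<omega>\<in>space M. (\<Sum>k\<in>{N<..n}. v k \<omega>) > \<kappa>}) \<union> {\<omega>\<in>space M. (S' n \<omega>)\<^sup>2 \<ge> a\<^sup>2}"
    proof (cases "(\<Sum>k\<in>{N<..n}. v k \<omega>) > \<kappa>")
      case False
      then have "P n \<omega>" by (simp add: P_def)
      then have "I k \<omega> = 1" if "k \<le> n" for k using Pmono that by (auto simp: I_def)
      then have "S' n \<omega> = (\<Sum>k\<in>{N<..n}. \<xi> k \<omega>)" by (auto simp: S'_def \<xi>'_def intro!: sum.cong)
      then have "a \<le> \<bar>S' n \<omega>\<bar>" using w by auto
      then have "a\<^sup>2 \<le> (S' n \<omega>)\<^sup>2" using a by (metis abs_le_square_iff abs_of_pos)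
      then show ?thesis using w by auto
    qed (use w in auto)
  qed
  then have "measure M (A \<inter> {\<omega>\<in>space M. \<bar>\<Sum>k\<in>{N<..n}. \<xi> k \<omega>\<bar> > a})
      \<le> measure M ((A \<inter> {\<omega>\<in>space M. (\<Sum>k\<in>{N<..n}. v k \<omega>) > \<kappa>}) \<union> {\<omega>\<in>space M. (S' n \<omega>)\<^sup>2 \<ge> a\<^sup>2})"
    by (intro finite_measure_mono) measurable
  also have "\<dots> \<le> measure M (A \<inter> {\<omega>\<in>space M. (\<Sum>k\<in>{N<..n}. v k \<omega>) > \<kappa>}) + measure M {\<omega>\<in>space M. (S' n \<omega>)\<^sup>2 \<ge> a\<^sup>2}"
    by (intro measure_Un_le) measurable
  also have "measure M {\<omega>\<in>space M. (S' n \<omega>)\<^sup>2 \<ge> a\<^sup>2} \<le> (\<integral>\<omega>. (S' n \<omega>)\<^sup>2 \<partial>M) / a\<^sup>2"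
    using second[of n] a by (intro integral_Markov_inequality_measure[where A = "{}"]) auto
  also have "(\<integral>\<omega>. (S' n \<omega>)\<^sup>2 \<partial>M) / a\<^sup>2 \<le> \<kappa> / a\<^sup>2" using ES by (intro divide_right_mono) auto
  finally show ?thesis by simp
qed

text \<open>The approximable events form a sigma-algebra. For a countable union, finitely many
  members carry all but \<open>e / 2\<close> of its probability, and each of these is approximated
  within its share of the other half.\<close>

lemma event_approximation:
  fixes F :: "nat \<Rightarrow> 'a measure"
  assumes M: "prob_space M" and F: "\<And>n. subalgebra M (F n)" "\<And>m n. m \<le> n \<Longrightarrow> sets (F m) \<subseteq> sets (F n)"
    and A: "A \<in> sigma_sets (space M) (\<Union>n. sets (F n))" and e: "e > 0"
  shows "\<exists>N. \<exists>B\<in>sets (F N). measure M (sym_diff A B) < e"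
proof -
  interpret prob_space M by fact
  have FM: "B \<in> sets M" if "B \<in> sets (F N)" for B N using that F(1)[of N] by (auto simp: subalgebra_def)
  have sub: "sigma_sets (space M) (\<Union>n. sets (F n)) \<subseteq> sets M"
    using FM by (intro sets.sigma_sets_subset) auto
  show ?thesis using A e
  proof (induction arbitrary: e rule: sigma_sets.induct)
    case (Basic a)
    then obtain n where "a \<in> sets (F n)" by auto
    then show ?case using Basic by (intro exI[of _ n] bexI[of _ a]) auto
  next
    case Empty
    then show ?case by (intro exI[of _ 0] bexI[of _ "{}"]) auto
  next
    case (Compl a)
    then obtain N B where B: "B \<in> sets (F N)" "measure M (sym_diff a B) < e" by blast
    have "sym_diff (space M - a) (space M - B) = sym_diff a B"
      using sets.sets_into_space[OF FM[OF B(1)]] sub Compl(1) sets.sets_into_space[of a M] by auto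
    moreover have "space M - B \<in> sets (F N)"
      using B F(1)[of N] sets.compl_sets[of B "F N"] by (simp add: subalgebra_def)
    ultimately show ?case using B by (intro exI[of _ N] bexI[of _ "space M - B"]) auto
  next
    case (Union a)
    have am: "a i \<in> sets M" for i using Union sub by auto
    define U where "U m = (\<Union>i<m. a i)" for m
    have "(\<lambda>m. measure M (U m)) \<longlonglongrightarrow> measure M (\<Union>m. U m)"
    proof (rule finite_Lim_measure_incseq)
      show "range U \<subseteq> sets M" using am by (auto simp: U_def)
      show "incseq U" unfolding U_def by (intro monoI UN_mono) auto
    qed
    moreover have "(\<Union>m. U m) = (\<Union>i. a i)" by (auto simp: U_def)
    ultimately have "\<forall>\<^sub>F m in sequentially. measure M (\<Union>i. a i) - e / 2 < measure M (U m)"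
      using Union(3) by (intro order_tendstoD) auto
    then obtain m where m: "measure M (\<Union>i. a i) - e / 2 < measure M (U m)" by (auto simp: eventually_sequentially)
    have "\<exists>N. \<exists>B\<in>sets (F N). measure M (sym_diff (a i) B) < e / (2 * (real m + 1))" for i
      using Union(2)[of "e / (2 * (real m + 1))" i] Union(3) by simp
    then obtain N B where B: "\<And>i. B i \<in> sets (F (N i))" "\<And>i. measure M (sym_diff (a i) (B i)) < e / (2 * (real m + 1))" by metis
    \<comment> \<open>Any common upper bound of the levels \<open>N i\<close> will do; the sum is a
      convenient one.\<close>
    define K where "K = (\<Sum>i<m. N i)"
    have NK: "N i \<le> K" if "i < m" for i unfolding K_def using that by (intro member_le_sum) auto
    define C where "C = (\<Union>i<m. B i)"
    have C: "C \<in> sets (F K)" unfolding C_def using B(1) F(2)[OF NK] by auto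
    have Bm: "B i \<in> sets M" for i using B(1) FM by auto
    have "sym_diff (\<Union>i. a i) C \<subseteq> ((\<Union>i. a i) - U m) \<union> (\<Union>i<m. sym_diff (a i) (B i))"
      by (auto simp: U_def C_def)
    then have "measure M (sym_diff (\<Union>i. a i) C) \<le> measure M (((\<Union>i. a i) - U m) \<union> (\<Union>i<m. sym_diff (a i) (B i)))"
      using am Bm by (intro finite_measure_mono) (auto simp: U_def)
    also have "\<dots> \<le> measure M ((\<Union>i. a i) - U m) + measure M (\<Union>i<m. sym_diff (a i) (B i))"
      using am Bm by (intro measure_Un_le) (auto simp: U_def)
    also have "measure M ((\<Union>i. a i) - U m) = measure M (\<Union>i. a i) - measure M (U m)"
      using am by (intro finite_measure_Diff) (auto simp: U_def)
    also have "measure M (\<Union>i<m. sym_diff (a i) (B i)) \<le> (\<Sum>i<m. measure M (sym_diff (a i) (B i)))"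
      using am Bm by (intro measure_UNION_le) auto
    also have "\<dots> \<le> (\<Sum>i<m. e / (2 * (real m + 1)))" using B(2) by (intro sum_mono less_imp_le) auto
    also have "\<dots> \<le> e / 2" using Union(3) by (simp add: field_simps)
    finally have "measure M (sym_diff (\<Union>i. a i) C) < e" using m by simp
    then show ?case using C by blast
  qed
qed

lemma convergence_event_sets:
  fixes X :: "nat \<Rightarrow> 'a \<Rightarrow> 'b :: {metric_space, second_countable_topology}"
  assumes [measurable]: "\<And>n. X n \<in> borel_measurable G"
  shows "{\<omega>\<in>space G. (\<lambda>n. X n \<omega>) \<longlonglongrightarrow> c} \<in> sets G"
proof -
  have "(\<lambda>n. X n \<omega>) \<longlonglongrightarrow> c \<longleftrightarrow> (\<forall>k. \<exists>N. \<forall>n\<ge>N. dist (X n \<omega>) c < 1 / real (Suc k))" for \<omega>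
  proof
    assume L: "(\<lambda>n. X n \<omega>) \<longlonglongrightarrow> c"
    show "\<forall>k. \<exists>N. \<forall>n\<ge>N. dist (X n \<omega>) c < 1 / real (Suc k)"
    proof
      fix k
      have "0 < 1 / real (Suc k)" by simp
      from metric_LIMSEQ_D[OF L this] show "\<exists>N. \<forall>n\<ge>N. dist (X n \<omega>) c < 1 / real (Suc k)" .
    qed
  next
    assume R: "\<forall>k. \<exists>N. \<forall>n\<ge>N. dist (X n \<omega>) c < 1 / real (Suc k)"
    show "(\<lambda>n. X n \<omega>) \<longlonglongrightarrow> c"
    proof (rule metric_LIMSEQ_I)
      fix r :: real assume "r > 0"
      then obtain k where "1 / real (Suc k) < r" using nat_approx_posE by blast
      with R show "\<exists>N. \<forall>n\<ge>N. dist (X n \<omega>) c < r" by (meson less_trans)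
    qed
  qed
  then have "{\<omega>\<in>space G. (\<lambda>n. X n \<omega>) \<longlonglongrightarrow> c} = {\<omega>\<in>space G. \<forall>k. \<exists>N. \<forall>n\<ge>N. dist (X n \<omega>) c < 1 / real (Suc k)}"
    by auto
  also have "\<dots> \<in> sets G" by measurable
  finally show ?thesis .
qed

text \<open>Convergence of an adapted process is an event of the sigma-algebra generated by all
  \<open>F n\<close>, since each \<open>X n\<close> is measurable with respect to it.\<close>

lemma convergence_event_approximation:
  fixes F :: "nat \<Rightarrow> 'a measure" and X :: "nat \<Rightarrow> 'a \<Rightarrow> 'b :: {metric_space, second_countable_topology}"
  assumes M: "prob_space M" and F: "\<And>n. subalgebra M (F n)" "\<And>m n. m \<le> n \<Longrightarrow> sets (F m) \<subseteq> sets (F n)"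
    and X: "\<And>n. X n \<in> borel_measurable (F n)" and e: "e > 0"
  shows "\<exists>N. \<exists>B\<in>sets (F N). measure M (sym_diff {\<omega>\<in>space M. (\<lambda>n. X n \<omega>) \<longlonglongrightarrow> c} B) < e"
proof (rule event_approximation[OF M F _ e])
  have sub: "(\<Union>n. sets (F n)) \<subseteq> Pow (space M)"
    using F(1) sets.sets_into_space unfolding subalgebra_def by fastforce
  define G where "G = sigma (space M) (\<Union>n. sets (F n))"
  have G: "space G = space M" "sets G = sigma_sets (space M) (\<Union>n. sets (F n))"
    using sub by (auto simp: G_def)
  have "X n \<in> borel_measurable G" for n
  proof -
    have "sets (F n) \<subseteq> sets G" unfolding G by auto
    then show ?thesis using X[of n] F(1)[of n] measurable_mono[of borel borel "F n" G] by (auto simp: G subalgebra_def)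
  qed
  from convergence_event_sets[of X, OF this, of c] show "{\<omega>\<in>space M. (\<lambda>n. X n \<omega>) \<longlonglongrightarrow> c} \<in> sigma_sets (space M) (\<Union>n. sets (F n))"
    by (simp add: G)
qed

section \<open>Convergence in law from characteristic functions\<close>

text \<open>Real trigonometric polynomials with arbitrary frequencies; \<open>u = 0\<close> gives
  the constants. These are the test functions whose integrals are linear combinations of real and
  imaginary parts of characteristic functions, and the addition formulas make them an
  algebra.\<close>

inductive trig_function :: "('a :: real_inner \<Rightarrow> real) \<Rightarrow> bool" where
  cos: "trig_function (\<lambda>x. cos (u \<bullet> x))"
| sin: "trig_function (\<lambda>x. sin (u \<bullet> x))"
| add: "trig_function f \<Longrightarrow> trig_function g \<Longrightarrow> trig_function (\<lambda>x. f x + g x)"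
| cmult: "trig_function f \<Longrightarrow> trig_function (\<lambda>x. c * f x)"

lemma trig_function_const: "trig_function (\<lambda>x. c)"
  using trig_function.cmult[OF trig_function.cos[of 0], of c] by simp

lemma trig_function_sum: "(\<And>i. i \<in> I \<Longrightarrow> trig_function (f i)) \<Longrightarrow> trig_function (\<lambda>x. \<Sum>i\<in>I. f i x)"
  by (induction I rule: infinite_finite_induct) (auto intro: trig_function_const trig_function.add)

lemma trig_function_mult_cos: "trig_function g \<Longrightarrow> trig_function (\<lambda>x. cos (u \<bullet> x) * g x)"
proof (induction rule: trig_function.induct)
  case (cos w)
  have "cos (u \<bullet> x) * cos (w \<bullet> x) = 1 / 2 * cos ((u - w) \<bullet> x) + 1 / 2 * cos ((u + w) \<bullet> x)" for x
    by (simp add: cos_times_cos inner_diff_left inner_add_left add_divide_distrib)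
  then show ?case by (simp only:) (intro trig_function.intros)
next
  case (sin w)
  have "cos (u \<bullet> x) * sin (w \<bullet> x) = 1 / 2 * sin ((u + w) \<bullet> x) + (- 1 / 2) * sin ((u - w) \<bullet> x)" for x
    by (simp add: cos_times_sin inner_diff_left inner_add_left diff_divide_distrib)
  then show ?case by (simp only:) (intro trig_function.intros)
next
  case (add f g)
  then show ?case unfolding distrib_left by (intro trig_function.add)
next
  case (cmult f c)
  then show ?case unfolding mult.left_commute[of _ c] by (intro trig_function.cmult)
qed

lemma trig_function_mult_sin: "trig_function g \<Longrightarrow> trig_function (\<lambda>x. sin (u \<bullet> x) * g x)"
proof (induction rule: trig_function.induct)
  case (cos w)
  show ?case using trig_function_mult_cos[OF trig_function.sin[of u], of w] by (simp add: mult.commute)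
next
  case (sin w)
  have "sin (u \<bullet> x) * sin (w \<bullet> x) = 1 / 2 * cos ((u - w) \<bullet> x) + (- 1 / 2) * cos ((u + w) \<bullet> x)" for x
    by (simp add: sin_times_sin inner_diff_left inner_add_left diff_divide_distrib)
  then show ?case by (simp only:) (intro trig_function.intros)
next
  case (add f g)
  then show ?case unfolding distrib_left by (intro trig_function.add)
next
  case (cmult f c)
  then show ?case unfolding mult.left_commute[of _ c] by (intro trig_function.cmult)
qed

lemma trig_function_mult:
  assumes "trig_function f" "trig_function g"
  shows "trig_function (\<lambda>x. f x * g x)"
  using assms(1)
proof (induction rule: trig_function.induct)
  case (add f1 f2)
  then show ?case unfolding distrib_right by (intro trig_function.add)
next
  case (cmult f c)
  then show ?case unfolding mult.assoc by (intro trig_function.cmult)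
qed (use assms(2) in \<open>auto intro: trig_function_mult_cos trig_function_mult_sin\<close>)

text \<open>The cube with side \<open>2 * K\<close> embeds into the torus of period \<open>4 * K\<close>, where polynomials in the coordinates
  are trigonometric functions of \<open>x\<close>; thus Stone-Weierstrass yields approximations on the cube with a global
  bound.\<close>

definition torus_map :: "real \<Rightarrow> real ^ 'd \<Rightarrow> complex ^ 'd" where
  "torus_map K x = (\<chi> i. cis (pi / K * x $ i))"

lemma trig_function_torus_poly:
  assumes "real_polynomial_function p"
  shows "trig_function (\<lambda>x. p (torus_map K x))"
  using assms
proof (induction rule: real_polynomial_function.induct)
  case (linear f)
  interpret bounded_linear f by fact
  have "trig_function (\<lambda>x :: real ^ 'a. torus_map K x \<bullet> b)" if bB: "b \<in> Basis" for b :: "complex ^ 'a"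
  proof -
    obtain i c where b: "b = axis i c" "c \<in> Basis" using bB unfolding Basis_vec_def by blast
    have "torus_map K x \<bullet> b = cis (pi / K * x $ i) \<bullet> c" for x :: "real ^ 'a"
      by (simp add: b inner_axis torus_map_def)
    moreover have "pi / K * x $ i = axis i (pi / K) \<bullet> x" for x :: "real ^ 'a"
      by (simp add: inner_axis')
    ultimately have "torus_map K x \<bullet> b = cis (axis i (pi / K) \<bullet> x) \<bullet> c" for x :: "real ^ 'a" by simp
    then show ?thesis using b(2) by (auto simp: Basis_complex_def inner_complex_def intro: trig_function.intros)
  qed
  then have "trig_function (\<lambda>x :: real ^ 'a. \<Sum>b\<in>Basis. f b * (torus_map K x \<bullet> b))"
    by (intro trig_function_sum trig_function.cmult)
  also have "(\<lambda>x. \<Sum>b\<in>Basis. f b * (torus_map K x \<bullet> b)) = (\<lambda>x. f (torus_map K x))"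
  proof
    fix x
    have "f (torus_map K x) = f (\<Sum>b\<in>Basis. (torus_map K x \<bullet> b) *\<^sub>R b)" by (simp only: euclidean_representation)
    then show "(\<Sum>b\<in>Basis. f b * (torus_map K x \<bullet> b)) = f (torus_map K x)"
      by (simp only: sum scaleR) (simp add: mult.commute)
  qed
  finally show ?case .
qed (auto intro: trig_function_const trig_function.add trig_function_mult)

lemma trig_approximation:
  fixes g :: "real ^ 'd \<Rightarrow> real"
  assumes g: "continuous_on UNIV g" "\<And>x. \<bar>g x\<bar> \<le> G" and K: "K > 0" and e: "e > 0"
  obtains h where "trig_function h" "\<And>x. (\<And>i. \<bar>x $ i\<bar> \<le> K) \<Longrightarrow> \<bar>h x - g x\<bar> < e" "\<And>x. \<bar>h x\<bar> \<le> G + e"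
proof -
  \<comment> \<open>With parameter \<open>2 * K\<close> the angles of points of the cube lie between
    \<open>- pi / 2\<close> and \<open>pi / 2\<close>, where the sine alone already determines them;
    hence the injectivity on \<open>Q\<close>.\<close>
  define T where "T = (torus_map (2 * K) :: real ^ 'd \<Rightarrow> complex ^ 'd)"
  define Q where "Q = cbox (\<chi> i. - K) (\<chi> i :: 'd. K)"
  have Q: "x \<in> Q \<longleftrightarrow> (\<forall>i. \<bar>x $ i\<bar> \<le> K)" for x by (auto simp: Q_def mem_box_cart abs_le_iff minus_le_iff)
  have G0: "0 \<le> G" using g(2)[of 0] by linarith
  have "continuous_on Q T"
    unfolding T_def torus_map_def cis_conv_exp
    by (intro continuous_on_vec_lambda continuous_on_exp continuous_on_mult continuous_on_of_real continuous_on_const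
        bounded_linear.continuous_on[OF bounded_linear_vec_nth] continuous_on_id)
  have inj: "inj_on T Q"
  proof (rule inj_onI)
    fix x y assume xy: "x \<in> Q" "y \<in> Q" "T x = T y"
    show "x = y"
    proof (rule vec_eq_iff[THEN iffD2], rule allI)
      fix i
      let ?a = "pi / (2 * K) * x $ i" and ?b = "pi / (2 * K) * y $ i"
      have bd: "\<bar>pi / (2 * K) * z\<bar> \<le> pi / 2" if "\<bar>z\<bar> \<le> K" for z
      proof -
        have "\<bar>pi / (2 * K) * z\<bar> = pi / (2 * K) * \<bar>z\<bar>" using K by (simp add: abs_mult)
        also have "\<dots> \<le> pi / (2 * K) * K" using K that by (intro mult_left_mono) auto
        finally show ?thesis using K by simp
      qed
      have "T x $ i = T y $ i" by (simp only: xy(3))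
      then have "cis ?a = cis ?b" by (simp only: T_def torus_map_def vec_lambda_beta)
      then have "Im (cis ?a) = Im (cis ?b)" by (simp only:)
      then have "sin ?a = sin ?b" by (simp only: cis.sel)
      have a: "\<bar>?a\<bar> \<le> pi / 2" by (rule bd) (use xy(1) Q in blast)
      have b: "\<bar>?b\<bar> \<le> pi / 2" by (rule bd) (use xy(2) Q in blast)
      have "- (pi / 2) \<le> ?a" "?a \<le> pi / 2" "- (pi / 2) \<le> ?b" "?b \<le> pi / 2"
        using abs_le_D1[OF a] abs_le_D2[OF a] abs_le_D1[OF b] abs_le_D2[OF b] by linarith+
      then have ab: "?a = ?b" using \<open>sin ?a = sin ?b\<close> by (rule sin_inj_pi)
      have "pi / (2 * K) \<noteq> 0" using K by simp
      with ab show "x $ i = y $ i" by (simp only: mult_cancel_left simp_thms)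
    qed
  qed
  have cQ: "compact Q" by (simp add: Q_def)
  have cT: "compact (T ` Q)" using \<open>continuous_on Q T\<close> cQ by (rule compact_continuous_image)
  define f where "f z = g (inv_into Q T z)" for z
  have "continuous_on (T ` Q) (inv_into Q T)"
    by (rule continuous_on_inv[OF \<open>continuous_on Q T\<close> cQ]) (simp add: inj)
  then have fc: "continuous_on (T ` Q) f"
    unfolding f_def by (rule continuous_on_compose2[OF g(1)]) simp
  have fT: "f (T x) = g x" if "x \<in> Q" for x using that inj by (simp add: f_def)
  have "closedin (top_of_set UNIV) (T ` Q)" using compact_imp_closed[OF cT] by simp
  moreover have "norm (f z) \<le> G" if "z \<in> T ` Q" for z using g(2) by (simp add: f_def)
  \<comment> \<open>Tietze's theorem preserves the bound \<open>G\<close>; this is where the global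
    bound on the approximating function originates.\<close>
  ultimately obtain f' where f': "continuous_on UNIV f'" "\<And>z. z \<in> T ` Q \<Longrightarrow> f' z = f z" "\<And>z. z \<in> UNIV \<Longrightarrow> norm (f' z) \<le> G"
    using Tietze[OF fc _ G0, of UNIV] by metis
  \<comment> \<open>A ball containing the whole torus, not just the image of the cube: the radius is
    the number of coordinates, each of modulus \<open>1\<close>. Approximation on \<open>S\<close>
    therefore bounds \<open>p (T x)\<close> for all \<open>x\<close>.\<close>
  define S where "S = cball (0 :: complex ^ 'd) (real CARD('d))"
  have TS: "T x \<in> S" for x
  proof -
    have "norm (T x) \<le> (\<Sum>i\<in>UNIV. norm (T x $ i))" unfolding norm_vec_def by (rule L2_set_le_sum) auto
    then show ?thesis by (simp add: S_def T_def torus_map_def)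
  qed
  obtain p where p: "real_polynomial_function p" "\<And>z. z \<in> S \<Longrightarrow> \<bar>f' z - p z\<bar> < e"
    using Stone_Weierstrass_real_polynomial_function[of S f' e] continuous_on_subset[OF f'(1)] e by (auto simp: S_def)
  show ?thesis
  proof (rule that[of "\<lambda>x. p (T x)"])
    show "trig_function (\<lambda>x. p (T x))" unfolding T_def by (rule trig_function_torus_poly[OF p(1)])
    show "\<bar>p (T x)\<bar> \<le> G + e" for x using p(2)[OF TS[of x]] f'(3)[of "T x"] by auto
    show "\<bar>p (T x) - g x\<bar> < e" if "\<And>i. \<bar>x $ i\<bar> \<le> K" for x
    proof -
      have "x \<in> Q" using that by (simp add: Q)
      then show ?thesis using p(2)[OF TS[of x]] f'(2)[of "T x"] fT by (simp add: abs_minus_commute)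
    qed
  qed
qed

lemma trig_function_bounded: "trig_function h \<Longrightarrow> \<exists>C. \<forall>x. \<bar>h x\<bar> \<le> C"
proof (induction rule: trig_function.induct)
  case (add f g)
  then obtain C D where "\<forall>x. \<bar>f x\<bar> \<le> C" "\<forall>x. \<bar>g x\<bar> \<le> D" by blast
  then have "\<forall>x. \<bar>f x + g x\<bar> \<le> C + D" by (meson abs_triangle_ineq add_mono order_trans)
  then show ?case by blast
next
  case (cmult f c)
  then obtain C where "\<forall>x. \<bar>f x\<bar> \<le> C" by blast
  then have "\<forall>x. \<bar>c * f x\<bar> \<le> \<bar>c\<bar> * C" by (simp add: abs_mult mult_left_mono)
  then show ?case by blast
qed (auto intro!: exI[of _ 1])

lemma trig_function_measurable: "trig_function (h :: 'a :: euclidean_space \<Rightarrow> real) \<Longrightarrow> h \<in> borel_measurable borel"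
  by (induction rule: trig_function.induct) auto

text \<open>A bounded continuous \<open>g\<close> is replaced by a trigonometric \<open>h\<close>
  that is close to it on a large cube and bounded by a constant independent of the cube. Outside the
  cube, tightness on \<open>A\<close> and of \<open>\<nu>\<close> makes the error small. Working
  directly with integrals over \<open>A\<close> avoids conditional laws, also when \<open>A\<close>
  has probability zero.\<close>

lemma converges_in_law_on_of_characteristic:
  fixes X :: "nat \<Rightarrow> 'a \<Rightarrow> real ^ 'd"
  assumes M: "prob_space M" and A: "A \<in> sets M" and X: "\<And>n. n \<ge> 1 \<Longrightarrow> X n \<in> borel_measurable M"
    and \<nu>: "prob_space \<nu>" "sets \<nu> = sets borel"
    and cf: "\<And>u. (\<lambda>n. \<integral>\<omega>. indicator A \<omega> * iexp (u \<bullet> X n \<omega>) \<partial>M) \<longlonglongrightarrow> of_real (measure M A) * (\<integral>x. iexp (u \<bullet> x) \<partial>\<nu>)"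
    and tight: "\<And>e. e > 0 \<Longrightarrow> \<exists>K. \<forall>\<^sub>F n in sequentially. measure M (A \<inter> {\<omega>\<in>space M. \<exists>i. \<bar>X n \<omega> $ i\<bar> > K}) < e"
  shows "converges_in_law_on M A X \<nu>"
  unfolding converges_in_law_on_def
proof (intro allI impI)
  interpret M: prob_space M by fact
  interpret N: prob_space \<nu> by fact
  note [measurable_cong] = \<nu>(2)
  note [measurable] = A
  fix g :: "real ^ 'd \<Rightarrow> real" assume g: "continuous_on UNIV g" "bounded (range g)"
  obtain G where G: "\<And>x. \<bar>g x\<bar> \<le> G" using g(2) by (auto simp: bounded_iff)
  have G0: "0 \<le> G" using G[of 0] by linarith
  have gm [measurable]: "g \<in> borel_measurable borel" using g(1) by (rule borel_measurable_continuous_onI)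
  have intM: "integrable M (\<lambda>\<omega>. indicator A \<omega> * h (X n \<omega>))"
    if "n \<ge> 1" "\<And>x. \<bar>h x\<bar> \<le> C" and [measurable]: "h \<in> borel_measurable borel" for h :: "real ^ 'd \<Rightarrow> real" and C n
  proof (rule M.integrable_const_bound[of _ C])
    have "0 \<le> C" using that(2)[of 0] by linarith
    then show "AE \<omega> in M. norm (indicator A \<omega> * h (X n \<omega>)) \<le> C" using that(2) by (auto simp: indicator_def)
    show "(\<lambda>\<omega>. indicator A \<omega> * h (X n \<omega>)) \<in> borel_measurable M" using X[OF that(1)] by measurable
  qed
  have intN: "integrable \<nu> h"
    if "\<And>x. \<bar>h x\<bar> \<le> C" and [measurable]: "h \<in> borel_measurable borel" for h :: "real ^ 'd \<Rightarrow> real" and C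
    by (rule N.integrable_const_bound[of _ C]) (use that in auto)
  have trig: "(\<lambda>n. \<integral>\<omega>. indicator A \<omega> * h (X n \<omega>) \<partial>M) \<longlonglongrightarrow> measure M A * (\<integral>x. h x \<partial>\<nu>)"
    if "trig_function h" for h
    using that
  proof (induction rule: trig_function.induct)
    case (cos u)
    have iN: "integrable \<nu> (\<lambda>x. iexp (u \<bullet> x))" by (rule N.integrable_const_bound[of _ 1]) auto
    have iM: "integrable M (\<lambda>\<omega>. indicator A \<omega> * iexp (u \<bullet> X n \<omega>))" if "n \<ge> 1" for n
      using X[OF that] by (intro M.integrable_const_bound[of _ 1]) (auto simp: norm_mult indicator_def)
    have "\<forall>\<^sub>F n in sequentially. Re (\<integral>\<omega>. indicator A \<omega> * iexp (u \<bullet> X n \<omega>) \<partial>M) = (\<integral>\<omega>. indicator A \<omega> * cos (u \<bullet> X n \<omega>) \<partial>M)"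
      using eventually_ge_at_top[of 1]
    proof eventually_elim
      case (elim n)
      then show ?case unfolding integral_Re[OF iM[OF elim], symmetric]
        by (intro Bochner_Integration.integral_cong) (auto simp: indicator_def Re_exp)
    qed
    moreover have "Re (\<integral>x. iexp (u \<bullet> x) \<partial>\<nu>) = (\<integral>x. cos (u \<bullet> x) \<partial>\<nu>)"
      unfolding integral_Re[OF iN, symmetric] by (simp add: Re_exp)
    then have "Re (of_real (measure M A) * (\<integral>x. iexp (u \<bullet> x) \<partial>\<nu>)) = measure M A * (\<integral>x. cos (u \<bullet> x) \<partial>\<nu>)"
      by simp
    ultimately show ?case using tendsto_Re[OF cf[of u]] by (simp only: tendsto_cong)
  next
    case (sin u)
    have iN: "integrable \<nu> (\<lambda>x. iexp (u \<bullet> x))" by (rule N.integrable_const_bound[of _ 1]) auto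
    have iM: "integrable M (\<lambda>\<omega>. indicator A \<omega> * iexp (u \<bullet> X n \<omega>))" if "n \<ge> 1" for n
      using X[OF that] by (intro M.integrable_const_bound[of _ 1]) (auto simp: norm_mult indicator_def)
    have "\<forall>\<^sub>F n in sequentially. Im (\<integral>\<omega>. indicator A \<omega> * iexp (u \<bullet> X n \<omega>) \<partial>M) = (\<integral>\<omega>. indicator A \<omega> * sin (u \<bullet> X n \<omega>) \<partial>M)"
      using eventually_ge_at_top[of 1]
    proof eventually_elim
      case (elim n)
      then show ?case unfolding integral_Im[OF iM[OF elim], symmetric]
        by (intro Bochner_Integration.integral_cong) (auto simp: indicator_def Im_exp)
    qed
    moreover have "Im (\<integral>x. iexp (u \<bullet> x) \<partial>\<nu>) = (\<integral>x. sin (u \<bullet> x) \<partial>\<nu>)"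
      unfolding integral_Im[OF iN, symmetric] by (simp add: Im_exp)
    then have "Im (of_real (measure M A) * (\<integral>x. iexp (u \<bullet> x) \<partial>\<nu>)) = measure M A * (\<integral>x. sin (u \<bullet> x) \<partial>\<nu>)"
      by simp
    ultimately show ?case using tendsto_Im[OF cf[of u]] by (simp only: tendsto_cong)
  next
    case (add f h)
    obtain C D where C: "\<And>x. \<bar>f x\<bar> \<le> C" and D: "\<And>x. \<bar>h x\<bar> \<le> D"
      using trig_function_bounded add.hyps by metis
    note m = trig_function_measurable[OF add.hyps(1)] trig_function_measurable[OF add.hyps(2)]
    have "\<forall>\<^sub>F n in sequentially. (\<integral>\<omega>. indicator A \<omega> * f (X n \<omega>) \<partial>M) + (\<integral>\<omega>. indicator A \<omega> * h (X n \<omega>) \<partial>M)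
        = (\<integral>\<omega>. indicator A \<omega> * (f (X n \<omega>) + h (X n \<omega>)) \<partial>M)"
      using eventually_ge_at_top[of 1]
      by eventually_elim (subst Bochner_Integration.integral_add[symmetric], auto intro: intM[OF _ C m(1)] intM[OF _ D m(2)] simp: distrib_left)
    moreover have "measure M A * (\<integral>x. f x + h x \<partial>\<nu>) = measure M A * (\<integral>x. f x \<partial>\<nu>) + measure M A * (\<integral>x. h x \<partial>\<nu>)"
      using intN[OF C m(1)] intN[OF D m(2)] by (simp add: distrib_left)
    ultimately show ?case using tendsto_add[OF add.IH] by (simp add: tendsto_cong)
  next
    case (cmult f c)
    have "(\<integral>\<omega>. indicator A \<omega> * (c * f (X n \<omega>)) \<partial>M) = c * (\<integral>\<omega>. indicator A \<omega> * f (X n \<omega>) \<partial>M)" for n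
      by (simp add: mult.left_commute)
    then show ?case using tendsto_mult[OF tendsto_const[of c] cmult.IH] by (simp add: mult.left_commute)
  qed
  show "(\<lambda>n. \<integral>\<omega>. indicator A \<omega> * g (X n \<omega>) \<partial>M) \<longlonglongrightarrow> measure M A * (\<integral>x. g x \<partial>\<nu>)"
  proof (rule LIMSEQ_I)
    fix r :: real assume r: "r > 0"
    \<comment> \<open>The total error is \<open>3 e + 2 (2 G + 1) e\<close>: twice the replacement
      of \<open>g\<close> by \<open>h\<close>, once the convergence for \<open>h\<close>. The larger
      factor \<open>4\<close> leaves room for a strict inequality.\<close>
    define e where "e = min 1 (r / (3 + 4 * (2 * G + 1)))"
    have den: "3 + 4 * (2 * G + 1) > 0" using G0 by simp
    have e: "0 < e" "e \<le> 1" "e * (3 + 4 * (2 * G + 1)) \<le> r"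
    proof -
      show "0 < e" "e \<le> 1" using r den by (auto simp: e_def)
      have "e * (3 + 4 * (2 * G + 1)) \<le> r / (3 + 4 * (2 * G + 1)) * (3 + 4 * (2 * G + 1))"
        using den by (intro mult_right_mono) (auto simp: e_def)
      then show "e * (3 + 4 * (2 * G + 1)) \<le> r" using den by simp
    qed
    obtain K1 where K1: "\<forall>\<^sub>F n in sequentially. measure M (A \<inter> {\<omega>\<in>space M. \<exists>i. \<bar>X n \<omega> $ i\<bar> > K1}) < e"
      using tight[OF e(1)] by blast
    have "(\<lambda>k. measure \<nu> {x :: real ^ 'd. \<exists>i. \<bar>x $ i\<bar> > real k}) \<longlonglongrightarrow> 0"
    proof (rule prob_eventually_avoided[OF \<nu>(1)])
      show "{x :: real ^ 'd. \<exists>i. \<bar>x $ i\<bar> > real k} \<in> sets \<nu>" for k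
      proof -
        have "{x \<in> space borel. \<exists>i. \<bar>(x :: real ^ 'd) $ i\<bar> > real k} \<in> sets borel" by measurable
        then show ?thesis by (simp add: \<nu>(2))
      qed
      show "AE x in \<nu>. \<forall>\<^sub>F k in sequentially. x \<notin> {x :: real ^ 'd. \<exists>i. \<bar>x $ i\<bar> > real k}"
      proof (rule AE_I2)
        fix x :: "real ^ 'd"
        obtain k0 where k0: "norm x \<le> real k0" using real_arch_simple by blast
        have "\<bar>x $ i\<bar> \<le> real k" if "k \<ge> k0" for k i
          using component_le_norm_cart[of x i] k0 that by simp
        then show "\<forall>\<^sub>F k in sequentially. x \<notin> {x :: real ^ 'd. \<exists>i. \<bar>x $ i\<bar> > real k}"
          by (auto simp: eventually_sequentially not_less intro!: exI[of _ k0])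
      qed
    qed
    then have "\<forall>\<^sub>F k in sequentially. measure \<nu> {x :: real ^ 'd. \<exists>i. \<bar>x $ i\<bar> > real k} < e" using e by (intro order_tendstoD) auto
    then obtain k where k: "measure \<nu> {x :: real ^ 'd. \<exists>i. \<bar>x $ i\<bar> > real k} < e" by (auto simp: eventually_sequentially)
    \<comment> \<open>One cube large enough for both tail estimates; the added \<open>1\<close>
      guarantees that its side is positive.\<close>
    define K where "K = max (real k + 1) K1"
    have K0: "K > 0" by (simp add: K_def)
    obtain h where h: "trig_function h" "\<And>x. (\<And>i. \<bar>x $ i\<bar> \<le> K) \<Longrightarrow> \<bar>h x - g x\<bar> < e" "\<And>x. \<bar>h x\<bar> \<le> G + e"
      using trig_approximation[OF g(1) G K0 e(1)] by blast
    note hm [measurable] = trig_function_measurable[OF h(1)]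
    have diff: "\<bar>h x - g x\<bar> \<le> e + (2 * G + 1) * of_bool (\<exists>i. \<bar>x $ i\<bar> > K)" for x
    proof (cases "\<exists>i. \<bar>x $ i\<bar> > K")
      case True
      then show ?thesis using h(3)[of x] G[of x] e by (auto simp: abs_le_iff)
    next
      case False
      then have "\<bar>h x - g x\<bar> < e" by (intro h(2)) (auto simp: not_less)
      moreover have "of_bool (\<exists>i. \<bar>x $ i\<bar> > K) = (0 :: real)" using False by simp
      ultimately show ?thesis by simp
    qed
    have Nd: "\<bar>(\<integral>x. h x \<partial>\<nu>) - (\<integral>x. g x \<partial>\<nu>)\<bar> \<le> e + (2 * G + 1) * e"
    proof -
      have s: "{x :: real ^ 'd. \<exists>i. \<bar>x $ i\<bar> > real k} \<in> sets \<nu>"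
      proof -
        have "{x \<in> space borel. \<exists>i. \<bar>(x :: real ^ 'd) $ i\<bar> > real k} \<in> sets borel" by measurable
        then show ?thesis by (simp add: \<nu>(2))
      qed
      have "norm (\<integral>x. h x - g x \<partial>\<nu>) \<le> (\<integral>x. e + (2 * G + 1) * indicator {x :: real ^ 'd. \<exists>i. \<bar>x $ i\<bar> > real k} x \<partial>\<nu>)"
      proof (rule order_trans[OF integral_norm_bound integral_mono])
        show "integrable \<nu> (\<lambda>x. norm (h x - g x))" using intN[OF h(3) hm] intN[OF G gm] by (intro integrable_norm) auto
        show "integrable \<nu> (\<lambda>x. e + (2 * G + 1) * indicator {x :: real ^ 'd. \<exists>i. \<bar>x $ i\<bar> > real k} x)" using s by (simp add: N.emeasure_eq_measure)
        fix x :: "real ^ 'd"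
        have "of_bool (\<exists>i. \<bar>x $ i\<bar> > K) \<le> (indicator {x :: real ^ 'd. \<exists>i. \<bar>x $ i\<bar> > real k} x :: real)"
          by (auto simp: K_def indicator_def) (metis le_less_trans less_add_one less_trans max.strict_boundedE)
        then have "(2 * G + 1) * of_bool (\<exists>i. \<bar>x $ i\<bar> > K) \<le> (2 * G + 1) * indicator {x :: real ^ 'd. \<exists>i. \<bar>x $ i\<bar> > real k} x"
          using G0 by (intro mult_left_mono) auto
        then show "norm (h x - g x) \<le> e + (2 * G + 1) * indicator {x :: real ^ 'd. \<exists>i. \<bar>x $ i\<bar> > real k} x" using diff[of x] by simp
      qed
      also have "\<dots> = e + (2 * G + 1) * measure \<nu> {x :: real ^ 'd. \<exists>i. \<bar>x $ i\<bar> > real k}" using s by (simp add: N.emeasure_eq_measure N.prob_space)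
      also have "\<dots> \<le> e + (2 * G + 1) * e" using k G0 by (intro add_left_mono mult_left_mono) auto
      finally show ?thesis using Bochner_Integration.integral_diff[OF intN[OF h(3) hm] intN[OF G gm]] by simp
    qed
    have "\<forall>\<^sub>F n in sequentially. \<bar>(\<integral>\<omega>. indicator A \<omega> * h (X n \<omega>) \<partial>M) - measure M A * (\<integral>x. h x \<partial>\<nu>)\<bar> < e"
      using tendstoD[OF trig[OF h(1)] e(1)] by (simp add: dist_real_def)
    with K1 eventually_ge_at_top[of 1]
    have "\<forall>\<^sub>F n in sequentially. norm ((\<integral>\<omega>. indicator A \<omega> * g (X n \<omega>) \<partial>M) - measure M A * (\<integral>x. g x \<partial>\<nu>)) < r"
    proof eventually_elim
      case (elim n)
      note [measurable] = X[OF elim(2)]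
      let ?E = "A \<inter> {\<omega>\<in>space M. \<exists>i. \<bar>X n \<omega> $ i\<bar> > K1}"
      have [measurable]: "(\<lambda>\<omega>. X n \<omega> $ i) \<in> borel_measurable M" for i
        by (rule measurable_compose[OF X[OF elim(2)]]) measurable
      have "{\<omega>\<in>space M. \<exists>i. \<bar>X n \<omega> $ i\<bar> > K1} \<in> sets M" by measurable
      with A have Em: "?E \<in> sets M" by (rule sets.Int)
      have "norm (\<integral>\<omega>. indicator A \<omega> * h (X n \<omega>) - indicator A \<omega> * g (X n \<omega>) \<partial>M) \<le> (\<integral>\<omega>. e + (2 * G + 1) * indicator ?E \<omega> \<partial>M)"
      proof (rule order_trans[OF integral_norm_bound integral_mono])
        show "integrable M (\<lambda>\<omega>. norm (indicator A \<omega> * h (X n \<omega>) - indicator A \<omega> * g (X n \<omega>)))"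
          using intM[OF elim(2) h(3) hm] intM[OF elim(2) G gm] by (intro integrable_norm) auto
        show "integrable M (\<lambda>\<omega>. e + (2 * G + 1) * indicator ?E \<omega>)" using Em by (simp add: M.emeasure_eq_measure)
        fix \<omega> assume w: "\<omega> \<in> space M"
        show "norm (indicator A \<omega> * h (X n \<omega>) - indicator A \<omega> * g (X n \<omega>)) \<le> e + (2 * G + 1) * indicator ?E \<omega>"
        proof (cases "\<omega> \<in> A")
          case True
          have "of_bool (\<exists>i. \<bar>X n \<omega> $ i\<bar> > K) \<le> (indicator ?E \<omega> :: real)" using w True by (auto simp: K_def indicator_def)
          then have "(2 * G + 1) * of_bool (\<exists>i. \<bar>X n \<omega> $ i\<bar> > K) \<le> (2 * G + 1) * indicator ?E \<omega>"
            using G0 by (intro mult_left_mono) auto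
          then show ?thesis using diff[of "X n \<omega>"] True by simp
        qed (use e G0 in auto)
      qed
      also have "\<dots> = e + (2 * G + 1) * measure M ?E" using Em by (simp add: M.emeasure_eq_measure M.prob_space)
      also have "\<dots> \<le> e + (2 * G + 1) * e" using elim(1) G0 by (intro add_left_mono mult_left_mono) auto
      finally have Md: "\<bar>(\<integral>\<omega>. indicator A \<omega> * h (X n \<omega>) \<partial>M) - (\<integral>\<omega>. indicator A \<omega> * g (X n \<omega>) \<partial>M)\<bar> \<le> e + (2 * G + 1) * e"
        using Bochner_Integration.integral_diff[OF intM[OF elim(2) h(3) hm] intM[OF elim(2) G gm]] by simp
      have "\<bar>measure M A * (\<integral>x. h x \<partial>\<nu>) - measure M A * (\<integral>x. g x \<partial>\<nu>)\<bar> = measure M A * \<bar>(\<integral>x. h x \<partial>\<nu>) - (\<integral>x. g x \<partial>\<nu>)\<bar>"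
        by (simp add: right_diff_distrib[symmetric] abs_mult)
      also have "\<dots> \<le> 1 * \<bar>(\<integral>x. h x \<partial>\<nu>) - (\<integral>x. g x \<partial>\<nu>)\<bar>" by (intro mult_right_mono) auto
      finally have "\<bar>measure M A * (\<integral>x. h x \<partial>\<nu>) - measure M A * (\<integral>x. g x \<partial>\<nu>)\<bar> \<le> e + (2 * G + 1) * e" using Nd by simp
      moreover have "(e + (2 * G + 1) * e) + e + (e + (2 * G + 1) * e) < r"
      proof -
        have "0 < 2 * ((2 * G + 1) * e)" using G0 e by simp
        moreover have "e * (3 + 4 * (2 * G + 1)) = (e + (2 * G + 1) * e) + e + (e + (2 * G + 1) * e) + 2 * ((2 * G + 1) * e)"
          by (simp add: algebra_simps)
        ultimately show ?thesis using e(3) by linarith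
      qed
      ultimately show ?case using Md elim(3) unfolding real_norm_def by linarith
    qed
    then show "\<exists>n0. \<forall>n\<ge>n0. norm ((\<integral>\<omega>. indicator A \<omega> * g (X n \<omega>) \<partial>M) - measure M A * (\<integral>x. g x \<partial>\<nu>)) < r"
      by (simp add: eventually_sequentially)
  qed
qed

lemma characteristic_std_normal_vec:
  "(\<integral>z. iexp (w \<bullet> z) \<partial>(std_normal_vec :: (real ^ 'd) measure)) = of_real (exp (- (norm w)\<^sup>2 / 2))"
proof -
  interpret P: prob_space "density lborel std_normal_density" by (rule prob_space_normal_density) simp
  interpret product_sigma_finite "\<lambda>_ :: 'd. density lborel (\<lambda>x. ennreal (std_normal_density x))" by unfold_locales
  let ?P = "\<Pi>\<^sub>M i\<in>(UNIV :: 'd set). density lborel (\<lambda>x. ennreal (std_normal_density x))"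
  have m: "(\<lambda>z. \<chi> i. z i) \<in> borel_measurable ?P"
    by (subst borel_measurable_euclidean_space) (auto simp: Basis_vec_def inner_axis)
  have "(\<integral>z. iexp (w \<bullet> z) \<partial>(std_normal_vec :: (real ^ 'd) measure)) = (\<integral>z. iexp (w \<bullet> (\<chi> i. z i)) \<partial>?P)"
    unfolding std_normal_vec_def by (rule integral_distr[OF m]) simp
  also have "\<dots> = (\<integral>z. (\<Prod>i\<in>UNIV. iexp (w $ i * z i)) \<partial>?P)"
    by (intro Bochner_Integration.integral_cong) (auto simp: inner_vec_def sum_distrib_left exp_sum)
  also have "\<dots> = (\<Prod>i\<in>UNIV. \<integral>x. iexp (w $ i * x) \<partial>density lborel (\<lambda>x. ennreal (std_normal_density x)))"
  proof (rule product_integral_prod)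
    show "integrable (density lborel (\<lambda>x. ennreal (std_normal_density x))) (\<lambda>x. iexp (w $ i * x))" for i
      by (rule P.integrable_const_bound[of _ 1]) auto
  qed simp
  also have "\<dots> = (\<Prod>i\<in>UNIV. of_real (exp (- (w $ i)\<^sup>2 / 2)))"
  proof (intro prod.cong refl)
    fix i
    show "(\<integral>x. iexp (w $ i * x) \<partial>density lborel (\<lambda>x. ennreal (std_normal_density x))) = of_real (exp (- (w $ i)\<^sup>2 / 2))"
      using fun_cong[OF char_std_normal_distribution, of "w $ i"] by (simp add: char_def)
  qed
  also have "\<dots> = of_real (exp (\<Sum>i\<in>UNIV. - (w $ i)\<^sup>2 / 2))" by (simp add: exp_sum)
  also have "(\<Sum>i\<in>UNIV. - (w $ i)\<^sup>2 / 2) = - (norm w)\<^sup>2 / 2"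
    by (simp add: norm_vec_def L2_set_def sum_nonneg sum_negf sum_divide_distrib)
  finally show ?thesis .
qed

text \<open>The chosen root \<open>A\<close> enters only through the squared norm of
  \<open>transpose A *v u\<close>, which is the quadratic form of \<open>\<Sigma>\<close>; the
  result is therefore independent of the choice.\<close>

lemma characteristic_mv_normal:
  fixes \<Sigma> :: "real ^ 'd ^ 'd"
  assumes "transpose \<Sigma> = \<Sigma>" "\<And>u. 0 \<le> u \<bullet> (\<Sigma> *v u)"
  shows "(\<integral>x. iexp (u \<bullet> x) \<partial>mv_normal 0 \<Sigma>) = of_real (exp (- (u \<bullet> (\<Sigma> *v u)) / 2))"
proof -
  define A where "A = (SOME A :: real ^ 'd ^ 'd. A ** transpose A = \<Sigma>)"
  have A: "A ** transpose A = \<Sigma>" unfolding A_def by (rule someI_ex) (rule psd_matrix_square_root[OF assms])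
  have m: "(\<lambda>z. 0 + A *v z) \<in> measurable std_normal_vec borel"
    by (simp add: std_normal_vec_def borel_measurable_continuous_onI matrix_vector_mult_linear_continuous_on)
  have "(\<integral>x. iexp (u \<bullet> x) \<partial>mv_normal 0 \<Sigma>) = (\<integral>z. iexp (u \<bullet> (0 + A *v z)) \<partial>std_normal_vec)"
    unfolding mv_normal_def A_def[symmetric] by (rule integral_distr[OF m]) simp
  also have "\<dots> = (\<integral>z. iexp ((transpose A *v u) \<bullet> z) \<partial>std_normal_vec)"
    by (simp add: dot_lmul_matrix[symmetric] transpose_matrix_vector)
  also have "\<dots> = of_real (exp (- (norm (transpose A *v u))\<^sup>2 / 2))" by (rule characteristic_std_normal_vec)
  also have "(norm (transpose A *v u))\<^sup>2 = u \<bullet> (\<Sigma> *v u)"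
    unfolding power2_norm_eq_inner A[symmetric]
    by (simp add: dot_lmul_matrix transpose_matrix_vector matrix_vector_mul_assoc[symmetric])
  finally show ?thesis .
qed

section \<open>Mean square bounds for the localized process\<close>

text \<open>The squared norm is expanded by means of the inner product. The cross term with
  \<open>W\<close> integrates to zero, since \<open>y\<close> and \<open>E\<close> belong to the
  past. The drift error \<open>R\<close> is not centered; its cross term is split by Young's
  inequality, at the price of a factor \<open>1 + \<kappa> g\<close> on the state and
  \<open>g / \<kappa>\<close> on \<open>R\<close>.\<close>

lemma mean_square_step:
  fixes M :: "'a measure" and G :: "'a measure" and x R W :: "'a \<Rightarrow> real ^ 'd" and N :: "real ^ 'd \<Rightarrow> real"
  assumes M: "prob_space M" and G: "subalgebra M G"
    and ip: "bilinear ip" "\<And>x y. ip x y = ip y x" "\<And>x. ip x x = (N x)\<^sup>2"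
    and N: "\<And>x. 0 \<le> N x" "\<And>x. norm x \<le> N x" "\<And>x. N x \<le> K0 * norm x"
    and E: "E \<in> sets G" and y: "y \<in> borel_measurable G"
    and R: "R \<in> borel_measurable M" "integrable M (\<lambda>\<omega>. indicator E \<omega> * (norm (R \<omega>))\<^sup>2)"
      "(\<integral>\<omega>. indicator E \<omega> * (norm (R \<omega>))\<^sup>2 \<partial>M) \<le> CR"
    and W: "\<And>i. cond_exp_version M G (\<lambda>\<omega>. W \<omega> $ i) (\<lambda>_. 0)" "integrable M (\<lambda>\<omega>. indicator E \<omega> * (norm (W \<omega>))\<^sup>2)"
      "(\<integral>\<omega>. indicator E \<omega> * (norm (W \<omega>))\<^sup>2 \<partial>M) \<le> CW"
    and x: "x \<in> borel_measurable G" "\<And>\<omega>. \<omega> \<in> E \<Longrightarrow> norm (x \<omega>) \<le> r"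
    and contr: "\<And>\<omega>. \<omega> \<in> E \<Longrightarrow> N (y \<omega>) \<le> c * N (x \<omega>)" and c: "0 \<le> c" "c \<le> 1"
    and g: "0 < g" and \<kappa>: "0 < \<kappa>"
  shows "integrable M (\<lambda>\<omega>. indicator E \<omega> * (N (x \<omega>))\<^sup>2)"
    "integrable M (\<lambda>\<omega>. indicator E \<omega> * (N (y \<omega> + g *\<^sub>R (R \<omega> + W \<omega>)))\<^sup>2)"
    "(\<integral>\<omega>. indicator E \<omega> * (N (y \<omega> + g *\<^sub>R (R \<omega> + W \<omega>)))\<^sup>2 \<partial>M)
      \<le> (1 + \<kappa> * g) * c\<^sup>2 * (\<integral>\<omega>. indicator E \<omega> * (N (x \<omega>))\<^sup>2 \<partial>M)
        + (g / \<kappa> + 2 * g\<^sup>2) * K0\<^sup>2 * CR + 2 * g\<^sup>2 * K0\<^sup>2 * CW"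
proof -
  interpret prob_space M by fact
  have EM [measurable]: "E \<in> sets M" using E G by (auto simp: subalgebra_def)
  have xM [measurable]: "x \<in> borel_measurable M" and yM [measurable]: "y \<in> borel_measurable M"
    using measurable_from_subalg[OF G x(1)] measurable_from_subalg[OF G y] by auto
  note [measurable] = R(1)
  have Wi: "(\<lambda>\<omega>. W \<omega> $ i) \<in> borel_measurable M" for i
    using cond_exp_version_integrable(6)[OF M G W(1)] .
  have WM [measurable]: "W \<in> borel_measurable M"
    by (subst borel_measurable_euclidean_space) (auto simp: Basis_vec_def inner_axis Wi)
  have ipb: "bounded_bilinear ip" using ip(1) by (simp add: bilinear_conv_bounded_bilinear)
  have ipm: "(\<lambda>\<omega>. ip (a \<omega>) (b \<omega>)) \<in> borel_measurable S" if "a \<in> borel_measurable S" "b \<in> borel_measurable S"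
    for a b :: "'a \<Rightarrow> real ^ 'd" and S
    by (rule borel_measurable_continuous_Pair[OF that])
       (intro bounded_bilinear.continuous_on[OF ipb] continuous_on_fst continuous_on_snd continuous_on_id)
  have NM [measurable]: "(\<lambda>\<omega>. (N (a \<omega>))\<^sup>2) \<in> borel_measurable S" if "a \<in> borel_measurable S" for a :: "'a \<Rightarrow> real ^ 'd" and S
    using ipm[OF that that] by (simp add: ip(3))
  have ipadd: "ip (a + b) d = ip a d + ip b d" "ip d (a + b) = ip d a + ip d b" for a b d
    using bilinear_ladd[OF ip(1)] bilinear_radd[OF ip(1)] by auto
  have ipsc: "ip (t *\<^sub>R a) d = t * ip a d" "ip d (t *\<^sub>R a) = t * ip d a" for a d and t :: real
    using bilinear_lmul[OF ip(1)] bilinear_rmul[OF ip(1)] by auto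
  \<comment> \<open>From positivity of the inner product at \<open>t a - b\<close>; with
    \<open>t = \<kappa>\<close> for the mixed term with \<open>R\<close>, and \<open>t = 1\<close>
    between \<open>R\<close> and \<open>W\<close>.\<close>
  have young: "2 * ip a b \<le> t * (N a)\<^sup>2 + (N b)\<^sup>2 / t" if "t > 0" for a b t
  proof -
    have "0 \<le> ip (t *\<^sub>R a - b) (t *\<^sub>R a - b)" by (simp add: ip(3))
    also have "\<dots> = t * (t * ip a a) - 2 * (t * ip a b) + ip b b"
      using ip(2)[of a b] by (simp add: bilinear_lsub[OF ip(1)] bilinear_rsub[OF ip(1)] ipsc algebra_simps)
    finally have "t * (2 * ip a b) \<le> t * (t * (N a)\<^sup>2) + (N b)\<^sup>2" by (simp add: ip(3))
    then show ?thesis using that by (simp add: field_simps)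
  qed
  have Nle: "(N a)\<^sup>2 \<le> K0\<^sup>2 * (norm a)\<^sup>2" for a
    unfolding power_mult_distrib[symmetric] using N by (intro power_mono) auto
  have expand: "(N (a + g *\<^sub>R (p + w)))\<^sup>2
      \<le> (1 + \<kappa> * g) * (N a)\<^sup>2 + (g / \<kappa> + 2 * g\<^sup>2) * (K0\<^sup>2 * (norm p)\<^sup>2) + 2 * g\<^sup>2 * (K0\<^sup>2 * (norm w)\<^sup>2) + 2 * g * ip a w" for a p w
  proof -
    have "(N (a + g *\<^sub>R (p + w)))\<^sup>2 = (N a)\<^sup>2 + g * (2 * ip a p) + 2 * g * ip a w + g\<^sup>2 * ((N p)\<^sup>2 + 2 * ip p w + (N w)\<^sup>2)"
      unfolding ip(3)[symmetric] ipadd ipsc using ip(2)[of p a] ip(2)[of w a] ip(2)[of w p]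
      by (simp add: algebra_simps power2_eq_square)
    also have "\<dots> \<le> (N a)\<^sup>2 + g * (\<kappa> * (N a)\<^sup>2 + (N p)\<^sup>2 / \<kappa>) + 2 * g * ip a w + g\<^sup>2 * (2 * (N p)\<^sup>2 + 2 * (N w)\<^sup>2)"
    proof -
      have "2 * ip p w \<le> (N p)\<^sup>2 + (N w)\<^sup>2" using young[of 1 p w] by simp
      then have "g\<^sup>2 * ((N p)\<^sup>2 + 2 * ip p w + (N w)\<^sup>2) \<le> g\<^sup>2 * (2 * (N p)\<^sup>2 + 2 * (N w)\<^sup>2)"
        by (intro mult_left_mono) (linarith, simp)
      moreover have "g * (2 * ip a p) \<le> g * (\<kappa> * (N a)\<^sup>2 + (N p)\<^sup>2 / \<kappa>)"
        using young[OF \<kappa>, of a p] g by (intro mult_left_mono) auto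
      ultimately show ?thesis by linarith
    qed
    also have "\<dots> = (1 + \<kappa> * g) * (N a)\<^sup>2 + (g / \<kappa> + 2 * g\<^sup>2) * (N p)\<^sup>2 + 2 * g\<^sup>2 * (N w)\<^sup>2 + 2 * g * ip a w"
      by (simp add: algebra_simps)
    also have "\<dots> \<le> (1 + \<kappa> * g) * (N a)\<^sup>2 + (g / \<kappa> + 2 * g\<^sup>2) * (K0\<^sup>2 * (norm p)\<^sup>2) + 2 * g\<^sup>2 * (K0\<^sup>2 * (norm w)\<^sup>2) + 2 * g * ip a w"
      using g \<kappa> Nle by (intro add_mono mult_left_mono order_refl) auto
    finally show ?thesis .
  qed
  have xb: "N (x \<omega>) \<le> \<bar>K0\<bar> * r" if "\<omega> \<in> E" for \<omega>
  proof -
    have "N (x \<omega>) \<le> \<bar>K0\<bar> * norm (x \<omega>)"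
      by (rule order_trans[OF N(3)]) (auto intro: mult_right_mono)
    also have "\<dots> \<le> \<bar>K0\<bar> * r" using x(2)[OF that] by (intro mult_left_mono) auto
    finally show ?thesis .
  qed
  have yb: "N (y \<omega>) \<le> N (x \<omega>)" if "\<omega> \<in> E" for \<omega>
    using contr[OF that] c N(1)[of "x \<omega>"] by (meson mult_left_le_one_le order_trans)
  have Nx2: "(N (x \<omega>))\<^sup>2 \<le> (\<bar>K0\<bar> * r)\<^sup>2" if "\<omega> \<in> E" for \<omega> using xb[OF that] N(1) by (intro power_mono) auto
  show i1: "integrable M (\<lambda>\<omega>. indicator E \<omega> * (N (x \<omega>))\<^sup>2)"
    using Nx2 by (intro integrable_const_bound[of _ "(\<bar>K0\<bar> * r)\<^sup>2"]) (auto simp: indicator_def)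
  have Ny2: "(N (y \<omega>))\<^sup>2 \<le> c\<^sup>2 * (N (x \<omega>))\<^sup>2" if "\<omega> \<in> E" for \<omega>
    unfolding power_mult_distrib[symmetric] using contr[OF that] N(1) by (intro power_mono) auto
  obtain Bi where Bi: "\<And>a b. norm (ip a b) \<le> norm a * norm b * Bi" "Bi > 0"
    using bounded_bilinear.pos_bounded[OF ipb] by blast
  \<comment> \<open>The coefficients of the linear functional \<open>ip y\<close> on
    \<open>E\<close>. They are bounded and known to \<open>G\<close>, so that the coordinates of
    \<open>W\<close> can be tested against them.\<close>
  define h where "h i \<omega> = indicator E \<omega> * ip (y \<omega>) (axis i 1)" for i \<omega>
  have hG: "h i \<in> borel_measurable G" for i
  proof -
    note [measurable] = E y
    have "(\<lambda>\<omega>. ip (y \<omega>) (axis i 1)) \<in> borel_measurable G" by (rule ipm) auto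
    then show ?thesis unfolding h_def by measurable
  qed
  have hb: "\<bar>h i \<omega>\<bar> \<le> \<bar>\<bar>K0\<bar> * r * Bi\<bar>" for i \<omega>
  proof (cases "\<omega> \<in> E")
    case True
    have "\<bar>ip (y \<omega>) (axis i 1)\<bar> \<le> norm (y \<omega>) * Bi" using Bi(1)[of "y \<omega>" "axis i 1"] by simp
    also have "\<dots> \<le> (\<bar>K0\<bar> * r) * Bi"
      using N(2)[of "y \<omega>"] yb[OF True] xb[OF True] Bi(2) by (intro mult_right_mono) auto
    finally show ?thesis using True by (simp add: h_def)
  qed (simp add: h_def)
  note hW = cond_exp_version_mult_bounded[OF M G W(1) hG hb]
  have ipW: "indicator E \<omega> * ip (y \<omega>) (W \<omega>) = (\<Sum>i\<in>UNIV. h i \<omega> * W \<omega> $ i)" for \<omega>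
  proof -
    have "W \<omega> = (\<Sum>i\<in>UNIV. (W \<omega> $ i) *\<^sub>R axis i 1)" by (simp add: basis_expansion scalar_mult_eq_scaleR[symmetric])
    then have "ip (y \<omega>) (W \<omega>) = ip (y \<omega>) (\<Sum>i\<in>UNIV. (W \<omega> $ i) *\<^sub>R axis i 1)" by simp
    also have "\<dots> = (\<Sum>i\<in>UNIV. W \<omega> $ i * ip (y \<omega>) (axis i 1))"
      using ip(1) by (simp add: linear_sum bilinear_def ipsc)
    finally show ?thesis by (simp add: h_def sum_distrib_left algebra_simps)
  qed
  have i3: "integrable M (\<lambda>\<omega>. indicator E \<omega> * ip (y \<omega>) (W \<omega>))"
    unfolding ipW using cond_exp_version_integrable(1)[OF M G hW] by (intro Bochner_Integration.integrable_sum) auto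
  have z3: "(\<integral>\<omega>. indicator E \<omega> * ip (y \<omega>) (W \<omega>) \<partial>M) = 0"
    unfolding ipW using cond_exp_version_integrable(1,3)[OF M G hW] by (subst Bochner_Integration.integral_sum) auto
  let ?B = "\<lambda>\<omega>. (1 + \<kappa> * g) * c\<^sup>2 * (indicator E \<omega> * (N (x \<omega>))\<^sup>2)
    + (g / \<kappa> + 2 * g\<^sup>2) * K0\<^sup>2 * (indicator E \<omega> * (norm (R \<omega>))\<^sup>2)
    + 2 * g\<^sup>2 * K0\<^sup>2 * (indicator E \<omega> * (norm (W \<omega>))\<^sup>2) + 2 * g * (indicator E \<omega> * ip (y \<omega>) (W \<omega>))"
  have le: "indicator E \<omega> * (N (y \<omega> + g *\<^sub>R (R \<omega> + W \<omega>)))\<^sup>2 \<le> ?B \<omega>" for \<omega>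
  proof (cases "\<omega> \<in> E")
    case True
    have "(1 + \<kappa> * g) * (N (y \<omega>))\<^sup>2 \<le> (1 + \<kappa> * g) * (c\<^sup>2 * (N (x \<omega>))\<^sup>2)"
      using Ny2[OF True] g \<kappa> by (intro mult_left_mono) auto
    then show ?thesis using expand[of "y \<omega>" "R \<omega>" "W \<omega>"] True by (simp add: algebra_simps)
  qed simp
  have iB: "integrable M ?B" using i1 R(2) W(2) i3 by simp
  show i4: "integrable M (\<lambda>\<omega>. indicator E \<omega> * (N (y \<omega> + g *\<^sub>R (R \<omega> + W \<omega>)))\<^sup>2)"
  proof (rule Bochner_Integration.integrable_bound[OF iB])
    show "AE \<omega> in M. norm (indicator E \<omega> * (N (y \<omega> + g *\<^sub>R (R \<omega> + W \<omega>)))\<^sup>2) \<le> norm (?B \<omega>)"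
    proof (rule AE_I2)
      fix \<omega>
      have "0 \<le> indicator E \<omega> * (N (y \<omega> + g *\<^sub>R (R \<omega> + W \<omega>)))\<^sup>2" by simp
      then show "norm (indicator E \<omega> * (N (y \<omega> + g *\<^sub>R (R \<omega> + W \<omega>)))\<^sup>2) \<le> norm (?B \<omega>)" using le[of \<omega>] by simp
    qed
  qed measurable
  have "(\<integral>\<omega>. indicator E \<omega> * (N (y \<omega> + g *\<^sub>R (R \<omega> + W \<omega>)))\<^sup>2 \<partial>M) \<le> (\<integral>\<omega>. ?B \<omega> \<partial>M)"
    by (rule integral_mono[OF i4 iB le])
  also have "\<dots> = (1 + \<kappa> * g) * c\<^sup>2 * (\<integral>\<omega>. indicator E \<omega> * (N (x \<omega>))\<^sup>2 \<partial>M)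
    + (g / \<kappa> + 2 * g\<^sup>2) * K0\<^sup>2 * (\<integral>\<omega>. indicator E \<omega> * (norm (R \<omega>))\<^sup>2 \<partial>M)
    + 2 * g\<^sup>2 * K0\<^sup>2 * (\<integral>\<omega>. indicator E \<omega> * (norm (W \<omega>))\<^sup>2 \<partial>M)"
    using i1 R(2) W(2) i3 z3 by simp
  also have "\<dots> \<le> (1 + \<kappa> * g) * c\<^sup>2 * (\<integral>\<omega>. indicator E \<omega> * (N (x \<omega>))\<^sup>2 \<partial>M)
        + (g / \<kappa> + 2 * g\<^sup>2) * K0\<^sup>2 * CR + 2 * g\<^sup>2 * K0\<^sup>2 * CW"
    using R(3) W(3) g \<kappa> by (intro add_mono mult_left_mono order_refl) auto
  finally show "(\<integral>\<omega>. indicator E \<omega> * (N (y \<omega> + g *\<^sub>R (R \<omega> + W \<omega>)))\<^sup>2 \<partial>M)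
      \<le> (1 + \<kappa> * g) * c\<^sup>2 * (\<integral>\<omega>. indicator E \<omega> * (N (x \<omega>))\<^sup>2 \<partial>M)
        + (g / \<kappa> + 2 * g\<^sup>2) * K0\<^sup>2 * CR + 2 * g\<^sup>2 * K0\<^sup>2 * CW" .
qed

text \<open>The localizing events decrease in \<open>n\<close>, so passing from time
  \<open>n\<close> to \<open>n - 1\<close> only enlarges the integral, and the event up to
  \<open>n - 1\<close> is known before the noise at \<open>n\<close> arrives. Squared noise enters
  with the square of \<open>\<gamma> n\<close>, which is why a second moment of order
  \<open>\<delta>^2 / \<gamma>\<close> for \<open>W\<close> produces the same inhomogeneity
  \<open>\<gamma> \<delta>^2\<close> as order \<open>\<delta>^2\<close> for
  \<open>R\<close>.\<close>

lemma mean_square_bound: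
  fixes M :: "'a measure" and F :: "nat \<Rightarrow> 'a measure" and \<theta> R W :: "nat \<Rightarrow> 'a \<Rightarrow> real ^ 'd" and N :: "real ^ 'd \<Rightarrow> real"
    and \<gamma> \<delta> :: "nat \<Rightarrow> real"
  assumes M: "prob_space M" and F: "\<And>n. subalgebra M (F n)" "\<And>m n. m \<le> n \<Longrightarrow> sets (F m) \<subseteq> sets (F n)"
    and ip: "bilinear ip" "\<And>x y. ip x y = ip y x" "\<And>x. ip x x = (N x)\<^sup>2"
    and N: "\<And>x. 0 \<le> N x" "\<And>x. norm x \<le> N x" "\<And>x. N x \<le> K0 * norm x"
    and \<theta>: "\<And>n. \<theta> n \<in> borel_measurable (F n)" and f\<theta>: "\<And>n. (\<lambda>\<omega>. f (\<theta> n \<omega>)) \<in> borel_measurable (F n)"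
    and R: "\<And>n. n > m \<Longrightarrow> R n \<in> borel_measurable M"
      "\<And>n. n > m \<Longrightarrow> integrable M (\<lambda>\<omega>. indicator (ball \<theta>s r) (\<theta> (n - 1) \<omega>) * (norm (R n \<omega>))\<^sup>2)"
      "\<And>n. n > m \<Longrightarrow> (\<integral>\<omega>. indicator (ball \<theta>s r) (\<theta> (n - 1) \<omega>) * (norm (R n \<omega>))\<^sup>2 \<partial>M) \<le> CR * (\<delta> n)\<^sup>2"
    and W: "\<And>n i. n > m \<Longrightarrow> cond_exp_version M (F (n - 1)) (\<lambda>\<omega>. W n \<omega> $ i) (\<lambda>_. 0)"
      "\<And>n. n > m \<Longrightarrow> integrable M (\<lambda>\<omega>. indicator (ball \<theta>s r) (\<theta> (n - 1) \<omega>) * (norm (W n \<omega>))\<^sup>2)"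
      "\<And>n. n > m \<Longrightarrow> (\<integral>\<omega>. indicator (ball \<theta>s r) (\<theta> (n - 1) \<omega>) * (norm (W n \<omega>))\<^sup>2 \<partial>M) \<le> CW * (\<delta> n)\<^sup>2 / \<gamma> n"
    and rec: "\<And>n \<omega>. n > m \<Longrightarrow> \<omega> \<in> space M \<Longrightarrow> \<theta> (n - 1) \<omega> \<in> ball \<theta>s r \<Longrightarrow> \<theta> n \<omega> \<in> ball \<theta>s r \<Longrightarrow>
        \<theta> n \<omega> = \<theta> (n - 1) \<omega> + \<gamma> n *\<^sub>R (f (\<theta> (n - 1) \<omega>) + R n \<omega> + W n \<omega>)"
    and contr: "\<And>n x. n > m \<Longrightarrow> x \<in> ball \<theta>s r \<Longrightarrow> N ((x - \<theta>s) + \<gamma> n *\<^sub>R f x) \<le> (1 - \<gamma> n * L1) * N (x - \<theta>s)"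
    and \<gamma>: "\<And>n. n > m \<Longrightarrow> 0 < \<gamma> n" "\<And>n. n > m \<Longrightarrow> \<gamma> n \<le> 1" "\<And>n. n > m \<Longrightarrow> \<gamma> n * L1 \<le> 1"
      "\<And>n. n > m \<Longrightarrow> (1 - \<gamma> n * L2)\<^sup>2 \<le> 1 - 2 * \<gamma> n * L2'" "\<And>n. n > m \<Longrightarrow> 2 * \<gamma> n * L2' \<le> 1"
    and \<delta>: "\<And>n. n \<ge> m \<Longrightarrow> \<delta> n > 0" "\<And>n. n > m \<Longrightarrow> 1 / \<gamma> n * (1 - \<delta> n / \<delta> (n - 1)) \<le> L3"
    and L: "0 < L3" "L3 < L2'" "L2' < L2" "L2 < L1" and C: "0 \<le> CR" "0 \<le> CW"
  shows "\<exists>K\<ge>0. \<forall>n\<ge>m. integrable M (\<lambda>\<omega>. indicator {\<omega>\<in>space M. \<forall>k\<in>{m..n}. \<theta> k \<omega> \<in> ball \<theta>s r} \<omega> * (norm (\<theta> n \<omega> - \<theta>s))\<^sup>2)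
     \<and> (\<integral>\<omega>. indicator {\<omega>\<in>space M. \<forall>k\<in>{m..n}. \<theta> k \<omega> \<in> ball \<theta>s r} \<omega> * (norm (\<theta> n \<omega> - \<theta>s))\<^sup>2 \<partial>M) \<le> K * (\<delta> n)\<^sup>2"
proof -
  interpret prob_space M by fact
  define E where "E n = {\<omega>\<in>space M. \<forall>k\<in>{m..n}. \<theta> k \<omega> \<in> ball \<theta>s r}" for n
  have meas: "X \<in> borel_measurable (F l)" if "k \<le> l" "X \<in> borel_measurable (F k)" for X :: "'a \<Rightarrow> real ^ 'd" and k l
    using that F measurable_mono[of borel borel "F k" "F l"] by (auto simp: subalgebra_def)
  have EF: "E n \<in> sets (F n)" for n
  proof -
    have [measurable]: "\<theta> k \<in> borel_measurable (F n)" if "k \<in> {m..n}" for k using meas[OF _ \<theta>[of k]] that by auto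
    have "E n = {\<omega>\<in>space (F n). \<forall>k\<in>{m..n}. \<theta> k \<omega> \<in> ball \<theta>s r}" using F(1)[of n] by (simp add: E_def subalgebra_def)
    also have "\<dots> \<in> sets (F n)" unfolding mem_ball by measurable
    finally show ?thesis .
  qed
  have EM [measurable]: "E n \<in> sets M" for n using EF F(1)[of n] by (auto simp: subalgebra_def)
  have \<theta>M [measurable]: "\<theta> n \<in> borel_measurable M" for n using measurable_from_subalg[OF F(1) \<theta>] .
  have ipb: "bounded_bilinear ip" using ip(1) by (simp add: bilinear_conv_bounded_bilinear)
  have NM: "(\<lambda>\<omega>. (N (a \<omega>))\<^sup>2) \<in> borel_measurable M" if "a \<in> borel_measurable M" for a :: "'a \<Rightarrow> real ^ 'd"
    unfolding ip(3)[symmetric]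
    by (rule borel_measurable_continuous_Pair[OF that that])
       (intro bounded_bilinear.continuous_on[OF ipb] continuous_on_fst continuous_on_snd continuous_on_id)
  have ball: "norm (x - \<theta>s) \<le> r" if "x \<in> ball \<theta>s r" for x using that by (simp add: dist_norm norm_minus_commute)
  define v where "v n = (\<integral>\<omega>. indicator (E n) \<omega> * (N (\<theta> n \<omega> - \<theta>s))\<^sup>2 \<partial>M)" for n
  have K0: "N x \<le> \<bar>K0\<bar> * norm x" for x by (rule order_trans[OF N(3)]) (auto intro: mult_right_mono)
  have vint: "integrable M (\<lambda>\<omega>. indicator (E n) \<omega> * (N (\<theta> n \<omega> - \<theta>s))\<^sup>2)" if "n \<ge> m" for n
  proof (rule integrable_const_bound[of _ "(\<bar>K0\<bar> * r)\<^sup>2"])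
    have "(N (\<theta> n \<omega> - \<theta>s))\<^sup>2 \<le> (\<bar>K0\<bar> * r)\<^sup>2" if "\<omega> \<in> E n" for \<omega>
    proof (rule power_mono[OF _ N(1)])
      have "norm (\<theta> n \<omega> - \<theta>s) \<le> r" using that \<open>n \<ge> m\<close> ball by (auto simp: E_def)
      then show "N (\<theta> n \<omega> - \<theta>s) \<le> \<bar>K0\<bar> * r" using K0[of "\<theta> n \<omega> - \<theta>s"] by (meson abs_ge_zero mult_left_mono order_trans)
    qed
    then show "AE \<omega> in M. norm (indicator (E n) \<omega> * (N (\<theta> n \<omega> - \<theta>s))\<^sup>2) \<le> (\<bar>K0\<bar> * r)\<^sup>2" by (auto simp: indicator_def)
    show "(\<lambda>\<omega>. indicator (E n) \<omega> * (N (\<theta> n \<omega> - \<theta>s))\<^sup>2) \<in> borel_measurable M"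
      using NM[of "\<lambda>\<omega>. \<theta> n \<omega> - \<theta>s"] by measurable
  qed
  \<comment> \<open>With this Young weight the factor \<open>1 + \<kappa> \<gamma>\<close> costs
    exactly the gap between \<open>L1\<close> and \<open>L2\<close>.\<close>
  define \<kappa> where "\<kappa> = L1 - L2"
  define C where "C = (1 / \<kappa> + 2) * K0\<^sup>2 * CR + 2 * K0\<^sup>2 * CW"
  have \<kappa>0: "\<kappa> > 0" using L by (simp add: \<kappa>_def)
  have step: "v n \<le> (1 - 2 * \<gamma> n * L2') * v (n - 1) + C * \<gamma> n * (\<delta> n)\<^sup>2" if n: "n > m" for n
  proof -
    let ?g = "\<gamma> n"
    note g = \<gamma>[OF n]
    define y where "y \<omega> = (\<theta> (n - 1) \<omega> - \<theta>s) + ?g *\<^sub>R f (\<theta> (n - 1) \<omega>)" for \<omega>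
    have Eb: "\<theta> (n - 1) \<omega> \<in> ball \<theta>s r" if "\<omega> \<in> E (n - 1)" for \<omega> using that n by (auto simp: E_def)
    have dom: "integrable M (\<lambda>\<omega>. indicator (E (n - 1)) \<omega> * (norm (X \<omega>))\<^sup>2) \<and>
        (\<integral>\<omega>. indicator (E (n - 1)) \<omega> * (norm (X \<omega>))\<^sup>2 \<partial>M) \<le> (\<integral>\<omega>. indicator (ball \<theta>s r) (\<theta> (n - 1) \<omega>) * (norm (X \<omega>))\<^sup>2 \<partial>M)"
      if "integrable M (\<lambda>\<omega>. indicator (ball \<theta>s r) (\<theta> (n - 1) \<omega>) * (norm (X \<omega>))\<^sup>2)" "X \<in> borel_measurable M" for X :: "'a \<Rightarrow> real ^ 'd"
    proof -
      have le: "indicator (E (n - 1)) \<omega> * (norm (X \<omega>))\<^sup>2 \<le> indicator (ball \<theta>s r) (\<theta> (n - 1) \<omega>) * (norm (X \<omega>))\<^sup>2" for \<omega>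
        using Eb by (auto simp: indicator_def)
      have i: "integrable M (\<lambda>\<omega>. indicator (E (n - 1)) \<omega> * (norm (X \<omega>))\<^sup>2)"
      proof (rule Bochner_Integration.integrable_bound[OF that(1)])
        show "(\<lambda>\<omega>. indicator (E (n - 1)) \<omega> * (norm (X \<omega>))\<^sup>2) \<in> borel_measurable M" using that(2) by measurable
        show "AE \<omega> in M. norm (indicator (E (n - 1)) \<omega> * (norm (X \<omega>))\<^sup>2) \<le> norm (indicator (ball \<theta>s r) (\<theta> (n - 1) \<omega>) * (norm (X \<omega>))\<^sup>2)"
          using Eb by (auto simp: indicator_def)
      qed
      with integral_mono[OF i that(1) le] show ?thesis by simp
    qed
    have WM: "W n \<in> borel_measurable M"
      using cond_exp_version_integrable(6)[OF M F(1) W(1)[OF n]]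
      by (subst borel_measurable_euclidean_space) (auto simp: Basis_vec_def inner_axis)
    note dR = dom[OF R(2)[OF n] R(1)[OF n]] and dW = dom[OF W(2)[OF n] WM]
    have xF: "(\<lambda>\<omega>. \<theta> (n - 1) \<omega> - \<theta>s) \<in> borel_measurable (F (n - 1))"
      using \<theta>[of "n - 1"] by measurable
    have yF: "y \<in> borel_measurable (F (n - 1))" unfolding y_def using \<theta>[of "n - 1"] f\<theta>[of "n - 1"] by measurable
    have ms: "integrable M (\<lambda>\<omega>. indicator (E (n - 1)) \<omega> * (N (y \<omega> + ?g *\<^sub>R (R n \<omega> + W n \<omega>)))\<^sup>2)"
      "(\<integral>\<omega>. indicator (E (n - 1)) \<omega> * (N (y \<omega> + ?g *\<^sub>R (R n \<omega> + W n \<omega>)))\<^sup>2 \<partial>M)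
      \<le> (1 + \<kappa> * ?g) * (1 - ?g * L1)\<^sup>2 * (\<integral>\<omega>. indicator (E (n - 1)) \<omega> * (N (\<theta> (n - 1) \<omega> - \<theta>s))\<^sup>2 \<partial>M)
        + (?g / \<kappa> + 2 * ?g\<^sup>2) * K0\<^sup>2 * (CR * (\<delta> n)\<^sup>2) + 2 * ?g\<^sup>2 * K0\<^sup>2 * (CW * (\<delta> n)\<^sup>2 / ?g)"
    proof (atomize (full), rule conjI)
      note ass = M F(1)[of "n - 1"] ip N EF[of "n - 1"] yF R(1)[OF n] conjunct1[OF dR]
        order_trans[OF conjunct2[OF dR] R(3)[OF n]] W(1)[OF n] conjunct1[OF dW] order_trans[OF conjunct2[OF dW] W(3)[OF n]] xF
      have p: "norm (\<theta> (n - 1) \<omega> - \<theta>s) \<le> r" if "\<omega> \<in> E (n - 1)" for \<omega> using ball[OF Eb[OF that]] .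
      have q: "N (y \<omega>) \<le> (1 - ?g * L1) * N (\<theta> (n - 1) \<omega> - \<theta>s)" if "\<omega> \<in> E (n - 1)" for \<omega>
        unfolding y_def by (rule contr[OF n Eb[OF that]])
      have c: "0 \<le> 1 - ?g * L1" "1 - ?g * L1 \<le> 1" using g L by auto
      show "integrable M (\<lambda>\<omega>. indicator (E (n - 1)) \<omega> * (N (y \<omega> + ?g *\<^sub>R (R n \<omega> + W n \<omega>)))\<^sup>2)"
        by (rule mean_square_step(2)[OF ass p q c g(1) \<kappa>0])
      show "(\<integral>\<omega>. indicator (E (n - 1)) \<omega> * (N (y \<omega> + ?g *\<^sub>R (R n \<omega> + W n \<omega>)))\<^sup>2 \<partial>M)
        \<le> (1 + \<kappa> * ?g) * (1 - ?g * L1)\<^sup>2 * (\<integral>\<omega>. indicator (E (n - 1)) \<omega> * (N (\<theta> (n - 1) \<omega> - \<theta>s))\<^sup>2 \<partial>M)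
          + (?g / \<kappa> + 2 * ?g\<^sup>2) * K0\<^sup>2 * (CR * (\<delta> n)\<^sup>2) + 2 * ?g\<^sup>2 * K0\<^sup>2 * (CW * (\<delta> n)\<^sup>2 / ?g)"
        by (rule mean_square_step(3)[OF ass p q c g(1) \<kappa>0])
    qed
    \<comment> \<open>On the smaller event both endpoints lie in the ball, so the recursion holds
      there; the right-hand side is defined without reference to time \<open>n\<close> being
      localized.\<close>
    have "v n \<le> (\<integral>\<omega>. indicator (E (n - 1)) \<omega> * (N (y \<omega> + ?g *\<^sub>R (R n \<omega> + W n \<omega>)))\<^sup>2 \<partial>M)"
      unfolding v_def
    proof (rule integral_mono[OF vint ms(1)])
      show "n \<ge> m" using n by simp
      fix \<omega> assume w: "\<omega> \<in> space M"
      show "indicator (E n) \<omega> * (N (\<theta> n \<omega> - \<theta>s))\<^sup>2 \<le> indicator (E (n - 1)) \<omega> * (N (y \<omega> + ?g *\<^sub>R (R n \<omega> + W n \<omega>)))\<^sup>2"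
      proof (cases "\<omega> \<in> E n")
        case True
        then have b: "\<theta> (n - 1) \<omega> \<in> ball \<theta>s r" "\<theta> n \<omega> \<in> ball \<theta>s r" "\<omega> \<in> E (n - 1)" using n by (auto simp: E_def)
        have "\<theta> n \<omega> - \<theta>s = y \<omega> + ?g *\<^sub>R (R n \<omega> + W n \<omega>)"
          unfolding y_def using rec[OF n w b(1,2)] by (simp add: algebra_simps)
        then show ?thesis using True b(3) by simp
      qed simp
    qed
    also note ms(2)
    also have "(1 + \<kappa> * ?g) * (1 - ?g * L1)\<^sup>2 * (\<integral>\<omega>. indicator (E (n - 1)) \<omega> * (N (\<theta> (n - 1) \<omega> - \<theta>s))\<^sup>2 \<partial>M) \<le> (1 - 2 * ?g * L2') * v (n - 1)"
      unfolding v_def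
    proof (rule mult_right_mono)
      have a: "(1 + \<kappa> * ?g) * (1 - ?g * L1) \<le> 1 - ?g * L2"
      proof -
        have "0 \<le> \<kappa> * ?g * (?g * L1)" using \<kappa>0 g L by auto
        then show ?thesis by (simp add: \<kappa>_def algebra_simps)
      qed
      have gl: "?g * L2 \<le> ?g * L1" using g L by auto
      have L2: "1 - ?g * L1 \<le> 1 - ?g * L2" "0 \<le> 1 - ?g * L2" using gl g(3) by linarith+
      have "(1 + \<kappa> * ?g) * (1 - ?g * L1)\<^sup>2 = ((1 + \<kappa> * ?g) * (1 - ?g * L1)) * (1 - ?g * L1)" by (simp add: power2_eq_square)
      also have "\<dots> \<le> (1 - ?g * L2) * (1 - ?g * L2)" using a L2 g by (intro mult_mono) auto
      also have "\<dots> \<le> 1 - 2 * ?g * L2'" using g(4) by (simp add: power2_eq_square)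
      finally show "(1 + \<kappa> * ?g) * (1 - ?g * L1)\<^sup>2 \<le> 1 - 2 * ?g * L2'" .
    qed (auto intro!: integral_nonneg_AE)
    also have "(?g / \<kappa> + 2 * ?g\<^sup>2) * K0\<^sup>2 * (CR * (\<delta> n)\<^sup>2) \<le> ?g * ((1 / \<kappa> + 2) * K0\<^sup>2 * CR * (\<delta> n)\<^sup>2)"
    proof -
      have "?g / \<kappa> + 2 * ?g\<^sup>2 \<le> ?g * (1 / \<kappa> + 2)" using g by (simp add: power2_eq_square algebra_simps mult_left_le_one_le)
      then have "(?g / \<kappa> + 2 * ?g\<^sup>2) * (K0\<^sup>2 * (CR * (\<delta> n)\<^sup>2)) \<le> ?g * (1 / \<kappa> + 2) * (K0\<^sup>2 * (CR * (\<delta> n)\<^sup>2))"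
        using C by (intro mult_right_mono) auto
      then show ?thesis by (simp add: mult.assoc)
    qed
    also have "2 * ?g\<^sup>2 * K0\<^sup>2 * (CW * (\<delta> n)\<^sup>2 / ?g) = ?g * (2 * K0\<^sup>2 * CW * (\<delta> n)\<^sup>2)" using g by (simp add: power2_eq_square)
    finally show ?thesis by (simp add: C_def algebra_simps)
  qed
  have "\<exists>K\<ge>0. \<forall>n\<ge>m. v n \<le> K * (\<delta> n)\<^sup>2"
  proof (rule quadratic_recursion_bound[of m v \<gamma> L2' C \<delta> L3, OF step])
    show "0 \<le> v n" for n unfolding v_def by (intro integral_nonneg_AE) auto
    show "C \<ge> 0" unfolding C_def using \<kappa>0 C by auto
  qed (use \<gamma> \<delta> L in auto)
  then obtain K where K: "K \<ge> 0" "\<And>n. n \<ge> m \<Longrightarrow> v n \<le> K * (\<delta> n)\<^sup>2" by blast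
  have "integrable M (\<lambda>\<omega>. indicator (E n) \<omega> * (norm (\<theta> n \<omega> - \<theta>s))\<^sup>2) \<and> (\<integral>\<omega>. indicator (E n) \<omega> * (norm (\<theta> n \<omega> - \<theta>s))\<^sup>2 \<partial>M) \<le> K * (\<delta> n)\<^sup>2"
    if n: "n \<ge> m" for n
  proof
    have le: "indicator (E n) \<omega> * (norm (\<theta> n \<omega> - \<theta>s))\<^sup>2 \<le> indicator (E n) \<omega> * (N (\<theta> n \<omega> - \<theta>s))\<^sup>2" for \<omega>
      using N(2) by (intro mult_left_mono power_mono) auto
    show i: "integrable M (\<lambda>\<omega>. indicator (E n) \<omega> * (norm (\<theta> n \<omega> - \<theta>s))\<^sup>2)"
    proof (rule Bochner_Integration.integrable_bound[OF vint[OF n]])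
      show "AE \<omega> in M. norm (indicator (E n) \<omega> * (norm (\<theta> n \<omega> - \<theta>s))\<^sup>2) \<le> norm (indicator (E n) \<omega> * (N (\<theta> n \<omega> - \<theta>s))\<^sup>2)"
        using le by (intro AE_I2) simp
    qed measurable
    show "(\<integral>\<omega>. indicator (E n) \<omega> * (norm (\<theta> n \<omega> - \<theta>s))\<^sup>2 \<partial>M) \<le> K * (\<delta> n)\<^sup>2"
      using integral_mono[OF i vint[OF n] le] K(2)[OF n] by (simp add: v_def)
  qed
  with K(1) show ?thesis unfolding E_def by blast
qed

section \<open>Weighted vector-valued martingales\<close>

lemma AE_all_ge_one:
  fixes P :: "nat \<Rightarrow> 'a \<Rightarrow> bool"
  assumes "\<And>k. k \<ge> 1 \<Longrightarrow> AE \<omega> in M. P k \<omega>"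
  shows "AE \<omega> in M. \<forall>k\<in>{1..}. P k \<omega>"
  by (rule AE_ball_countable[THEN iffD2]) (use assms in \<open>simp_all add: Ball_def\<close>)

text \<open>Truncating at \<open>0\<close> makes the version nonnegative everywhere, so that its partial sums are monotone in
  time for every \<open>\<omega>\<close>.\<close>

definition quad_version :: "'a measure \<Rightarrow> 'a measure \<Rightarrow> real ^ 'd \<Rightarrow> ('a \<Rightarrow> real ^ 'd) \<Rightarrow> 'a \<Rightarrow> real" where
  "quad_version M G w X \<omega> = max 0 (real_cond_exp M G (\<lambda>\<omega>. (w \<bullet> X \<omega>)\<^sup>2) \<omega>)"

locale square_integrable_vector = prob_space M for M :: "'a measure" +
  fixes G :: "'a measure" and X :: "'a \<Rightarrow> real ^ 'd"
  assumes sub: "subalgebra M G" and Xm [measurable]: "X \<in> borel_measurable M"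
    and sq: "integrable M (\<lambda>\<omega>. (norm (X \<omega>))\<^sup>2)"
begin

sublocale finite_measure_subalgebra M G by unfold_locales (rule sub)

lemma Xi [measurable]: "(\<lambda>\<omega>. X \<omega> $ i) \<in> borel_measurable M"
  by (rule measurable_compose[OF Xm]) measurable

lemma int_square: "integrable M (\<lambda>\<omega>. (w \<bullet> X \<omega>)\<^sup>2)"
proof (rule Bochner_Integration.integrable_bound)
  show "integrable M (\<lambda>\<omega>. (norm w)\<^sup>2 * (norm (X \<omega>))\<^sup>2)" using sq by simp
  have "(w \<bullet> X \<omega>)\<^sup>2 \<le> (norm w)\<^sup>2 * (norm (X \<omega>))\<^sup>2" for \<omega>
    using Cauchy_Schwarz_ineq2[of w "X \<omega>"] by (metis abs_ge_zero power2_abs power_mono power_mult_distrib)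
  then show "AE \<omega> in M. norm ((w \<bullet> X \<omega>)\<^sup>2) \<le> norm ((norm w)\<^sup>2 * (norm (X \<omega>))\<^sup>2)" by simp
qed measurable

lemma int_prod: "integrable M (\<lambda>\<omega>. X \<omega> $ i * X \<omega> $ j)"
proof (rule Bochner_Integration.integrable_bound[OF sq])
  have "\<bar>X \<omega> $ i * X \<omega> $ j\<bar> \<le> norm (X \<omega>) * norm (X \<omega>)" for \<omega>
    unfolding abs_mult by (intro mult_mono component_le_norm_cart) auto
  then show "AE \<omega> in M. norm (X \<omega> $ i * X \<omega> $ j) \<le> norm ((norm (X \<omega>))\<^sup>2)" by (simp add: power2_eq_square)
qed measurable

lemma quad_version_AE: "AE \<omega> in M. real_cond_exp M G (\<lambda>\<omega>. (w \<bullet> X \<omega>)\<^sup>2) \<omega> = quad_version M G w X \<omega>"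
proof -
  have "AE \<omega> in M. real_cond_exp M G (\<lambda>\<omega>. (w \<bullet> X \<omega>)\<^sup>2) \<omega> \<ge> 0"
    by (rule real_cond_exp_pos) auto
  then show ?thesis by eventually_elim (simp add: quad_version_def)
qed

lemma quad_version: "cond_exp_version M G (\<lambda>\<omega>. (w \<bullet> X \<omega>)\<^sup>2) (quad_version M G w X)"
  unfolding cond_exp_version_def using int_square quad_version_AE
  by (auto simp: quad_version_def[abs_def])

lemma quad_version_bilinear:
  "AE \<omega> in M. quad_version M G w X \<omega> = (\<Sum>i\<in>UNIV. \<Sum>j\<in>UNIV. w $ i * w $ j * real_cond_exp M G (\<lambda>\<omega>. X \<omega> $ i * X \<omega> $ j) \<omega>)"
proof -
  have ij: "AE \<omega> in M. real_cond_exp M G (\<lambda>\<omega>. (w $ i * w $ j) * (X \<omega> $ i * X \<omega> $ j)) \<omega>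
      = (w $ i * w $ j) * real_cond_exp M G (\<lambda>\<omega>. X \<omega> $ i * X \<omega> $ j) \<omega>" for i j
    by (rule real_cond_exp_cmult[OF int_prod])
  have i: "AE \<omega> in M. real_cond_exp M G (\<lambda>\<omega>. \<Sum>j\<in>UNIV. (w $ i * w $ j) * (X \<omega> $ i * X \<omega> $ j)) \<omega>
      = (\<Sum>j\<in>UNIV. real_cond_exp M G (\<lambda>\<omega>. (w $ i * w $ j) * (X \<omega> $ i * X \<omega> $ j)) \<omega>)" for i
    by (rule real_cond_exp_sum) (use int_prod in simp)
  have a: "AE \<omega> in M. real_cond_exp M G (\<lambda>\<omega>. \<Sum>i\<in>UNIV. \<Sum>j\<in>UNIV. (w $ i * w $ j) * (X \<omega> $ i * X \<omega> $ j)) \<omega>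
      = (\<Sum>i\<in>UNIV. real_cond_exp M G (\<lambda>\<omega>. \<Sum>j\<in>UNIV. (w $ i * w $ j) * (X \<omega> $ i * X \<omega> $ j)) \<omega>)"
    by (rule real_cond_exp_sum) (use int_prod in simp)
  have e: "(\<lambda>\<omega>. (w \<bullet> X \<omega>)\<^sup>2) = (\<lambda>\<omega>. \<Sum>i\<in>UNIV. \<Sum>j\<in>UNIV. (w $ i * w $ j) * (X \<omega> $ i * X \<omega> $ j))"
    by (simp add: inner_vec_def power2_eq_square sum_product algebra_simps)
  have "AE \<omega> in M. \<forall>i j. real_cond_exp M G (\<lambda>\<omega>. (w $ i * w $ j) * (X \<omega> $ i * X \<omega> $ j)) \<omega>
      = (w $ i * w $ j) * real_cond_exp M G (\<lambda>\<omega>. X \<omega> $ i * X \<omega> $ j) \<omega>"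
    using ij by (simp only: AE_all_countable) simp
  moreover have "AE \<omega> in M. \<forall>i. real_cond_exp M G (\<lambda>\<omega>. \<Sum>j\<in>UNIV. (w $ i * w $ j) * (X \<omega> $ i * X \<omega> $ j)) \<omega>
      = (\<Sum>j\<in>UNIV. real_cond_exp M G (\<lambda>\<omega>. (w $ i * w $ j) * (X \<omega> $ i * X \<omega> $ j)) \<omega>)"
    using i by (simp only: AE_all_countable) simp
  ultimately show ?thesis using a quad_version_AE[of w] unfolding e by eventually_elim simp
qed

text \<open>Used for weights that depend on the final time and are known only through their norm:
  the trace of the conditional second moments then bounds all directions at once.\<close>

lemma quad_version_le:
  "AE \<omega> in M. quad_version M G w X \<omega> \<le> (norm w)\<^sup>2 * (\<Sum>i\<in>UNIV. real_cond_exp M G (\<lambda>\<omega>. X \<omega> $ i * X \<omega> $ i) \<omega>)"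
proof -
  have "AE \<omega> in M. real_cond_exp M G (\<lambda>\<omega>. (w \<bullet> X \<omega>)\<^sup>2) \<omega> \<le> real_cond_exp M G (\<lambda>\<omega>. (norm w)\<^sup>2 * (\<Sum>i\<in>UNIV. X \<omega> $ i * X \<omega> $ i)) \<omega>"
  proof (rule real_cond_exp_mono[OF _ int_square])
    have "(w \<bullet> X \<omega>)\<^sup>2 \<le> (norm w)\<^sup>2 * (norm (X \<omega>))\<^sup>2" for \<omega>
      using Cauchy_Schwarz_ineq2[of w "X \<omega>"] by (metis abs_ge_zero power2_abs power_mono power_mult_distrib)
    moreover have "(norm (X \<omega>))\<^sup>2 = (\<Sum>i\<in>UNIV. X \<omega> $ i * X \<omega> $ i)" for \<omega>
      by (simp add: power2_norm_eq_inner inner_vec_def)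
    ultimately show "AE \<omega> in M. (w \<bullet> X \<omega>)\<^sup>2 \<le> (norm w)\<^sup>2 * (\<Sum>i\<in>UNIV. X \<omega> $ i * X \<omega> $ i)" by simp
    show "integrable M (\<lambda>\<omega>. (norm w)\<^sup>2 * (\<Sum>i\<in>UNIV. X \<omega> $ i * X \<omega> $ i))" using int_prod by simp
  qed
  moreover have "AE \<omega> in M. real_cond_exp M G (\<lambda>\<omega>. (norm w)\<^sup>2 * (\<Sum>i\<in>UNIV. X \<omega> $ i * X \<omega> $ i)) \<omega>
      = (norm w)\<^sup>2 * real_cond_exp M G (\<lambda>\<omega>. \<Sum>i\<in>UNIV. X \<omega> $ i * X \<omega> $ i) \<omega>"
    by (rule real_cond_exp_cmult) (use int_prod in simp)
  moreover have "AE \<omega> in M. real_cond_exp M G (\<lambda>\<omega>. \<Sum>i\<in>UNIV. X \<omega> $ i * X \<omega> $ i) \<omega>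
      = (\<Sum>i\<in>UNIV. real_cond_exp M G (\<lambda>\<omega>. X \<omega> $ i * X \<omega> $ i) \<omega>)"
    by (rule real_cond_exp_sum) (rule int_prod)
  ultimately show ?thesis using quad_version_AE[of w] by eventually_elim simp
qed

lemma linear_version:
  assumes "\<And>i. cond_exp_version M G (\<lambda>\<omega>. X \<omega> $ i) (\<lambda>_. 0)"
  shows "cond_exp_version M G (\<lambda>\<omega>. w \<bullet> X \<omega>) (\<lambda>_. 0)"
proof -
  have i: "integrable M (\<lambda>\<omega>. X \<omega> $ i)" "AE \<omega> in M. real_cond_exp M G (\<lambda>\<omega>. X \<omega> $ i) \<omega> = 0" for i
    using assms by (auto simp: cond_exp_version_def)
  have e: "(\<lambda>\<omega>. w \<bullet> X \<omega>) = (\<lambda>\<omega>. \<Sum>i\<in>UNIV. w $ i * X \<omega> $ i)" by (simp add: inner_vec_def)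
  have "AE \<omega> in M. real_cond_exp M G (\<lambda>\<omega>. w $ i * X \<omega> $ i) \<omega> = 0" for i
    using real_cond_exp_cmult[OF i(1)[of i], of "w $ i"] i(2)[of i] by eventually_elim simp
  then have "AE \<omega> in M. \<forall>i. real_cond_exp M G (\<lambda>\<omega>. w $ i * X \<omega> $ i) \<omega> = 0" by (simp only: AE_all_countable) simp
  moreover have "AE \<omega> in M. real_cond_exp M G (\<lambda>\<omega>. \<Sum>i\<in>UNIV. w $ i * X \<omega> $ i) \<omega> = (\<Sum>i\<in>UNIV. real_cond_exp M G (\<lambda>\<omega>. w $ i * X \<omega> $ i) \<omega>)"
    by (rule real_cond_exp_sum) (use i in simp)
  ultimately have "AE \<omega> in M. real_cond_exp M G (\<lambda>\<omega>. w \<bullet> X \<omega>) \<omega> = 0" unfolding e by eventually_elim simp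
  then show ?thesis using i(1) by (auto simp: cond_exp_version_def e)
qed

end

text \<open>The conditional covariances appear as second moments because the increments are
  centered. The sequence \<open>s\<close> is the unnormalized fluctuation scale, that is,
  \<open>eps_diff\<close> without the division by the total weight.\<close>

locale weighted_vector_martingale = prob_space M for M :: "'a measure" +
  fixes F :: "nat \<Rightarrow> 'a measure" and X :: "nat \<Rightarrow> 'a \<Rightarrow> real ^ 'd" and b \<delta> s :: "nat \<Rightarrow> real"
    and A :: "'a set" and \<Gamma> :: "real ^ 'd ^ 'd"
  assumes F_sub: "\<And>n. subalgebra M (F n)" and F_mono: "\<And>m n. m \<le> n \<Longrightarrow> sets (F m) \<subseteq> sets (F n)"
    and A_sets [measurable]: "A \<in> sets M" and A_approx: "\<And>e. e > 0 \<Longrightarrow> \<exists>N. \<exists>B\<in>sets (F N). measure M (sym_diff A B) < e"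
    and X_adapted: "\<And>k. k \<ge> 1 \<Longrightarrow> X k \<in> borel_measurable (F k)"
    and X_mean: "\<And>k i. k \<ge> 1 \<Longrightarrow> cond_exp_version M (F (k - 1)) (\<lambda>\<omega>. X k \<omega> $ i) (\<lambda>_. 0)"
    and X_square: "\<And>k. k \<ge> 1 \<Longrightarrow> integrable M (\<lambda>\<omega>. (norm (X k \<omega>))\<^sup>2)"
    and b_pos: "\<And>k. k \<ge> 1 \<Longrightarrow> b k > 0" and \<delta>_pos: "\<And>k. k \<ge> 1 \<Longrightarrow> \<delta> k > 0"
    and s_def: "\<And>n. s n = sqrt (\<Sum>k=1..n. (b k * \<delta> k)\<^sup>2)"
    and s_top: "filterlim (\<lambda>n. \<Sum>k=1..n. (b k * \<delta> k)\<^sup>2) at_top sequentially"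
    and s_last: "(\<lambda>n. (b n * \<delta> n)\<^sup>2 / (\<Sum>k=1..n. (b k * \<delta> k)\<^sup>2)) \<longlonglongrightarrow> 0"
    and cov: "AE \<omega> in M. \<omega> \<in> A \<longrightarrow> (\<forall>i j. (\<lambda>n. real_cond_exp M (F (n - 1)) (\<lambda>\<omega>. X n \<omega> $ i * X n \<omega> $ j) \<omega> / (\<delta> n)\<^sup>2) \<longlonglongrightarrow> \<Gamma> $ i $ j)"
begin

lemma vec: "k \<ge> 1 \<Longrightarrow> square_integrable_vector M (F (k - 1)) (X k)"
  by unfold_locales (auto intro: F_sub X_square measurable_from_subalg[OF F_sub X_adapted])

lemma s_sq: "(s n)\<^sup>2 = (\<Sum>k=1..n. (b k * \<delta> k)\<^sup>2)"
  by (simp add: s_def sum_nonneg)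

lemma s_pos: "n \<ge> 1 \<Longrightarrow> s n > 0"
proof -
  assume n: "n \<ge> 1"
  have "0 < (b 1 * \<delta> 1)\<^sup>2" using b_pos[of 1] \<delta>_pos[of 1] by simp
  also have "\<dots> \<le> (\<Sum>k=1..n. (b k * \<delta> k)\<^sup>2)" using n by (intro member_le_sum) auto
  finally show ?thesis by (simp add: s_def)
qed

lemma s_mono: "m \<le> n \<Longrightarrow> s m \<le> s n"
  unfolding s_def by (intro real_sqrt_le_mono sum_mono2) auto

lemma s_at_top: "filterlim s at_top sequentially"
  unfolding s_def by (rule filterlim_compose[OF sqrt_at_top s_top])

abbreviation "Q k w \<equiv> quad_version M (F (k - 1)) w (X k)"

lemma Q_scaled: "k \<ge> 1 \<Longrightarrow> AE \<omega> in M. Q k (c *\<^sub>R w) \<omega> = c\<^sup>2 * Q k w \<omega>"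
proof -
  assume k: "k \<ge> 1"
  interpret V: square_integrable_vector M "F (k - 1)" "X k" by (rule vec[OF k])
  show ?thesis using V.quad_version_bilinear[of "c *\<^sub>R w"] V.quad_version_bilinear[of w]
    by eventually_elim (simp add: sum_distrib_left power2_eq_square algebra_simps)
qed

lemma Q_limit: "AE \<omega> in M. \<omega> \<in> A \<longrightarrow> (\<lambda>n. Q n u \<omega> / (\<delta> n)\<^sup>2) \<longlonglongrightarrow> u \<bullet> (\<Gamma> *v u)"
proof -
  have "AE \<omega> in M. \<forall>n\<in>{1..}. Q n u \<omega> = (\<Sum>i\<in>UNIV. \<Sum>j\<in>UNIV. u $ i * u $ j * real_cond_exp M (F (n - 1)) (\<lambda>\<omega>. X n \<omega> $ i * X n \<omega> $ j) \<omega>)"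
    by (rule AE_all_ge_one) (rule square_integrable_vector.quad_version_bilinear[OF vec])
  then show ?thesis using cov
  proof (eventually_elim, intro impI)
    fix \<omega> assume h: "\<forall>n\<in>{1..}. Q n u \<omega> = (\<Sum>i\<in>UNIV. \<Sum>j\<in>UNIV. u $ i * u $ j * real_cond_exp M (F (n - 1)) (\<lambda>\<omega>. X n \<omega> $ i * X n \<omega> $ j) \<omega>)"
      "\<omega> \<in> A \<longrightarrow> (\<forall>i j. (\<lambda>n. real_cond_exp M (F (n - 1)) (\<lambda>\<omega>. X n \<omega> $ i * X n \<omega> $ j) \<omega> / (\<delta> n)\<^sup>2) \<longlonglongrightarrow> \<Gamma> $ i $ j)" "\<omega> \<in> A"
    have "(\<lambda>n. \<Sum>i\<in>UNIV. \<Sum>j\<in>UNIV. u $ i * u $ j * (real_cond_exp M (F (n - 1)) (\<lambda>\<omega>. X n \<omega> $ i * X n \<omega> $ j) \<omega> / (\<delta> n)\<^sup>2))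
        \<longlonglongrightarrow> (\<Sum>i\<in>UNIV. \<Sum>j\<in>UNIV. u $ i * u $ j * \<Gamma> $ i $ j)"
      using h by (intro tendsto_sum tendsto_mult tendsto_const) auto
    also have "(\<Sum>i\<in>UNIV. \<Sum>j\<in>UNIV. u $ i * u $ j * \<Gamma> $ i $ j) = u \<bullet> (\<Gamma> *v u)"
      by (simp add: inner_vec_def matrix_vector_mult_def sum_distrib_left algebra_simps)
    finally have l: "(\<lambda>n. \<Sum>i\<in>UNIV. \<Sum>j\<in>UNIV. u $ i * u $ j * (real_cond_exp M (F (n - 1)) (\<lambda>\<omega>. X n \<omega> $ i * X n \<omega> $ j) \<omega> / (\<delta> n)\<^sup>2)) \<longlonglongrightarrow> u \<bullet> (\<Gamma> *v u)" .
    show "(\<lambda>n. Q n u \<omega> / (\<delta> n)\<^sup>2) \<longlonglongrightarrow> u \<bullet> (\<Gamma> *v u)"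
    proof (rule Lim_transform_eventually[OF l])
      show "\<forall>\<^sub>F n in sequentially. (\<Sum>i\<in>UNIV. \<Sum>j\<in>UNIV. u $ i * u $ j * (real_cond_exp M (F (n - 1)) (\<lambda>\<omega>. X n \<omega> $ i * X n \<omega> $ j) \<omega> / (\<delta> n)\<^sup>2)) = Q n u \<omega> / (\<delta> n)\<^sup>2"
        using eventually_ge_at_top[of 1] by eventually_elim (use h(1) in \<open>simp add: sum_divide_distrib\<close>)
    qed
  qed
qed

text \<open>Toeplitz's lemma with weights \<open>(b k * \<delta> k)^2\<close>, after scaling the
  quadratic form by the weight. The second limit uses that the last weight is negligible, which
  excludes a single dominating increment.\<close>

lemma Q_average:
  "AE \<omega> in M. \<omega> \<in> A \<longrightarrow> (\<lambda>n. (\<Sum>k=1..n. Q k (b k *\<^sub>R u) \<omega>) / (s n)\<^sup>2) \<longlonglongrightarrow> u \<bullet> (\<Gamma> *v u)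
      \<and> (\<lambda>n. Q n (b n *\<^sub>R u) \<omega> / (s n)\<^sup>2) \<longlonglongrightarrow> 0"
proof -
  have "AE \<omega> in M. \<forall>k\<in>{1..}. Q k (b k *\<^sub>R u) \<omega> = (b k)\<^sup>2 * Q k u \<omega>"
    by (rule AE_all_ge_one) (rule Q_scaled)
  then show ?thesis using Q_limit[of u]
  proof (eventually_elim, intro impI)
    fix \<omega> assume h: "\<forall>k\<in>{1..}. Q k (b k *\<^sub>R u) \<omega> = (b k)\<^sup>2 * Q k u \<omega>"
      "\<omega> \<in> A \<longrightarrow> (\<lambda>n. Q n u \<omega> / (\<delta> n)\<^sup>2) \<longlonglongrightarrow> u \<bullet> (\<Gamma> *v u)" "\<omega> \<in> A"
    have e: "Q k (b k *\<^sub>R u) \<omega> = (b k * \<delta> k)\<^sup>2 * (Q k u \<omega> / (\<delta> k)\<^sup>2)" if "k \<ge> 1" for k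
      using h(1) that \<delta>_pos[OF that] by (simp add: power_mult_distrib)
    have lim: "(\<lambda>n. Q n u \<omega> / (\<delta> n)\<^sup>2) \<longlonglongrightarrow> u \<bullet> (\<Gamma> *v u)" using h by blast
    have "(\<Sum>k=1..n. Q k (b k *\<^sub>R u) \<omega>) = (\<Sum>k=1..n. (b k * \<delta> k)\<^sup>2 * (Q k u \<omega> / (\<delta> k)\<^sup>2))" for n
      by (intro sum.cong e refl) auto
    then have 1: "(\<lambda>n. (\<Sum>k=1..n. Q k (b k *\<^sub>R u) \<omega>) / (s n)\<^sup>2) \<longlonglongrightarrow> u \<bullet> (\<Gamma> *v u)"
      using weighted_average_tendsto[OF _ s_top lim] by (simp only: s_sq) auto
    have "(\<lambda>n. (b n * \<delta> n)\<^sup>2 / (s n)\<^sup>2 * (Q n u \<omega> / (\<delta> n)\<^sup>2)) \<longlonglongrightarrow> 0 * (u \<bullet> (\<Gamma> *v u))"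
      using s_last by (intro tendsto_mult lim) (simp only: s_sq)
    then have l2: "(\<lambda>n. (b n * \<delta> n)\<^sup>2 / (s n)\<^sup>2 * (Q n u \<omega> / (\<delta> n)\<^sup>2)) \<longlonglongrightarrow> 0" by simp
    have "(\<lambda>n. Q n (b n *\<^sub>R u) \<omega> / (s n)\<^sup>2) \<longlonglongrightarrow> 0"
      by (rule Lim_transform_eventually[OF l2])
         (use eventually_ge_at_top[of 1] in \<open>eventually_elim, simp only: e, simp\<close>)
    with 1 show "(\<lambda>n. (\<Sum>k=1..n. Q k (b k *\<^sub>R u) \<omega>) / (s n)\<^sup>2) \<longlonglongrightarrow> u \<bullet> (\<Gamma> *v u)
      \<and> (\<lambda>n. Q n (b n *\<^sub>R u) \<omega> / (s n)\<^sup>2) \<longlonglongrightarrow> 0" by blast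
  qed
qed

text \<open>An event of positive probability contains at least one path along which all limits hold;
  symmetry and positivity pass to the limit along it.\<close>

lemma \<Gamma>_psd:
  assumes "measure M A > 0"
  shows "transpose \<Gamma> = \<Gamma>" "0 \<le> u \<bullet> (\<Gamma> *v u)"
proof -
  have ex: "\<exists>\<omega>\<in>A. P \<omega>" if "AE \<omega> in M. \<omega> \<in> A \<longrightarrow> P \<omega>" for P
  proof (rule ccontr)
    assume "\<not> (\<exists>\<omega>\<in>A. P \<omega>)"
    with that have "AE \<omega> in M. \<omega> \<notin> A" by (auto elim: eventually_mono)
    then have "emeasure M A = 0" by (subst (asm) AE_iff_measurable[of A]) (use sets.sets_into_space[OF A_sets] in auto)
    then show False using assms by (simp add: measure_def)
  qed
  obtain \<omega> where w: "\<forall>i j. (\<lambda>n. real_cond_exp M (F (n - 1)) (\<lambda>\<omega>. X n \<omega> $ i * X n \<omega> $ j) \<omega> / (\<delta> n)\<^sup>2) \<longlonglongrightarrow> \<Gamma> $ i $ j"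
    using ex[OF cov] by blast
  have "\<Gamma> $ j $ i = \<Gamma> $ i $ j" for i j
  proof (rule LIMSEQ_unique)
    show "(\<lambda>n. real_cond_exp M (F (n - 1)) (\<lambda>\<omega>. X n \<omega> $ i * X n \<omega> $ j) \<omega> / (\<delta> n)\<^sup>2) \<longlonglongrightarrow> \<Gamma> $ i $ j" using w by blast
    show "(\<lambda>n. real_cond_exp M (F (n - 1)) (\<lambda>\<omega>. X n \<omega> $ i * X n \<omega> $ j) \<omega> / (\<delta> n)\<^sup>2) \<longlonglongrightarrow> \<Gamma> $ j $ i"
      using w[rule_format, of j i] by (simp add: mult.commute)
  qed
  then show "transpose \<Gamma> = \<Gamma>" by (simp add: vec_eq_iff transpose_def)
  obtain \<omega> where "(\<lambda>n. Q n u \<omega> / (\<delta> n)\<^sup>2) \<longlonglongrightarrow> u \<bullet> (\<Gamma> *v u)" using ex[OF Q_limit] by blast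
  then show "0 \<le> u \<bullet> (\<Gamma> *v u)"
    by (rule LIMSEQ_le_const) (auto simp: quad_version_def)
qed

text \<open>The weights may depend on the final time \<open>n\<close>, so that the sums need not
  form one martingale in \<open>n\<close>; for each fixed \<open>n\<close> the Lenglart bound
  applies, and the pathwise bound on the variances removes its first term.\<close>

lemma tail_bound:
  fixes w :: "nat \<Rightarrow> nat \<Rightarrow> real ^ 'd"
  assumes "k0 \<ge> 1" and a: "a > 0" and \<kappa>: "0 < \<kappa>"
    and ae: "AE \<omega> in M. \<omega> \<in> A \<longrightarrow> (\<forall>\<^sub>F n in sequentially. (\<Sum>k=k0..n. Q k (w n k) \<omega>) \<le> \<kappa>)"
    and e: "e > \<kappa> / a\<^sup>2"
  shows "\<forall>\<^sub>F n in sequentially. measure M (A \<inter> {\<omega>\<in>space M. \<bar>\<Sum>k=k0..n. w n k \<bullet> X k \<omega>\<bar> > a}) < e"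
proof -
  have iv: "{k0 - 1<..n} = {k0..n}" for n using \<open>k0 \<ge> 1\<close> by auto
  have Qm: "(\<lambda>\<omega>. \<Sum>k=k0..n. Q k (w n k) \<omega>) \<in> borel_measurable M" for n
  proof (intro borel_measurable_sum)
    fix k assume "k \<in> {k0..n}"
    then have k: "k \<ge> 1" using \<open>k0 \<ge> 1\<close> by auto
    show "Q k (w n k) \<in> borel_measurable M"
      using cond_exp_version_integrable(5)[OF prob_space_axioms F_sub square_integrable_vector.quad_version[OF vec[OF k]]] .
  qed
  have "(\<lambda>n. measure M (A \<inter> {\<omega>\<in>space M. (\<Sum>k=k0..n. Q k (w n k) \<omega>) > \<kappa>})) \<longlonglongrightarrow> 0"
  proof (rule prob_eventually_avoided[OF prob_space_axioms])
    show "A \<inter> {\<omega>\<in>space M. (\<Sum>k=k0..n. Q k (w n k) \<omega>) > \<kappa>} \<in> sets M" for n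
      using Qm[of n] by measurable
    show "AE \<omega> in M. \<forall>\<^sub>F n in sequentially. \<omega> \<notin> A \<inter> {\<omega>\<in>space M. (\<Sum>k=k0..n. Q k (w n k) \<omega>) > \<kappa>}"
      using ae
    proof eventually_elim
      case (elim \<omega>)
      show ?case
      proof (cases "\<omega> \<in> A")
        case True
        with elim have "\<forall>\<^sub>F n in sequentially. (\<Sum>k=k0..n. Q k (w n k) \<omega>) \<le> \<kappa>" by blast
        then show ?thesis by eventually_elim auto
      qed auto
    qed
  qed
  then have "\<forall>\<^sub>F n in sequentially. measure M (A \<inter> {\<omega>\<in>space M. (\<Sum>k=k0..n. Q k (w n k) \<omega>) > \<kappa>}) < e - \<kappa> / a\<^sup>2"
    using e by (intro order_tendstoD) auto
  then show ?thesis
  proof eventually_elim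
    case (elim n)
    have "measure M (A \<inter> {\<omega>\<in>space M. \<bar>\<Sum>k\<in>{k0 - 1<..n}. w n k \<bullet> X k \<omega>\<bar> > a})
      \<le> measure M (A \<inter> {\<omega>\<in>space M. (\<Sum>k\<in>{k0 - 1<..n}. Q k (w n k) \<omega>) > \<kappa>}) + \<kappa> / a\<^sup>2"
    proof (rule martingale_tail_bound[where F = F, OF prob_space_axioms F_sub F_mono A_sets])
      fix k assume "k0 - 1 < k" "k \<le> n"
      then have k: "k \<ge> 1" by auto
      show "(\<lambda>\<omega>. w n k \<bullet> X k \<omega>) \<in> borel_measurable (F k)" using X_adapted[OF k] by measurable
      show "cond_exp_version M (F (k - 1)) (\<lambda>\<omega>. w n k \<bullet> X k \<omega>) (\<lambda>_. 0)"
        by (rule square_integrable_vector.linear_version[OF vec[OF k] X_mean[OF k]])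
      show "cond_exp_version M (F (k - 1)) (\<lambda>\<omega>. (w n k \<bullet> X k \<omega>)\<^sup>2) (Q k (w n k))"
        by (rule square_integrable_vector.quad_version[OF vec[OF k]])
    qed (use a \<kappa> in \<open>auto simp: quad_version_def\<close>)
    then show ?case using elim unfolding iv by simp
  qed
qed

lemma norm_tail:
  fixes Y :: "'a \<Rightarrow> real ^ 'd"
  assumes [measurable]: "Y \<in> borel_measurable M" and "\<And>i. measure M (A \<inter> {\<omega>\<in>space M. \<bar>Y \<omega> $ i\<bar> > a}) < e"
  shows "measure M (A \<inter> {\<omega>\<in>space M. norm (Y \<omega>) > a * real CARD('d)}) < e * real CARD('d)"
proof -
  have [measurable]: "(\<lambda>\<omega>. Y \<omega> $ i) \<in> borel_measurable M" for i
    by (rule measurable_compose[OF assms(1)]) measurable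
  have sub: "A \<inter> {\<omega>\<in>space M. norm (Y \<omega>) > a * real CARD('d)} \<subseteq> (\<Union>i\<in>UNIV. A \<inter> {\<omega>\<in>space M. \<bar>Y \<omega> $ i\<bar> > a})"
  proof
    fix \<omega> assume w: "\<omega> \<in> A \<inter> {\<omega>\<in>space M. norm (Y \<omega>) > a * real CARD('d)}"
    have "\<exists>i. \<bar>Y \<omega> $ i\<bar> > a"
    proof (rule ccontr)
      assume "\<not> (\<exists>i. \<bar>Y \<omega> $ i\<bar> > a)"
      then have "(\<Sum>i\<in>UNIV. \<bar>Y \<omega> $ i\<bar>) \<le> (\<Sum>i\<in>(UNIV :: 'd set). a)" by (intro sum_mono) (auto simp: not_less)
      moreover have "norm (Y \<omega>) \<le> (\<Sum>i\<in>UNIV. \<bar>Y \<omega> $ i\<bar>)" by (rule norm_le_l1_cart)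
      ultimately show False using w by (simp add: mult.commute)
    qed
    then show "\<omega> \<in> (\<Union>i\<in>UNIV. A \<inter> {\<omega>\<in>space M. \<bar>Y \<omega> $ i\<bar> > a})" using w by auto
  qed
  have m: "A \<inter> {\<omega>\<in>space M. \<bar>Y \<omega> $ i\<bar> > a} \<in> sets M" for i by measurable
  have "measure M (A \<inter> {\<omega>\<in>space M. norm (Y \<omega>) > a * real CARD('d)}) \<le> measure M (\<Union>i\<in>UNIV. A \<inter> {\<omega>\<in>space M. \<bar>Y \<omega> $ i\<bar> > a})"
    by (rule finite_measure_mono[OF sub]) (use m in auto)
  also have "\<dots> \<le> (\<Sum>i\<in>UNIV. measure M (A \<inter> {\<omega>\<in>space M. \<bar>Y \<omega> $ i\<bar> > a}))"
    by (rule measure_UNION_le) (use m in auto)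
  also have "\<dots> < (\<Sum>i\<in>(UNIV :: 'd set). e)" by (rule sum_strict_mono) (use assms(2) in auto)
  finally show ?thesis by (simp add: mult.commute)
qed

lemma X_meas: "k \<ge> 1 \<Longrightarrow> X k \<in> borel_measurable M"
  by (rule measurable_from_subalg[OF F_sub X_adapted])

lemma tight:
  assumes e: "e > 0"
  shows "\<exists>K. \<forall>\<^sub>F n in sequentially. measure M (A \<inter> {\<omega>\<in>space M. norm ((1 / s n) *\<^sub>R (\<Sum>k=1..n. b k *\<^sub>R X k \<omega>)) > K}) < e"
proof -
  define d where "d = real CARD('d)"
  have d: "d > 0" by (simp add: d_def)
  define \<kappa> where "\<kappa> = 1 + (\<Sum>i\<in>UNIV. \<bar>axis i 1 \<bullet> (\<Gamma> *v axis i 1)\<bar>)"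
  have \<kappa>: "\<kappa> > 0" unfolding \<kappa>_def by (intro add_pos_nonneg sum_nonneg) auto
  \<comment> \<open>Chosen so that \<open>\<kappa> / a^2\<close> is \<open>e / (2 d)\<close>,
    strictly below the share \<open>e / d\<close> of one coordinate.\<close>
  define a where "a = sqrt (2 * \<kappa> * d / e)"
  have a: "a > 0" "\<kappa> / a\<^sup>2 < e / d" using \<kappa> d e by (auto simp: a_def field_simps)
  have "\<forall>\<^sub>F n in sequentially. \<forall>i\<in>UNIV. measure M (A \<inter> {\<omega>\<in>space M. \<bar>\<Sum>k=1..n. ((b k / s n) *\<^sub>R axis i 1) \<bullet> X k \<omega>\<bar> > a}) < e / d"
  proof (intro eventually_ball_finite ballI)
    fix i :: 'd
    show "\<forall>\<^sub>F n in sequentially. measure M (A \<inter> {\<omega>\<in>space M. \<bar>\<Sum>k=1..n. ((b k / s n) *\<^sub>R axis i 1) \<bullet> X k \<omega>\<bar> > a}) < e / d"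
    proof (rule tail_bound[OF order_refl a(1) \<kappa> _ a(2)])
      have "AE \<omega> in M. \<forall>n\<in>{1..}. \<forall>k\<in>{1..}. Q k ((1 / s n) *\<^sub>R (b k *\<^sub>R axis i 1)) \<omega> = (1 / s n)\<^sup>2 * Q k (b k *\<^sub>R axis i 1) \<omega>"
        by (intro AE_all_ge_one Q_scaled)
      then show "AE \<omega> in M. \<omega> \<in> A \<longrightarrow> (\<forall>\<^sub>F n in sequentially. (\<Sum>k=1..n. Q k ((b k / s n) *\<^sub>R axis i 1) \<omega>) \<le> \<kappa>)"
        using Q_average[of "axis i 1"]
      proof (eventually_elim, intro impI)
        fix \<omega> assume h: "\<forall>n\<in>{1..}. \<forall>k\<in>{1..}. Q k ((1 / s n) *\<^sub>R (b k *\<^sub>R axis i 1)) \<omega> = (1 / s n)\<^sup>2 * Q k (b k *\<^sub>R axis i 1) \<omega>"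
          "\<omega> \<in> A \<longrightarrow> (\<lambda>n. (\<Sum>k=1..n. Q k (b k *\<^sub>R axis i 1) \<omega>) / (s n)\<^sup>2) \<longlonglongrightarrow> axis i 1 \<bullet> (\<Gamma> *v axis i 1)
              \<and> (\<lambda>n. Q n (b n *\<^sub>R axis i 1) \<omega> / (s n)\<^sup>2) \<longlonglongrightarrow> 0" "\<omega> \<in> A"
        have "\<bar>axis i 1 \<bullet> (\<Gamma> *v axis i 1)\<bar> \<le> (\<Sum>i\<in>UNIV. \<bar>axis i 1 \<bullet> (\<Gamma> *v axis i 1)\<bar>)" by (intro member_le_sum) auto
        then have "axis i 1 \<bullet> (\<Gamma> *v axis i 1) < \<kappa>" unfolding \<kappa>_def by linarith
        then have "\<forall>\<^sub>F n in sequentially. (\<Sum>k=1..n. Q k (b k *\<^sub>R axis i 1) \<omega>) / (s n)\<^sup>2 < \<kappa>"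
          using h by (intro order_tendstoD) auto
        then show "\<forall>\<^sub>F n in sequentially. (\<Sum>k=1..n. Q k ((b k / s n) *\<^sub>R axis i 1) \<omega>) \<le> \<kappa>"
          using eventually_ge_at_top[of 1]
        proof eventually_elim
          case (elim n)
          have "(\<Sum>k=1..n. Q k ((b k / s n) *\<^sub>R axis i 1) \<omega>) = (\<Sum>k=1..n. Q k (b k *\<^sub>R axis i 1) \<omega> / (s n)\<^sup>2)"
          proof (intro sum.cong refl)
            fix k assume "k \<in> {1..n}"
            then show "Q k ((b k / s n) *\<^sub>R axis i 1) \<omega> = Q k (b k *\<^sub>R axis i 1) \<omega> / (s n)\<^sup>2"
              using h(1)[rule_format, of n k] elim by (simp add: power_divide)
          qed
          then show ?case using elim by (simp add: sum_divide_distrib[symmetric])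
        qed
      qed
    qed
  qed simp
  then have "\<forall>\<^sub>F n in sequentially. measure M (A \<inter> {\<omega>\<in>space M. norm ((1 / s n) *\<^sub>R (\<Sum>k=1..n. b k *\<^sub>R X k \<omega>)) > a * d}) < e / d * d"
  proof eventually_elim
    case (elim n)
    have Ym: "(\<lambda>\<omega>. (1 / s n) *\<^sub>R (\<Sum>k=1..n. b k *\<^sub>R X k \<omega>)) \<in> borel_measurable M"
      by (intro borel_measurable_scaleR borel_measurable_const borel_measurable_sum X_meas) auto
    have c: "((1 / s n) *\<^sub>R (\<Sum>k=1..n. b k *\<^sub>R X k \<omega>)) $ i = (\<Sum>k=1..n. ((b k / s n) *\<^sub>R axis i 1) \<bullet> X k \<omega>)" for \<omega> i
      by (simp add: inner_axis' sum_distrib_left)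
    show ?case unfolding d_def by (rule norm_tail[OF Ym]) (use elim in \<open>simp only: c d_def UNIV_I\<close>)
  qed
  then show ?thesis using d by (intro exI[of _ "a * d"]) simp
qed

text \<open>Replacing \<open>B k n\<close> by its limit costs a martingale whose conditional
  variances are weighted by the squares of the operator bounds \<open>g k n\<close>; these average
  to zero, and a pathwise bounded covariance ratio transfers this to the quadratic variation on
  \<open>A\<close>.\<close>

lemma negligible:
  fixes B :: "nat \<Rightarrow> nat \<Rightarrow> real ^ 'd ^ 'd" and g :: "nat \<Rightarrow> nat \<Rightarrow> real"
  assumes k0: "k0 \<ge> 1" and B: "\<And>n k x. k0 \<le> k \<Longrightarrow> k \<le> n \<Longrightarrow> norm (B k n *v x) \<le> g k n * norm x"
    and g: "(\<lambda>n. (\<Sum>k=k0..n. (b k * \<delta> k)\<^sup>2 * (g k n)\<^sup>2) / (s n)\<^sup>2) \<longlonglongrightarrow> 0" and \<eta>: "\<eta> > 0"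
  shows "(\<lambda>n. measure M (A \<inter> {\<omega>\<in>space M. norm ((1 / s n) *\<^sub>R (\<Sum>k=k0..n. b k *\<^sub>R (B k n *v X k \<omega>))) > \<eta>})) \<longlonglongrightarrow> 0"
proof (rule LIMSEQ_I)
  fix e :: real assume e: "e > 0"
  define d where "d = real CARD('d)"
  have d: "d > 0" by (simp add: d_def)
  define a where "a = \<eta> / d"
  have a: "a > 0" using \<eta> d by (simp add: a_def)
  \<comment> \<open>Again half of what one coordinate may contribute: \<open>\<kappa> / a^2\<close>
    equals \<open>e / (2 d)\<close>.\<close>
  define \<kappa> where "\<kappa> = e / d * a\<^sup>2 / 2"
  have \<kappa>: "\<kappa> > 0" "\<kappa> / a\<^sup>2 < e / d" using e d a by (auto simp: \<kappa>_def divide_strict_left_mono)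
  define w where "w i n k = (b k / s n) *\<^sub>R (B k n $ i)" for i n k
  \<comment> \<open>A row is bounded by the operator norm: apply the matrix to its own row and read
    off the corresponding coordinate, which is the squared length of the row.\<close>
  have row: "norm (B k n $ i) \<le> g k n" if "k0 \<le> k" "k \<le> n" for k n i
  proof (cases "B k n $ i = 0")
    case True
    have "0 \<le> norm (B k n *v axis i 1)" by simp
    also have "\<dots> \<le> g k n * norm (axis i 1 :: real ^ 'd)" by (rule B[OF that])
    finally show ?thesis using True by simp
  next
    case False
    have "norm (B k n $ i) * norm (B k n $ i) = (B k n *v (B k n $ i)) $ i"
      by (simp add: matrix_vector_mul_component power2_norm_eq_inner[symmetric] power2_eq_square)
    also have "\<dots> \<le> norm (B k n *v (B k n $ i))" using component_le_norm_cart[of "B k n *v (B k n $ i)" i] by linarith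
    also have "\<dots> \<le> g k n * norm (B k n $ i)" by (rule B[OF that])
    finally show ?thesis using False by simp
  qed
  have "\<forall>\<^sub>F n in sequentially. \<forall>i\<in>UNIV. measure M (A \<inter> {\<omega>\<in>space M. \<bar>\<Sum>k=k0..n. w i n k \<bullet> X k \<omega>\<bar> > a}) < e / d"
  proof (intro eventually_ball_finite ballI)
    fix i :: 'd
    show "\<forall>\<^sub>F n in sequentially. measure M (A \<inter> {\<omega>\<in>space M. \<bar>\<Sum>k=k0..n. w i n k \<bullet> X k \<omega>\<bar> > a}) < e / d"
    proof (rule tail_bound[OF k0 a \<kappa>(1) _ \<kappa>(2)])
      define T where "T k \<omega> = (\<Sum>i\<in>UNIV. real_cond_exp M (F (k - 1)) (\<lambda>\<omega>. X k \<omega> $ i * X k \<omega> $ i) \<omega>)" for k \<omega>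
      have "AE \<omega> in M. \<forall>n\<in>{1..}. \<forall>k\<in>{1..}. Q k (w i n k) \<omega> \<le> (norm (w i n k))\<^sup>2 * T k \<omega>"
        unfolding T_def by (intro AE_all_ge_one square_integrable_vector.quad_version_le[OF vec])
      then show "AE \<omega> in M. \<omega> \<in> A \<longrightarrow> (\<forall>\<^sub>F n in sequentially. (\<Sum>k=k0..n. Q k (w i n k) \<omega>) \<le> \<kappa>)"
        using cov
      proof (eventually_elim, intro impI)
        fix \<omega> assume h: "\<forall>n\<in>{1..}. \<forall>k\<in>{1..}. Q k (w i n k) \<omega> \<le> (norm (w i n k))\<^sup>2 * T k \<omega>"
          "\<omega> \<in> A \<longrightarrow> (\<forall>i j. (\<lambda>n. real_cond_exp M (F (n - 1)) (\<lambda>\<omega>. X n \<omega> $ i * X n \<omega> $ j) \<omega> / (\<delta> n)\<^sup>2) \<longlonglongrightarrow> \<Gamma> $ i $ j)" "\<omega> \<in> A"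
        have "(\<lambda>n. \<Sum>i\<in>UNIV. real_cond_exp M (F (n - 1)) (\<lambda>\<omega>. X n \<omega> $ i * X n \<omega> $ i) \<omega> / (\<delta> n)\<^sup>2) \<longlonglongrightarrow> (\<Sum>i\<in>UNIV. \<Gamma> $ i $ i)"
          using h by (intro tendsto_sum) auto
        then have "(\<lambda>n. T n \<omega> / (\<delta> n)\<^sup>2) \<longlonglongrightarrow> (\<Sum>i\<in>UNIV. \<Gamma> $ i $ i)" by (simp add: T_def sum_divide_distrib)
        then have "Bseq (\<lambda>n. T n \<omega> / (\<delta> n)\<^sup>2)" by (intro convergent_imp_Bseq) (auto simp: convergent_def)
        then obtain K where K: "K > 0" "\<And>n. \<bar>T n \<omega> / (\<delta> n)\<^sup>2\<bar> \<le> K" by (auto simp: Bseq_def)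
        have "(\<lambda>n. K * ((\<Sum>k=k0..n. (b k * \<delta> k)\<^sup>2 * (g k n)\<^sup>2) / (s n)\<^sup>2)) \<longlonglongrightarrow> K * 0"
          by (intro tendsto_mult tendsto_const g)
        then have "\<forall>\<^sub>F n in sequentially. K * ((\<Sum>k=k0..n. (b k * \<delta> k)\<^sup>2 * (g k n)\<^sup>2) / (s n)\<^sup>2) < \<kappa>"
          using \<kappa> by (intro order_tendstoD) auto
        then show "\<forall>\<^sub>F n in sequentially. (\<Sum>k=k0..n. Q k (w i n k) \<omega>) \<le> \<kappa>"
          using eventually_ge_at_top[of 1]
        proof eventually_elim
          case (elim n)
          have "(\<Sum>k=k0..n. Q k (w i n k) \<omega>) \<le> (\<Sum>k=k0..n. K * ((b k * \<delta> k)\<^sup>2 * (g k n)\<^sup>2 / (s n)\<^sup>2))"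
          proof (rule sum_mono)
            fix k assume k: "k \<in> {k0..n}"
            then have k1: "k \<ge> 1" using k0 by auto
            have "Q k (w i n k) \<omega> \<le> (norm (w i n k))\<^sup>2 * T k \<omega>" using h(1) elim k1 by auto
            also have "(norm (w i n k))\<^sup>2 = (b k / s n)\<^sup>2 * (norm (B k n $ i))\<^sup>2" by (simp add: w_def power_mult_distrib power_divide)
            also have "(b k / s n)\<^sup>2 * (norm (B k n $ i))\<^sup>2 * T k \<omega> \<le> (b k / s n)\<^sup>2 * (norm (B k n $ i))\<^sup>2 * (K * (\<delta> k)\<^sup>2)"
            proof (rule mult_left_mono)
              have "T k \<omega> / (\<delta> k)\<^sup>2 \<le> K" using K(2)[of k] by linarith
              then show "T k \<omega> \<le> K * (\<delta> k)\<^sup>2" using \<delta>_pos[OF k1] by (simp add: pos_divide_le_eq)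
            qed simp
            also have "\<dots> \<le> (b k / s n)\<^sup>2 * (g k n)\<^sup>2 * (K * (\<delta> k)\<^sup>2)"
              using row[of k n i] k K(1) by (intro mult_right_mono mult_left_mono power_mono) auto
            also have "\<dots> = K * ((b k * \<delta> k)\<^sup>2 * (g k n)\<^sup>2 / (s n)\<^sup>2)" by (simp add: power_mult_distrib power_divide)
            finally show "Q k (w i n k) \<omega> \<le> K * ((b k * \<delta> k)\<^sup>2 * (g k n)\<^sup>2 / (s n)\<^sup>2)" .
          qed
          also have "\<dots> = K * ((\<Sum>k=k0..n. (b k * \<delta> k)\<^sup>2 * (g k n)\<^sup>2) / (s n)\<^sup>2)"
            by (simp add: sum_distrib_left sum_divide_distrib)
          finally show ?case using elim by simp
        qed
      qed
    qed
  qed simp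
  then have "\<forall>\<^sub>F n in sequentially. measure M (A \<inter> {\<omega>\<in>space M. norm ((1 / s n) *\<^sub>R (\<Sum>k=k0..n. b k *\<^sub>R (B k n *v X k \<omega>))) > a * d}) < e / d * d"
  proof eventually_elim
    case (elim n)
    have BX: "(\<lambda>\<omega>. B k n *v X k \<omega>) \<in> borel_measurable M" if "k \<ge> 1" for k
      by (rule measurable_compose[OF X_meas[OF that]])
         (intro borel_measurable_continuous_onI matrix_vector_mult_linear_continuous_on)
    have Ym: "(\<lambda>\<omega>. (1 / s n) *\<^sub>R (\<Sum>k=k0..n. b k *\<^sub>R (B k n *v X k \<omega>))) \<in> borel_measurable M"
      using k0 by (intro borel_measurable_scaleR borel_measurable_const borel_measurable_sum BX) auto
    have c: "((1 / s n) *\<^sub>R (\<Sum>k=k0..n. b k *\<^sub>R (B k n *v X k \<omega>))) $ i = (\<Sum>k=k0..n. w i n k \<bullet> X k \<omega>)" for \<omega> i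
      by (simp add: w_def matrix_vector_mul_component sum_distrib_left)
    show ?case unfolding d_def by (rule norm_tail[OF Ym]) (use elim in \<open>simp only: c d_def UNIV_I\<close>)
  qed
  then have "\<forall>\<^sub>F n in sequentially. measure M (A \<inter> {\<omega>\<in>space M. norm ((1 / s n) *\<^sub>R (\<Sum>k=k0..n. b k *\<^sub>R (B k n *v X k \<omega>))) > \<eta>}) < e"
    using d by (simp add: a_def)
  then show "\<exists>n0. \<forall>n\<ge>n0. norm (measure M (A \<inter> {\<omega>\<in>space M. norm ((1 / s n) *\<^sub>R (\<Sum>k=k0..n. b k *\<^sub>R (B k n *v X k \<omega>))) > \<eta>}) - 0) < e"
    by (auto simp: eventually_sequentially)
qed


text \<open>The Lindeberg condition is stated for a dominating sequence \<open>Z\<close> and with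
  extended nonnegative conditional expectations, because in the application only the truncated noise
  \<open>X\<close> is known to be square integrable while the assumption concerns the original
  noise.\<close>

lemma clt:
  fixes Z :: "nat \<Rightarrow> 'a \<Rightarrow> real ^ 'd"
  assumes Zm: "\<And>k. k \<ge> 1 \<Longrightarrow> Z k \<in> borel_measurable M"
    and dom: "\<And>k \<omega>. k \<ge> 1 \<Longrightarrow> \<omega> \<in> space M \<Longrightarrow> norm (X k \<omega>) \<le> norm (Z k \<omega>)"
    and lind: "\<And>\<epsilon> \<eta> :: real. \<epsilon> > 0 \<Longrightarrow> \<eta> > 0 \<Longrightarrow> (\<lambda>n. measure M (A \<inter> {\<omega>\<in>space M.
      (\<Sum>l=1..n. ennreal ((b l)\<^sup>2 / (s n)\<^sup>2) * nn_cond_exp M (F (l - 1))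
        (\<lambda>\<omega>'. ennreal (indicator {\<epsilon> * s n / b l <..} (norm (Z l \<omega>')) * (norm (Z l \<omega>'))\<^sup>2)) \<omega>) > ennreal \<eta>})) \<longlonglongrightarrow> 0"
  shows "(\<lambda>n. \<integral>\<omega>. indicator A \<omega> * iexp (u \<bullet> ((1 / s n) *\<^sub>R (\<Sum>k=1..n. b k *\<^sub>R X k \<omega>))) \<partial>M)
    \<longlonglongrightarrow> of_real (measure M A * exp (- (u \<bullet> (\<Gamma> *v u)) / 2))"
\<comment> \<open>On a null event both sides vanish. The case is separated because nonnegativity of
  the limit variance is read off from paths in \<open>A\<close>.\<close>
proof (cases "measure M A = 0")
  case True
  then have "emeasure M A = 0" by (simp add: emeasure_eq_measure)
  then have "AE \<omega> in M. \<omega> \<notin> A" by (rule AE_not_in[OF null_setsI]) (rule A_sets)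
  then have "(\<integral>\<omega>. indicator A \<omega> * iexp (u \<bullet> ((1 / s n) *\<^sub>R (\<Sum>k=1..n. b k *\<^sub>R X k \<omega>))) \<partial>M) = 0" for n
    by (intro integral_eq_zero_AE) (auto elim: eventually_mono)
  then show ?thesis using True by simp
next
  case False
  then have A0: "measure M A > 0" by (simp add: zero_less_measure_iff)
  define Y where "Y k \<omega> = (b k *\<^sub>R u) \<bullet> X k \<omega>" for k \<omega>
  define T where "T \<epsilon> n k \<omega> = (Y k \<omega>)\<^sup>2 * indicator {\<omega>. \<bar>Y k \<omega>\<bar> > \<epsilon> * s n} \<omega>" for \<epsilon> n k \<omega>
  define l where "l \<epsilon> n k \<omega> = max 0 (real_cond_exp M (F (k - 1)) (T \<epsilon> n k) \<omega>)" for \<epsilon> n k \<omega>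
  have fms: "finite_measure_subalgebra M (F k)" for k by unfold_locales (rule F_sub)
  have Ym [measurable]: "Y k \<in> borel_measurable M" if "k \<ge> 1" for k
    unfolding Y_def using X_meas[OF that] by measurable
  have Tm: "T \<epsilon> n k \<in> borel_measurable M" if "k \<ge> 1" for \<epsilon> n k
  proof -
    note [measurable] = Ym[OF that]
    have "T \<epsilon> n k = (\<lambda>\<omega>. if \<bar>Y k \<omega>\<bar> > \<epsilon> * s n then (Y k \<omega>)\<^sup>2 else 0)" by (auto simp: T_def)
    also have "\<dots> \<in> borel_measurable M" by measurable
    finally show ?thesis .
  qed
  have Ti: "integrable M (T \<epsilon> n k)" if "k \<ge> 1" for \<epsilon> n k
  proof (rule Bochner_Integration.integrable_bound[OF square_integrable_vector.int_square[OF vec[OF that], of "b k *\<^sub>R u"] Tm[OF that]])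
    show "AE \<omega> in M. norm (T \<epsilon> n k \<omega>) \<le> norm (((b k *\<^sub>R u) \<bullet> X k \<omega>)\<^sup>2)" by (auto simp: T_def Y_def indicator_def)
  qed
  have T0: "0 \<le> T \<epsilon> n k \<omega>" for \<epsilon> n k \<omega> by (simp add: T_def)
  have lver: "cond_exp_version M (F (k - 1)) (T \<epsilon> n k) (l \<epsilon> n k)" if k: "k \<ge> 1" for \<epsilon> n k
  proof -
    interpret finite_measure_subalgebra M "F (k - 1)" by (rule fms)
    have "AE \<omega> in M. real_cond_exp M (F (k - 1)) (T \<epsilon> n k) \<omega> \<ge> 0"
      by (rule real_cond_exp_pos) (use T0 Tm[OF k] in auto)
    then have "AE \<omega> in M. real_cond_exp M (F (k - 1)) (T \<epsilon> n k) \<omega> = l \<epsilon> n k \<omega>" by eventually_elim (simp add: l_def)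
    then show ?thesis using Ti[OF k] by (auto simp: cond_exp_version_def l_def[abs_def])
  qed
  \<comment> \<open>Adding \<open>1\<close> keeps the scaling factor positive for
    \<open>u = 0\<close>, so that thresholds may be divided by it.\<close>
  define U where "U = norm u + 1"
  have U: "U > 0" "norm u \<le> U" by (auto simp: U_def add_nonneg_pos)
  define W where "W \<epsilon> n k \<omega> = ennreal (indicator {\<epsilon> * s n / b k <..} (norm (Z k \<omega>)) * (norm (Z k \<omega>))\<^sup>2)" for \<epsilon> n k \<omega>
  have Wm: "W \<epsilon> n k \<in> borel_measurable M" if "k \<ge> 1" for \<epsilon> n k
  proof -
    note [measurable] = Zm[OF that]
    show ?thesis unfolding W_def by measurable
  qed
  have lle: "AE \<omega> in M. ennreal (l \<epsilon> n k \<omega>) \<le> ennreal (U\<^sup>2 * (b k)\<^sup>2) * nn_cond_exp M (F (k - 1)) (W (\<epsilon> / U) n k) \<omega>"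
    if k: "k \<ge> 1" for \<epsilon> n k
  proof -
    interpret finite_measure_subalgebra M "F (k - 1)" by (rule fms)
    have dom': "ennreal (T \<epsilon> n k \<omega>) \<le> ennreal (U\<^sup>2 * (b k)\<^sup>2) * W (\<epsilon> / U) n k \<omega>" if w: "\<omega> \<in> space M" for \<omega>
    proof (cases "\<bar>Y k \<omega>\<bar> > \<epsilon> * s n")
      case True
      have "\<bar>Y k \<omega>\<bar> \<le> b k * (norm u * norm (X k \<omega>))"
        using Cauchy_Schwarz_ineq2[of u "X k \<omega>"] b_pos[OF k] by (simp add: Y_def abs_mult)
      also have "\<dots> \<le> b k * (U * norm (Z k \<omega>))"
        using b_pos[OF k] U dom[OF k w] by (intro mult_left_mono mult_mono) auto
      finally have Yle: "\<bar>Y k \<omega>\<bar> \<le> b k * U * norm (Z k \<omega>)" by simp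
      with True have "\<epsilon> * s n < b k * U * norm (Z k \<omega>)" by simp
      then have "\<epsilon> / U * s n / b k < norm (Z k \<omega>)" using U b_pos[OF k] by (simp add: field_simps)
      then have "W (\<epsilon> / U) n k \<omega> = ennreal ((norm (Z k \<omega>))\<^sup>2)" by (simp add: W_def)
      moreover have "(Y k \<omega>)\<^sup>2 \<le> (b k * U * norm (Z k \<omega>))\<^sup>2" using Yle by (metis abs_ge_zero power2_abs power_mono)
      then have "T \<epsilon> n k \<omega> \<le> U\<^sup>2 * (b k)\<^sup>2 * (norm (Z k \<omega>))\<^sup>2" using True by (simp add: T_def power_mult_distrib algebra_simps)
      ultimately show ?thesis by (simp add: ennreal_mult[symmetric] ennreal_leI)
    qed (simp add: T_def)
    have m1: "(\<lambda>\<omega>. ennreal (T \<epsilon> n k \<omega>)) \<in> borel_measurable M" using Tm[OF k] by measurable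
    have m2: "(\<lambda>\<omega>. ennreal (U\<^sup>2 * (b k)\<^sup>2) * W (\<epsilon> / U) n k \<omega>) \<in> borel_measurable M" using Wm[OF k] by measurable
    have "AE \<omega> in M. nn_cond_exp M (F (k - 1)) (\<lambda>\<omega>. ennreal (T \<epsilon> n k \<omega>)) \<omega>
        \<le> nn_cond_exp M (F (k - 1)) (\<lambda>\<omega>. ennreal (U\<^sup>2 * (b k)\<^sup>2) * W (\<epsilon> / U) n k \<omega>) \<omega>"
      by (rule nn_cond_exp_mono[OF _ m1 m2]) (use dom' in auto)
    moreover have "AE \<omega> in M. ennreal (U\<^sup>2 * (b k)\<^sup>2) * nn_cond_exp M (F (k - 1)) (W (\<epsilon> / U) n k) \<omega>
        = nn_cond_exp M (F (k - 1)) (\<lambda>\<omega>. ennreal (U\<^sup>2 * (b k)\<^sup>2) * W (\<epsilon> / U) n k \<omega>) \<omega>"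
      by (rule nn_cond_exp_prod) (use Wm[OF k] in auto)
    ultimately show ?thesis
    proof eventually_elim
      case (elim \<omega>)
      have "real_cond_exp M (F (k - 1)) (T \<epsilon> n k) \<omega> \<le> enn2real (nn_cond_exp M (F (k - 1)) (\<lambda>\<omega>. ennreal (T \<epsilon> n k \<omega>)) \<omega>)"
        by (simp add: real_cond_exp_def)
      then have "l \<epsilon> n k \<omega> \<le> enn2real (nn_cond_exp M (F (k - 1)) (\<lambda>\<omega>. ennreal (T \<epsilon> n k \<omega>)) \<omega>)"
        by (simp add: l_def)
      then have "ennreal (l \<epsilon> n k \<omega>) \<le> ennreal (enn2real (nn_cond_exp M (F (k - 1)) (\<lambda>\<omega>. ennreal (T \<epsilon> n k \<omega>)) \<omega>))"
        by (rule ennreal_leI)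
      also have "\<dots> \<le> nn_cond_exp M (F (k - 1)) (\<lambda>\<omega>. ennreal (T \<epsilon> n k \<omega>)) \<omega>" by (simp add: ennreal_enn2real_if)
      finally show ?case using elim by simp
    qed
  qed
  have "(\<lambda>n. \<integral>\<omega>. indicator A \<omega> * iexp ((\<Sum>k=1..n. Y k \<omega>) / s n) \<partial>M) \<longlonglongrightarrow> of_real (measure M A * exp (- (u \<bullet> (\<Gamma> *v u)) / 2))"
  proof (rule martingale_clt_on_event[where F = F and y = "\<lambda>k. Q k (b k *\<^sub>R u)" and l = l,
        OF prob_space_axioms F_sub F_mono A_sets A_approx s_pos s_mono s_at_top])
    fix k :: nat assume k: "k \<ge> 1"
    show "Y k \<in> borel_measurable (F k)" unfolding Y_def using X_adapted[OF k] by measurable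
    show "cond_exp_version M (F (k - 1)) (Y k) (\<lambda>_. 0)"
      using square_integrable_vector.linear_version[OF vec[OF k] X_mean[OF k], of "b k *\<^sub>R u"] by (simp only: Y_def[abs_def])
    show "cond_exp_version M (F (k - 1)) (\<lambda>\<omega>. (Y k \<omega>)\<^sup>2) (Q k (b k *\<^sub>R u))"
      using square_integrable_vector.quad_version[OF vec[OF k], of "b k *\<^sub>R u"] by (simp only: Y_def)
    show "cond_exp_version M (F (k - 1)) (\<lambda>\<omega>. (Y k \<omega>)\<^sup>2 * indicator {\<omega>. \<bar>Y k \<omega>\<bar> > \<epsilon> * s n} \<omega>) (l \<epsilon> n k)" for \<epsilon> n
      using lver[OF k, of \<epsilon> n] by (simp only: T_def[abs_def])
  next
    show "AE \<omega> in M. \<omega> \<in> A \<longrightarrow> (\<lambda>n. (\<Sum>k=1..n. Q k (b k *\<^sub>R u) \<omega>) / (s n)\<^sup>2) \<longlonglongrightarrow> u \<bullet> (\<Gamma> *v u)"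
      "AE \<omega> in M. \<omega> \<in> A \<longrightarrow> (\<lambda>n. Q n (b n *\<^sub>R u) \<omega> / (s n)\<^sup>2) \<longlonglongrightarrow> 0"
      using Q_average[of u] by (auto elim!: eventually_mono)
    show "0 \<le> u \<bullet> (\<Gamma> *v u)" by (rule \<Gamma>_psd(2)[OF A0])
    fix \<epsilon> \<eta> :: real assume e: "\<epsilon> > 0" "\<eta> > 0"
    let ?R = "\<lambda>n \<omega>. \<Sum>k=1..n. ennreal ((b k)\<^sup>2 / (s n)\<^sup>2) * nn_cond_exp M (F (k - 1)) (W (\<epsilon> / U) n k) \<omega>"
    have lim: "(\<lambda>n. measure M (A \<inter> {\<omega>\<in>space M. ?R n \<omega> > ennreal (\<eta> / U\<^sup>2)})) \<longlonglongrightarrow> 0"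
      using lind[of "\<epsilon> / U" "\<eta> / U\<^sup>2"] e U unfolding W_def by simp
    show "(\<lambda>n. measure M (A \<inter> {\<omega>\<in>space M. (\<Sum>k=1..n. l \<epsilon> n k \<omega>) / (s n)\<^sup>2 > \<eta>})) \<longlonglongrightarrow> 0"
    proof (rule tendsto_sandwich[OF _ _ tendsto_const lim])
      show "\<forall>\<^sub>F n in sequentially. measure M (A \<inter> {\<omega>\<in>space M. (\<Sum>k=1..n. l \<epsilon> n k \<omega>) / (s n)\<^sup>2 > \<eta>})
          \<le> measure M (A \<inter> {\<omega>\<in>space M. ?R n \<omega> > ennreal (\<eta> / U\<^sup>2)})"
        using eventually_ge_at_top[of 1]
      proof eventually_elim
        case (elim n)
        have "AE \<omega> in M. \<forall>k\<in>{1..}. ennreal (l \<epsilon> n k \<omega>) \<le> ennreal (U\<^sup>2 * (b k)\<^sup>2) * nn_cond_exp M (F (k - 1)) (W (\<epsilon> / U) n k) \<omega>"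
          by (rule AE_all_ge_one) (rule lle)
        then have "AE \<omega> in M. \<omega> \<in> A \<inter> {\<omega>\<in>space M. (\<Sum>k=1..n. l \<epsilon> n k \<omega>) / (s n)\<^sup>2 > \<eta>} \<longrightarrow>
            \<omega> \<in> A \<inter> {\<omega>\<in>space M. ?R n \<omega> > ennreal (\<eta> / U\<^sup>2)}"
        proof (eventually_elim, intro impI)
          fix \<omega> assume h: "\<forall>k\<in>{1..}. ennreal (l \<epsilon> n k \<omega>) \<le> ennreal (U\<^sup>2 * (b k)\<^sup>2) * nn_cond_exp M (F (k - 1)) (W (\<epsilon> / U) n k) \<omega>"
            and w: "\<omega> \<in> A \<inter> {\<omega>\<in>space M. (\<Sum>k=1..n. l \<epsilon> n k \<omega>) / (s n)\<^sup>2 > \<eta>}"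
          have l0: "0 \<le> l \<epsilon> n k \<omega>" for k by (simp add: l_def)
          have "ennreal ((\<Sum>k=1..n. l \<epsilon> n k \<omega>) / (s n)\<^sup>2) = (\<Sum>k=1..n. ennreal (1 / (s n)\<^sup>2) * ennreal (l \<epsilon> n k \<omega>))"
            using l0 by (simp add: sum_divide_distrib ennreal_mult[symmetric])
          also have "\<dots> \<le> (\<Sum>k=1..n. ennreal (1 / (s n)\<^sup>2) * (ennreal (U\<^sup>2 * (b k)\<^sup>2) * nn_cond_exp M (F (k - 1)) (W (\<epsilon> / U) n k) \<omega>))"
            using h by (intro sum_mono mult_left_mono) auto
          also have "\<dots> = (\<Sum>k=1..n. ennreal (U\<^sup>2) * (ennreal ((b k)\<^sup>2 / (s n)\<^sup>2) * nn_cond_exp M (F (k - 1)) (W (\<epsilon> / U) n k) \<omega>))"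
          proof (intro sum.cong refl)
            fix k
            have "ennreal (1 / (s n)\<^sup>2) * ennreal (U\<^sup>2 * (b k)\<^sup>2) = ennreal (U\<^sup>2) * ennreal ((b k)\<^sup>2 / (s n)\<^sup>2)"
              by (simp add: ennreal_mult[symmetric])
            then show "ennreal (1 / (s n)\<^sup>2) * (ennreal (U\<^sup>2 * (b k)\<^sup>2) * nn_cond_exp M (F (k - 1)) (W (\<epsilon> / U) n k) \<omega>)
              = ennreal (U\<^sup>2) * (ennreal ((b k)\<^sup>2 / (s n)\<^sup>2) * nn_cond_exp M (F (k - 1)) (W (\<epsilon> / U) n k) \<omega>)"
              by (simp only: mult.assoc[symmetric])
          qed
          also have "\<dots> = ennreal (U\<^sup>2) * ?R n \<omega>" by (simp only: sum_distrib_left)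
          finally have le: "ennreal ((\<Sum>k=1..n. l \<epsilon> n k \<omega>) / (s n)\<^sup>2) \<le> ennreal (U\<^sup>2) * ?R n \<omega>" .
          have "?R n \<omega> > ennreal (\<eta> / U\<^sup>2)"
          proof (rule ccontr)
            assume "\<not> ?R n \<omega> > ennreal (\<eta> / U\<^sup>2)"
            then have "ennreal (U\<^sup>2) * ?R n \<omega> \<le> ennreal (U\<^sup>2) * ennreal (\<eta> / U\<^sup>2)" by (intro mult_left_mono) (auto simp: not_less)
            also have "\<dots> = ennreal \<eta>" using U e by (simp add: ennreal_mult[symmetric])
            finally have "ennreal ((\<Sum>k=1..n. l \<epsilon> n k \<omega>) / (s n)\<^sup>2) \<le> ennreal \<eta>" using le by simp
            then show False using w e by (simp add: ennreal_le_iff)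
          qed
          then show "\<omega> \<in> A \<inter> {\<omega>\<in>space M. ?R n \<omega> > ennreal (\<eta> / U\<^sup>2)}" using w by auto
        qed
        moreover have "A \<inter> {\<omega>\<in>space M. ?R n \<omega> > ennreal (\<eta> / U\<^sup>2)} \<in> sets M"
        proof -
          have "(\<lambda>\<omega>. ?R n \<omega>) \<in> borel_measurable M"
            by (intro borel_measurable_sum borel_measurable_times_ennreal borel_measurable_const borel_measurable_nn_cond_exp2)
          then show ?thesis by measurable
        qed
        ultimately show ?case by (rule finite_measure_mono_AE)
      qed
    qed simp
  qed (auto simp: quad_version_def l_def)
  moreover have "u \<bullet> ((1 / s n) *\<^sub>R (\<Sum>k=1..n. b k *\<^sub>R X k \<omega>)) = (\<Sum>k=1..n. Y k \<omega>) / s n" for n \<omega>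
    by (simp add: Y_def inner_sum_right)
  ultimately show ?thesis by (simp only:)
qed

end

text \<open>Slutsky's theorem on an event, carried out on characteristic functions; tightness of the
  sum is inherited from its two summands.\<close>

lemma converges_in_law_on_perturbed:
  fixes U W :: "nat \<Rightarrow> 'a \<Rightarrow> real ^ 'd"
  assumes M: "prob_space M" and A: "A \<in> sets M"
    and U: "\<And>n. n \<ge> 1 \<Longrightarrow> U n \<in> borel_measurable M" and W: "\<And>n. n \<ge> 1 \<Longrightarrow> W n \<in> borel_measurable M"
    and \<nu>: "prob_space \<nu>" "sets \<nu> = sets borel"
    and cf: "\<And>u. (\<lambda>n. \<integral>\<omega>. indicator A \<omega> * iexp (u \<bullet> U n \<omega>) \<partial>M) \<longlonglongrightarrow> of_real (measure M A) * (\<integral>x. iexp (u \<bullet> x) \<partial>\<nu>)"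
    and tight: "\<And>e. e > 0 \<Longrightarrow> \<exists>K. \<forall>\<^sub>F n in sequentially. measure M (A \<inter> {\<omega>\<in>space M. norm (U n \<omega>) > K}) < e"
    and small: "\<And>\<eta>. \<eta> > 0 \<Longrightarrow> (\<lambda>n. measure M (A \<inter> {\<omega>\<in>space M. norm (W n \<omega>) > \<eta>})) \<longlonglongrightarrow> 0"
  shows "converges_in_law_on M A (\<lambda>n \<omega>. U n \<omega> + W n \<omega>) \<nu>"
proof (rule converges_in_law_on_of_characteristic[OF M A _ \<nu>])
  interpret prob_space M by fact
  note [measurable] = A
  show "(\<lambda>\<omega>. U n \<omega> + W n \<omega>) \<in> borel_measurable M" if "n \<ge> 1" for n using U[OF that] W[OF that] by measurable
  show "(\<lambda>n. \<integral>\<omega>. indicator A \<omega> * iexp (u \<bullet> (U n \<omega> + W n \<omega>)) \<partial>M) \<longlonglongrightarrow> of_real (measure M A) * (\<integral>x. iexp (u \<bullet> x) \<partial>\<nu>)" for u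
  proof -
    have "(\<lambda>n. (\<integral>\<omega>. indicator A \<omega> * iexp (u \<bullet> (U n \<omega> + W n \<omega>)) \<partial>M) - (\<integral>\<omega>. indicator A \<omega> * iexp (u \<bullet> U n \<omega>) \<partial>M)) \<longlonglongrightarrow> 0"
    proof (rule LIMSEQ_I)
      fix e :: real assume e: "e > 0"
      \<comment> \<open>Where the perturbation is below \<open>\<eta>\<close> the exponentials
        differ by at most \<open>e / 2\<close>; elsewhere by at most \<open>2\<close>, on a set of
        probability below \<open>e / 4\<close>.\<close>
      define \<eta> where "\<eta> = e / (2 * (norm u + 1))"
      have nu: "norm u + 1 > 0" by (simp add: add_nonneg_pos)
      have \<eta>: "\<eta> > 0" using e nu by (simp add: \<eta>_def)
      have "\<forall>\<^sub>F n in sequentially. measure M (A \<inter> {\<omega>\<in>space M. norm (W n \<omega>) > \<eta>}) < e / 4"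
        using small[OF \<eta>] e by (intro order_tendstoD) auto
      then have "\<forall>\<^sub>F n in sequentially. norm ((\<integral>\<omega>. indicator A \<omega> * iexp (u \<bullet> (U n \<omega> + W n \<omega>)) \<partial>M) - (\<integral>\<omega>. indicator A \<omega> * iexp (u \<bullet> U n \<omega>) \<partial>M)) < e"
        using eventually_ge_at_top[of 1]
      proof eventually_elim
        case (elim n)
        note [measurable] = U[OF elim(2)] W[OF elim(2)]
        let ?E = "A \<inter> {\<omega>\<in>space M. norm (W n \<omega>) > \<eta>}"
        have Em: "?E \<in> sets M" by measurable
        have i: "integrable M (\<lambda>\<omega>. indicator A \<omega> * iexp (Y \<omega>))" if [measurable]: "Y \<in> borel_measurable M" for Y :: "'a \<Rightarrow> real"
          by (rule integrable_const_bound[of _ 1]) (auto simp: norm_mult indicator_def)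
        have i1: "integrable M (\<lambda>\<omega>. indicator A \<omega> * iexp (u \<bullet> (U n \<omega> + W n \<omega>)))" by (rule i) measurable
        have i2: "integrable M (\<lambda>\<omega>. indicator A \<omega> * iexp (u \<bullet> U n \<omega>))" by (rule i) measurable
        have b: "norm (indicator A \<omega> * iexp (u \<bullet> (U n \<omega> + W n \<omega>)) - indicator A \<omega> * iexp (u \<bullet> U n \<omega>)) \<le> e / 2 + 2 * indicator ?E \<omega>"
          if w: "\<omega> \<in> space M" for \<omega>
        proof (cases "\<omega> \<in> A")
          case True
          have "indicator A \<omega> * iexp (u \<bullet> (U n \<omega> + W n \<omega>)) - indicator A \<omega> * iexp (u \<bullet> U n \<omega>) = iexp (u \<bullet> U n \<omega>) * (iexp (u \<bullet> W n \<omega>) - 1)"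
            using True by (simp add: inner_add_right distrib_left exp_add right_diff_distrib)
          then have eq: "norm (indicator A \<omega> * iexp (u \<bullet> (U n \<omega> + W n \<omega>)) - indicator A \<omega> * iexp (u \<bullet> U n \<omega>)) = cmod (iexp (u \<bullet> W n \<omega>) - 1)"
            by (simp only: norm_mult norm_exp_i_times mult_1)
          show ?thesis
          proof (cases "norm (W n \<omega>) > \<eta>")
            case True
            have "cmod (iexp (u \<bullet> W n \<omega>) - 1) \<le> 2" by (rule order_trans[OF norm_triangle_ineq4]) simp
            then show ?thesis unfolding eq using True \<open>\<omega> \<in> A\<close> w e by simp
          next
            case False
            have "cmod (iexp (u \<bullet> W n \<omega>) - 1) \<le> \<bar>u \<bullet> W n \<omega>\<bar>" using iexp_approx1[of "u \<bullet> W n \<omega>" 0] by simp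
            also have "\<dots> \<le> norm u * norm (W n \<omega>)" by (rule Cauchy_Schwarz_ineq2)
            also have "\<dots> \<le> (norm u + 1) * \<eta>" using False \<eta> by (intro mult_mono) auto
            also have "\<dots> = e / 2"
            using nu unfolding \<eta>_def by (simp only: times_divide_eq_right) (simp add: divide_eq_eq)
            finally show ?thesis unfolding eq using False by simp
          qed
        qed (use e in auto)
        have "norm (\<integral>\<omega>. indicator A \<omega> * iexp (u \<bullet> (U n \<omega> + W n \<omega>)) - indicator A \<omega> * iexp (u \<bullet> U n \<omega>) \<partial>M) \<le> (\<integral>\<omega>. e / 2 + 2 * indicator ?E \<omega> \<partial>M)"
          by (rule order_trans[OF integral_norm_bound integral_mono[OF integrable_norm[OF Bochner_Integration.integrable_diff[OF i1 i2]] _ b]])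
             (use Em in \<open>simp add: emeasure_eq_measure\<close>)
        also have "(\<integral>\<omega>. e / 2 + 2 * indicator ?E \<omega> \<partial>M) = e / 2 + 2 * measure M ?E" using Em by (simp add: emeasure_eq_measure prob_space)
        also have "\<dots> < e" using elim by simp
        finally show ?case using Bochner_Integration.integral_diff[OF i1 i2] by (simp only:)
      qed
      then show "\<exists>n0. \<forall>n\<ge>n0. norm ((\<integral>\<omega>. indicator A \<omega> * iexp (u \<bullet> (U n \<omega> + W n \<omega>)) \<partial>M) - (\<integral>\<omega>. indicator A \<omega> * iexp (u \<bullet> U n \<omega>) \<partial>M) - 0) < e"
        by (simp add: eventually_sequentially)
    qed
    from tendsto_add[OF this cf[of u]] show ?thesis by simp
  qed
  show "\<exists>K. \<forall>\<^sub>F n in sequentially. measure M (A \<inter> {\<omega>\<in>space M. \<exists>i. \<bar>(U n \<omega> + W n \<omega>) $ i\<bar> > K}) < e" if e: "e > 0" for e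
  proof -
    obtain K where "\<forall>\<^sub>F n in sequentially. measure M (A \<inter> {\<omega>\<in>space M. norm (U n \<omega>) > K}) < e / 2"
      using tight[of "e / 2"] e by auto
    moreover have "\<forall>\<^sub>F n in sequentially. measure M (A \<inter> {\<omega>\<in>space M. norm (W n \<omega>) > 1}) < e / 2"
      using small[of 1] e by (intro order_tendstoD) auto
    ultimately have "\<forall>\<^sub>F n in sequentially. measure M (A \<inter> {\<omega>\<in>space M. \<exists>i. \<bar>(U n \<omega> + W n \<omega>) $ i\<bar> > K + 1}) < e"
      using eventually_ge_at_top[of 1]
    proof eventually_elim
      case (elim n)
      note [measurable] = U[OF elim(3)] W[OF elim(3)]
      have m: "A \<inter> {\<omega>\<in>space M. norm (U n \<omega>) > K} \<in> sets M" "A \<inter> {\<omega>\<in>space M. norm (W n \<omega>) > 1} \<in> sets M" by measurable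
      have "A \<inter> {\<omega>\<in>space M. \<exists>i. \<bar>(U n \<omega> + W n \<omega>) $ i\<bar> > K + 1}
        \<subseteq> (A \<inter> {\<omega>\<in>space M. norm (U n \<omega>) > K}) \<union> (A \<inter> {\<omega>\<in>space M. norm (W n \<omega>) > 1})"
      proof
        fix \<omega> assume w: "\<omega> \<in> A \<inter> {\<omega>\<in>space M. \<exists>i. \<bar>(U n \<omega> + W n \<omega>) $ i\<bar> > K + 1}"
        then obtain i where "\<bar>(U n \<omega> + W n \<omega>) $ i\<bar> > K + 1" by auto
        then have "norm (U n \<omega> + W n \<omega>) > K + 1" using component_le_norm_cart[of "U n \<omega> + W n \<omega>" i] by linarith
        then have "norm (U n \<omega>) > K \<or> norm (W n \<omega>) > 1" using norm_triangle_ineq[of "U n \<omega>" "W n \<omega>"] by linarith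
        then show "\<omega> \<in> (A \<inter> {\<omega>\<in>space M. norm (U n \<omega>) > K}) \<union> (A \<inter> {\<omega>\<in>space M. norm (W n \<omega>) > 1})" using w by auto
      qed
      then have "measure M (A \<inter> {\<omega>\<in>space M. \<exists>i. \<bar>(U n \<omega> + W n \<omega>) $ i\<bar> > K + 1})
         \<le> measure M ((A \<inter> {\<omega>\<in>space M. norm (U n \<omega>) > K}) \<union> (A \<inter> {\<omega>\<in>space M. norm (W n \<omega>) > 1}))"
        using m by (intro finite_measure_mono) auto
      also have "\<dots> \<le> measure M (A \<inter> {\<omega>\<in>space M. norm (U n \<omega>) > K}) + measure M (A \<inter> {\<omega>\<in>space M. norm (W n \<omega>) > 1})"
        using m by (intro measure_Un_le) auto
      finally show ?case using elim by simp
    qed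
    then show ?thesis by blast
  qed
qed

text \<open>On each localizing event the remainder is a pathwise constant plus an integrable part.
  The constant is swallowed by the diverging scale, the integrable part is handled by Markov's
  inequality, and the set of paths not yet localized at level \<open>m\<close> is small for large
  \<open>m\<close>. The constant in the moment bound may depend on \<open>m\<close>, which is
  therefore fixed before \<open>n\<close> grows.\<close>

lemma localized_remainder_negligible:
  fixes Y :: "nat \<Rightarrow> 'a \<Rightarrow> real" and T :: "nat \<Rightarrow> nat \<Rightarrow> 'a \<Rightarrow> real" and a t :: "nat \<Rightarrow> real"
  assumes M: "prob_space M" and A: "A \<in> sets M" and \<Omega>: "\<And>m. \<Omega> m \<in> sets M" "incseq \<Omega>" "A \<subseteq> (\<Union>m. \<Omega> m)"
    and Y: "\<And>n. n \<ge> 1 \<Longrightarrow> Y n \<in> borel_measurable M"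
    and le: "\<And>m \<omega>. m \<ge> m0 \<Longrightarrow> \<omega> \<in> \<Omega> m \<Longrightarrow> \<exists>c. \<forall>n\<ge>m. Y n \<omega> \<le> c + T m n \<omega>"
    and T: "\<And>m n. m \<ge> m0 \<Longrightarrow> n \<ge> m \<Longrightarrow> integrable M (T m n)" "\<And>m n \<omega>. m \<ge> m0 \<Longrightarrow> n \<ge> m \<Longrightarrow> 0 \<le> T m n \<omega>"
      "\<And>m. m \<ge> m0 \<Longrightarrow> \<exists>K. \<forall>n\<ge>m. (\<integral>\<omega>. T m n \<omega> \<partial>M) \<le> K * t n"
    and a: "filterlim a at_top sequentially" and t: "(\<lambda>n. t n / a n) \<longlonglongrightarrow> 0" and \<eta>: "\<eta> > 0"
  shows "(\<lambda>n. measure M (A \<inter> {\<omega>\<in>space M. Y n \<omega> > \<eta> * a n})) \<longlonglongrightarrow> 0"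
proof (rule LIMSEQ_I)
  interpret prob_space M by fact
  note [measurable] = A \<Omega>(1)
  fix e :: real assume e: "e > 0"
  have inc: "incseq (\<lambda>m. A \<inter> \<Omega> m)" using \<Omega>(2) by (auto simp: incseq_def)
  have "(\<lambda>m. measure M (A \<inter> \<Omega> m)) \<longlonglongrightarrow> measure M (\<Union>m. A \<inter> \<Omega> m)"
    by (rule finite_Lim_measure_incseq[OF _ inc]) auto
  also have "(\<Union>m. A \<inter> \<Omega> m) = A" using \<Omega>(3) by auto
  finally have "\<forall>\<^sub>F m in sequentially. measure M A - e / 3 < measure M (A \<inter> \<Omega> m)" using e by (intro order_tendstoD) auto
  then have "\<forall>\<^sub>F m in sequentially. measure M A - e / 3 < measure M (A \<inter> \<Omega> m) \<and> m \<ge> max m0 1"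
    by (intro eventually_conj eventually_ge_at_top)
  then obtain m where m: "measure M A - e / 3 < measure M (A \<inter> \<Omega> m)" "m \<ge> m0" "m \<ge> 1" by (auto simp: eventually_sequentially)
  obtain K where K: "\<And>n. n \<ge> m \<Longrightarrow> (\<integral>\<omega>. T m n \<omega> \<partial>M) \<le> K * t n" using T(3)[OF m(2)] by blast
  have AO: "measure M (A - \<Omega> m) < e / 3"
  proof -
    have "A - \<Omega> m = A - (A \<inter> \<Omega> m)" by auto
    then have "measure M (A - \<Omega> m) = measure M A - measure M (A \<inter> \<Omega> m)"
      using finite_measure_Diff[of A "A \<inter> \<Omega> m"] by simp
    then show ?thesis using m(1) by simp
  qed
  \<comment> \<open>The constant \<open>c\<close> depends on the path and need not be measurable in
    it. The event that \<open>Y - T\<close> exceeds half of the threshold is measurable, and every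
    path eventually avoids it.\<close>
  define E where "E n = (if n \<ge> m then {\<omega>\<in>space M. \<omega> \<in> \<Omega> m \<and> Y n \<omega> - T m n \<omega> > \<eta> / 2 * a n} else {})" for n
  have Em: "E n \<in> sets M" for n
  proof (cases "n \<ge> m")
    case True
    have [measurable]: "T m n \<in> borel_measurable M" "Y n \<in> borel_measurable M" using T(1)[OF m(2) True] Y[of n] True m(3) by auto
    show ?thesis unfolding E_def by simp measurable
  qed (simp add: E_def)
  have a\<eta>: "filterlim (\<lambda>n. \<eta> / 2 * a n) at_top sequentially"
    by (rule filterlim_tendsto_pos_mult_at_top[OF tendsto_const _ a]) (use \<eta> in simp)
  have "(\<lambda>n. measure M (E n)) \<longlonglongrightarrow> 0"
  proof (rule prob_eventually_avoided[OF M Em], rule AE_I2)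
    fix \<omega>
    show "\<forall>\<^sub>F n in sequentially. \<omega> \<notin> E n"
    proof (cases "\<omega> \<in> \<Omega> m")
      case True
      then obtain c where c: "\<And>n. n \<ge> m \<Longrightarrow> Y n \<omega> \<le> c + T m n \<omega>" using le[OF m(2)] by blast
      have "\<forall>\<^sub>F n in sequentially. \<eta> / 2 * a n \<ge> c" using a\<eta> by (simp add: filterlim_at_top)
      then show ?thesis
      proof eventually_elim
        case (elim n)
        then show ?case using c[of n] by (auto simp: E_def)
      qed
    qed (auto simp: E_def)
  qed
  then have e1: "\<forall>\<^sub>F n in sequentially. measure M (E n) < e / 3" using e by (intro order_tendstoD) auto
  have "(\<lambda>n. \<bar>K\<bar> * 2 / \<eta> * \<bar>t n / a n\<bar>) \<longlonglongrightarrow> \<bar>K\<bar> * 2 / \<eta> * \<bar>0\<bar>" by (intro tendsto_intros t)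
  then have e2: "\<forall>\<^sub>F n in sequentially. \<bar>K\<bar> * 2 / \<eta> * \<bar>t n / a n\<bar> < e / 3" using e by (intro order_tendstoD) auto
  have e3: "\<forall>\<^sub>F n in sequentially. a n \<ge> 1" using a by (simp add: filterlim_at_top)
  have "\<forall>\<^sub>F n in sequentially. measure M (A \<inter> {\<omega>\<in>space M. Y n \<omega> > \<eta> * a n}) < e"
    using e1 e2 e3 eventually_ge_at_top[of m]
  proof eventually_elim
    case (elim n)
    note Ti = T(1)[OF m(2) elim(4)]
    have [measurable]: "T m n \<in> borel_measurable M" "Y n \<in> borel_measurable M" using Ti Y[of n] elim m(3) by auto
    let ?G = "{\<omega>\<in>space M. T m n \<omega> \<ge> \<eta> / 2 * a n}"
    have Gm: "?G \<in> sets M" by measurable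
    have "A \<inter> {\<omega>\<in>space M. Y n \<omega> > \<eta> * a n} \<subseteq> (A - \<Omega> m) \<union> (E n \<union> ?G)"
      using elim(4) by (auto simp: E_def)
    then have "measure M (A \<inter> {\<omega>\<in>space M. Y n \<omega> > \<eta> * a n}) \<le> measure M ((A - \<Omega> m) \<union> (E n \<union> ?G))"
      using Em Gm by (intro finite_measure_mono) auto
    also have "\<dots> \<le> measure M (A - \<Omega> m) + measure M (E n \<union> ?G)" using Em Gm by (intro measure_Un_le) auto
    also have "measure M (E n \<union> ?G) \<le> measure M (E n) + measure M ?G" using Em Gm by (intro measure_Un_le) auto
    also have "measure M ?G \<le> (\<integral>\<omega>. T m n \<omega> \<partial>M) / (\<eta> / 2 * a n)"
      using \<eta> elim(3) T(2)[OF m(2) elim(4)] by (intro integral_Markov_inequality_measure[OF Ti, where A = "{}"]) auto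
    also have "\<dots> \<le> (K * t n) / (\<eta> / 2 * a n)" using K[OF elim(4)] \<eta> elim(3) by (intro divide_right_mono) auto
    also have "\<dots> \<le> \<bar>K\<bar> * 2 / \<eta> * \<bar>t n / a n\<bar>"
    proof -
      have "(K * t n) / (\<eta> / 2 * a n) \<le> \<bar>(K * t n) / (\<eta> / 2 * a n)\<bar>" by (rule abs_ge_self)
      also have "\<dots> = \<bar>K\<bar> * 2 / \<eta> * \<bar>t n / a n\<bar>" using \<eta> by (simp add: abs_mult)
      finally show ?thesis .
    qed
    finally show ?case using AO elim(1,2) by linarith
  qed
  then show "\<exists>n0. \<forall>n\<ge>n0. norm (measure M (A \<inter> {\<omega>\<in>space M. Y n \<omega> > \<eta> * a n}) - 0) < e"
    by (auto simp: eventually_sequentially)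
qed

section \<open>The averaged process\<close>

text \<open>The spectral bound is strict, which leaves room for a rate \<open>L'\<close> beyond
  \<open>L\<close>; all later losses are paid from this gap. Invertibility holds because a kernel
  vector would be an eigenvector for \<open>0\<close>, whose real part is not negative.\<close>

lemma contracting_zero_contraction:
  fixes H :: "real ^ 'd ^ 'd"
  assumes zero: "contracting_zero L D f \<theta>s H" and L: "L > 0"
  obtains A \<rho> N h L' where "\<rho> > 0" "N > 0" "h > 0" "L < L'"
    "\<And>g x. 0 \<le> g \<Longrightarrow> g \<le> h \<Longrightarrow> orbit_norm A \<rho> N (x + g *\<^sub>R (H *v x)) \<le> (1 - g * L') * orbit_norm A \<rho> N x"
    "matrix_inv H ** H = mat 1" "H ** matrix_inv H = mat 1"
proof -
  define S where "S = (SUP z \<in> {z. complex_eigenvalue H z}. Re z)"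
  have S: "S < - L" using zero by (simp add: contracting_zero_def S_def)
  obtain K where K: "\<And>z w. w \<noteq> 0 \<Longrightarrow> map_matrix complex_of_real H *v w = z *s w \<Longrightarrow> norm z \<le> K"
    using eigenvalue_norm_bound[of "map_matrix complex_of_real H"] by blast
  \<comment> \<open>The supremum in \<open>contracting_zero\<close> bounds its elements only because
    the set of real parts is bounded above.\<close>
  have bdd: "bdd_above (Re ` {z. complex_eigenvalue H z})"
  proof (rule bdd_aboveI2[of _ _ K])
    fix z assume "z \<in> {z. complex_eigenvalue H z}"
    then have "norm z \<le> K" using K by (auto simp: complex_eigenvalue_def)
    then show "Re z \<le> K" using complex_Re_le_cmod[of z] by linarith
  qed
  have ev: "Re z \<le> - (- S)" if "w \<noteq> 0" "map_matrix complex_of_real H *v w = z *s w" for z w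
    unfolding S_def minus_minus by (rule cSUP_upper[OF _ bdd]) (use that in \<open>auto simp: complex_eigenvalue_def\<close>)
  \<comment> \<open>The midpoint between \<open>L\<close> and the spectral gap
    \<open>- S\<close>.\<close>
  define L' where "L' = (L - S) / 2"
  have L': "0 < L'" "L' < - S" "L < L'" using S L by (auto simp: L'_def)
  obtain A \<rho> N h where c: "\<rho> > 0" "N > 0" "h > 0"
    "\<And>g x. 0 \<le> g \<Longrightarrow> g \<le> h \<Longrightarrow> orbit_norm A \<rho> N (x + g *\<^sub>R (H *v x)) \<le> (1 - g * L') * orbit_norm A \<rho> N x"
    by (rule contracting_matrix_norm[of H "- S" L', OF _ L'(1,2)]) (erule (1) ev, blast)
  have "x = 0" if x: "H *v x = 0" for x
  proof (rule ccontr)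
    assume "x \<noteq> 0"
    define w where "w = (\<chi> i. complex_of_real (x $ i))"
    have "w \<noteq> 0" using \<open>x \<noteq> 0\<close> by (auto simp: w_def vec_eq_iff)
    moreover have "map_matrix complex_of_real H *v w = (\<chi> i. complex_of_real ((H *v x) $ i))"
      by (simp add: vec_eq_iff matrix_vector_mult_def w_def map_matrix_def)
    then have "map_matrix complex_of_real H *v w = 0 *s w" unfolding x by (simp add: vec_eq_iff)
    ultimately have "Re 0 \<le> - (- S)" by (rule ev)
    then show False using S L by simp
  qed
  then obtain B where "B ** H = mat 1" using matrix_left_invertible_ker[of H] by blast
  then have "invertible H" using matrix_left_right_inverse[of B H] by (auto simp: invertible_def)
  then have "H ** matrix_inv H = mat 1 \<and> matrix_inv H ** H = mat 1"
    unfolding invertible_def matrix_inv_def by (rule someI_ex)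
  then show ?thesis using that[OF c(1,2,3) L'(3) c(4)] by blast
qed

text \<open>Converts the extended real assumption into integrability and a bound between real
  numbers. The radius may shrink afterwards, so that one ball serves both noise terms and the
  linearization.\<close>

lemma limsup_second_moment:
  fixes X :: "nat \<Rightarrow> 'a \<Rightarrow> real ^ 'd" and \<theta> :: "nat \<Rightarrow> 'a \<Rightarrow> real ^ 'd"
  assumes X: "\<And>n. n \<ge> 1 \<Longrightarrow> X n \<in> borel_measurable M" and \<theta>: "\<And>n. \<theta> n \<in> borel_measurable M"
    and c: "\<And>n. n \<ge> 1 \<Longrightarrow> c n > 0"
    and lim: "limsup (\<lambda>n. ennreal (1 / c n) * ennreal_sqrt
      (\<integral>\<^sup>+\<omega>. ennreal (indicator (ball \<theta>s \<epsilon>) (\<theta> (n - 1) \<omega>) * (norm (X n \<omega>))\<^sup>2) \<partial>M)) < \<infinity>"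
  obtains C n0 where "C \<ge> 0" "n0 \<ge> (1::nat)"
    "\<And>n r. n \<ge> n0 \<Longrightarrow> r \<le> \<epsilon> \<Longrightarrow> integrable M (\<lambda>\<omega>. indicator (ball \<theta>s r) (\<theta> (n - 1) \<omega>) * (norm (X n \<omega>))\<^sup>2)"
    "\<And>n r. n \<ge> n0 \<Longrightarrow> r \<le> \<epsilon> \<Longrightarrow> (\<integral>\<omega>. indicator (ball \<theta>s r) (\<theta> (n - 1) \<omega>) * (norm (X n \<omega>))\<^sup>2 \<partial>M) \<le> C * (c n)\<^sup>2"
proof -
  define I where "I n = (\<integral>\<^sup>+\<omega>. ennreal (indicator (ball \<theta>s \<epsilon>) (\<theta> (n - 1) \<omega>) * (norm (X n \<omega>))\<^sup>2) \<partial>M)" for n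
  obtain K where K: "limsup (\<lambda>n. ennreal (1 / c n) * ennreal_sqrt (I n)) < K" "K < top"
    using dense[OF lim] by (auto simp: I_def)
  obtain k where k: "K = ennreal k" "k \<ge> 0" using K(2) by (cases K) auto
  have "\<forall>\<^sub>F n in sequentially. ennreal (1 / c n) * ennreal_sqrt (I n) < K"
    by (rule Limsup_lessD[OF K(1)])
  then have "\<forall>\<^sub>F n in sequentially. ennreal (1 / c n) * ennreal_sqrt (I n) < K \<and> n \<ge> 1"
    using eventually_ge_at_top by (rule eventually_conj)
  then obtain n0 where n0: "\<And>n. n \<ge> n0 \<Longrightarrow> ennreal (1 / c n) * ennreal_sqrt (I n) < K \<and> n \<ge> 1"
    by (auto simp: eventually_sequentially)
  have I: "I n \<le> ennreal (k\<^sup>2 * (c n)\<^sup>2)" if n: "n \<ge> n0" for n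
  proof -
    have n1: "n \<ge> 1" and lt: "ennreal (1 / c n) * ennreal_sqrt (I n) < ennreal k" using n0[OF n] k by auto
    note cn = c[OF n1]
    \<comment> \<open>A finite limit superior excludes infinite moments from \<open>n0\<close> on,
      since the prefactor is strictly positive.\<close>
    have fin: "I n \<noteq> \<infinity>"
    proof
      assume "I n = \<infinity>"
      then have "ennreal (1 / c n) * ennreal_sqrt (I n) = top" using cn by (simp add: ennreal_sqrt_def ennreal_mult_top)
      then show False using lt by simp
    qed
    then obtain v where v: "I n = ennreal v" "v \<ge> 0" by (cases "I n") auto
    have "ennreal (1 / c n) * ennreal_sqrt (I n) = ennreal (1 / c n * sqrt v)"
      using v cn fin by (simp add: ennreal_sqrt_def ennreal_mult[symmetric])
    then have "1 / c n * sqrt v < k" using lt k v cn by (simp add: ennreal_less_iff)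
    then have "sqrt v \<le> k * c n" using cn by (simp add: field_simps)
    then have "(sqrt v)\<^sup>2 \<le> (k * c n)\<^sup>2" using v by (intro power_mono) auto
    then show ?thesis using v by (simp add: power_mult_distrib ennreal_leI)
  qed
  have small: "(\<integral>\<^sup>+\<omega>. ennreal (indicator (ball \<theta>s r) (\<theta> (n - 1) \<omega>) * (norm (X n \<omega>))\<^sup>2) \<partial>M) \<le> ennreal (k\<^sup>2 * (c n)\<^sup>2)"
    if "n \<ge> n0" "r \<le> \<epsilon>" for n r
  proof -
    have "(\<integral>\<^sup>+\<omega>. ennreal (indicator (ball \<theta>s r) (\<theta> (n - 1) \<omega>) * (norm (X n \<omega>))\<^sup>2) \<partial>M) \<le> I n"
      unfolding I_def using that(2) by (intro nn_integral_mono ennreal_leI mult_right_mono) (auto simp: indicator_def)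
    then show ?thesis using I[OF that(1)] by simp
  qed
  have meas: "(\<lambda>\<omega>. indicator (ball \<theta>s r) (\<theta> (n - 1) \<omega>) * (norm (X n \<omega>))\<^sup>2) \<in> borel_measurable M" if "n \<ge> n0" for n r
  proof -
    have "n \<ge> 1" using n0[OF that] by simp
    then have [measurable]: "X n \<in> borel_measurable M" "\<theta> (n - 1) \<in> borel_measurable M" using X \<theta> by auto
    have "(\<lambda>\<omega>. indicator (ball \<theta>s r) (\<theta> (n - 1) \<omega>) * (norm (X n \<omega>))\<^sup>2)
        = (\<lambda>\<omega>. if dist \<theta>s (\<theta> (n - 1) \<omega>) < r then (norm (X n \<omega>))\<^sup>2 else 0)"
      by (auto simp: indicator_def)
    also have "\<dots> \<in> borel_measurable M" by measurable
    finally show ?thesis .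
  qed
  have int: "integrable M (\<lambda>\<omega>. indicator (ball \<theta>s r) (\<theta> (n - 1) \<omega>) * (norm (X n \<omega>))\<^sup>2)" if "n \<ge> n0" "r \<le> \<epsilon>" for n r
  proof (rule integrableI_bounded[OF meas[OF that(1)]])
    have "(\<integral>\<^sup>+\<omega>. ennreal (norm (indicator (ball \<theta>s r) (\<theta> (n - 1) \<omega>) * (norm (X n \<omega>))\<^sup>2)) \<partial>M) \<le> ennreal (k\<^sup>2 * (c n)\<^sup>2)"
      using small[OF that] by simp
    then show "(\<integral>\<^sup>+\<omega>. ennreal (norm (indicator (ball \<theta>s r) (\<theta> (n - 1) \<omega>) * (norm (X n \<omega>))\<^sup>2)) \<partial>M) < \<infinity>"
      by (rule le_less_trans) simp
  qed
  show ?thesis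
  proof (rule that[of "k\<^sup>2" "max n0 1"])
    fix n r assume n: "max n0 1 \<le> n" "r \<le> \<epsilon>"
    then show "integrable M (\<lambda>\<omega>. indicator (ball \<theta>s r) (\<theta> (n - 1) \<omega>) * (norm (X n \<omega>))\<^sup>2)" by (intro int) auto
    have "ennreal (\<integral>\<omega>. indicator (ball \<theta>s r) (\<theta> (n - 1) \<omega>) * (norm (X n \<omega>))\<^sup>2 \<partial>M) \<le> ennreal (k\<^sup>2 * (c n)\<^sup>2)"
      using small[of n r] n int[of n r] by (subst nn_integral_eq_integral[symmetric]) auto
    then show "(\<integral>\<omega>. indicator (ball \<theta>s r) (\<theta> (n - 1) \<omega>) * (norm (X n \<omega>))\<^sup>2 \<partial>M) \<le> k\<^sup>2 * (c n)\<^sup>2"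
      by (subst (asm) ennreal_le_iff) auto
  qed auto
qed

lemma local_linearization:
  fixes H :: "real ^ 'd ^ 'd"
  assumes zero: "contracting_zero L D f \<theta>s H"
    and B: "(\<lambda>x. norm (f x - H *v (x - \<theta>s))) \<in> O[at \<theta>s within D](\<lambda>x. norm (x - \<theta>s) powr (1 + lam))"
    and \<kappa>: "\<kappa> > 0"
  obtains r C where "r > 0" "C \<ge> 0" "ball \<theta>s r \<subseteq> interior D"
    "\<And>x. x \<in> ball \<theta>s r \<Longrightarrow> norm (f x - H *v (x - \<theta>s)) \<le> \<kappa> * norm (x - \<theta>s)"
    "\<And>x. x \<in> ball \<theta>s r \<Longrightarrow> norm (f x - H *v (x - \<theta>s)) \<le> C * norm (x - \<theta>s) powr (1 + lam)"
proof -
  have z: "\<theta>s \<in> interior D" "f \<theta>s = 0" "(\<lambda>x. norm (f x - H *v (x - \<theta>s))) \<in> o[at \<theta>s within D](\<lambda>x. norm (x - \<theta>s))"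
    using zero by (auto simp: contracting_zero_def)
  obtain C where C: "C > 0" "\<forall>\<^sub>F x in at \<theta>s within D. norm (norm (f x - H *v (x - \<theta>s))) \<le> C * norm (norm (x - \<theta>s) powr (1 + lam))"
    using landau_o.bigE[OF B] by blast
  have "\<forall>\<^sub>F x in at \<theta>s within D. norm (norm (f x - H *v (x - \<theta>s))) \<le> \<kappa> * norm (norm (x - \<theta>s))"
    using landau_o.smallD[OF z(3) \<kappa>] .
  with C(2) have "\<forall>\<^sub>F x in at \<theta>s within D. norm (f x - H *v (x - \<theta>s)) \<le> \<kappa> * norm (x - \<theta>s) \<and>
      norm (f x - H *v (x - \<theta>s)) \<le> C * norm (x - \<theta>s) powr (1 + lam)"
    by eventually_elim auto
  then obtain r1 where r1: "r1 > 0" "\<And>x. x \<in> D \<Longrightarrow> x \<noteq> \<theta>s \<Longrightarrow> dist x \<theta>s < r1 \<Longrightarrow> norm (f x - H *v (x - \<theta>s)) \<le> \<kappa> * norm (x - \<theta>s) \<and>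
      norm (f x - H *v (x - \<theta>s)) \<le> C * norm (x - \<theta>s) powr (1 + lam)"
    unfolding eventually_at by blast
  obtain r2 where r2: "r2 > 0" "ball \<theta>s r2 \<subseteq> interior D"
    using z(1) open_interior[of D] openE by blast
  have "ball \<theta>s (min r1 r2) \<subseteq> ball \<theta>s r2" by (rule subset_ball) simp
  then have sub: "ball \<theta>s (min r1 r2) \<subseteq> interior D" using r2 by blast
  have *: "norm (f x - H *v (x - \<theta>s)) \<le> \<kappa> * norm (x - \<theta>s) \<and> norm (f x - H *v (x - \<theta>s)) \<le> C * norm (x - \<theta>s) powr (1 + lam)"
    if "x \<in> ball \<theta>s (min r1 r2)" for x
  \<comment> \<open>The Landau estimates hold near the zero but say nothing at the point itself;
    there \<open>f \<theta>s = 0\<close> takes over.\<close>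
  proof (cases "x = \<theta>s")
    case False
    have "x \<in> D" using that sub interior_subset by blast
    then show ?thesis using r1(2)[of x] False that by (simp add: dist_commute)
  qed (use z(2) in simp)
  show ?thesis by (rule that[of "min r1 r2" C]) (use r1 r2 C sub * in auto)
qed

lemma vector_weighted_average:
  fixes \<rho> :: "nat \<Rightarrow> real ^ 'd"
  assumes "\<And>k. k \<ge> 1 \<Longrightarrow> 0 \<le> w k" "filterlim (\<lambda>n. \<Sum>k=1..n. w k) at_top sequentially" "\<rho> \<longlonglongrightarrow> \<mu>"
  shows "(\<lambda>n. (1 / (\<Sum>k=1..n. w k)) *\<^sub>R (\<Sum>k=1..n. w k *\<^sub>R \<rho> k)) \<longlonglongrightarrow> \<mu>"
proof (rule vec_tendstoI)
  fix i
  have "(\<lambda>n. \<rho> n $ i) \<longlonglongrightarrow> \<mu> $ i" using assms(3) by (rule tendsto_vec_nth)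
  from weighted_average_tendsto[OF assms(1,2) this]
  show "(\<lambda>n. ((1 / (\<Sum>k=1..n. w k)) *\<^sub>R (\<Sum>k=1..n. w k *\<^sub>R \<rho> k)) $ i) \<longlonglongrightarrow> \<mu> $ i"
    by (simp add: sum_component)
qed

lemma bounded_matrix: "\<exists>C>0. \<forall>x. norm ((A :: real ^ 'd ^ 'd) *v x) \<le> C * norm x"
proof -
  have "bounded_linear ((*v) A)" by (rule matrix_vector_mul_bounded_linear)
  then obtain K where "K > 0" "\<And>x. norm (A *v x) \<le> norm x * K" using bounded_linear.pos_bounded by blast
  then show ?thesis by (intro exI[of _ K]) (simp add: mult.commute)
qed

text \<open>Writing \<open>B = - Hi + (B + Hi)\<close>, the constant part gives the average of
  \<open>\<rho>\<close> up to finitely many indices, and the deviation is controlled by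
  \<open>g\<close> together with the boundedness of \<open>\<rho>\<close>.\<close>

lemma bias_limit:
  fixes \<rho> :: "nat \<Rightarrow> real ^ 'd" and B :: "nat \<Rightarrow> nat \<Rightarrow> real ^ 'd ^ 'd"
  assumes w: "\<And>k. k \<ge> 1 \<Longrightarrow> 0 \<le> w k" and W: "filterlim (\<lambda>n. \<Sum>k=1..n. w k) at_top sequentially" and \<rho>: "\<rho> \<longlonglongrightarrow> \<mu>"
    and k0: "k0 \<ge> 1" and B: "\<And>n k x. k0 \<le> k \<Longrightarrow> k \<le> n \<Longrightarrow> norm ((B k n + Hi) *v x) \<le> g k n * norm x"
    and g: "\<And>k n. k0 \<le> k \<Longrightarrow> k \<le> n \<Longrightarrow> 0 \<le> g k n" "(\<lambda>n. (\<Sum>k=k0..n. w k * g k n) / (\<Sum>k=1..n. w k)) \<longlonglongrightarrow> 0"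
  shows "(\<lambda>n. (1 / (\<Sum>k=1..n. w k)) *\<^sub>R (\<Sum>k=k0..n. w k *\<^sub>R (B k n *v \<rho> k))) \<longlonglongrightarrow> - (Hi *v \<mu>)"
proof -
  define S where "S n = (\<Sum>k=1..n. w k)" for n
  have S0: "\<forall>\<^sub>F n in sequentially. S n > 0" using W unfolding S_def by (simp only: filterlim_at_top_dense)
  have "Bseq \<rho>" using \<rho> by (intro convergent_imp_Bseq) (auto simp: convergent_def)
  then obtain K where K: "K > 0" "\<And>n. norm (\<rho> n) \<le> K" by (auto simp: Bseq_def)
  have p1: "(\<lambda>n. - (Hi *v ((1 / S n) *\<^sub>R (\<Sum>k=1..n. w k *\<^sub>R \<rho> k)))) \<longlonglongrightarrow> - (Hi *v \<mu>)"
    unfolding S_def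
    by (intro tendsto_minus bounded_linear.tendsto[OF matrix_vector_mul_bounded_linear] vector_weighted_average[OF w W \<rho>])
  have inv: "(\<lambda>n. 1 / S n) \<longlonglongrightarrow> 0"
    using W unfolding S_def by (intro tendsto_divide_0[OF tendsto_const] filterlim_at_top_imp_at_infinity)
  have p2: "(\<lambda>n. (1 / S n) *\<^sub>R (Hi *v (\<Sum>k\<in>{1..<k0}. w k *\<^sub>R \<rho> k))) \<longlonglongrightarrow> 0"
    using tendsto_scaleR[OF inv tendsto_const[of "Hi *v (\<Sum>k\<in>{1..<k0}. w k *\<^sub>R \<rho> k)"]] by simp
  have p3: "(\<lambda>n. (1 / S n) *\<^sub>R (\<Sum>k=k0..n. w k *\<^sub>R ((B k n + Hi) *v \<rho> k))) \<longlonglongrightarrow> 0"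
  proof (rule Lim_null_comparison)
    show "(\<lambda>n. K * ((\<Sum>k=k0..n. w k * g k n) / S n)) \<longlonglongrightarrow> 0"
      using tendsto_mult[OF tendsto_const[of K] g(2)] by (simp add: S_def)
    show "\<forall>\<^sub>F n in sequentially. norm ((1 / S n) *\<^sub>R (\<Sum>k=k0..n. w k *\<^sub>R ((B k n + Hi) *v \<rho> k))) \<le> K * ((\<Sum>k=k0..n. w k * g k n) / S n)"
      using S0
    proof eventually_elim
      case (elim n)
      have "norm (\<Sum>k=k0..n. w k *\<^sub>R ((B k n + Hi) *v \<rho> k)) \<le> (\<Sum>k=k0..n. K * (w k * g k n))"
      proof (rule sum_norm_le)
        fix k assume k: "k \<in> {k0..n}"
        then have wk: "0 \<le> w k" using w k0 by auto
        have "norm ((B k n + Hi) *v \<rho> k) \<le> g k n * norm (\<rho> k)" using B k by auto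
        also have "\<dots> \<le> g k n * K" using K(2) g(1)[of k n] k by (intro mult_left_mono) auto
        finally have "w k * norm ((B k n + Hi) *v \<rho> k) \<le> w k * (g k n * K)" using wk by (intro mult_left_mono)
        then show "norm (w k *\<^sub>R ((B k n + Hi) *v \<rho> k)) \<le> K * (w k * g k n)"
          unfolding norm_scaleR abs_of_nonneg[OF wk] by (simp only: mult_ac)
      qed
      then show ?case using elim by (simp add: sum_distrib_left[symmetric] divide_right_mono)
    qed
  qed
  have "(\<lambda>n. - (Hi *v ((1 / S n) *\<^sub>R (\<Sum>k=1..n. w k *\<^sub>R \<rho> k))) + (1 / S n) *\<^sub>R (Hi *v (\<Sum>k\<in>{1..<k0}. w k *\<^sub>R \<rho> k))
      + (1 / S n) *\<^sub>R (\<Sum>k=k0..n. w k *\<^sub>R ((B k n + Hi) *v \<rho> k))) \<longlonglongrightarrow> - (Hi *v \<mu>) + 0 + 0"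
    by (intro tendsto_add p1 p2 p3)
  then have lim: "(\<lambda>n. - (Hi *v ((1 / S n) *\<^sub>R (\<Sum>k=1..n. w k *\<^sub>R \<rho> k))) + (1 / S n) *\<^sub>R (Hi *v (\<Sum>k\<in>{1..<k0}. w k *\<^sub>R \<rho> k))
      + (1 / S n) *\<^sub>R (\<Sum>k=k0..n. w k *\<^sub>R ((B k n + Hi) *v \<rho> k))) \<longlonglongrightarrow> - (Hi *v \<mu>)" by simp
  show ?thesis unfolding S_def[symmetric]
  proof (rule Lim_transform_eventually[OF lim])
    show "\<forall>\<^sub>F n in sequentially. - (Hi *v ((1 / S n) *\<^sub>R (\<Sum>k=1..n. w k *\<^sub>R \<rho> k))) + (1 / S n) *\<^sub>R (Hi *v (\<Sum>k\<in>{1..<k0}. w k *\<^sub>R \<rho> k))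
      + (1 / S n) *\<^sub>R (\<Sum>k=k0..n. w k *\<^sub>R ((B k n + Hi) *v \<rho> k)) = (1 / S n) *\<^sub>R (\<Sum>k=k0..n. w k *\<^sub>R (B k n *v \<rho> k))"
      using eventually_ge_at_top[of k0]
    proof eventually_elim
      case (elim n)
      have un: "{1..n} = {1..<k0} \<union> {k0..n}" using elim k0 by auto
      have "(\<Sum>k=1..n. w k *\<^sub>R \<rho> k) = (\<Sum>k\<in>{1..<k0}. w k *\<^sub>R \<rho> k) + (\<Sum>k=k0..n. w k *\<^sub>R \<rho> k)"
        unfolding un by (rule sum.union_disjoint) auto
      moreover have "Hi *v (\<Sum>k=k0..n. w k *\<^sub>R \<rho> k) = (\<Sum>k=k0..n. w k *\<^sub>R (Hi *v \<rho> k))"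
        by (simp add: linear_sum[OF matrix_vector_mul_linear] linear_cmul[OF matrix_vector_mul_linear])
      moreover have "(\<Sum>k=k0..n. w k *\<^sub>R ((B k n + Hi) *v \<rho> k)) = (\<Sum>k=k0..n. w k *\<^sub>R (B k n *v \<rho> k)) + (\<Sum>k=k0..n. w k *\<^sub>R (Hi *v \<rho> k))"
        by (simp add: matrix_vector_mult_add_rdistrib scaleR_add_right sum.distrib)
      ultimately show ?case
        by (simp add: matrix_vector_mult_scaleR matrix_vector_right_distrib scaleR_add_right)
    qed
  qed
qed

text \<open>The recursion is linear only from time \<open>m\<close> on. All contributions up to that
  time are bounded by a constant depending on the path but not on \<open>n\<close>, because the
  averaging matrices are bounded uniformly in \<open>n\<close>; what remains is the weighted
  linearization error.\<close>

lemma averaging_remainder_bound: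
  fixes x R X e :: "nat \<Rightarrow> real ^ 'd"
  assumes b: "\<And>k. k \<ge> 1 \<Longrightarrow> b k > 0" and \<gamma>: "\<And>k. k \<ge> 1 \<Longrightarrow> \<gamma> k > 0" and k0: "1 \<le> k0" "k0 \<le> m"
    and C: "\<And>n k x. k0 \<le> k \<Longrightarrow> k \<le> n \<Longrightarrow> norm (averaging_matrix b \<gamma> H k n *v x) \<le> C * norm x"
    and x: "\<And>k. m < k \<Longrightarrow> x k = x (k - 1) + \<gamma> k *\<^sub>R (H *v x (k - 1) + (e (k - 1) + R k + X k))"
  shows "\<exists>c. \<forall>n\<ge>m. norm ((\<Sum>l=1..n. b l *\<^sub>R x l) - (\<Sum>k=k0..n. b k *\<^sub>R (averaging_matrix b \<gamma> H k n *v R k))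
      - (\<Sum>k=k0..n. b k *\<^sub>R (averaging_matrix b \<gamma> H k n *v X k))) \<le> c + C * (\<Sum>k=Suc m..n. b k * norm (e (k - 1)))"
proof (intro exI allI impI)
  fix n assume mn: "m \<le> n"
  let ?B = "averaging_matrix b \<gamma> H"
  let ?c = "norm (\<Sum>l\<in>{1..<m}. b l *\<^sub>R x l) + b m / \<gamma> m * (C * norm (x m)) + (\<Sum>k=k0..m. b k * (C * norm (R k + X k)))"
  have m1: "1 \<le> m" using k0 by simp
  have un: "{1..n} = {1..<m} \<union> {m..n}" using mn m1 by auto
  have s1: "(\<Sum>l=1..n. b l *\<^sub>R x l) = (\<Sum>l\<in>{1..<m}. b l *\<^sub>R x l) + (\<Sum>l=m..n. b l *\<^sub>R x l)"
    unfolding un by (rule sum.union_disjoint) auto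
  have s2: "(\<Sum>l=m..n. b l *\<^sub>R x l) = (b m / \<gamma> m) *\<^sub>R (?B m n *v x m) + (\<Sum>k=Suc m..n. b k *\<^sub>R (?B k n *v (e (k - 1) + R k + X k)))"
    by (rule weighted_sum_of_linear_recursion) (use b \<gamma> x m1 mn in auto)
  have s3: "(\<Sum>k=Suc m..n. b k *\<^sub>R (?B k n *v (e (k - 1) + R k + X k)))
      = (\<Sum>k=Suc m..n. b k *\<^sub>R (?B k n *v e (k - 1))) + (\<Sum>k=Suc m..n. b k *\<^sub>R (?B k n *v (R k + X k)))"
    by (simp add: sum.distrib[symmetric] matrix_vector_right_distrib scaleR_add_right add.assoc)
  have un2: "{k0..n} = {k0..m} \<union> {Suc m..n}" using mn k0 by auto
  have s4: "(\<Sum>k=k0..n. b k *\<^sub>R (?B k n *v R k)) + (\<Sum>k=k0..n. b k *\<^sub>R (?B k n *v X k))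
      = (\<Sum>k=k0..m. b k *\<^sub>R (?B k n *v (R k + X k))) + (\<Sum>k=Suc m..n. b k *\<^sub>R (?B k n *v (R k + X k)))"
  proof -
    have "(\<Sum>k=k0..n. b k *\<^sub>R (?B k n *v R k)) + (\<Sum>k=k0..n. b k *\<^sub>R (?B k n *v X k)) = (\<Sum>k=k0..n. b k *\<^sub>R (?B k n *v (R k + X k)))"
      by (simp add: sum.distrib[symmetric] matrix_vector_right_distrib scaleR_add_right)
    also have "\<dots> = (\<Sum>k=k0..m. b k *\<^sub>R (?B k n *v (R k + X k))) + (\<Sum>k=Suc m..n. b k *\<^sub>R (?B k n *v (R k + X k)))"
      unfolding un2 by (rule sum.union_disjoint) auto
    finally show ?thesis .
  qed
  have eq: "(\<Sum>l=1..n. b l *\<^sub>R x l) - (\<Sum>k=k0..n. b k *\<^sub>R (?B k n *v R k)) - (\<Sum>k=k0..n. b k *\<^sub>R (?B k n *v X k))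
      = (\<Sum>l\<in>{1..<m}. b l *\<^sub>R x l) + (b m / \<gamma> m) *\<^sub>R (?B m n *v x m) - (\<Sum>k=k0..m. b k *\<^sub>R (?B k n *v (R k + X k)))
        + (\<Sum>k=Suc m..n. b k *\<^sub>R (?B k n *v e (k - 1)))"
    unfolding diff_diff_eq s4 unfolding s1 s2 s3 by (simp add: algebra_simps)
  have n1: "norm ((b m / \<gamma> m) *\<^sub>R (?B m n *v x m)) \<le> b m / \<gamma> m * (C * norm (x m))"
    using C[OF k0(2) mn, of "x m"] b[OF m1] \<gamma>[OF m1] by (simp add: divide_right_mono mult_left_mono)
  have n2: "norm (\<Sum>k=k0..m. b k *\<^sub>R (?B k n *v (R k + X k))) \<le> (\<Sum>k=k0..m. b k * (C * norm (R k + X k)))"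
  proof (rule sum_norm_le)
    fix k assume k: "k \<in> {k0..m}"
    then have bk: "b k > 0" using b k0 by auto
    show "norm (b k *\<^sub>R (?B k n *v (R k + X k))) \<le> b k * (C * norm (R k + X k))"
      using C[of k n "R k + X k"] k mn bk by simp
  qed
  have n3: "norm (\<Sum>k=Suc m..n. b k *\<^sub>R (?B k n *v e (k - 1))) \<le> (\<Sum>k=Suc m..n. C * (b k * norm (e (k - 1))))"
  proof (rule sum_norm_le)
    fix k assume k: "k \<in> {Suc m..n}"
    then have bk: "b k > 0" using b by auto
    have "b k * norm (?B k n *v e (k - 1)) \<le> b k * (C * norm (e (k - 1)))" using C[of k n "e (k - 1)"] k k0 bk by simp
    then show "norm (b k *\<^sub>R (?B k n *v e (k - 1))) \<le> C * (b k * norm (e (k - 1)))" using bk by (simp add: algebra_simps)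
  qed
  have tri: "norm (p + q - r + t) \<le> norm p + norm q + norm r + norm t" for p q r t :: "real ^ 'd"
    using norm_triangle_ineq[of "p + q - r" t] norm_triangle_ineq4[of "p + q" r] norm_triangle_ineq[of p q] by linarith
  show "norm ((\<Sum>l=1..n. b l *\<^sub>R x l) - (\<Sum>k=k0..n. b k *\<^sub>R (?B k n *v R k)) - (\<Sum>k=k0..n. b k *\<^sub>R (?B k n *v X k)))
      \<le> ?c + C * (\<Sum>k=Suc m..n. b k * norm (e (k - 1)))"
    unfolding eq using n1 n2 n3 by (intro order_trans[OF tri]) (simp add: sum_distrib_left)
qed

text \<open>Allows a bound on a moment of order \<open>1 + lam\<close> to be read off from a second
  moment of order \<open>d^2\<close>, in place of an interpolation inequality: after scaling by
  \<open>d\<close>, small values contribute the \<open>1\<close> and large ones the square.\<close>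

lemma powr_le_quadratic:
  fixes a d lam :: real
  assumes "0 \<le> a" "d > 0" "0 < lam" "lam \<le> 1"
  shows "a powr (1 + lam) \<le> d powr (1 + lam) * (1 + a\<^sup>2 / d\<^sup>2)"
proof -
  have "a powr (1 + lam) = d powr (1 + lam) * (a / d) powr (1 + lam)"
    using assms by (simp add: powr_mult[symmetric])
  also have "(a / d) powr (1 + lam) \<le> 1 + (a / d)\<^sup>2"
  proof (cases "a / d \<le> 1")
    case True
    have "(a / d) powr (1 + lam) \<le> 1 powr (1 + lam)" using True assms by (intro powr_mono2) auto
    then show ?thesis by (simp add: add_increasing2)
  next
    case False
    then have "(a / d) powr (1 + lam) \<le> (a / d) powr 2" using assms by (intro powr_mono) auto
    also have "\<dots> = (a / d)\<^sup>2" using False by (simp add: powr_numeral)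
    finally show ?thesis by simp
  qed
  finally show ?thesis using assms by (simp add: power_divide mult_left_mono)
qed

lemma vanishing_of_AE:
  fixes W :: "nat \<Rightarrow> 'a \<Rightarrow> real ^ 'd"
  assumes M: "prob_space M" and A: "A \<in> sets M" and W: "\<And>n. n \<ge> 1 \<Longrightarrow> W n \<in> borel_measurable M"
    and ae: "AE \<omega> in M. \<omega> \<in> A \<longrightarrow> (\<lambda>n. W n \<omega>) \<longlonglongrightarrow> 0" and \<eta>: "\<eta> > 0"
  shows "(\<lambda>n. measure M (A \<inter> {\<omega>\<in>space M. norm (W n \<omega>) > \<eta>})) \<longlonglongrightarrow> 0"
proof -
  define E where "E n = (if n \<ge> 1 then A \<inter> {\<omega>\<in>space M. norm (W n \<omega>) > \<eta>} else {})" for n :: nat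
  have Em: "E n \<in> sets M" for n
  proof (cases "n \<ge> 1")
    case True
    note [measurable] = W[OF True] A
    have "A \<inter> {\<omega>\<in>space M. norm (W n \<omega>) > \<eta>} \<in> sets M" by measurable
    then show ?thesis using True by (simp add: E_def)
  qed (simp add: E_def)
  have "(\<lambda>n. measure M (E n)) \<longlonglongrightarrow> 0"
  proof (rule prob_eventually_avoided[OF M Em])
    show "AE \<omega> in M. \<forall>\<^sub>F n in sequentially. \<omega> \<notin> E n"
      using ae
    proof eventually_elim
      case (elim \<omega>)
      show ?case
      proof (cases "\<omega> \<in> A")
        case True
        with elim have "(\<lambda>n. norm (W n \<omega>)) \<longlonglongrightarrow> 0" by (simp add: tendsto_norm_zero)
        then have "\<forall>\<^sub>F n in sequentially. norm (W n \<omega>) < \<eta>" using \<eta> by (intro order_tendstoD) auto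
        then show ?thesis by eventually_elim (auto simp: E_def)
      qed (auto simp: E_def)
    qed
  qed
  moreover have "\<forall>\<^sub>F n in sequentially. measure M (E n) = measure M (A \<inter> {\<omega>\<in>space M. norm (W n \<omega>) > \<eta>})"
    using eventually_ge_at_top[of 1] by eventually_elim (simp add: E_def)
  ultimately show ?thesis by (rule Lim_transform_eventually)
qed

lemma vanishing_add:
  fixes W1 W2 :: "nat \<Rightarrow> 'a \<Rightarrow> real ^ 'd"
  assumes M: "prob_space M" and A: "A \<in> sets M"
    and W1: "\<And>n. n \<ge> 1 \<Longrightarrow> W1 n \<in> borel_measurable M" and W2: "\<And>n. n \<ge> 1 \<Longrightarrow> W2 n \<in> borel_measurable M"
    and v1: "\<And>\<eta>. \<eta> > 0 \<Longrightarrow> (\<lambda>n. measure M (A \<inter> {\<omega>\<in>space M. norm (W1 n \<omega>) > \<eta>})) \<longlonglongrightarrow> 0"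
    and v2: "\<And>\<eta>. \<eta> > 0 \<Longrightarrow> (\<lambda>n. measure M (A \<inter> {\<omega>\<in>space M. norm (W2 n \<omega>) > \<eta>})) \<longlonglongrightarrow> 0"
    and eq: "\<And>n \<omega>. n \<ge> n0 \<Longrightarrow> W n \<omega> = W1 n \<omega> + W2 n \<omega>" and \<eta>: "\<eta> > 0"
  shows "(\<lambda>n. measure M (A \<inter> {\<omega>\<in>space M. norm (W n \<omega>) > \<eta>})) \<longlonglongrightarrow> 0"
proof (rule tendsto_sandwich[OF _ _ tendsto_const])
  interpret prob_space M by fact
  show "(\<lambda>n. measure M (A \<inter> {\<omega>\<in>space M. norm (W1 n \<omega>) > \<eta> / 2}) + measure M (A \<inter> {\<omega>\<in>space M. norm (W2 n \<omega>) > \<eta> / 2})) \<longlonglongrightarrow> 0"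
    using tendsto_add[OF v1[of "\<eta> / 2"] v2[of "\<eta> / 2"]] \<eta> by simp
  show "\<forall>\<^sub>F n in sequentially. measure M (A \<inter> {\<omega>\<in>space M. norm (W n \<omega>) > \<eta>})
    \<le> measure M (A \<inter> {\<omega>\<in>space M. norm (W1 n \<omega>) > \<eta> / 2}) + measure M (A \<inter> {\<omega>\<in>space M. norm (W2 n \<omega>) > \<eta> / 2})"
    using eventually_ge_at_top[of 1] eventually_ge_at_top[of n0]
  proof eventually_elim
    case (elim n)
    note [measurable] = W1[OF elim(1)] W2[OF elim(1)] A
    have m: "A \<inter> {\<omega>\<in>space M. norm (W1 n \<omega>) > \<eta> / 2} \<in> sets M" "A \<inter> {\<omega>\<in>space M. norm (W2 n \<omega>) > \<eta> / 2} \<in> sets M" by measurable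
    have "A \<inter> {\<omega>\<in>space M. norm (W n \<omega>) > \<eta>} \<subseteq> (A \<inter> {\<omega>\<in>space M. norm (W1 n \<omega>) > \<eta> / 2}) \<union> (A \<inter> {\<omega>\<in>space M. norm (W2 n \<omega>) > \<eta> / 2})"
    proof
      fix \<omega> assume w: "\<omega> \<in> A \<inter> {\<omega>\<in>space M. norm (W n \<omega>) > \<eta>}"
      then have "norm (W1 n \<omega> + W2 n \<omega>) > \<eta>" using eq[OF elim(2)] by simp
      then have "norm (W1 n \<omega>) > \<eta> / 2 \<or> norm (W2 n \<omega>) > \<eta> / 2" using norm_triangle_ineq[of "W1 n \<omega>" "W2 n \<omega>"] by linarith
      then show "\<omega> \<in> (A \<inter> {\<omega>\<in>space M. norm (W1 n \<omega>) > \<eta> / 2}) \<union> (A \<inter> {\<omega>\<in>space M. norm (W2 n \<omega>) > \<eta> / 2})" using w by auto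
    qed
    then have "measure M (A \<inter> {\<omega>\<in>space M. norm (W n \<omega>) > \<eta>})
      \<le> measure M ((A \<inter> {\<omega>\<in>space M. norm (W1 n \<omega>) > \<eta> / 2}) \<union> (A \<inter> {\<omega>\<in>space M. norm (W2 n \<omega>) > \<eta> / 2}))"
      using m by (intro finite_measure_mono) auto
    also have "\<dots> \<le> measure M (A \<inter> {\<omega>\<in>space M. norm (W1 n \<omega>) > \<eta> / 2}) + measure M (A \<inter> {\<omega>\<in>space M. norm (W2 n \<omega>) > \<eta> / 2})"
      using m by (intro measure_Un_le) auto
    finally show ?case .
  qed
qed simp

lemma converges_in_law_on_cong:
  assumes "converges_in_law_on M A X \<nu>" "\<And>n \<omega>. n \<ge> n0 \<Longrightarrow> X n \<omega> = Y n \<omega>"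
  shows "converges_in_law_on M A Y \<nu>"
  unfolding converges_in_law_on_def
proof (intro allI impI)
  fix g :: "'b \<Rightarrow> real" assume "continuous_on UNIV g" "bounded (range g)"
  with assms(1) have "(\<lambda>n. \<integral>\<omega>. indicator A \<omega> * g (X n \<omega>) \<partial>M) \<longlonglongrightarrow> measure M A * (\<integral>x. g x \<partial>\<nu>)"
    by (auto simp: converges_in_law_on_def)
  moreover have "\<forall>\<^sub>F n in sequentially. (\<integral>\<omega>. indicator A \<omega> * g (X n \<omega>) \<partial>M) = (\<integral>\<omega>. indicator A \<omega> * g (Y n \<omega>) \<partial>M)"
    using eventually_ge_at_top[of n0] by eventually_elim (simp add: assms(2))
  ultimately show "(\<lambda>n. \<integral>\<omega>. indicator A \<omega> * g (Y n \<omega>) \<partial>M) \<longlonglongrightarrow> measure M A * (\<integral>x. g x \<partial>\<nu>)"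
    by (rule Lim_transform_eventually)
qed

theorem theorem1p2:
  fixes M :: "'a measure"
    and F :: "nat \<Rightarrow> 'a measure"
    and D :: "(real ^ 'd) set"
    and f P :: "real ^ 'd \<Rightarrow> real ^ 'd"
    and \<theta>0 \<theta>s \<mu> :: "real ^ 'd"
    and H \<Gamma> :: "real ^ 'd ^ 'd"
    and \<theta> R Dn :: "nat \<Rightarrow> 'a \<Rightarrow> real ^ 'd"
    and \<gamma> b \<delta> \<delta>bias \<delta>diff :: "nat \<Rightarrow> real"
    and L lam :: real
  defines "conv \<equiv> {\<omega> \<in> space M. (\<lambda>n. \<theta> n \<omega>) \<longlonglongrightarrow> \<theta>s}"
  assumes prob: "prob_space M"
    and filt: "filtration (space M) F" "\<And>n. subalgebra M (F n)"
    and D: "closed D" "\<theta>0 \<in> D"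
    and f: "f \<in> borel_measurable (restrict_space borel D)"
    and proj: "P \<in> borel_measurable borel" "\<And>x. P x \<in> D" "\<And>x. x \<in> D \<Longrightarrow> P x = x"
      "\<And>x. x \<notin> D \<Longrightarrow> P x \<in> frontier D"
    and R_adapted: "\<And>n. n \<ge> 1 \<Longrightarrow> R n \<in> borel_measurable (F n)"
    and Dn_mds: "martingale_differences M F Dn"
    and \<gamma>_pos: "\<And>n. n \<ge> 1 \<Longrightarrow> \<gamma> n > 0"
    and \<theta>_adapted: "\<And>n. \<theta> n \<in> borel_measurable (F n)"
    and \<theta>_in_D: "\<And>n \<omega>. \<omega> \<in> space M \<Longrightarrow> \<theta> n \<omega> \<in> D"
    and \<theta>_start: "\<And>\<omega>. \<omega> \<in> space M \<Longrightarrow> \<theta> 0 \<omega> = \<theta>0"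
    and \<theta>_rec: "\<And>n \<omega>. n \<ge> 1 \<Longrightarrow> \<omega> \<in> space M \<Longrightarrow>
      \<theta> n \<omega> = P (\<theta> (n - 1) \<omega> + \<gamma> n *\<^sub>R (f (\<theta> (n - 1) \<omega>) + R n \<omega> + Dn n \<omega>))"
    and L_pos: "L > 0"
    and zero: "contracting_zero L D f \<theta>s H"
    and b_pos: "\<And>n. n \<ge> 1 \<Longrightarrow> b n > 0"
    and lam: "0 < lam" "lam \<le> 1"
    and \<delta>_pos: "\<And>n. n \<ge> 1 \<Longrightarrow> \<delta>bias n > 0" "\<And>n. n \<ge> 1 \<Longrightarrow> \<delta>diff n > 0"
      "\<And>n. n \<ge> 1 \<Longrightarrow> \<delta> n > 0"
    \<comment> \<open>(A)\<close>
    and A_decr: "\<And>n. n \<ge> 1 \<Longrightarrow> \<gamma> (n + 1) \<le> \<gamma> n" "\<gamma> \<longlonglongrightarrow> 0"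
    and A_n\<gamma>: "filterlim (\<lambda>n. real n * \<gamma> n) at_top sequentially"
    and A_ratio: "limsup (\<lambda>n. ereal (\<gamma> (n - 1) / \<gamma> n)) < \<infinity>"
    and A_\<delta>: "limsup (\<lambda>n. ereal (1 / \<gamma> n * (1 - \<delta> n / \<delta> (n - 1)))) \<le> ereal L"
    and A_b: "(\<lambda>n. 1 / \<gamma> n * (b (n + 1) * \<gamma> n / (b n * \<gamma> (n + 1)) - 1)) \<longlonglongrightarrow> 0"
    \<comment> \<open>(B)\<close>
    and B: "(\<lambda>x. norm (f x - H *v (x - \<theta>s))) \<in> O[at \<theta>s within D](\<lambda>x. norm (x - \<theta>s) powr (1 + lam))"
    \<comment> \<open>(C)\<close>
    and C_bias: "filterlim (\<lambda>n. \<Sum>k=1..n. b k * \<delta>bias k) at_top sequentially"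
    and C_diff: "filterlim (\<lambda>n. \<Sum>k=1..n. (b k * \<delta>diff k)\<^sup>2) at_top sequentially"
    and C_tail: "\<And>l :: nat \<Rightarrow> nat. (\<And>n. n \<ge> 1 \<Longrightarrow> 1 \<le> l n \<and> l n \<le> n) \<Longrightarrow>
      (\<lambda>n. real n - real (l n)) \<in> o(\<lambda>n. real n) \<Longrightarrow>
        (\<lambda>n. (\<Sum>k=l n + 1..n. b k * \<delta>bias k) / (\<Sum>k=1..n. b k * \<delta>bias k)) \<longlonglongrightarrow> 0 \<and>
        (\<lambda>n. (\<Sum>k=l n + 1..n. (b k * \<delta>diff k)\<^sup>2) / (\<Sum>k=1..n. (b k * \<delta>diff k)\<^sup>2)) \<longlonglongrightarrow> 0"
    \<comment> \<open>(D)\<close>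
    and D_lim: "AE \<omega> in M. \<omega> \<in> conv \<longrightarrow> (\<lambda>n. (1 / \<delta>bias n) *\<^sub>R R n \<omega>) \<longlonglongrightarrow> \<mu>"
    and D_moment: "\<exists>\<epsilon>'>0. limsup (\<lambda>n. ennreal (1 / \<delta> n) * ennreal_sqrt
      (\<integral>\<^sup>+\<omega>. ennreal (indicator (ball \<theta>s \<epsilon>') (\<theta> (n - 1) \<omega>) * (norm (R n \<omega>))\<^sup>2) \<partial>M)) < \<infinity>"
    \<comment> \<open>(E)\<close>
    and E_cov: "AE \<omega> in M. \<omega> \<in> conv \<longrightarrow>
      (\<lambda>n. (1 / (\<delta>diff n)\<^sup>2) *\<^sub>R cond_cov M (F (n - 1)) (Dn n) \<omega>) \<longlonglongrightarrow> \<Gamma>"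
    and E_lindeberg: "\<And>\<epsilon> :: real. \<epsilon> > 0 \<Longrightarrow> vanishes_in_prob_on M conv
      (\<lambda>n \<omega>. ennreal (1 / (eps_diff b \<delta>diff n)\<^sup>2) *
        (\<Sum>l=1..n. ennreal ((b l)\<^sup>2 / (\<Sum>k=1..n. b k)\<^sup>2) *
          nn_cond_exp M (F (l - 1))
            (\<lambda>\<omega>'. ennreal (indicator {\<epsilon> * (\<Sum>k=1..n. b k) * eps_diff b \<delta>diff n / b l <..} (norm (Dn l \<omega>'))
                            * (norm (Dn l \<omega>'))\<^sup>2)) \<omega>))"
    and E_moment: "\<exists>\<epsilon>'>0. limsup (\<lambda>n. ennreal (1 / (\<delta> n / sqrt (\<gamma> n))) * ennreal_sqrt
      (\<integral>\<^sup>+\<omega>. ennreal (indicator (ball \<theta>s \<epsilon>') (\<theta> (n - 1) \<omega>) * (norm (Dn n \<omega>))\<^sup>2) \<partial>M)) < \<infinity>"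
    \<comment> \<open>(F)\<close>
    and F: "(\<lambda>n. 1 / (\<Sum>k=1..n. b k) * (\<Sum>l=1..n. b l * \<delta> l powr (1 + lam))) \<in> o(eps_bias b \<delta>bias) \<or>
      (\<lambda>n. 1 / (\<Sum>k=1..n. b k) * (\<Sum>l=1..n. b l * \<delta> l powr (1 + lam))) \<in> o(eps_diff b \<delta>diff)"
  shows "\<exists>V :: nat \<Rightarrow> 'a \<Rightarrow> real ^ 'd.
    (\<forall>n\<ge>1. V n \<in> borel_measurable M) \<and>
    converges_in_prob_on M conv (\<lambda>n \<omega>. (1 / eps_bias b \<delta>bias n) *\<^sub>R (V n \<omega> - \<theta>s))
      (- (matrix_inv H *v \<mu>)) \<and>
    converges_in_law_on M conv
      (\<lambda>n \<omega>. (1 / eps_diff b \<delta>diff n) *\<^sub>R (weighted_avg b (\<lambda>k. \<theta> k \<omega>) n - V n \<omega>))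
      (mv_normal 0 (matrix_inv H ** \<Gamma> ** transpose (matrix_inv H)))"
proof -

  \<comment> \<open>Measurability and the adapted norm\<close>
  interpret prob_space M by (rule prob)
  have Fmono: "sets (F m) \<subseteq> sets (F n)" if "m \<le> n" for m n using filtration.sets_F_mono[OF filt(1) that] .
  note Fsub = filt(2)
  have \<theta>M [measurable]: "\<theta> n \<in> borel_measurable M" for n using measurable_from_subalg[OF Fsub \<theta>_adapted] .
  have RM: "R n \<in> borel_measurable M" if "n \<ge> 1" for n using measurable_from_subalg[OF Fsub R_adapted[OF that]] .
  have DnF: "Dn n \<in> borel_measurable (F n)" if "n \<ge> 1" for n using Dn_mds that by (auto simp: martingale_differences_def)
  have DnM: "Dn n \<in> borel_measurable M" if "n \<ge> 1" for n using measurable_from_subalg[OF Fsub DnF[OF that]] .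
  have Dnv: "cond_exp_version M (F (n - 1)) (\<lambda>\<omega>. Dn n \<omega> $ i) (\<lambda>_. 0)" if "n \<ge> 1" for n i
  proof -
    have "integrable M (Dn n)" using Dn_mds that by (auto simp: martingale_differences_def)
    then have "integrable M (\<lambda>\<omega>. Dn n \<omega> $ i)" by (rule integrable_bounded_linear[OF bounded_linear_vec_nth])
    moreover have "AE \<omega> in M. real_cond_exp M (F (n - 1)) (\<lambda>\<omega>. Dn n \<omega> $ i) \<omega> = 0"
      using Dn_mds that unfolding martingale_differences_def by blast
    ultimately show ?thesis by (simp add: cond_exp_version_def)
  qed
  have convM [measurable]: "conv \<in> sets M" unfolding conv_def by (rule convergence_event_sets) (rule \<theta>M)
  define Hi where "Hi = matrix_inv H"
  obtain Am \<rho> N h L' where ctr: "\<rho> > 0" "N > 0" "h > 0" "L < L'"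
    "\<And>g x. 0 \<le> g \<Longrightarrow> g \<le> h \<Longrightarrow> orbit_norm Am \<rho> N (x + g *\<^sub>R (H *v x)) \<le> (1 - g * L') * orbit_norm Am \<rho> N x"
    and Hinv: "Hi ** H = mat 1" "H ** Hi = mat 1"
    unfolding Hi_def proof (rule contracting_zero_contraction[OF zero L_pos])
  qed (use that in blast)+
  define nm where "nm = orbit_norm Am \<rho> N"
  obtain K0 where K0: "K0 > 0" "\<And>x. nm x \<le> K0 * norm x"
    unfolding nm_def proof (rule orbit_norm_le_norm[OF ctr(1), where A = Am and N = N])
  qed (use that in blast)+
  have nm: "0 \<le> nm x" "norm x \<le> nm x" for x
    by (simp_all add: nm_def orbit_norm_nonneg norm_le_orbit_norm[OF ctr(2)])
  have L'0: "L' > 0" using L_pos ctr(4) by simp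
  let ?B = "averaging_matrix b \<gamma> H"

  \<comment> \<open>The averaging matrices and their deviation from the limit\<close>
  have ratio: "\<exists>K. \<forall>\<^sub>F n in sequentially. \<gamma> n \<le> K * \<gamma> (Suc n)"
  proof -
    obtain K where "limsup (\<lambda>n. ereal (\<gamma> (n - 1) / \<gamma> n)) < ereal K" using ereal_dense2[OF A_ratio] by blast
    then have "\<forall>\<^sub>F n in sequentially. ereal (\<gamma> (n - 1) / \<gamma> n) < ereal K" by (rule Limsup_lessD)
    then have "\<forall>\<^sub>F n in sequentially. ereal (\<gamma> (Suc n - 1) / \<gamma> (Suc n)) < ereal K"
      by (subst eventually_sequentially_Suc)
    then have "\<forall>\<^sub>F n in sequentially. \<gamma> n \<le> K * \<gamma> (Suc n)"
    proof eventually_elim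
      case (elim n)
      then show ?case using \<gamma>_pos[of "Suc n"] by (simp add: pos_divide_less_eq)
    qed
    then show ?thesis ..
  qed
  then obtain Kr where Kr: "\<forall>\<^sub>F n in sequentially. \<gamma> n \<le> Kr * \<gamma> (Suc n)" ..
  obtain k0 c C \<zeta> where k0: "k0 \<ge> 1" and cC: "c > 0" "C \<ge> 0" and \<zeta>: "\<zeta> \<longlonglongrightarrow> 0" "\<And>k. 0 \<le> \<zeta> k"
    and BH: "\<And>k n x. k0 \<le> k \<Longrightarrow> k \<le> n \<Longrightarrow> norm ((?B k n + Hi) *v x) \<le> (C * exp (- c * (real (n - k) * \<gamma> n)) + \<zeta> k) * norm x"
  proof (rule averaging_matrix_limit[of nm K0 h L' H Hi b \<gamma> Kr])
    show "nm (x + g *\<^sub>R (H *v x)) \<le> (1 - g * L') * nm x" if "0 \<le> g" "g \<le> h" for g x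
      unfolding nm_def by (rule ctr(5)[OF that])
    show "(\<lambda>n. 1 / \<gamma> n * (b (Suc n) * \<gamma> n / (b n * \<gamma> (Suc n)) - 1)) \<longlonglongrightarrow> 0" using A_b by (simp only: Suc_eq_plus1)
    show "\<gamma> (Suc n) \<le> \<gamma> n" if "n \<ge> 1" for n using A_decr(1)[OF that] by simp
  qed (use nm K0 ctr(3) L'0 Hinv(1) b_pos \<gamma>_pos A_decr(2) Kr in \<open>blast+\<close>)
  define g where "g k n = C * exp (- c * (real (n - k) * \<gamma> n)) + \<zeta> k" for k n
  have BHg: "norm ((?B k n + Hi) *v x) \<le> g k n * norm x" if "k0 \<le> k" "k \<le> n" for k n x
    unfolding g_def by (rule BH[OF that])
  have g0: "0 \<le> g k n" for k n unfolding g_def using cC \<zeta>(2) by (intro add_nonneg_nonneg mult_nonneg_nonneg) auto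
  obtain Z where Z: "\<And>k. \<zeta> k \<le> Z"
  proof -
    have "Bseq \<zeta>" using \<zeta>(1) by (intro convergent_imp_Bseq) (auto simp: convergent_def)
    then obtain Z where "\<And>n. norm (\<zeta> n) \<le> Z" by (auto simp: Bseq_def)
    then show ?thesis using that[of Z] by (metis abs_le_D1 real_norm_def)
  qed
  have gG: "g k n \<le> C + Z" if "k0 \<le> k" "k \<le> n" for k n
  proof -
    have "exp (- c * (real (n - k) * \<gamma> n)) \<le> 1" using cC(1) \<gamma>_pos[of n] that k0 by simp
    then have "C * exp (- c * (real (n - k) * \<gamma> n)) \<le> C * 1" using cC(2) by (intro mult_left_mono)
    then show ?thesis using Z[of k] by (simp add: g_def)
  qed
  obtain KH where KH: "KH > 0" "\<And>x. norm (Hi *v x) \<le> KH * norm x" using bounded_matrix[of Hi] by blast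
  define CB where "CB = \<bar>C + Z\<bar> + KH"
  have CB: "CB > 0" using KH by (simp add: CB_def)
  have Bbd: "norm (?B k n *v x) \<le> CB * norm x" if "k0 \<le> k" "k \<le> n" for k n x
  proof -
    have "?B k n *v x = (?B k n + Hi) *v x - Hi *v x" by (simp add: matrix_vector_mult_add_rdistrib)
    then have "norm (?B k n *v x) \<le> norm ((?B k n + Hi) *v x) + norm (Hi *v x)" by (simp only: norm_triangle_ineq4)
    also have "\<dots> \<le> g k n * norm x + KH * norm x" by (intro add_mono BHg[OF that] KH(2))
    also have "\<dots> \<le> \<bar>C + Z\<bar> * norm x + KH * norm x" using gG[OF that] by (intro add_mono mult_right_mono) auto
    finally show ?thesis by (simp add: CB_def distrib_right)
  qed

  \<comment> \<open>Normalizing sequences and vanishing averages of the deviation\<close>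
  define s where "s n = sqrt (\<Sum>k=1..n. (b k * \<delta>diff k)\<^sup>2)" for n
  define Wb where "Wb n = (\<Sum>k=1..n. b k * \<delta>bias k)" for n
  define Sb where "Sb n = (\<Sum>k=1..n. b k)" for n
  have s2: "(s n)\<^sup>2 = (\<Sum>k=1..n. (b k * \<delta>diff k)\<^sup>2)" for n by (simp add: s_def sum_nonneg)
  have Sb: "Sb n > 0" if "n \<ge> 1" for n
    unfolding Sb_def using that b_pos by (intro sum_pos) auto
  have eb: "eps_bias b \<delta>bias n = Wb n / Sb n" for n by (simp add: eps_bias_def Wb_def Sb_def)
  have ed: "eps_diff b \<delta>diff n = s n / Sb n" for n by (simp add: eps_diff_def s_def Sb_def)
  have gbias: "(\<lambda>n. (\<Sum>k=k0..n. b k * \<delta>bias k * g k n) / Wb n) \<longlonglongrightarrow> 0"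
    unfolding Wb_def
  proof (rule windowed_sum_negligible[OF _ C_bias _ A_n\<gamma> A_decr(2) \<gamma>_pos \<zeta> cC k0])
    show "0 \<le> b k * \<delta>bias k" if "k \<ge> 1" for k using b_pos[OF that] \<delta>_pos(1)[OF that] by simp
    show "(\<lambda>n. (\<Sum>k=l n + 1..n. b k * \<delta>bias k) / (\<Sum>k=1..n. b k * \<delta>bias k)) \<longlonglongrightarrow> 0"
      if "\<And>n. n \<ge> 1 \<Longrightarrow> 1 \<le> l n \<and> l n \<le> n" "(\<lambda>n. real n - real (l n)) \<in> o(\<lambda>n. real n)" for l :: "nat \<Rightarrow> nat"
      using C_tail[OF that] by blast
    show "0 \<le> g k n" "g k n \<le> C * exp (- c * (real (n - k) * \<gamma> n)) + \<zeta> k" for k n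
      using g0[of k n] by (simp_all only: g_def order_refl)
  qed simp_all
  have gdiff0: "(\<lambda>n. (\<Sum>k=k0..n. (b k * \<delta>diff k)\<^sup>2 * g k n) / (s n)\<^sup>2) \<longlonglongrightarrow> 0"
    unfolding s2
  proof (rule windowed_sum_negligible[OF _ C_diff _ A_n\<gamma> A_decr(2) \<gamma>_pos \<zeta> cC k0])
    show "(\<lambda>n. (\<Sum>k=l n + 1..n. (b k * \<delta>diff k)\<^sup>2) / (\<Sum>k=1..n. (b k * \<delta>diff k)\<^sup>2)) \<longlonglongrightarrow> 0"
      if "\<And>n. n \<ge> 1 \<Longrightarrow> 1 \<le> l n \<and> l n \<le> n" "(\<lambda>n. real n - real (l n)) \<in> o(\<lambda>n. real n)" for l :: "nat \<Rightarrow> nat"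
      using C_tail[OF that] by blast
    show "0 \<le> g k n" "g k n \<le> C * exp (- c * (real (n - k) * \<gamma> n)) + \<zeta> k" for k n
      using g0[of k n] by (simp_all only: g_def order_refl)
  qed simp_all
  \<comment> \<open>The martingale part needs squares of \<open>g\<close>; since \<open>g\<close> is
    bounded, its square is at most a multiple of \<open>g\<close>.\<close>
  have gdiff: "(\<lambda>n. (\<Sum>k=k0..n. (b k * \<delta>diff k)\<^sup>2 * (g k n)\<^sup>2) / (s n)\<^sup>2) \<longlonglongrightarrow> 0"
  proof (rule tendsto_sandwich[OF _ _ tendsto_const])
    show "(\<lambda>n. \<bar>C + Z\<bar> * ((\<Sum>k=k0..n. (b k * \<delta>diff k)\<^sup>2 * g k n) / (s n)\<^sup>2)) \<longlonglongrightarrow> 0"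
      using tendsto_mult[OF tendsto_const[of "\<bar>C + Z\<bar>"] gdiff0] by (simp only: mult_zero_right)
    show "\<forall>\<^sub>F n in sequentially. 0 \<le> (\<Sum>k=k0..n. (b k * \<delta>diff k)\<^sup>2 * (g k n)\<^sup>2) / (s n)\<^sup>2"
      by (intro always_eventually allI divide_nonneg_nonneg sum_nonneg) auto
    show "\<forall>\<^sub>F n in sequentially. (\<Sum>k=k0..n. (b k * \<delta>diff k)\<^sup>2 * (g k n)\<^sup>2) / (s n)\<^sup>2 \<le> \<bar>C + Z\<bar> * ((\<Sum>k=k0..n. (b k * \<delta>diff k)\<^sup>2 * g k n) / (s n)\<^sup>2)"
    proof (rule always_eventually, rule allI)
      fix n
      have "(\<Sum>k=k0..n. (b k * \<delta>diff k)\<^sup>2 * (g k n)\<^sup>2) \<le> (\<Sum>k=k0..n. \<bar>C + Z\<bar> * ((b k * \<delta>diff k)\<^sup>2 * g k n))"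
      proof (rule sum_mono)
        fix k assume k: "k \<in> {k0..n}"
        have "(g k n)\<^sup>2 \<le> \<bar>C + Z\<bar> * g k n"
          unfolding power2_eq_square using gG[of k n] k g0[of k n] by (intro mult_right_mono) auto
        then have "(b k * \<delta>diff k)\<^sup>2 * (g k n)\<^sup>2 \<le> (b k * \<delta>diff k)\<^sup>2 * (\<bar>C + Z\<bar> * g k n)" by (intro mult_left_mono) auto
        then show "(b k * \<delta>diff k)\<^sup>2 * (g k n)\<^sup>2 \<le> \<bar>C + Z\<bar> * ((b k * \<delta>diff k)\<^sup>2 * g k n)" by (simp only: mult_ac)
      qed
      then have "(\<Sum>k=k0..n. (b k * \<delta>diff k)\<^sup>2 * (g k n)\<^sup>2) / (s n)\<^sup>2 \<le> (\<Sum>k=k0..n. \<bar>C + Z\<bar> * ((b k * \<delta>diff k)\<^sup>2 * g k n)) / (s n)\<^sup>2"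
        by (intro divide_right_mono) auto
      then show "(\<Sum>k=k0..n. (b k * \<delta>diff k)\<^sup>2 * (g k n)\<^sup>2) / (s n)\<^sup>2 \<le> \<bar>C + Z\<bar> * ((\<Sum>k=k0..n. (b k * \<delta>diff k)\<^sup>2 * g k n) / (s n)\<^sup>2)"
        by (simp add: sum_distrib_left)
    qed
  qed
  \<comment> \<open>The tail condition for a window containing only the last index; the maximum in
    \<open>l\<close> merely keeps \<open>l 1\<close> positive.\<close>
  have slast: "(\<lambda>n. (b n * \<delta>diff n)\<^sup>2 / (\<Sum>k=1..n. (b k * \<delta>diff k)\<^sup>2)) \<longlonglongrightarrow> 0"
  proof -
    define l where "l n = max 1 (n - 1)" for n :: nat
    have l1: "1 \<le> l n \<and> l n \<le> n" if "n \<ge> 1" for n using that by (auto simp: l_def)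
    have l2: "(\<lambda>n. real n - real (l n)) \<in> o(\<lambda>n. real n)"
    proof (rule smalloI_tendsto)
      have ev: "\<forall>\<^sub>F n in sequentially. 1 / real n = (real n - real (l n)) / real n"
        using eventually_ge_at_top[of 2] by eventually_elim (simp add: l_def max_def of_nat_diff)
      show "(\<lambda>n. (real n - real (l n)) / real n) \<longlonglongrightarrow> 0"
        by (rule Lim_transform_eventually[OF _ ev]) (rule lim_1_over_n)
      show "\<forall>\<^sub>F n in sequentially. real n \<noteq> 0" using eventually_gt_at_top[of 0] by eventually_elim auto
    qed
    have "(\<lambda>n. (\<Sum>k=l n + 1..n. (b k * \<delta>diff k)\<^sup>2) / (\<Sum>k=1..n. (b k * \<delta>diff k)\<^sup>2)) \<longlonglongrightarrow> 0"
      using C_tail[of l, OF l1 l2] by blast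
    moreover have "\<forall>\<^sub>F n in sequentially. (\<Sum>k=l n + 1..n. (b k * \<delta>diff k)\<^sup>2) / (\<Sum>k=1..n. (b k * \<delta>diff k)\<^sup>2) = (b n * \<delta>diff n)\<^sup>2 / (\<Sum>k=1..n. (b k * \<delta>diff k)\<^sup>2)"
      using eventually_ge_at_top[of 2]
    proof eventually_elim
      case (elim n)
      then have "{l n + 1..n} = {n}" by (auto simp: l_def)
      then show ?case by simp
    qed
    ultimately show ?thesis by (rule Lim_transform_eventually)
  qed

  \<comment> \<open>Rates, localization radius and starting time\<close>
  define L1 L2 L2' L3 where "L1 = L + 4 * ((L' - L) / 5)" and "L2 = L + 3 * ((L' - L) / 5)"
    and "L2' = L + 2 * ((L' - L) / 5)" and "L3 = L + (L' - L) / 5"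
  \<comment> \<open>The gap between \<open>L\<close> and \<open>L'\<close> is spent in five equal
    parts: down to \<open>L1\<close> for the nonlinearity of \<open>f\<close>, to \<open>L2\<close>
    for the cross term with \<open>R\<close>, to \<open>L2'\<close> for the quadratic term of a
    squared contraction, to \<open>L3\<close> for absorbing the noise variance, and the last part
    because (A) bounds only a limit superior by \<open>L\<close>.\<close>
  have Ls: "0 < L3" "L < L3" "L3 < L2'" "L2' < L2" "L2 < L1" "L1 < L'"
  proof -
    have "0 < (L' - L) / 5" using ctr(4) by simp
    moreover have "L' = L + 5 * ((L' - L) / 5)" by (simp add: field_simps)
    ultimately show "0 < L3" "L < L3" "L3 < L2'" "L2' < L2" "L2 < L1" "L1 < L'"
      using L_pos unfolding L1_def L2_def L2'_def L3_def by linarith+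
  qed
  \<comment> \<open>The admissible relative linearization error in the standard norm; the factor
    \<open>K0\<close> is lost when passing to the adapted norm.\<close>
  define \<kappa> where "\<kappa> = (L' - L1) / K0"
  have \<kappa>: "\<kappa> > 0" using Ls K0 by (simp add: \<kappa>_def)
  obtain r1 Cf where r1: "r1 > 0" "Cf \<ge> 0" "ball \<theta>s r1 \<subseteq> interior D"
    "\<And>x. x \<in> ball \<theta>s r1 \<Longrightarrow> norm (f x - H *v (x - \<theta>s)) \<le> \<kappa> * norm (x - \<theta>s)"
    "\<And>x. x \<in> ball \<theta>s r1 \<Longrightarrow> norm (f x - H *v (x - \<theta>s)) \<le> Cf * norm (x - \<theta>s) powr (1 + lam)"
    proof (rule local_linearization[OF zero B \<kappa>])
  qed (use that in blast)+
  obtain \<epsilon>1 where \<epsilon>1: "\<epsilon>1 > 0" "limsup (\<lambda>n. ennreal (1 / \<delta> n) * ennreal_sqrt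
      (\<integral>\<^sup>+\<omega>. ennreal (indicator (ball \<theta>s \<epsilon>1) (\<theta> (n - 1) \<omega>) * (norm (R n \<omega>))\<^sup>2) \<partial>M)) < \<infinity>" using D_moment by blast
  obtain \<epsilon>2 where \<epsilon>2: "\<epsilon>2 > 0" "limsup (\<lambda>n. ennreal (1 / (\<delta> n / sqrt (\<gamma> n))) * ennreal_sqrt
      (\<integral>\<^sup>+\<omega>. ennreal (indicator (ball \<theta>s \<epsilon>2) (\<theta> (n - 1) \<omega>) * (norm (Dn n \<omega>))\<^sup>2) \<partial>M)) < \<infinity>" using E_moment by blast
  obtain CR nR where CR: "CR \<ge> 0" "nR \<ge> 1"
    "\<And>n r. n \<ge> nR \<Longrightarrow> r \<le> \<epsilon>1 \<Longrightarrow> integrable M (\<lambda>\<omega>. indicator (ball \<theta>s r) (\<theta> (n - 1) \<omega>) * (norm (R n \<omega>))\<^sup>2)"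
    "\<And>n r. n \<ge> nR \<Longrightarrow> r \<le> \<epsilon>1 \<Longrightarrow> (\<integral>\<omega>. indicator (ball \<theta>s r) (\<theta> (n - 1) \<omega>) * (norm (R n \<omega>))\<^sup>2 \<partial>M) \<le> CR * (\<delta> n)\<^sup>2"
    proof (rule limsup_second_moment[OF RM \<theta>M \<delta>_pos(3) \<epsilon>1(2)])
  qed (use that in blast)+
  have dsg: "\<delta> n / sqrt (\<gamma> n) > 0" if "n \<ge> 1" for n using \<delta>_pos(3)[OF that] \<gamma>_pos[OF that] by simp
  obtain CD nD where CD: "CD \<ge> 0" "nD \<ge> 1"
    "\<And>n r. n \<ge> nD \<Longrightarrow> r \<le> \<epsilon>2 \<Longrightarrow> integrable M (\<lambda>\<omega>. indicator (ball \<theta>s r) (\<theta> (n - 1) \<omega>) * (norm (Dn n \<omega>))\<^sup>2)"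
    "\<And>n r. n \<ge> nD \<Longrightarrow> r \<le> \<epsilon>2 \<Longrightarrow> (\<integral>\<omega>. indicator (ball \<theta>s r) (\<theta> (n - 1) \<omega>) * (norm (Dn n \<omega>))\<^sup>2 \<partial>M) \<le> CD * (\<delta> n / sqrt (\<gamma> n))\<^sup>2"
    proof (rule limsup_second_moment[OF DnM \<theta>M dsg \<epsilon>2(2)])
  qed (use that in blast)+
  define r where "r = min r1 (min \<epsilon>1 \<epsilon>2)"
  have r: "r > 0" "r \<le> r1" "r \<le> \<epsilon>1" "r \<le> \<epsilon>2" using r1 \<epsilon>1 \<epsilon>2 by (auto simp: r_def)
  have br: "x \<in> ball \<theta>s r1" if "x \<in> ball \<theta>s r" for x using that r(2) by auto
  have ev\<gamma>: "\<forall>\<^sub>F n in sequentially. \<gamma> n < e" if "e > 0" for e using A_decr(2) that by (intro order_tendstoD) auto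
  have ev\<delta>: "\<forall>\<^sub>F n in sequentially. 1 / \<gamma> n * (1 - \<delta> n / \<delta> (n - 1)) \<le> L3"
  proof -
    have "limsup (\<lambda>n. ereal (1 / \<gamma> n * (1 - \<delta> n / \<delta> (n - 1)))) < ereal L3" using A_\<delta> Ls(2) by (simp add: le_less_trans)
    then have "\<forall>\<^sub>F n in sequentially. ereal (1 / \<gamma> n * (1 - \<delta> n / \<delta> (n - 1))) < ereal L3" by (rule Limsup_lessD)
    then show ?thesis by eventually_elim simp
  qed
  \<comment> \<open>By the last limit in (A) the ratio of \<open>b / \<gamma>\<close> at successive
    times is at most \<open>1 + \<gamma> n\<close>, hence at most \<open>2\<close>, and
    \<open>\<gamma>\<close> decreases. This later permits shifting weights by one index.\<close>
  have evb: "\<forall>\<^sub>F n in sequentially. b (Suc n) \<le> 2 * b n"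
  proof -
    have "\<forall>\<^sub>F n in sequentially. 1 / \<gamma> n * (b (n + 1) * \<gamma> n / (b n * \<gamma> (n + 1)) - 1) < 1"
      using A_b by (intro order_tendstoD) auto
    then show ?thesis using ev\<gamma>[of 1, OF zero_less_one] eventually_ge_at_top[of 1]
    proof eventually_elim
      case (elim n)
      note p = \<gamma>_pos[OF elim(3)] \<gamma>_pos[of "n + 1"] b_pos[OF elim(3)] b_pos[of "n + 1"]
      define t where "t = b (n + 1) * \<gamma> n / (b n * \<gamma> (n + 1))"
      have "(t - 1) / \<gamma> n < 1" using elim(1) by (simp add: t_def)
      then have "t - 1 < \<gamma> n" using p by (simp only: pos_divide_less_eq mult_1)
      then have "t \<le> 2" using elim(2) by linarith
      then have "b (n + 1) * \<gamma> n / (b n * \<gamma> (n + 1)) \<le> 2" by (simp only: t_def)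
      then have "b (n + 1) * \<gamma> n \<le> 2 * (b n * \<gamma> (n + 1))" using p by (simp add: pos_divide_le_eq)
      also have "\<dots> \<le> 2 * (b n * \<gamma> n)" using A_decr(1)[OF elim(3)] p by simp
      finally show ?case using p by simp
    qed
  qed
  \<comment> \<open>The step size must be admissible for the contraction and at most
    \<open>1\<close>; the third entry keeps the contraction factors nonnegative, and the fourth
    makes \<open>(1 - \<gamma> L2)^2\<close> at most \<open>1 - 2 \<gamma> L2'\<close>.\<close>
  define G where "G = min h (min 1 (min (1 / (2 * (L1 + 1))) ((L2 - L2') / (L2 + 1)\<^sup>2)))"
  have L10: "L1 > 0" "L2 > 0" "L2' > 0" using Ls by auto
  have Gpos: "G > 0" unfolding G_def using ctr(3) L10 Ls by (simp add: add_pos_pos)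
  have "\<forall>\<^sub>F n in sequentially. \<gamma> n < G \<and> 1 / \<gamma> n * (1 - \<delta> n / \<delta> (n - 1)) \<le> L3 \<and> b (Suc n) \<le> 2 * b n"
    by (intro eventually_conj ev\<gamma> ev\<delta> evb Gpos)
  then obtain m1 where m1: "\<And>n. n \<ge> m1 \<Longrightarrow> \<gamma> n < G \<and> 1 / \<gamma> n * (1 - \<delta> n / \<delta> (n - 1)) \<le> L3 \<and> b (Suc n) \<le> 2 * b n"
    unfolding eventually_sequentially by blast
  define m0 where "m0 = Max {m1, k0, nR, nD}"
  have m0: "m1 \<le> m0" "k0 \<le> m0" "nR \<le> m0" "nD \<le> m0" "1 \<le> m0" using k0 CR(2) by (auto simp: m0_def)
  have \<gamma>G: "\<gamma> n \<le> h" "\<gamma> n \<le> 1" "\<gamma> n * L1 \<le> 1" "2 * \<gamma> n * L2' \<le> 1" "(1 - \<gamma> n * L2)\<^sup>2 \<le> 1 - 2 * \<gamma> n * L2'" "0 < \<gamma> n" if "n \<ge> m0" for n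
  proof -
    have n: "n \<ge> m1" "n \<ge> 1" using that m0 by auto
    have lt: "\<gamma> n < G" using m1[OF n(1)] by blast
    show p: "0 < \<gamma> n" by (rule \<gamma>_pos[OF n(2)])
    show "\<gamma> n \<le> h" "\<gamma> n \<le> 1" using lt by (auto simp: G_def)
    have "\<gamma> n \<le> 1 / (2 * (L1 + 1))" using lt by (auto simp: G_def)
    then have q: "\<gamma> n * (2 * (L1 + 1)) \<le> 1" using L10 by (simp add: pos_le_divide_eq)
    have a: "\<gamma> n * L2' \<le> \<gamma> n * L1" "0 < \<gamma> n * L1" using p Ls L10 by auto
    have "\<gamma> n * (2 * (L1 + 1)) = 2 * (\<gamma> n * L1) + 2 * \<gamma> n" by (simp add: algebra_simps)
    with q p a have "\<gamma> n * L1 \<le> 1" "2 * (\<gamma> n * L2') \<le> 1" by linarith+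
    then show "\<gamma> n * L1 \<le> 1" "2 * \<gamma> n * L2' \<le> 1" by (simp_all only: mult.assoc)
    have "\<gamma> n \<le> (L2 - L2') / (L2 + 1)\<^sup>2" using lt by (auto simp: G_def)
    then have "\<gamma> n * (L2 + 1)\<^sup>2 \<le> L2 - L2'" using L10 by (simp add: pos_le_divide_eq)
    moreover have "\<gamma> n * L2\<^sup>2 \<le> \<gamma> n * (L2 + 1)\<^sup>2" using p L10 by (intro mult_left_mono power_mono) auto
    ultimately have "\<gamma> n * L2\<^sup>2 \<le> L2 - L2'" by linarith
    then have "\<gamma> n * (\<gamma> n * L2\<^sup>2) \<le> \<gamma> n * (L2 - L2')" using p by (intro mult_left_mono) auto
    moreover have "0 \<le> \<gamma> n * (L2 - L2')" using p Ls by simp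
    moreover have "(1 - \<gamma> n * L2)\<^sup>2 = 1 - 2 * (\<gamma> n * L2) + \<gamma> n * (\<gamma> n * L2\<^sup>2)" by (simp add: power2_eq_square algebra_simps)
    ultimately show "(1 - \<gamma> n * L2)\<^sup>2 \<le> 1 - 2 * \<gamma> n * L2'" by (simp add: right_diff_distrib)
  qed

  \<comment> \<open>The unprojected recursion and its second moments near the zero\<close>
  have rec: "\<theta> n \<omega> = \<theta> (n - 1) \<omega> + \<gamma> n *\<^sub>R (f (\<theta> (n - 1) \<omega>) + R n \<omega> + Dn n \<omega>)"
    if n: "n \<ge> 1" and w: "\<omega> \<in> space M" and b: "\<theta> n \<omega> \<in> ball \<theta>s r" for n \<omega>
  proof -
    let ?y = "\<theta> (n - 1) \<omega> + \<gamma> n *\<^sub>R (f (\<theta> (n - 1) \<omega>) + R n \<omega> + Dn n \<omega>)"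
    have eq: "\<theta> n \<omega> = P ?y" by (rule \<theta>_rec[OF n w])
    \<comment> \<open>The projection sends points outside \<open>D\<close> to the boundary, so an
      interior value shows that it was not active in this step.\<close>
    have "\<theta> n \<omega> \<in> interior D" using br[OF b] r1(3) by blast
    then have "P ?y \<notin> frontier D" unfolding eq by (simp add: frontier_def)
    then have "?y \<in> D" using proj(4) by blast
    then show ?thesis using eq proj(3) by simp
  qed
  have f\<theta>: "(\<lambda>\<omega>. f (\<theta> n \<omega>)) \<in> borel_measurable (F n)" for n
  proof (rule measurable_compose[OF _ f])
    have "space (F n) = space M" using Fsub[of n] by (simp add: subalgebra_def)
    then show "\<theta> n \<in> measurable (F n) (restrict_space borel D)"
      using \<theta>_adapted[of n] \<theta>_in_D by (intro measurable_restrict_space2) auto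
  qed
  have contr: "nm ((x - \<theta>s) + \<gamma> n *\<^sub>R f x) \<le> (1 - \<gamma> n * L1) * nm (x - \<theta>s)" if n: "n \<ge> m0" and x: "x \<in> ball \<theta>s r" for n x
  proof -
    let ?x = "x - \<theta>s" and ?e = "f x - H *v (x - \<theta>s)"
    note p = \<gamma>G[OF n]
    have "?x + \<gamma> n *\<^sub>R f x = (?x + \<gamma> n *\<^sub>R (H *v ?x)) + \<gamma> n *\<^sub>R ?e" by (simp add: algebra_simps)
    then have "nm (?x + \<gamma> n *\<^sub>R f x) \<le> nm (?x + \<gamma> n *\<^sub>R (H *v ?x)) + nm (\<gamma> n *\<^sub>R ?e)"
      unfolding nm_def by (simp only: orbit_norm_triangle[OF ctr(1)])
    also have "nm (?x + \<gamma> n *\<^sub>R (H *v ?x)) \<le> (1 - \<gamma> n * L') * nm ?x"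
      unfolding nm_def by (rule ctr(5)) (use p in auto)
    also have "nm (\<gamma> n *\<^sub>R ?e) = \<gamma> n * nm ?e" unfolding nm_def orbit_norm_scaleR using p by simp
    also have "\<gamma> n * nm ?e \<le> \<gamma> n * ((L' - L1) * nm ?x)"
    proof (rule mult_left_mono)
      have "nm ?e \<le> K0 * norm ?e" by (rule K0)
      also have "\<dots> \<le> K0 * (\<kappa> * norm ?x)" using r1(4)[OF br[OF x]] K0 by (intro mult_left_mono) auto
      also have "\<dots> \<le> K0 * (\<kappa> * nm ?x)" using nm(2)[of ?x] K0 \<kappa> by (intro mult_left_mono) auto
      also have "\<dots> = (L' - L1) * nm ?x" using K0 by (simp add: \<kappa>_def)
      finally show "nm ?e \<le> (L' - L1) * nm ?x" .
    qed (use p in simp)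
    finally show ?thesis by (simp add: algebra_simps)
  qed
  define E where "E m n = {\<omega>\<in>space M. \<forall>k\<in>{m..n}. \<theta> k \<omega> \<in> ball \<theta>s r}" for m n
  have second: "\<exists>K\<ge>0. \<forall>n\<ge>m. integrable M (\<lambda>\<omega>. indicator (E m n) \<omega> * (norm (\<theta> n \<omega> - \<theta>s))\<^sup>2)
     \<and> (\<integral>\<omega>. indicator (E m n) \<omega> * (norm (\<theta> n \<omega> - \<theta>s))\<^sup>2 \<partial>M) \<le> K * (\<delta> n)\<^sup>2" if m: "m \<ge> m0" for m
    unfolding E_def
  proof (rule mean_square_bound[where F = F and ip = "orbit_inner Am \<rho> N" and N = nm and f = f and R = R and W = Dn and \<gamma> = \<gamma>
        and CR = CR and CW = CD and ?L1.0 = L1 and ?L2.0 = L2 and L2' = L2' and ?L3.0 = L3, OF prob Fsub Fmono])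
    show "bilinear (orbit_inner Am \<rho> N)" by (rule bilinear_orbit_inner)
    show "orbit_inner Am \<rho> N x y = orbit_inner Am \<rho> N y x" for x y by (rule orbit_inner_commute)
    show "orbit_inner Am \<rho> N x x = (nm x)\<^sup>2" for x unfolding nm_def by (rule orbit_inner_self)
    fix n assume n: "n > m"
    then have n': "n \<ge> 1" "n \<ge> m0" "n \<ge> nR" "n \<ge> nD" "n \<ge> m1" using m m0 by auto
    show "R n \<in> borel_measurable M" by (rule RM[OF n'(1)])
    show "integrable M (\<lambda>\<omega>. indicator (ball \<theta>s r) (\<theta> (n - 1) \<omega>) * (norm (R n \<omega>))\<^sup>2)" by (rule CR(3)[OF n'(3) r(3)])
    show "(\<integral>\<omega>. indicator (ball \<theta>s r) (\<theta> (n - 1) \<omega>) * (norm (R n \<omega>))\<^sup>2 \<partial>M) \<le> CR * (\<delta> n)\<^sup>2" by (rule CR(4)[OF n'(3) r(3)])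
    show "cond_exp_version M (F (n - 1)) (\<lambda>\<omega>. Dn n \<omega> $ i) (\<lambda>_. 0)" for i by (rule Dnv[OF n'(1)])
    show "integrable M (\<lambda>\<omega>. indicator (ball \<theta>s r) (\<theta> (n - 1) \<omega>) * (norm (Dn n \<omega>))\<^sup>2)" by (rule CD(3)[OF n'(4) r(4)])
    have "(\<delta> n / sqrt (\<gamma> n))\<^sup>2 = (\<delta> n)\<^sup>2 / \<gamma> n" using \<gamma>G(6)[OF n'(2)] by (simp add: power_divide)
    then show "(\<integral>\<omega>. indicator (ball \<theta>s r) (\<theta> (n - 1) \<omega>) * (norm (Dn n \<omega>))\<^sup>2 \<partial>M) \<le> CD * (\<delta> n)\<^sup>2 / \<gamma> n"
      using CD(4)[OF n'(4) r(4)] by simp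
    show "\<theta> n \<omega> = \<theta> (n - 1) \<omega> + \<gamma> n *\<^sub>R (f (\<theta> (n - 1) \<omega>) + R n \<omega> + Dn n \<omega>)"
      if "\<omega> \<in> space M" "\<theta> n \<omega> \<in> ball \<theta>s r" for \<omega> by (rule rec[OF n'(1) that])
    show "nm ((x - \<theta>s) + \<gamma> n *\<^sub>R f x) \<le> (1 - \<gamma> n * L1) * nm (x - \<theta>s)" if "x \<in> ball \<theta>s r" for x by (rule contr[OF n'(2) that])
    show "0 < \<gamma> n" "\<gamma> n \<le> 1" "\<gamma> n * L1 \<le> 1" "(1 - \<gamma> n * L2)\<^sup>2 \<le> 1 - 2 * \<gamma> n * L2'" "2 * \<gamma> n * L2' \<le> 1"
      using \<gamma>G[OF n'(2)] by blast+
    show "1 / \<gamma> n * (1 - \<delta> n / \<delta> (n - 1)) \<le> L3" using m1[OF n'(5)] by blast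
  next
    show "\<delta> n > 0" if "n \<ge> m" for n using \<delta>_pos(3)[of n] that m m0 by auto
  qed (use nm K0 \<theta>_adapted f\<theta> Ls CR(1) CD(1) in \<open>blast+\<close>)
  \<comment> \<open>The indicator makes the noise square integrable; on \<open>conv\<close> it is eventually \<open>1\<close>.\<close>
  define J where "J k \<omega> = (if m0 \<le> k then indicator (ball \<theta>s r) (\<theta> (k - 1) \<omega>) else (0 :: real))" for k \<omega>
  have JF: "J k \<in> borel_measurable (F (k - 1))" for k
  proof -
    note [measurable] = \<theta>_adapted[of "k - 1"]
    have "J k = (\<lambda>\<omega>. if m0 \<le> k \<and> dist \<theta>s (\<theta> (k - 1) \<omega>) < r then 1 else 0)"
      by (auto simp: J_def indicator_def)
    also have "\<dots> \<in> borel_measurable (F (k - 1))" by measurable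
    finally show ?thesis .
  qed
  have J01: "\<bar>J k \<omega>\<bar> \<le> 1" "J k \<omega> * J k \<omega> = J k \<omega>" for k \<omega> by (auto simp: J_def indicator_def)

  \<comment> \<open>The localized noise and its conditional covariances\<close>
  define X where "X k \<omega> = J k \<omega> *\<^sub>R Dn k \<omega>" for k \<omega>
  have JF': "J k \<in> borel_measurable (F k)" for k
    using JF[of k] Fsub[of k] Fsub[of "k - 1"] Fmono[of "k - 1" k] measurable_mono[of borel borel "F (k - 1)" "F k"]
    by (auto simp: subalgebra_def)
  have XF: "X k \<in> borel_measurable (F k)" if "k \<ge> 1" for k
    unfolding X_def using JF' DnF[OF that] by (intro borel_measurable_scaleR)
  have XM: "X k \<in> borel_measurable M" if "k \<ge> 1" for k using measurable_from_subalg[OF Fsub XF[OF that]] .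
  have Xsq: "integrable M (\<lambda>\<omega>. (norm (X k \<omega>))\<^sup>2)" if "k \<ge> 1" for k
  proof (cases "m0 \<le> k")
    case True
    have "(\<lambda>\<omega>. (norm (X k \<omega>))\<^sup>2) = (\<lambda>\<omega>. indicator (ball \<theta>s r) (\<theta> (k - 1) \<omega>) * (norm (Dn k \<omega>))\<^sup>2)"
      using True by (auto simp: X_def J_def indicator_def)
    then show ?thesis using CD(3)[of k r] True m0 r by simp
  qed (simp add: X_def J_def)
  have Xdom: "norm (X k \<omega>) \<le> norm (Dn k \<omega>)" for k \<omega>
    using J01(1)[of k \<omega>] by (simp add: X_def mult_left_le_one_le)
  \<comment> \<open>The factor \<open>J k\<close> is idempotent and known at time
    \<open>k - 1\<close>, so it leaves the conditional expectation; the centering terms in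
    \<open>cond_cov\<close> vanish because the noise has conditional mean zero. Square integrability
    of the original noise is not at hand, but the product \<open>J k\<close> times the noise
    products is integrable.\<close>
  have XJ: "AE \<omega> in M. real_cond_exp M (F (k - 1)) (\<lambda>\<omega>. X k \<omega> $ i * X k \<omega> $ j) \<omega> = J k \<omega> * cond_cov M (F (k - 1)) (Dn k) \<omega> $ i $ j"
    if k: "k \<ge> 1" for k i j
  proof -
    interpret S: square_integrable_vector M "F (k - 1)" "X k"
      by unfold_locales (use Fsub XM[OF k] Xsq[OF k] in auto)
    have Di [measurable]: "(\<lambda>\<omega>. Dn k \<omega> $ i) \<in> borel_measurable M" for i
      by (rule measurable_compose[OF DnM[OF k]]) measurable
    have z: "AE \<omega> in M. real_cond_exp M (F (k - 1)) (\<lambda>\<omega>. Dn k \<omega> $ i) \<omega> = 0" for i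
      using Dnv[OF k] by (auto simp: cond_exp_version_def)
    have 1: "AE \<omega> in M. cond_cov M (F (k - 1)) (Dn k) \<omega> $ i $ j = real_cond_exp M (F (k - 1)) (\<lambda>\<omega>. Dn k \<omega> $ i * Dn k \<omega> $ j) \<omega>"
      unfolding cond_cov_def vec_lambda_beta
    proof (rule S.real_cond_exp_cong)
      show "AE \<omega> in M. (Dn k \<omega> $ i - real_cond_exp M (F (k - 1)) (\<lambda>x. Dn k x $ i) \<omega>) *
          (Dn k \<omega> $ j - real_cond_exp M (F (k - 1)) (\<lambda>x. Dn k x $ j) \<omega>) = Dn k \<omega> $ i * Dn k \<omega> $ j"
        using z[of i] z[of j] by eventually_elim simp
    qed measurable
    have e: "(\<lambda>\<omega>. X k \<omega> $ i * X k \<omega> $ j) = (\<lambda>\<omega>. J k \<omega> * (Dn k \<omega> $ i * Dn k \<omega> $ j))"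
    proof
      fix \<omega>
      have "X k \<omega> $ i * X k \<omega> $ j = (J k \<omega> * J k \<omega>) * (Dn k \<omega> $ i * Dn k \<omega> $ j)" by (simp add: X_def)
      then show "X k \<omega> $ i * X k \<omega> $ j = J k \<omega> * (Dn k \<omega> $ i * Dn k \<omega> $ j)" by (simp only: J01(2))
    qed
    have "AE \<omega> in M. real_cond_exp M (F (k - 1)) (\<lambda>\<omega>. J k \<omega> * (Dn k \<omega> $ i * Dn k \<omega> $ j)) \<omega> = J k \<omega> * real_cond_exp M (F (k - 1)) (\<lambda>\<omega>. Dn k \<omega> $ i * Dn k \<omega> $ j) \<omega>"
      by (rule S.real_cond_exp_mult) (use JF S.int_prod[of i j] in \<open>auto simp: e\<close>)
    with 1 show ?thesis unfolding e by eventually_elim simp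
  qed
  have ev_ball: "\<forall>\<^sub>F n in sequentially. \<theta> n \<omega> \<in> ball \<theta>s r" if "\<omega> \<in> conv" for \<omega>
  proof -
    have "(\<lambda>n. \<theta> n \<omega>) \<longlonglongrightarrow> \<theta>s" using that by (simp add: conv_def)
    from tendstoD[OF this r(1)] show ?thesis by eventually_elim (simp add: dist_commute)
  qed
  interpret W: weighted_vector_martingale M F X b \<delta>diff s conv \<Gamma>
  proof unfold_locales
    show "\<exists>N. \<exists>B\<in>sets (F N). measure M (sym_diff conv B) < e" if "e > 0" for e
      unfolding conv_def by (rule convergence_event_approximation[OF prob Fsub Fmono \<theta>_adapted that])
    show "cond_exp_version M (F (k - 1)) (\<lambda>\<omega>. X k \<omega> $ i) (\<lambda>_. 0)" if "k \<ge> 1" for k i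
      using cond_exp_version_mult_bounded[OF prob Fsub Dnv[OF that] JF J01(1)] by (simp add: X_def)
    have "AE \<omega> in M. \<forall>k\<in>{1..}. \<forall>i j. real_cond_exp M (F (k - 1)) (\<lambda>\<omega>. X k \<omega> $ i * X k \<omega> $ j) \<omega> = J k \<omega> * cond_cov M (F (k - 1)) (Dn k) \<omega> $ i $ j"
    proof (rule AE_all_ge_one)
      fix k :: nat assume k: "k \<ge> 1"
      show "AE \<omega> in M. \<forall>i j. real_cond_exp M (F (k - 1)) (\<lambda>\<omega>. X k \<omega> $ i * X k \<omega> $ j) \<omega> = J k \<omega> * cond_cov M (F (k - 1)) (Dn k) \<omega> $ i $ j"
        unfolding AE_all_countable using XJ[OF k] by blast
    qed
    then show "AE \<omega> in M. \<omega> \<in> conv \<longrightarrow> (\<forall>i j. (\<lambda>n. real_cond_exp M (F (n - 1)) (\<lambda>\<omega>. X n \<omega> $ i * X n \<omega> $ j) \<omega> / (\<delta>diff n)\<^sup>2) \<longlonglongrightarrow> \<Gamma> $ i $ j)"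
      using E_cov
    proof (eventually_elim, intro impI allI)
      fix \<omega> i j
      assume h: "\<forall>k\<in>{1..}. \<forall>i j. real_cond_exp M (F (k - 1)) (\<lambda>\<omega>. X k \<omega> $ i * X k \<omega> $ j) \<omega> = J k \<omega> * cond_cov M (F (k - 1)) (Dn k) \<omega> $ i $ j"
        "\<omega> \<in> conv \<longrightarrow> (\<lambda>n. (1 / (\<delta>diff n)\<^sup>2) *\<^sub>R cond_cov M (F (n - 1)) (Dn n) \<omega>) \<longlonglongrightarrow> \<Gamma>" and w: "\<omega> \<in> conv"
      have "(\<lambda>n. ((1 / (\<delta>diff n)\<^sup>2) *\<^sub>R cond_cov M (F (n - 1)) (Dn n) \<omega>) $ i $ j) \<longlonglongrightarrow> \<Gamma> $ i $ j"
        using h(2) w by (intro tendsto_vec_nth) auto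
      moreover have "\<forall>\<^sub>F n in sequentially. \<theta> (n - 1) \<omega> \<in> ball \<theta>s r"
        using ev_ball[OF w] by (subst eventually_sequentially_Suc[symmetric]) simp
      then have "\<forall>\<^sub>F n in sequentially. ((1 / (\<delta>diff n)\<^sup>2) *\<^sub>R cond_cov M (F (n - 1)) (Dn n) \<omega>) $ i $ j
          = real_cond_exp M (F (n - 1)) (\<lambda>\<omega>. X n \<omega> $ i * X n \<omega> $ j) \<omega> / (\<delta>diff n)\<^sup>2"
        using eventually_ge_at_top[of m0]
      proof eventually_elim
        case (elim n)
        have J1: "J n \<omega> = 1" using elim by (simp add: J_def)
        have "n \<in> {1..}" using elim m0 by auto
        with h(1) have "real_cond_exp M (F (n - 1)) (\<lambda>\<omega>. X n \<omega> $ i * X n \<omega> $ j) \<omega> = J n \<omega> * cond_cov M (F (n - 1)) (Dn n) \<omega> $ i $ j" by blast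
        then show ?case unfolding J1 by simp
      qed
      ultimately show "(\<lambda>n. real_cond_exp M (F (n - 1)) (\<lambda>\<omega>. X n \<omega> $ i * X n \<omega> $ j) \<omega> / (\<delta>diff n)\<^sup>2) \<longlonglongrightarrow> \<Gamma> $ i $ j"
        by (rule Lim_transform_eventually)
    qed
  qed (use Fsub Fmono convM XF Xsq b_pos \<delta>_pos(2) C_diff slast in \<open>auto simp: s_def\<close>)

  \<comment> \<open>Splitting the weighted sum into bias, martingale and remainder\<close>
  define x where "x k \<omega> = \<theta> k \<omega> - \<theta>s" for k \<omega>
  have xM [measurable]: "x k \<in> borel_measurable M" for k unfolding x_def by measurable
  define N1 where "N1 n \<omega> = (\<Sum>k=k0..n. b k *\<^sub>R (?B k n *v R k \<omega>))" for n \<omega>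
  define N2 where "N2 n \<omega> = (\<Sum>k=k0..n. b k *\<^sub>R (?B k n *v X k \<omega>))" for n \<omega>
  define Rem where "Rem n \<omega> = (\<Sum>l=1..n. b l *\<^sub>R x l \<omega>) - N1 n \<omega> - N2 n \<omega>" for n \<omega>
  have matM: "(\<lambda>\<omega>. Mat *v Y \<omega>) \<in> borel_measurable M" if "Y \<in> borel_measurable M" for Mat :: "real ^ 'd ^ 'd" and Y :: "'a \<Rightarrow> real ^ 'd"
    by (rule measurable_compose[OF that]) (intro borel_measurable_continuous_onI matrix_vector_mult_linear_continuous_on)
  have N1M [measurable]: "N1 n \<in> borel_measurable M" for n
    unfolding N1_def using k0 by (intro borel_measurable_sum borel_measurable_scaleR borel_measurable_const matM RM) auto
  have N2M [measurable]: "N2 n \<in> borel_measurable M" for n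
    unfolding N2_def using k0 by (intro borel_measurable_sum borel_measurable_scaleR borel_measurable_const matM XM) auto
  have RemM [measurable]: "Rem n \<in> borel_measurable M" for n unfolding Rem_def by measurable
  define t where "t n = (\<Sum>l=1..n. b l * \<delta> l powr (1 + lam))" for n
  define \<Omega> where "\<Omega> m = {\<omega>\<in>space M. \<forall>k\<in>{m..}. \<theta> k \<omega> \<in> ball \<theta>s r}" for m
  have EM [measurable]: "E m n \<in> sets M" for m n unfolding E_def mem_ball by measurable
  \<comment> \<open>The localized power of the distance that dominates the linearization error. The
    event up to time \<open>k\<close> is used, matching the second moment bound, although paths in
    \<open>\<Omega> m\<close> stay in the ball forever.\<close>
  define a where "a m k \<omega> = indicator (E m k) \<omega> * norm (x k \<omega>) powr (1 + lam)" for m k \<omega>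
  define T where "T m n \<omega> = CB * (Cf * (\<Sum>k=Suc m..n. b k * a m (k - 1) \<omega>))" for m n \<omega>
  have a0: "0 \<le> a m k \<omega>" for m k \<omega> by (simp add: a_def)
  have aint: "\<exists>K\<ge>0. \<forall>k\<ge>m. integrable M (a m k) \<and> (\<integral>\<omega>. a m k \<omega> \<partial>M) \<le> K * \<delta> k powr (1 + lam)" if m: "m \<ge> m0" for m
  proof -
    obtain K where K: "K \<ge> 0" "\<And>n. n \<ge> m \<Longrightarrow> integrable M (\<lambda>\<omega>. indicator (E m n) \<omega> * (norm (x n \<omega>))\<^sup>2)"
      "\<And>n. n \<ge> m \<Longrightarrow> (\<integral>\<omega>. indicator (E m n) \<omega> * (norm (x n \<omega>))\<^sup>2 \<partial>M) \<le> K * (\<delta> n)\<^sup>2"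
      using second[OF m] unfolding x_def by blast
    have "integrable M (a m k) \<and> (\<integral>\<omega>. a m k \<omega> \<partial>M) \<le> (1 + K) * \<delta> k powr (1 + lam)" if k: "k \<ge> m" for k
    proof
      have dk: "\<delta> k > 0" using \<delta>_pos(3)[of k] k m m0 by auto
      let ?u = "\<lambda>\<omega>. \<delta> k powr (1 + lam) * (1 + (indicator (E m k) \<omega> * (norm (x k \<omega>))\<^sup>2) / (\<delta> k)\<^sup>2)"
      have le: "a m k \<omega> \<le> ?u \<omega>" for \<omega>
        using powr_le_quadratic[of "norm (x k \<omega>)" "\<delta> k" lam] dk lam by (auto simp: a_def indicator_def)
      have iu: "integrable M ?u" using K(2)[OF k] by simp
      show i: "integrable M (a m k)"
      proof (rule Bochner_Integration.integrable_bound[OF iu])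
        show "a m k \<in> borel_measurable M" unfolding a_def by measurable
        show "AE \<omega> in M. norm (a m k \<omega>) \<le> norm (?u \<omega>)"
        proof (rule AE_I2)
          fix \<omega>
          show "norm (a m k \<omega>) \<le> norm (?u \<omega>)" using le[of \<omega>] a0[of m k \<omega>] by simp
        qed
      qed
      have "(\<integral>\<omega>. a m k \<omega> \<partial>M) \<le> (\<integral>\<omega>. ?u \<omega> \<partial>M)" by (rule integral_mono[OF i iu le])
      also have "\<dots> = \<delta> k powr (1 + lam) * (1 + (\<integral>\<omega>. indicator (E m k) \<omega> * (norm (x k \<omega>))\<^sup>2 \<partial>M) / (\<delta> k)\<^sup>2)"
        using K(2)[OF k] by (simp add: prob_space)
      also have "\<dots> \<le> \<delta> k powr (1 + lam) * (1 + K * (\<delta> k)\<^sup>2 / (\<delta> k)\<^sup>2)"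
        using K(3)[OF k] by (intro mult_left_mono add_left_mono divide_right_mono) auto
      also have "\<dots> = (1 + K) * \<delta> k powr (1 + lam)" using dk by simp
      finally show "(\<integral>\<omega>. a m k \<omega> \<partial>M) \<le> (1 + K) * \<delta> k powr (1 + lam)" .
    qed
    then show ?thesis using K(1) by (intro exI[of _ "1 + K"]) simp
  qed
  \<comment> \<open>Stated for an arbitrary scale \<open>q\<close>, since (F) decides only at the
    end whether the remainder is measured against \<open>Wb\<close> or against
    \<open>s\<close>.\<close>
  have small: "(\<lambda>n. measure M (conv \<inter> {\<omega>\<in>space M. norm (Rem n \<omega>) > \<eta> * q n})) \<longlonglongrightarrow> 0"
    if q: "filterlim q at_top sequentially" "(\<lambda>n. t n / q n) \<longlonglongrightarrow> 0" and \<eta>: "\<eta> > 0" for q and \<eta> :: real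
  proof (rule localized_remainder_negligible[where \<Omega> = \<Omega> and T = T and t = t and a = q and ?m0.0 = m0, OF prob convM _ _ _ _ _ _ _ _ q \<eta>])
    show "\<Omega> m \<in> sets M" for m unfolding \<Omega>_def mem_ball by measurable
    show "incseq \<Omega>" by (auto simp: incseq_def \<Omega>_def)
    show "conv \<subseteq> (\<Union>m. \<Omega> m)"
    proof
      fix \<omega> assume w: "\<omega> \<in> conv"
      from ev_ball[OF w] obtain m where "\<forall>n\<ge>m. \<theta> n \<omega> \<in> ball \<theta>s r" by (auto simp: eventually_sequentially)
      then have "\<omega> \<in> \<Omega> m" using w by (auto simp: \<Omega>_def conv_def)
      then show "\<omega> \<in> (\<Union>m. \<Omega> m)" by blast
    qed
    show "(\<lambda>\<omega>. norm (Rem n \<omega>)) \<in> borel_measurable M" for n by measurable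
  next
    fix m \<omega> assume m: "m \<ge> m0" and w: "\<omega> \<in> \<Omega> m"
    have bal: "\<theta> k \<omega> \<in> ball \<theta>s r" if "k \<ge> m" for k using w that by (auto simp: \<Omega>_def)
    have wM: "\<omega> \<in> space M" using w by (simp add: \<Omega>_def)
    define e where "e k = f (\<theta> k \<omega>) - H *v x k \<omega>" for k
    have step: "x k \<omega> = x (k - 1) \<omega> + \<gamma> k *\<^sub>R (H *v x (k - 1) \<omega> + (e (k - 1) + R k \<omega> + X k \<omega>))" if k: "m < k" for k
    proof -
      have k1: "k \<ge> 1" using k by simp
      \<comment> \<open>Here \<open>k > m\<close>, so the previous state
        \<open>\<theta> (k - 1)\<close> already lies in the ball and the truncated noise is the
        original one.\<close>
      have "J k \<omega> = 1" using k m bal[of "k - 1"] by (simp add: J_def)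
      then have "X k \<omega> = Dn k \<omega>" by (simp add: X_def)
      then show ?thesis using rec[OF k1 wM bal[of k]] k by (simp add: x_def e_def algebra_simps)
    qed
    have k0m: "k0 \<le> m" using m m0 by simp
    have "\<exists>c. \<forall>n\<ge>m. norm ((\<Sum>l=1..n. b l *\<^sub>R x l \<omega>) - (\<Sum>k=k0..n. b k *\<^sub>R (?B k n *v R k \<omega>))
      - (\<Sum>k=k0..n. b k *\<^sub>R (?B k n *v X k \<omega>))) \<le> c + CB * (\<Sum>k=Suc m..n. b k * norm (e (k - 1)))"
      by (rule averaging_remainder_bound[OF b_pos \<gamma>_pos k0 k0m Bbd step])
    then obtain c where c: "\<And>n. n \<ge> m \<Longrightarrow> norm ((\<Sum>l=1..n. b l *\<^sub>R x l \<omega>) - (\<Sum>k=k0..n. b k *\<^sub>R (?B k n *v R k \<omega>))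
      - (\<Sum>k=k0..n. b k *\<^sub>R (?B k n *v X k \<omega>))) \<le> c + CB * (\<Sum>k=Suc m..n. b k * norm (e (k - 1)))" by blast
    have "norm (Rem n \<omega>) \<le> c + T m n \<omega>" if n: "n \<ge> m" for n
    proof -
      have "(\<Sum>k=Suc m..n. b k * norm (e (k - 1))) \<le> (\<Sum>k=Suc m..n. b k * (Cf * a m (k - 1) \<omega>))"
      proof (rule sum_mono)
        fix k assume k: "k \<in> {Suc m..n}"
        then have k1: "k \<ge> 1" "k - 1 \<ge> m" by auto
        have "\<omega> \<in> E m (k - 1)" using wM bal by (auto simp: E_def)
        then have "a m (k - 1) \<omega> = norm (x (k - 1) \<omega>) powr (1 + lam)" by (simp add: a_def)
        moreover have "norm (e (k - 1)) \<le> Cf * norm (x (k - 1) \<omega>) powr (1 + lam)"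
          unfolding e_def x_def by (rule r1(5)[OF br[OF bal[OF k1(2)]]])
        ultimately show "b k * norm (e (k - 1)) \<le> b k * (Cf * a m (k - 1) \<omega>)" using b_pos[OF k1(1)] by simp
      qed
      also have "\<dots> = Cf * (\<Sum>k=Suc m..n. b k * a m (k - 1) \<omega>)" by (simp add: sum_distrib_left mult.left_commute)
      finally have "CB * (\<Sum>k=Suc m..n. b k * norm (e (k - 1))) \<le> T m n \<omega>"
        unfolding T_def using CB by (intro mult_left_mono) auto
      then show ?thesis using c[OF n] by (simp add: Rem_def N1_def N2_def)
    qed
    then show "\<exists>c. \<forall>n\<ge>m. norm (Rem n \<omega>) \<le> c + T m n \<omega>" by blast
  next
    fix m n assume m: "m \<ge> m0" "n \<ge> m"
    have K: "integrable M (a m k)" if "k \<ge> m" for k using aint[OF m(1)] that by blast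
    show "integrable M (T m n)" unfolding T_def
      by (intro integrable_mult_right Bochner_Integration.integrable_sum K) auto
    show "0 \<le> T m n \<omega>" for \<omega>
      unfolding T_def using CB r1(2) a0 b_pos by (intro mult_nonneg_nonneg sum_nonneg) (auto simp: less_imp_le)
  next
    fix m assume m: "m \<ge> m0"
    obtain K where K: "K \<ge> 0" "\<And>k. k \<ge> m \<Longrightarrow> integrable M (a m k)" "\<And>k. k \<ge> m \<Longrightarrow> (\<integral>\<omega>. a m k \<omega> \<partial>M) \<le> K * \<delta> k powr (1 + lam)"
      using aint[OF m] by blast
    have "(\<integral>\<omega>. T m n \<omega> \<partial>M) \<le> CB * (Cf * (2 * K)) * t n" if n: "n \<ge> m" for n
    proof -
      have "(\<integral>\<omega>. (\<Sum>k=Suc m..n. b k * a m (k - 1) \<omega>) \<partial>M) = (\<Sum>k=Suc m..n. \<integral>\<omega>. b k * a m (k - 1) \<omega> \<partial>M)"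
        by (intro Bochner_Integration.integral_sum integrable_mult_right K(2)) auto
      then have "(\<integral>\<omega>. T m n \<omega> \<partial>M) = CB * (Cf * (\<Sum>k=Suc m..n. b k * (\<integral>\<omega>. a m (k - 1) \<omega> \<partial>M)))"
        unfolding T_def by (simp only: integral_mult_right_zero)
      also have "\<dots> \<le> CB * (Cf * (\<Sum>k=Suc m..n. 2 * K * (b (k - 1) * \<delta> (k - 1) powr (1 + lam))))"
      proof (intro mult_left_mono sum_mono)
        fix k assume k: "k \<in> {Suc m..n}"
        then have k1: "k \<ge> 1" "k - 1 \<ge> m" "k - 1 \<ge> m1" "Suc (k - 1) = k" using m m0 by auto
        have "b k * (\<integral>\<omega>. a m (k - 1) \<omega> \<partial>M) \<le> b k * (K * \<delta> (k - 1) powr (1 + lam))"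
          using K(3)[OF k1(2)] b_pos[OF k1(1)] by (intro mult_left_mono) auto
        \<comment> \<open>The error made at the state of time \<open>k - 1\<close> carries the
          weight of time \<open>k\<close>; the factor \<open>2\<close> aligns the indices with the
          sum in (F).\<close>
        also have "\<dots> \<le> (2 * b (k - 1)) * (K * \<delta> (k - 1) powr (1 + lam))"
          using m1[OF k1(3)] k1(4) K(1) by (intro mult_right_mono) auto
        finally show "b k * (\<integral>\<omega>. a m (k - 1) \<omega> \<partial>M) \<le> 2 * K * (b (k - 1) * \<delta> (k - 1) powr (1 + lam))" by (simp add: mult_ac)
      qed (use CB r1(2) in auto)
      also have "(\<Sum>k=Suc m..n. 2 * K * (b (k - 1) * \<delta> (k - 1) powr (1 + lam))) = 2 * K * (\<Sum>k=Suc m..n. b (k - 1) * \<delta> (k - 1) powr (1 + lam))"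
        by (simp add: sum_distrib_left)
      also have "CB * (Cf * (2 * K * (\<Sum>k=Suc m..n. b (k - 1) * \<delta> (k - 1) powr (1 + lam)))) \<le> CB * (Cf * (2 * K * t n))"
      proof (intro mult_left_mono)
        have inj: "inj_on (\<lambda>k. k - 1) {Suc m..n}" by (auto simp: inj_on_def)
        have "(\<Sum>k=Suc m..n. b (k - 1) * \<delta> (k - 1) powr (1 + lam)) = (\<Sum>l\<in>(\<lambda>k. k - 1) ` {Suc m..n}. b l * \<delta> l powr (1 + lam))"
          by (simp only: sum.reindex[OF inj] o_def)
        also have "\<dots> \<le> t n"
          unfolding t_def using m m0 b_pos by (intro sum_mono2) (auto simp: less_imp_le)
        finally show "(\<Sum>k=Suc m..n. b (k - 1) * \<delta> (k - 1) powr (1 + lam)) \<le> t n" .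
      qed (use CB r1(2) K(1) in auto)
      finally show ?thesis by (simp only: mult.assoc)
    qed
    then show "\<exists>K. \<forall>n\<ge>m. (\<integral>\<omega>. T m n \<omega> \<partial>M) \<le> K * t n" by blast
  qed

  \<comment> \<open>The bias part\<close>
  have N1lim: "AE \<omega> in M. \<omega> \<in> conv \<longrightarrow> (\<lambda>n. (1 / Wb n) *\<^sub>R N1 n \<omega>) \<longlonglongrightarrow> - (Hi *v \<mu>)"
    using D_lim
  proof (eventually_elim, intro impI)
    fix \<omega> assume h: "\<omega> \<in> conv \<longrightarrow> (\<lambda>n. (1 / \<delta>bias n) *\<^sub>R R n \<omega>) \<longlonglongrightarrow> \<mu>" and w: "\<omega> \<in> conv"
    have "(\<lambda>n. (1 / (\<Sum>k=1..n. b k * \<delta>bias k)) *\<^sub>R (\<Sum>k=k0..n. (b k * \<delta>bias k) *\<^sub>R (?B k n *v ((1 / \<delta>bias k) *\<^sub>R R k \<omega>)))) \<longlonglongrightarrow> - (Hi *v \<mu>)"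
    proof (rule bias_limit[OF _ C_bias _ k0 BHg g0])
      show "0 \<le> b k * \<delta>bias k" if "k \<ge> 1" for k using b_pos[OF that] \<delta>_pos(1)[OF that] by simp
      show "(\<lambda>n. (1 / \<delta>bias n) *\<^sub>R R n \<omega>) \<longlonglongrightarrow> \<mu>" using h w by blast
      show "(\<lambda>n. (\<Sum>k=k0..n. b k * \<delta>bias k * g k n) / (\<Sum>k=1..n. b k * \<delta>bias k)) \<longlonglongrightarrow> 0" using gbias by (simp only: Wb_def)
    qed
    moreover have "(\<Sum>k=k0..n. (b k * \<delta>bias k) *\<^sub>R (?B k n *v ((1 / \<delta>bias k) *\<^sub>R R k \<omega>))) = N1 n \<omega>" for n
      unfolding N1_def
    proof (intro sum.cong refl)
      fix k assume "k \<in> {k0..n}"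
      then have "\<delta>bias k > 0" using k0 \<delta>_pos(1)[of k] by auto
      then show "(b k * \<delta>bias k) *\<^sub>R (?B k n *v ((1 / \<delta>bias k) *\<^sub>R R k \<omega>)) = b k *\<^sub>R (?B k n *v R k \<omega>)"
        by (simp add: matrix_vector_mult_scaleR)
    qed
    ultimately show "(\<lambda>n. (1 / Wb n) *\<^sub>R N1 n \<omega>) \<longlonglongrightarrow> - (Hi *v \<mu>)" by (simp only: Wb_def)
  qed
  have bias: "(\<lambda>n. measure M (conv \<inter> {\<omega>\<in>space M. norm ((1 / Wb n) *\<^sub>R N1 n \<omega> - (- (Hi *v \<mu>))) > \<eta>})) \<longlonglongrightarrow> 0" if "\<eta> > 0" for \<eta>
  proof (rule vanishing_of_AE[OF prob convM _ _ that])
    show "(\<lambda>\<omega>. (1 / Wb n) *\<^sub>R N1 n \<omega> - (- (Hi *v \<mu>))) \<in> borel_measurable M" for n by measurable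
    show "AE \<omega> in M. \<omega> \<in> conv \<longrightarrow> (\<lambda>n. (1 / Wb n) *\<^sub>R N1 n \<omega> - (- (Hi *v \<mu>))) \<longlonglongrightarrow> 0"
      using N1lim by eventually_elim (simp only: LIM_zero_iff)
  qed

  \<comment> \<open>The martingale part\<close>
  define Zs where "Zs n \<omega> = (1 / s n) *\<^sub>R (\<Sum>k=1..n. b k *\<^sub>R X k \<omega>)" for n \<omega>
  have ZsM [measurable]: "Zs n \<in> borel_measurable M" for n
    unfolding Zs_def by (intro borel_measurable_scaleR borel_measurable_const borel_measurable_sum XM) auto
  define U where "U n \<omega> = - (Hi *v Zs n \<omega>)" for n \<omega>
  have UM [measurable]: "U n \<in> borel_measurable M" for n
    unfolding U_def by (intro borel_measurable_uminus matM ZsM)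
  define \<Sigma> where "\<Sigma> = Hi ** \<Gamma> ** transpose Hi"
  have \<Sigma>u: "u \<bullet> (\<Sigma> *v u) = (transpose Hi *v u) \<bullet> (\<Gamma> *v (transpose Hi *v u))" for u
    unfolding \<Sigma>_def by (simp add: matrix_vector_mul_assoc[symmetric] dot_lmul_matrix transpose_matrix_vector)
  have clt: "(\<lambda>n. \<integral>\<omega>. indicator conv \<omega> * iexp (u \<bullet> U n \<omega>) \<partial>M) \<longlonglongrightarrow> of_real (measure M conv) * (\<integral>x. iexp (u \<bullet> x) \<partial>mv_normal 0 \<Sigma>)" for u
  proof -
    \<comment> \<open>Moving the limit matrix \<open>- Hi\<close> to the other side of the inner
      product reduces the claim to the sum with constant weights.\<close>
    define u' where "u' = - (transpose Hi *v u)"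
    have uu: "u \<bullet> U n \<omega> = u' \<bullet> Zs n \<omega>" for n \<omega>
      by (simp add: U_def u'_def dot_lmul_matrix[symmetric] transpose_matrix_vector)
    have "(\<lambda>n. \<integral>\<omega>. indicator conv \<omega> * iexp (u' \<bullet> Zs n \<omega>) \<partial>M) \<longlonglongrightarrow> of_real (measure M conv * exp (- (u' \<bullet> (\<Gamma> *v u')) / 2))"
      unfolding Zs_def
    proof (rule W.clt[OF DnM Xdom])
      fix \<epsilon> \<eta> :: real assume e: "\<epsilon> > 0" "\<eta> > 0"
      let ?L = "\<lambda>n \<omega>. ennreal (1 / (eps_diff b \<delta>diff n)\<^sup>2) *
        (\<Sum>l=1..n. ennreal ((b l)\<^sup>2 / (\<Sum>k=1..n. b k)\<^sup>2) * nn_cond_exp M (F (l - 1))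
            (\<lambda>\<omega>'. ennreal (indicator {\<epsilon> * (\<Sum>k=1..n. b k) * eps_diff b \<delta>diff n / b l <..} (norm (Dn l \<omega>')) * (norm (Dn l \<omega>'))\<^sup>2)) \<omega>)"
      let ?R = "\<lambda>n \<omega>. \<Sum>l=1..n. ennreal ((b l)\<^sup>2 / (s n)\<^sup>2) * nn_cond_exp M (F (l - 1))
            (\<lambda>\<omega>'. ennreal (indicator {\<epsilon> * s n / b l <..} (norm (Dn l \<omega>')) * (norm (Dn l \<omega>'))\<^sup>2)) \<omega>"
      have "(\<lambda>n. measure M (conv \<inter> {\<omega>\<in>space M. ?L n \<omega> > ennreal \<eta>})) \<longlonglongrightarrow> 0"
        using E_lindeberg[OF e(1)] e(2) unfolding vanishes_in_prob_on_def by blast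
      \<comment> \<open>The total weight cancels both from the truncation level and from the
        prefactor, so the two Lindeberg sums agree for every \<open>n \<ge> 1\<close>.\<close>
      moreover have "\<forall>\<^sub>F n in sequentially. measure M (conv \<inter> {\<omega>\<in>space M. ?L n \<omega> > ennreal \<eta>}) = measure M (conv \<inter> {\<omega>\<in>space M. ?R n \<omega> > ennreal \<eta>})"
        using eventually_ge_at_top[of 1]
      proof eventually_elim
        case (elim n)
        note p = Sb[OF elim] W.s_pos[OF elim]
        have c1: "\<epsilon> * (\<Sum>k=1..n. b k) * eps_diff b \<delta>diff n / b l = \<epsilon> * s n / b l" for l
          unfolding ed Sb_def[symmetric] using p by simp
        have c2: "ennreal (1 / (eps_diff b \<delta>diff n)\<^sup>2) * ennreal ((b l)\<^sup>2 / (\<Sum>k=1..n. b k)\<^sup>2) = ennreal ((b l)\<^sup>2 / (s n)\<^sup>2)" for l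
          unfolding ed Sb_def[symmetric] using p by (simp add: ennreal_mult[symmetric] power_divide)
        have "?L n \<omega> = ?R n \<omega>" for \<omega>
          by (rule trans[OF sum_distrib_left]) (simp only: c1 mult.assoc[symmetric] c2)
        then show ?case by (simp only:)
      qed
      ultimately show "(\<lambda>n. measure M (conv \<inter> {\<omega>\<in>space M. ?R n \<omega> > ennreal \<eta>})) \<longlonglongrightarrow> 0" by (rule Lim_transform_eventually)
    qed
    moreover have "of_real (measure M conv * exp (- (u' \<bullet> (\<Gamma> *v u')) / 2)) = of_real (measure M conv) * (\<integral>x. iexp (u \<bullet> x) \<partial>mv_normal 0 \<Sigma>)"
    proof (cases "measure M conv = 0")
      case False
      then have pos: "measure M conv > 0" by (simp add: zero_less_measure_iff)
      have tr: "transpose \<Sigma> = \<Sigma>" unfolding \<Sigma>_def matrix_transpose_mul transpose_transpose W.\<Gamma>_psd(1)[OF pos] by (simp add: matrix_mul_assoc)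
      have psd: "0 \<le> v \<bullet> (\<Sigma> *v v)" for v unfolding \<Sigma>u by (rule W.\<Gamma>_psd(2)[OF pos])
      have "u' \<bullet> (\<Gamma> *v u') = u \<bullet> (\<Sigma> *v u)"
      proof -
        have "\<Gamma> *v (- y) = - (\<Gamma> *v y)" for y using linear_neg[OF matrix_vector_mul_linear] .
        then show ?thesis unfolding u'_def \<Sigma>u by simp
      qed
      then show ?thesis unfolding characteristic_mv_normal[OF tr psd] by simp
    qed simp
    ultimately show ?thesis unfolding uu by (simp only:)
  qed
  have Utight: "\<exists>K. \<forall>\<^sub>F n in sequentially. measure M (conv \<inter> {\<omega>\<in>space M. norm (U n \<omega>) > K}) < e" if e: "e > 0" for e
  proof -
    obtain K where K: "\<forall>\<^sub>F n in sequentially. measure M (conv \<inter> {\<omega>\<in>space M. norm (Zs n \<omega>) > K}) < e"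
      using W.tight[OF e] unfolding Zs_def by blast
    then have "\<forall>\<^sub>F n in sequentially. measure M (conv \<inter> {\<omega>\<in>space M. norm (U n \<omega>) > KH * K}) < e"
    proof eventually_elim
      case (elim n)
      have "norm (Zs n \<omega>) > K" if "norm (U n \<omega>) > KH * K" for \<omega>
      proof -
        have "KH * K < KH * norm (Zs n \<omega>)" using that KH(2)[of "Zs n \<omega>"] by (simp add: U_def)
        then show ?thesis using KH(1) by simp
      qed
      then have "conv \<inter> {\<omega>\<in>space M. norm (U n \<omega>) > KH * K} \<subseteq> conv \<inter> {\<omega>\<in>space M. norm (Zs n \<omega>) > K}" by auto
      then have "measure M (conv \<inter> {\<omega>\<in>space M. norm (U n \<omega>) > KH * K}) \<le> measure M (conv \<inter> {\<omega>\<in>space M. norm (Zs n \<omega>) > K})"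
        by (rule finite_measure_mono) measurable
      then show ?case using elim by simp
    qed
    then show ?thesis by blast
  qed
  \<comment> \<open>The deviation bounds start at \<open>k0\<close>. The earlier indices, which
    occur in \<open>U\<close> but not in \<open>N2\<close>, form the fixed sum \<open>V1\<close>,
    removed by \<open>s n\<close>; \<open>V2\<close> contains the deviations of the averaging
    matrices from their limit.\<close>
  define V1 where "V1 n \<omega> = (1 / s n) *\<^sub>R (Hi *v (\<Sum>k\<in>{1..<k0}. b k *\<^sub>R X k \<omega>))" for n \<omega>
  define V2 where "V2 n \<omega> = (1 / s n) *\<^sub>R (\<Sum>k=k0..n. b k *\<^sub>R ((?B k n + Hi) *v X k \<omega>))" for n \<omega>
  have V1M: "V1 n \<in> borel_measurable M" for n
    unfolding V1_def by (intro borel_measurable_scaleR borel_measurable_const matM borel_measurable_sum XM) auto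
  have V2M: "V2 n \<in> borel_measurable M" for n
    unfolding V2_def using k0 by (intro borel_measurable_scaleR borel_measurable_const borel_measurable_sum matM XM) auto
  define W0 where "W0 n \<omega> = (1 / s n) *\<^sub>R N2 n \<omega> - U n \<omega>" for n \<omega>
  have W0M: "W0 n \<in> borel_measurable M" for n unfolding W0_def by measurable
  have W0eq: "W0 n \<omega> = V1 n \<omega> + V2 n \<omega>" if n: "n \<ge> k0" for n \<omega>
  proof -
    have un: "{1..n} = {1..<k0} \<union> {k0..n}" using n k0 by auto
    have "(\<Sum>k=1..n. b k *\<^sub>R X k \<omega>) = (\<Sum>k\<in>{1..<k0}. b k *\<^sub>R X k \<omega>) + (\<Sum>k=k0..n. b k *\<^sub>R X k \<omega>)"
      unfolding un by (rule sum.union_disjoint) auto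
    moreover have "Hi *v (\<Sum>k=k0..n. b k *\<^sub>R X k \<omega>) = (\<Sum>k=k0..n. b k *\<^sub>R (Hi *v X k \<omega>))"
      by (simp add: linear_sum[OF matrix_vector_mul_linear] linear_cmul[OF matrix_vector_mul_linear])
    moreover have "(\<Sum>k=k0..n. b k *\<^sub>R ((?B k n + Hi) *v X k \<omega>)) = N2 n \<omega> + (\<Sum>k=k0..n. b k *\<^sub>R (Hi *v X k \<omega>))"
      by (simp add: N2_def matrix_vector_mult_add_rdistrib scaleR_add_right sum.distrib)
    ultimately show ?thesis
      by (simp add: W0_def V1_def V2_def U_def Zs_def matrix_vector_mult_scaleR matrix_vector_right_distrib scaleR_add_right)
  qed
  have W0small: "(\<lambda>n. measure M (conv \<inter> {\<omega>\<in>space M. norm (W0 n \<omega>) > \<eta>})) \<longlonglongrightarrow> 0" if \<eta>: "\<eta> > 0" for \<eta>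
  proof (rule vanishing_add[OF prob convM V1M V2M _ _ W0eq \<eta>])
    fix \<eta> :: real assume \<eta>: "\<eta> > 0"
    show "(\<lambda>n. measure M (conv \<inter> {\<omega>\<in>space M. norm (V1 n \<omega>) > \<eta>})) \<longlonglongrightarrow> 0"
    proof (rule vanishing_of_AE[OF prob convM V1M _ \<eta>], rule AE_I2, rule impI)
      fix \<omega>
      have "(\<lambda>n. 1 / s n) \<longlonglongrightarrow> 0"
        by (intro tendsto_divide_0[OF tendsto_const] filterlim_at_top_imp_at_infinity W.s_at_top)
      from tendsto_scaleR[OF this tendsto_const[of "Hi *v (\<Sum>k\<in>{1..<k0}. b k *\<^sub>R X k \<omega>)"]]
      show "(\<lambda>n. V1 n \<omega>) \<longlonglongrightarrow> 0" by (simp add: V1_def)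
    qed
    show "(\<lambda>n. measure M (conv \<inter> {\<omega>\<in>space M. norm (V2 n \<omega>) > \<eta>})) \<longlonglongrightarrow> 0"
      unfolding V2_def by (rule W.negligible[OF k0 BHg gdiff \<eta>])
  qed
  have \<nu>: "prob_space (mv_normal 0 \<Sigma>)" "sets (mv_normal 0 \<Sigma>) = sets borel"
    by (rule prob_space_mv_normal) (simp add: mv_normal_def)

  \<comment> \<open>Recombining the weighted average\<close>
  have avg: "weighted_avg b (\<lambda>k. \<theta> k \<omega>) n = \<theta>s + (1 / Sb n) *\<^sub>R (N1 n \<omega> + N2 n \<omega> + Rem n \<omega>)" if n: "n \<ge> 1" for n \<omega>
  proof -
    have "(\<Sum>k=1..n. b k *\<^sub>R \<theta> k \<omega>) = (\<Sum>k=1..n. b k *\<^sub>R x k \<omega>) + Sb n *\<^sub>R \<theta>s"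
      by (simp add: x_def Sb_def scaleR_diff_right sum_subtractf scaleR_sum_left)
    moreover have "(\<Sum>k=1..n. b k *\<^sub>R x k \<omega>) = N1 n \<omega> + N2 n \<omega> + Rem n \<omega>" by (simp add: Rem_def)
    ultimately have "(\<Sum>k=1..n. b k *\<^sub>R \<theta> k \<omega>) = N1 n \<omega> + N2 n \<omega> + Rem n \<omega> + Sb n *\<^sub>R \<theta>s" by (simp only:)
    then have "weighted_avg b (\<lambda>k. \<theta> k \<omega>) n = (1 / Sb n) *\<^sub>R (N1 n \<omega> + N2 n \<omega> + Rem n \<omega> + Sb n *\<^sub>R \<theta>s)"
      by (simp only: weighted_avg_def Sb_def)
    then show ?thesis using Sb[OF n] by (simp add: scaleR_add_right)
  qed
  \<comment> \<open>The multiplication by \<open>1 / q n\<close> and the comparison with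
    \<open>\<eta> * q n\<close> agree only where \<open>q n\<close> is positive, hence
    eventually.\<close>
  have remW: "(\<lambda>n. measure M (conv \<inter> {\<omega>\<in>space M. norm ((1 / q n) *\<^sub>R Rem n \<omega>) > \<eta>})) \<longlonglongrightarrow> 0"
    if q: "filterlim q at_top sequentially" "(\<lambda>n. t n / q n) \<longlonglongrightarrow> 0" and \<eta>: "\<eta> > 0" for q and \<eta> :: real
  proof (rule Lim_transform_eventually[OF small[OF q \<eta>]])
    have "\<forall>\<^sub>F n in sequentially. q n > 0" using q(1) by (simp only: filterlim_at_top_dense)
    then show "\<forall>\<^sub>F n in sequentially. measure M (conv \<inter> {\<omega>\<in>space M. norm (Rem n \<omega>) > \<eta> * q n}) = measure M (conv \<inter> {\<omega>\<in>space M. norm ((1 / q n) *\<^sub>R Rem n \<omega>) > \<eta>})"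
      by eventually_elim (simp add: pos_less_divide_eq)
  qed
  have Wb_top: "filterlim Wb at_top sequentially" using C_bias by (simp only: Wb_def[abs_def])
  have dist_eq: "dist y z > \<eta> \<longleftrightarrow> norm (y - z) > \<eta>" for y z :: "real ^ 'd" and \<eta> by (simp add: dist_norm)
  have main: "converges_in_law_on M conv (\<lambda>n \<omega>. U n \<omega> + V n \<omega>) (mv_normal 0 \<Sigma>)"
    if "\<And>n. V n \<in> borel_measurable M" "\<And>\<eta>. \<eta> > 0 \<Longrightarrow> (\<lambda>n. measure M (conv \<inter> {\<omega>\<in>space M. norm (V n \<omega>) > \<eta>})) \<longlonglongrightarrow> 0" for V
    by (rule converges_in_law_on_perturbed[OF prob convM UM that(1) \<nu> clt Utight that(2)])
  \<comment> \<open>The linearization error \<open>Rem\<close> goes into the centering \<open>V\<close> or into the fluctuation, whichever scale dominates it.\<close>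
  from F show ?thesis
  proof
    assume o: "(\<lambda>n. 1 / (\<Sum>k=1..n. b k) * (\<Sum>l=1..n. b l * \<delta> l powr (1 + lam))) \<in> o(eps_bias b \<delta>bias)"
    have tW: "(\<lambda>n. t n / Wb n) \<longlonglongrightarrow> 0"
    proof (rule Lim_transform_eventually[OF smalloD_tendsto[OF o]])
      show "\<forall>\<^sub>F n in sequentially. 1 / (\<Sum>k=1..n. b k) * (\<Sum>l=1..n. b l * \<delta> l powr (1 + lam)) / eps_bias b \<delta>bias n = t n / Wb n"
        using eventually_ge_at_top[of 1]
      proof eventually_elim
        case (elim n)
        then show ?case unfolding eb Sb_def[symmetric] t_def[symmetric] using Sb[OF elim] by simp
      qed
    qed
    define V where "V n \<omega> = \<theta>s + (1 / Sb n) *\<^sub>R (N1 n \<omega> + Rem n \<omega>)" for n \<omega>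
    have "converges_in_prob_on M conv (\<lambda>n \<omega>. (1 / eps_bias b \<delta>bias n) *\<^sub>R (V n \<omega> - \<theta>s)) (- (Hi *v \<mu>))"
      unfolding converges_in_prob_on_def dist_eq
    proof (intro allI impI)
      fix \<eta> :: real assume \<eta>: "\<eta> > 0"
      show "(\<lambda>n. measure M (conv \<inter> {\<omega>\<in>space M. norm ((1 / eps_bias b \<delta>bias n) *\<^sub>R (V n \<omega> - \<theta>s) - - (Hi *v \<mu>)) > \<eta>})) \<longlonglongrightarrow> 0"
      proof (rule vanishing_add[OF prob convM _ _ bias remW[OF Wb_top tW] _ \<eta>])
        fix n :: nat and \<omega> assume n: "n \<ge> 1"
        show "(1 / eps_bias b \<delta>bias n) *\<^sub>R (V n \<omega> - \<theta>s) - - (Hi *v \<mu>) = ((1 / Wb n) *\<^sub>R N1 n \<omega> - - (Hi *v \<mu>)) + (1 / Wb n) *\<^sub>R Rem n \<omega>"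
          using Sb[OF n] by (simp add: eb V_def scaleR_add_right)
      qed measurable
    qed
    moreover have "converges_in_law_on M conv (\<lambda>n \<omega>. (1 / eps_diff b \<delta>diff n) *\<^sub>R (weighted_avg b (\<lambda>k. \<theta> k \<omega>) n - V n \<omega>)) (mv_normal 0 \<Sigma>)"
    proof (rule converges_in_law_on_cong[OF main[OF W0M W0small]])
      fix n :: nat and \<omega> assume n: "n \<ge> 1"
      show "U n \<omega> + W0 n \<omega> = (1 / eps_diff b \<delta>diff n) *\<^sub>R (weighted_avg b (\<lambda>k. \<theta> k \<omega>) n - V n \<omega>)"
        using Sb[OF n] by (simp add: avg[OF n] V_def W0_def ed scaleR_add_right)
    qed
    moreover have "V n \<in> borel_measurable M" for n unfolding V_def by measurable
    ultimately show ?thesis unfolding Hi_def[symmetric] \<Sigma>_def by blast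
  next
    assume o: "(\<lambda>n. 1 / (\<Sum>k=1..n. b k) * (\<Sum>l=1..n. b l * \<delta> l powr (1 + lam))) \<in> o(eps_diff b \<delta>diff)"
    have ts: "(\<lambda>n. t n / s n) \<longlonglongrightarrow> 0"
    proof (rule Lim_transform_eventually[OF smalloD_tendsto[OF o]])
      show "\<forall>\<^sub>F n in sequentially. 1 / (\<Sum>k=1..n. b k) * (\<Sum>l=1..n. b l * \<delta> l powr (1 + lam)) / eps_diff b \<delta>diff n = t n / s n"
        using eventually_ge_at_top[of 1]
      proof eventually_elim
        case (elim n)
        then show ?case unfolding ed Sb_def[symmetric] t_def[symmetric] using Sb[OF elim] by simp
      qed
    qed
    define V where "V n \<omega> = \<theta>s + (1 / Sb n) *\<^sub>R N1 n \<omega>" for n \<omega>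
    have "converges_in_prob_on M conv (\<lambda>n \<omega>. (1 / eps_bias b \<delta>bias n) *\<^sub>R (V n \<omega> - \<theta>s)) (- (Hi *v \<mu>))"
      unfolding converges_in_prob_on_def dist_eq
    proof (intro allI impI)
      fix \<eta> :: real assume \<eta>: "\<eta> > 0"
      show "(\<lambda>n. measure M (conv \<inter> {\<omega>\<in>space M. norm ((1 / eps_bias b \<delta>bias n) *\<^sub>R (V n \<omega> - \<theta>s) - - (Hi *v \<mu>)) > \<eta>})) \<longlonglongrightarrow> 0"
      proof (rule Lim_transform_eventually[OF bias[OF \<eta>]])
        show "\<forall>\<^sub>F n in sequentially. measure M (conv \<inter> {\<omega>\<in>space M. norm ((1 / Wb n) *\<^sub>R N1 n \<omega> - - (Hi *v \<mu>)) > \<eta>})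
            = measure M (conv \<inter> {\<omega>\<in>space M. norm ((1 / eps_bias b \<delta>bias n) *\<^sub>R (V n \<omega> - \<theta>s) - - (Hi *v \<mu>)) > \<eta>})"
          using eventually_ge_at_top[of 1]
        proof eventually_elim
          case (elim n)
          have "(1 / eps_bias b \<delta>bias n) *\<^sub>R (V n \<omega> - \<theta>s) = (1 / Wb n) *\<^sub>R N1 n \<omega>" for \<omega>
            using Sb[OF elim] by (simp add: eb V_def)
          then show ?case by (simp only:)
        qed
      qed
    qed
    moreover have "converges_in_law_on M conv (\<lambda>n \<omega>. (1 / eps_diff b \<delta>diff n) *\<^sub>R (weighted_avg b (\<lambda>k. \<theta> k \<omega>) n - V n \<omega>)) (mv_normal 0 \<Sigma>)"
    proof (rule converges_in_law_on_cong[OF main])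
      show "(\<lambda>\<omega>. W0 n \<omega> + (1 / s n) *\<^sub>R Rem n \<omega>) \<in> borel_measurable M" for n using W0M[of n] by measurable
      show "(\<lambda>n. measure M (conv \<inter> {\<omega>\<in>space M. norm (W0 n \<omega> + (1 / s n) *\<^sub>R Rem n \<omega>) > \<eta>})) \<longlonglongrightarrow> 0" if \<eta>: "\<eta> > 0" for \<eta>
      proof (rule vanishing_add[OF prob convM W0M _ W0small remW[OF W.s_at_top ts] refl \<eta>])
        show "(\<lambda>\<omega>. (1 / s n) *\<^sub>R Rem n \<omega>) \<in> borel_measurable M" for n by measurable
      qed
      fix n :: nat and \<omega> assume n: "n \<ge> 1"
      show "U n \<omega> + (W0 n \<omega> + (1 / s n) *\<^sub>R Rem n \<omega>) = (1 / eps_diff b \<delta>diff n) *\<^sub>R (weighted_avg b (\<lambda>k. \<theta> k \<omega>) n - V n \<omega>)"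
        using Sb[OF n] by (simp add: avg[OF n] V_def W0_def ed scaleR_add_right)
    qed
    moreover have "V n \<in> borel_measurable M" for n unfolding V_def by measurable
    ultimately show ?thesis unfolding Hi_def[symmetric] \<Sigma>_def by blast
  qed
qed

end
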